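(* Let $f,\sigma,a,b:[0,T]\to\mathbb{R}$ be known bounded functions with $f$ and $\sigma$ separated from $0$. For $\varepsilon\in(0,1]$ and $\vartheta\in\Theta=(\alpha,\beta)$ let $$dX_t=f(t)Y_t\,dt+\varepsilon\sigma(t)\,dW_t,\quad X_0=0,\qquad dY_t=a(t)Y_t\,dt+\varepsilon b(t)\,dV_t,\quad Y_0=\vartheta,\qquad 0\le t\le T,$$ where $W,V$ are independent Wiener processes, $X$ is observed, $Y$ is hidden, and the deterministic initial value $\vartheta$ is unknown. Let $m(\vartheta,t)=\mathbf{E}_\vartheta(Y_t\mid\mathfrak{F}^X_t)$, and let $\Phi(0,t)$, $\mathrm{I}^t$ and the adaptive filter $m^\star_t$ be as defined in the context. Then for every $t\in(0,T]$: (i) for every $\vartheta_0\in\Theta$ and every family of estimators $\bar m_{t,\varepsilon}$ of $m(\vartheta,t)$ (i.e. $\mathfrak{F}^X_t$-measurable random variables, not depending on $\vartheta$), $$\lim_{\nu\to0}\ \liminf_{\varepsilon\to0}\ \sup_{|\vartheta-\vartheta_0|\le\nu}\varepsilon^{-2}\,\mathbf{E}_\vartheta\bigl[\bar m_{t,\varepsilon}-m(\vartheta,t)\bigr]^2\ \ge\ \frac{\Phi(0,t)^2}{\mathrm{I}^t};$$ (ii) for every $\vartheta\in\Theta$ the adaptive filter satisfies $$\varepsilon^{-2}\,\mathbf{E}_\vartheta\bigl[m^\star_t-m(\vartheta,t)\bigr]^2=\frac{\Phi(0,t)^2}{\mathrm{I}^t},$$ so that $m^\star_t$ is asymptotically efficient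 (it attains the lower bound in (i)).
   Context: $\mathfrak{F}^X_t$ is the $\sigma$-algebra generated by $X^t=(X_s,0\le s\le t)$; $\mathbf{E}_\vartheta$ is expectation when the initial value is $\vartheta$. "Separated from $0$" means $\inf_t|f(t)|>0$, $\inf_t|\sigma(t)|>0$. Let $\gamma_*$ solve the Riccati equation $$\gamma_*'(t)=2a(t)\gamma_*(t)-\frac{f(t)^2\gamma_*(t)^2}{\sigma(t)^2}+b(t)^2,\qquad\gamma_*(0)=0,$$ and put $$A(t)=a(t)-\frac{f(t)^2\gamma_*(t)}{\sigma(t)^2},\qquad \Phi(s,t)=\exp\Bigl(\int_s^tA(r)\,dr\Bigr),\qquad H(t,X^t)=\int_0^t\Phi(s,t)\frac{f(s)\gamma_*(s)}{\sigma(s)^2}\,dX_s,$$ $$\mathrm{I}^t=\int_0^t\frac{f(s)^2\Phi(0,s)^2}{\sigma(s)^2}\,ds .$$ By the Kalman–Bucy equations, $m(\vartheta,t)=\vartheta\,\Phi(0,t)+H(t,X^t)$. The estimator of $\vartheta$ based on $X^t$ is $$\hat\vartheta_{t,\varepsilon}=\frac1{\mathrm{I}^t}\int_0^t\frac{f(s)\Phi(0,s)}{\sigma(s)^2}\bigl[dX_s-f(s)H(s,X^s)\,ds\bigr],$$ and the adaptive filter is $m^\star_t=\hat\vartheta_{t,\varepsilon}\,\Phi(0,t)+H(t,X^t)$. *)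

theory Defs
  imports "HOL-Probability.Probability"
begin

section \<open>Wiener processes on a bounded time interval\<close>

definition wiener_process :: "'w measure \<Rightarrow> real \<Rightarrow> (real \<Rightarrow> 'w \<Rightarrow> real) \<Rightarrow> bool" where
  "wiener_process M T W \<longleftrightarrow>
     prob_space M \<and>
     (\<forall>s\<in>{0..T}. W s \<in> borel_measurable M) \<and>
     (\<forall>\<omega>\<in>space M. continuous_on {0..T} (\<lambda>s. W s \<omega>)) \<and>
     (AE \<omega> in M. W 0 \<omega> = 0) \<and>
     (\<forall>s u. 0 \<le> s \<and> s < u \<and> u \<le> T \<longrightarrow>
        distributed M lborel (\<lambda>\<omega>. W u \<omega> - W s \<omega>) (normal_density 0 (sqrt (u - s)))) \<and>
     (\<forall>n (\<tau> :: nat \<Rightarrow> real). 0 \<le> \<tau> 0 \<and> (\<forall>i<n. \<tau> i \<le> \<tau> (Suc i)) \<and> \<tau> n \<le> T \<longrightarrow>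
        prob_space.indep_vars M (\<lambda>_. borel) (\<lambda>i \<omega>. W (\<tau> (Suc i)) \<omega> - W (\<tau> i) \<omega>) {..<n})"

text \<open>The path of a process up to time \<open>t\<close>, as an element of the product space over \<open>[0,t]\<close>, and
  the \<open>\<sigma>\<close>-algebra it generates.\<close>

abbreviation path_space :: "real \<Rightarrow> (real \<Rightarrow> real) measure" where
  "path_space t \<equiv> (\<Pi>\<^sub>M s\<in>{0..t}. (borel :: real measure))"

definition path_upto :: "real \<Rightarrow> (real \<Rightarrow> 'w \<Rightarrow> real) \<Rightarrow> 'w \<Rightarrow> (real \<Rightarrow> real)" where
  "path_upto t Z \<omega> = (\<lambda>s\<in>{0..t}. Z s \<omega>)"

definition path_sigma :: "'w measure \<Rightarrow> (real \<Rightarrow> 'w \<Rightarrow> real) \<Rightarrow> real \<Rightarrow> 'w measure" where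
  "path_sigma M Z t = vimage_algebra (space M) (path_upto t Z) (path_space t)"

section \<open>Stochastic integrals of deterministic functions\<close>

text \<open>A list of triples \<open>(c, u, v)\<close> encodes the step function \<open>\<Sum> c 1\<^bsub>(u,v]\<^esub>\<close>; its integral with respect
  to \<open>Z\<close> is \<open>\<Sum> c (Z\<^sub>v - Z\<^sub>u)\<close>.\<close>

definition step_fun :: "(real \<times> real \<times> real) list \<Rightarrow> real \<Rightarrow> real" where
  "step_fun p s = (\<Sum>(c, u, v)\<leftarrow>p. c * indicator {u<..v} s)"

definition step_integral ::
    "(real \<times> real \<times> real) list \<Rightarrow> (real \<Rightarrow> 'w \<Rightarrow> real) \<Rightarrow> 'w \<Rightarrow> real" where
  "step_integral p Z \<omega> = (\<Sum>(c, u, v)\<leftarrow>p. c * (Z v \<omega> - Z u \<omega>))"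

text \<open>\<open>is_stoch_integral M Z g t J\<close>: the random variable \<open>J\<close> is a version of \<open>\<integral>\<^sub>0\<^sup>t g dZ\<close>, i.e. the
  \<open>L\<^sup>2(M)\<close>-limit of the integrals of step functions that converge to \<open>g\<close> in \<open>L\<^sup>2[0,t]\<close>.
  For a Wiener process, or an Ito process \<open>dZ = D ds + c dW\<close> with bounded deterministic \<open>c\<close> and
  \<open>sup\<^sub>s E D\<^sub>s\<^sup>2 < \<infinity>\<close>, the second moment of a step integral is at most a constant times the squared
  \<open>L\<^sup>2[0,t]\<close>-norm of the step function. So \<open>J\<close> exists, does not depend on the approximating
  sequence up to null sets, and is the Ito integral.\<close>

definition is_stoch_integral ::
    "'w measure \<Rightarrow> (real \<Rightarrow> 'w \<Rightarrow> real) \<Rightarrow> (real \<Rightarrow> real) \<Rightarrow> real \<Rightarrow> ('w \<Rightarrow> real) \<Rightarrow> bool" where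
  "is_stoch_integral M Z g t J \<longleftrightarrow>
     J \<in> borel_measurable M \<and>
     (\<exists>p :: nat \<Rightarrow> (real \<times> real \<times> real) list.
        (\<forall>n. \<forall>(c, u, v)\<in>set (p n). 0 \<le> u \<and> u \<le> v \<and> v \<le> t) \<and>
        (\<lambda>n. \<integral>\<^sup>+ s\<in>{0..t}. ennreal ((step_fun (p n) s - g s)\<^sup>2) \<partial>lborel) \<longlonglongrightarrow> 0 \<and>
        (\<lambda>n. \<integral>\<^sup>+ \<omega>. ennreal ((step_integral (p n) Z \<omega> - J \<omega>)\<^sup>2) \<partial>M) \<longlonglongrightarrow> 0)"

text \<open>\<open>Z\<close> is a continuous process with \<open>dZ\<^sub>s = D\<^sub>s ds + \<epsilon> c(s) dB\<^sub>s\<close> on \<open>[0,T]\<close> and \<open>Z\<^sub>0 = z\<close>.\<close>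

definition solves_sde ::
    "'w measure \<Rightarrow> real \<Rightarrow> real \<Rightarrow> (real \<Rightarrow> 'w \<Rightarrow> real) \<Rightarrow> real \<Rightarrow> (real \<Rightarrow> real) \<Rightarrow>
     (real \<Rightarrow> 'w \<Rightarrow> real) \<Rightarrow> (real \<Rightarrow> 'w \<Rightarrow> real) \<Rightarrow> bool" where
  "solves_sde M T z D \<epsilon> c B Z \<longleftrightarrow>
     (\<forall>s\<in>{0..T}. Z s \<in> borel_measurable M) \<and>
     (\<forall>\<omega>\<in>space M. continuous_on {0..T} (\<lambda>s. Z s \<omega>)) \<and>
     (\<forall>s\<in>{0..T}. \<exists>J. is_stoch_integral M B c s J \<and>
        (AE \<omega> in M. Z s \<omega> = z + (LINT r:{0..s}|lborel. D r \<omega>) + \<epsilon> * J \<omega>))"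

section \<open>The partially observed linear system\<close>

definition linear_system ::
    "'w measure \<Rightarrow> real \<Rightarrow> (real \<Rightarrow> real) \<Rightarrow> (real \<Rightarrow> real) \<Rightarrow> (real \<Rightarrow> real) \<Rightarrow> (real \<Rightarrow> real) \<Rightarrow>
     real \<Rightarrow> real \<Rightarrow> (real \<Rightarrow> 'w \<Rightarrow> real) \<Rightarrow> (real \<Rightarrow> 'w \<Rightarrow> real) \<Rightarrow>
     (real \<Rightarrow> 'w \<Rightarrow> real) \<Rightarrow> (real \<Rightarrow> 'w \<Rightarrow> real) \<Rightarrow> bool" where
  "linear_system M T f \<sigma> a b \<epsilon> \<theta> W V X Y \<longleftrightarrow>
     prob_space M \<and> wiener_process M T W \<and> wiener_process M T V \<and>
     prob_space.indep_var M (path_space T) (path_upto T W) (path_space T) (path_upto T V) \<and>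
     solves_sde M T 0 (\<lambda>s \<omega>. f s * Y s \<omega>) \<epsilon> \<sigma> W X \<and>
     solves_sde M T \<theta> (\<lambda>s \<omega>. a s * Y s \<omega>) \<epsilon> b V Y"

definition cond_mean ::
    "'w measure \<Rightarrow> (real \<Rightarrow> 'w \<Rightarrow> real) \<Rightarrow> (real \<Rightarrow> 'w \<Rightarrow> real) \<Rightarrow> real \<Rightarrow> 'w \<Rightarrow> real" where
  "cond_mean M X Y t = real_cond_exp M (path_sigma M X t) (Y t)"

text \<open>The normalized quadratic risk \<open>\<epsilon>\<^bsup>-2\<^esup> E [Z - m(t)]\<^sup>2\<close>; it may be infinite.\<close>

definition filter_risk ::
    "'w measure \<Rightarrow> (real \<Rightarrow> 'w \<Rightarrow> real) \<Rightarrow> (real \<Rightarrow> 'w \<Rightarrow> real) \<Rightarrow> real \<Rightarrow> real \<Rightarrow> ('w \<Rightarrow> real) \<Rightarrow> ennreal"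
  where
  "filter_risk M X Y \<epsilon> t Z =
     ennreal (1 / \<epsilon>\<^sup>2) * (\<integral>\<^sup>+ \<omega>. ennreal ((Z \<omega> - cond_mean M X Y t \<omega>)\<^sup>2) \<partial>M)"

section \<open>Kalman--Bucy quantities and the adaptive filter\<close>

text \<open>The coefficients are only bounded and measurable, so the Riccati equation is understood in
  integrated (Caratheodory) form.\<close>

definition riccati_solution ::
    "real \<Rightarrow> (real \<Rightarrow> real) \<Rightarrow> (real \<Rightarrow> real) \<Rightarrow> (real \<Rightarrow> real) \<Rightarrow> (real \<Rightarrow> real) \<Rightarrow> (real \<Rightarrow> real) \<Rightarrow> bool"
  where
  "riccati_solution T f \<sigma> a b \<gamma> \<longleftrightarrow>
     continuous_on {0..T} \<gamma> \<and>
     (\<forall>t\<in>{0..T}. \<gamma> t =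
        (LINT s:{0..t}|lborel. 2 * a s * \<gamma> s - (f s)\<^sup>2 * (\<gamma> s)\<^sup>2 / (\<sigma> s)\<^sup>2 + (b s)\<^sup>2))"

definition KB_A ::
    "(real \<Rightarrow> real) \<Rightarrow> (real \<Rightarrow> real) \<Rightarrow> (real \<Rightarrow> real) \<Rightarrow> (real \<Rightarrow> real) \<Rightarrow> real \<Rightarrow> real" where
  "KB_A f \<sigma> a \<gamma> t = a t - (f t)\<^sup>2 * \<gamma> t / (\<sigma> t)\<^sup>2"

text \<open>Only used for \<open>s \<le> t\<close>.\<close>

definition KB_Phi ::
    "(real \<Rightarrow> real) \<Rightarrow> (real \<Rightarrow> real) \<Rightarrow> (real \<Rightarrow> real) \<Rightarrow> (real \<Rightarrow> real) \<Rightarrow> real \<Rightarrow> real \<Rightarrow> real" where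
  "KB_Phi f \<sigma> a \<gamma> s t = exp (LINT r:{s..t}|lborel. KB_A f \<sigma> a \<gamma> r)"

definition KB_info ::
    "(real \<Rightarrow> real) \<Rightarrow> (real \<Rightarrow> real) \<Rightarrow> (real \<Rightarrow> real) \<Rightarrow> (real \<Rightarrow> real) \<Rightarrow> real \<Rightarrow> real" where
  "KB_info f \<sigma> a \<gamma> t = (LINT s:{0..t}|lborel. (f s)\<^sup>2 * (KB_Phi f \<sigma> a \<gamma> 0 s)\<^sup>2 / (\<sigma> s)\<^sup>2)"

text \<open>\<open>H\<close> is a version of the process \<open>H(s, X\<^sup>s)\<close>, \<open>0 \<le> s \<le> t\<close>, jointly measurable so that it can be
  integrated pathwise over time.\<close>

definition is_KB_H ::
    "'w measure \<Rightarrow> (real \<Rightarrow> real) \<Rightarrow> (real \<Rightarrow> real) \<Rightarrow> (real \<Rightarrow> real) \<Rightarrow> (real \<Rightarrow> real) \<Rightarrow>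
     (real \<Rightarrow> 'w \<Rightarrow> real) \<Rightarrow> real \<Rightarrow> (real \<Rightarrow> 'w \<Rightarrow> real) \<Rightarrow> bool" where
  "is_KB_H M f \<sigma> a \<gamma> X t H \<longleftrightarrow>
     (\<lambda>(s, \<omega>). H s \<omega>) \<in> borel_measurable (restrict_space lborel {0..t} \<Otimes>\<^sub>M M) \<and>
     (\<forall>s\<in>{0..t}. is_stoch_integral M X (\<lambda>r. KB_Phi f \<sigma> a \<gamma> r s * (f r * \<gamma> r / (\<sigma> r)\<^sup>2)) s (H s))"

text \<open>\<open>\<theta>hat\<close> is a version of the estimator of the initial value, computed from \<open>H\<close>.\<close>

definition is_initial_estimator ::
    "'w measure \<Rightarrow> (real \<Rightarrow> real) \<Rightarrow> (real \<Rightarrow> real) \<Rightarrow> (real \<Rightarrow> real) \<Rightarrow> (real \<Rightarrow> real) \<Rightarrow>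
     (real \<Rightarrow> 'w \<Rightarrow> real) \<Rightarrow> real \<Rightarrow> (real \<Rightarrow> 'w \<Rightarrow> real) \<Rightarrow> ('w \<Rightarrow> real) \<Rightarrow> bool" where
  "is_initial_estimator M f \<sigma> a \<gamma> X t H \<theta>hat \<longleftrightarrow>
     (\<exists>J. is_stoch_integral M X (\<lambda>s. f s * KB_Phi f \<sigma> a \<gamma> 0 s / (\<sigma> s)\<^sup>2) t J \<and>
        (AE \<omega> in M. \<theta>hat \<omega> = 1 / KB_info f \<sigma> a \<gamma> t *
           (J \<omega> - (LINT s:{0..t}|lborel. f s * KB_Phi f \<sigma> a \<gamma> 0 s / (\<sigma> s)\<^sup>2 * (f s * H s \<omega>)))))"

definition is_adaptive_filter ::
    "'w measure \<Rightarrow> (real \<Rightarrow> real) \<Rightarrow> (real \<Rightarrow> real) \<Rightarrow> (real \<Rightarrow> real) \<Rightarrow> (real \<Rightarrow> real) \<Rightarrow>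
     (real \<Rightarrow> 'w \<Rightarrow> real) \<Rightarrow> real \<Rightarrow> ('w \<Rightarrow> real) \<Rightarrow> bool" where
  "is_adaptive_filter M f \<sigma> a \<gamma> X t mstar \<longleftrightarrow>
     mstar \<in> borel_measurable M \<and>
     (\<exists>H \<theta>hat. is_KB_H M f \<sigma> a \<gamma> X t H \<and> is_initial_estimator M f \<sigma> a \<gamma> X t H \<theta>hat \<and>
        (AE \<omega> in M. mstar \<omega> = \<theta>hat \<omega> * KB_Phi f \<sigma> a \<gamma> 0 t + H t \<omega>))"

section \<open>Estimators and their local asymptotic maximal risk\<close>

text \<open>A family of estimators, one for each \<open>\<epsilon> \<in> (0,1]\<close>: random variables that are measurable with
  respect to the \<open>\<sigma>\<close>-algebra generated by \<open>X\<^sup>t\<close> and do not depend on \<open>\<theta>\<close>, i.e. measurable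
  functionals \<open>h \<epsilon>\<close> of the observed path.\<close>

definition estimator_family :: "real \<Rightarrow> (real \<Rightarrow> (real \<Rightarrow> real) \<Rightarrow> real) \<Rightarrow> bool" where
  "estimator_family t h \<longleftrightarrow> (\<forall>\<epsilon>\<in>{0<..1}. h \<epsilon> \<in> borel_measurable (path_space t))"

text \<open>\<open>liminf\<^bsub>\<epsilon>\<rightarrow>0\<^esub> sup\<^bsub>|\<theta> - \<theta>0| \<le> \<nu>\<^esub> \<epsilon>\<^bsup>-2\<^esup> E\<^sub>\<theta> [h\<^sub>\<epsilon>(X\<^sup>t) - m(\<theta>,t)]\<^sup>2\<close>, the supremum being over the
  parameter set \<open>\<Theta>\<close>. The arguments of \<open>M\<close>, \<open>X\<close>, \<open>Y\<close> are \<open>\<epsilon>\<close> and \<open>\<theta>\<close>.\<close>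

definition local_max_risk ::
    "(real \<Rightarrow> real \<Rightarrow> 'w measure) \<Rightarrow> (real \<Rightarrow> real \<Rightarrow> real \<Rightarrow> 'w \<Rightarrow> real) \<Rightarrow>
     (real \<Rightarrow> real \<Rightarrow> real \<Rightarrow> 'w \<Rightarrow> real) \<Rightarrow> real set \<Rightarrow> real \<Rightarrow>
     (real \<Rightarrow> (real \<Rightarrow> real) \<Rightarrow> real) \<Rightarrow> real \<Rightarrow> real \<Rightarrow> ennreal" where
  "local_max_risk M X Y \<Theta> t h \<theta>0 \<nu> =
     Liminf (at_right 0) (\<lambda>\<epsilon>. SUP \<theta>\<in>{\<theta>\<in>\<Theta>. \<bar>\<theta> - \<theta>0\<bar> \<le> \<nu>}.
       filter_risk (M \<epsilon> \<theta>) (X \<epsilon> \<theta>) (Y \<epsilon> \<theta>) \<epsilon> t (\<lambda>\<omega>. h \<epsilon> (path_upto t (X \<epsilon> \<theta>) \<omega>)))"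

text \<open>Standing assumption on a coefficient, and being separated from zero.\<close>

definition bounded_coefficient :: "real \<Rightarrow> (real \<Rightarrow> real) \<Rightarrow> bool" where
  "bounded_coefficient T g \<longleftrightarrow> set_borel_measurable lborel {0..T} g \<and> bounded (g ` {0..T})"

definition separated_from_zero :: "real \<Rightarrow> (real \<Rightarrow> real) \<Rightarrow> bool" where
  "separated_from_zero T g \<longleftrightarrow> (INF s\<in>{0..T}. \<bar>g s\<bar>) > 0"

end

theory Submission
  imports Defs
begin

text \<open>All processes are Wiener integrals of explicit deterministic kernels with respect to \<open>(W, V)\<close>, plus a
  mean that is linear in \<open>\<theta>\<close>. Kernel calculus shows that the error of \<open>\<theta> Phi(0,t) + H(t)\<close> is uncorrelated
  with, hence independent of, the path of \<open>X\<close>, so this is the conditional mean, and that the estimator of the initial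
  value is \<open>\<theta> + \<epsilon> U\<close> with \<open>U\<close> of variance \<open>1 / I\<close>. This gives the exact risk of the adaptive filter.
  For the lower bound, the path is \<open>(\<theta> + \<epsilon> U) xbar + \<epsilon> N\<close> with a deterministic function \<open>xbar\<close> and a noise \<open>N\<close>
  independent of \<open>U\<close>; the law of \<open>(U, N)\<close> depends neither on \<open>\<epsilon>\<close> nor on \<open>\<theta>\<close> and is invariant under \<open>U \<mapsto> -U\<close>.
  Averaging the risk over a uniform prior around \<open>\<theta>0\<close> and symmetrizing in \<open>U\<close> removes the estimator from
  the bound.\<close>

section \<open>Square-integrable functions\<close>

text \<open>The coefficients are merely bounded and measurable, so differential identities are used
  in integrated form and stochastic ones become inner products of kernels in L^2[0,T]. Each inner
  product that matters is computable because its integrand is the derivative of an explicit product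
  with known endpoint values. Independence of an error and the path is used only as invariance of a
  joint law under a change of sign. Cosine moments reduce this to covariances and also compare laws
  on different spaces, as required because each pair of \<open>\<epsilon>\<close> and
  \<open>\<theta>\<close> has its own model. The path splits because the covariance of the noise in
  \<open>X s\<close> with \<open>U\<close> is proportional to the mean of \<open>X s\<close>:
  regressing the noise on \<open>U\<close> yields a multiple of \<open>xbar\<close>, which merges
  with the signal. Once \<open>w = \<theta> + \<epsilon> U\<close> is given, the path carries no
  information on the sign of \<open>U\<close>. The range of \<open>w\<close> under the uniform prior
  moves with \<open>U\<close>; truncation repairs this at the cost of a factor
  \<open>1 - \<delta> / \<eta>\<close>, which disappears when \<open>\<epsilon>\<close> tends to 0
  before \<open>\<delta>\<close>.\<close>

definition sq_integrable :: "'a measure \<Rightarrow> ('a \<Rightarrow> real) \<Rightarrow> bool" where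
  "sq_integrable M X \<longleftrightarrow> X \<in> borel_measurable M \<and> integrable M (\<lambda>x. (X x)\<^sup>2)"

text \<open>Formulated with the nonnegative integral, so that square-integrability of the limit is a
  consequence (\<open>sq_integrable_lim\<close>) and not a prerequisite.\<close>

definition l2_lim :: "'a measure \<Rightarrow> (nat \<Rightarrow> 'a \<Rightarrow> real) \<Rightarrow> ('a \<Rightarrow> real) \<Rightarrow> bool" where
  "l2_lim M S Z \<longleftrightarrow> (\<lambda>n. \<integral>\<^sup>+ x. ennreal ((S n x - Z x)\<^sup>2) \<partial>M) \<longlonglongrightarrow> 0"

lemma sq_integrable_square: "sq_integrable M X \<Longrightarrow> integrable M (\<lambda>x. (X x)\<^sup>2)"
  by (simp add: sq_integrable_def)

lemma sq_integrable_mult: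
  assumes X: "sq_integrable M X" and Y: "sq_integrable M Y"
  shows "integrable M (\<lambda>x. X x * Y x)"
proof (rule Bochner_Integration.integrable_bound)
  show "integrable M (\<lambda>x. (X x)\<^sup>2 + (Y x)\<^sup>2)"
    using X Y by (auto simp: sq_integrable_def)
  show "(\<lambda>x. X x * Y x) \<in> borel_measurable M"
    using X Y by (auto simp: sq_integrable_def)
  have "\<bar>a * b\<bar> \<le> a\<^sup>2 + b\<^sup>2" for a b :: real
  proof -
    have "2 * \<bar>a\<bar> * \<bar>b\<bar> \<le> a\<^sup>2 + b\<^sup>2" using sum_squares_bound[of "\<bar>a\<bar>" "\<bar>b\<bar>"] by simp
    moreover have "0 \<le> \<bar>a\<bar> * \<bar>b\<bar>" by simp
    ultimately show ?thesis unfolding abs_mult by linarith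
  qed
  then show "AE x in M. norm (X x * Y x) \<le> norm ((X x)\<^sup>2 + (Y x)\<^sup>2)"
    by simp
qed

lemma sq_integrable_cmult: "sq_integrable M X \<Longrightarrow> sq_integrable M (\<lambda>x. c * X x)"
  by (auto simp: sq_integrable_def power_mult_distrib)

lemma sq_integrable_add:
  assumes X: "sq_integrable M X" and Y: "sq_integrable M Y"
  shows "sq_integrable M (\<lambda>x. X x + Y x)"
proof -
  have "integrable M (\<lambda>x. (X x)\<^sup>2 + (Y x)\<^sup>2 + 2 * (X x * Y x))"
    using X Y sq_integrable_mult[OF X Y] by (auto simp: sq_integrable_def)
  then show ?thesis
    using X Y by (auto simp: sq_integrable_def power2_sum algebra_simps)
qed

lemma sq_integrable_diff:
  assumes X: "sq_integrable M X" and Y: "sq_integrable M Y"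
  shows "sq_integrable M (\<lambda>x. X x - Y x)"
  using sq_integrable_add[OF X sq_integrable_cmult[OF Y, of "-1"]] by simp

lemma sq_integrable_0[simp]: "sq_integrable M (\<lambda>x. 0)"
  by (simp add: sq_integrable_def)

lemma (in finite_measure) sq_integrable_const[simp]: "sq_integrable M (\<lambda>x. c)"
  by (simp add: sq_integrable_def)

lemma (in finite_measure) sq_integrable_integrable: "sq_integrable M X \<Longrightarrow> integrable M X"
  using sq_integrable_mult[of M X "\<lambda>_. 1"] by simp

lemma (in finite_measure) sq_integrable_bounded:
  assumes "X \<in> borel_measurable M" "\<And>x. x \<in> space M \<Longrightarrow> \<bar>X x\<bar> \<le> C"
  shows "sq_integrable M X"
proof -
  have "integrable M (\<lambda>x. (X x)\<^sup>2)"
  proof (rule integrable_const_bound[where B="C\<^sup>2"])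
    show "AE x in M. norm ((X x)\<^sup>2) \<le> C\<^sup>2"
    proof (rule AE_I2)
      fix x assume "x \<in> space M"
      from assms(2)[OF this] have "\<bar>X x\<bar>\<^sup>2 \<le> C\<^sup>2" by (intro power_mono) auto
      then show "norm ((X x)\<^sup>2) \<le> C\<^sup>2" by simp
    qed
  qed (use assms in auto)
  then show ?thesis using assms by (simp add: sq_integrable_def)
qed

lemma nn_integral_sq:
  "sq_integrable M X \<Longrightarrow> (\<integral>\<^sup>+ x. ennreal ((X x)\<^sup>2) \<partial>M) = ennreal (\<integral>x. (X x)\<^sup>2 \<partial>M)"
  by (intro nn_integral_eq_integral) (auto simp: sq_integrable_def)

lemma sq_integrableI_nn_integral:
  assumes "X \<in> borel_measurable M" "(\<integral>\<^sup>+ x. ennreal ((X x)\<^sup>2) \<partial>M) < \<infinity>"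
  shows "sq_integrable M X"
  using assms unfolding sq_integrable_def by (auto intro!: integrableI_bounded)

text \<open>Used above all with \<open>c = 1\<close> and \<open>d = -1\<close>: if both second
  moments equal the mixed moment, the two variables agree almost surely.\<close>

lemma integral_square_lin2:
  assumes X: "sq_integrable M X" and Y: "sq_integrable M Y"
  shows "(\<integral>x. (c * X x + d * Y x)\<^sup>2 \<partial>M) =
    c\<^sup>2 * (\<integral>x. (X x)\<^sup>2 \<partial>M) + 2 * c * d * (\<integral>x. X x * Y x \<partial>M) + d\<^sup>2 * (\<integral>x. (Y x)\<^sup>2 \<partial>M)"
proof -
  have "(\<integral>x. (c * X x + d * Y x)\<^sup>2 \<partial>M) =
     (\<integral>x. c\<^sup>2 * (X x)\<^sup>2 + 2 * c * d * (X x * Y x) + d\<^sup>2 * (Y x)\<^sup>2 \<partial>M)"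
    by (intro Bochner_Integration.integral_cong) (auto simp: power2_eq_square algebra_simps)
  then show ?thesis
    using sq_integrable_square[OF X] sq_integrable_square[OF Y] sq_integrable_mult[OF X Y] by simp
qed

lemma l2_Cauchy_Schwarz:
  assumes X: "sq_integrable M X" and Y: "sq_integrable M Y"
  shows "\<bar>\<integral>x. X x * Y x \<partial>M\<bar> \<le> sqrt (\<integral>x. (X x)\<^sup>2 \<partial>M) * sqrt (\<integral>x. (Y x)\<^sup>2 \<partial>M)"
proof -
  define a b c where "a = (\<integral>x. (X x)\<^sup>2 \<partial>M)" "b = (\<integral>x. (Y x)\<^sup>2 \<partial>M)" "c = (\<integral>x. X x * Y x \<partial>M)"
  have ab: "a \<ge> 0" "b \<ge> 0" by (auto simp: a_b_c_def)
  have q: "0 \<le> s\<^sup>2 * a + 2 * s * u * c + u\<^sup>2 * b" for s u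
  proof -
    have "0 \<le> (\<integral>x. (s * X x + u * Y x)\<^sup>2 \<partial>M)" by (rule Bochner_Integration.integral_nonneg) simp
    then show ?thesis unfolding integral_square_lin2[OF X Y, of s u] a_b_c_def by simp
  qed
  have "c\<^sup>2 \<le> a * b"
  proof (cases "b = 0")
    case True
    have "c = 0"
    proof (rule ccontr)
      assume "c \<noteq> 0"
      \<comment> \<open>With \<open>b = 0\<close> the form is linear in \<open>u\<close>; this
        \<open>u\<close> makes it equal to -1.\<close>
      then show False using q[of 1 "- (a + 1) / (2 * c)"] True ab by (simp add: field_simps)
    qed
    then show ?thesis using ab by simp
  next
    case False
    \<comment> \<open>At \<open>s = b\<close>, \<open>u = - c\<close> the form factors as
      \<open>b * (a * b - c\<^sup>2)\<close>.\<close>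
    have "0 \<le> b * (a * b - c\<^sup>2)" using q[of b "- c"] by (simp add: power2_eq_square algebra_simps)
    then show ?thesis using ab False by (simp add: zero_le_mult_iff)
  qed
  then have "sqrt (c\<^sup>2) \<le> sqrt (a * b)" by (rule real_sqrt_le_mono)
  then show ?thesis by (simp add: a_b_c_def real_sqrt_mult)
qed

lemma (in prob_space) l2_abs_expectation_le:
  assumes X: "sq_integrable M X"
  shows "(\<integral>x. \<bar>X x\<bar> \<partial>M) \<le> sqrt (\<integral>x. (X x)\<^sup>2 \<partial>M)"
proof -
  have "sq_integrable M (\<lambda>x. \<bar>X x\<bar>)" using X by (auto simp: sq_integrable_def)
  from l2_Cauchy_Schwarz[OF this sq_integrable_const, of 1] show ?thesis by (simp add: prob_space)
qed

text \<open>One member of the sequence at finite distance suffices: \<open>Z\<close> is that member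
  minus a square-integrable difference.\<close>

lemma sq_integrable_lim:
  assumes S: "\<And>n. sq_integrable M (S n)" and Z: "Z \<in> borel_measurable M" and "l2_lim M S Z"
  shows "sq_integrable M Z"
proof -
  have "\<forall>\<^sub>F n in sequentially. (\<integral>\<^sup>+ x. ennreal ((S n x - Z x)\<^sup>2) \<partial>M) < 1"
    using assms(3) unfolding l2_lim_def by (rule order_tendstoD(2)) simp
  then obtain n where n: "(\<integral>\<^sup>+ x. ennreal ((S n x - Z x)\<^sup>2) \<partial>M) < 1"
    using eventually_happens'[OF sequentially_bot] by blast
  have "sq_integrable M (\<lambda>x. S n x - Z x)"
  proof (rule sq_integrableI_nn_integral)
    show "(\<lambda>x. S n x - Z x) \<in> borel_measurable M" using S[of n] Z by (auto simp: sq_integrable_def)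
    show "(\<integral>\<^sup>+ x. ennreal ((S n x - Z x)\<^sup>2) \<partial>M) < \<infinity>" using n by (rule order.strict_trans) simp
  qed
  from sq_integrable_diff[OF S[of n] this] show ?thesis by simp
qed

lemma l2_lim_iff:
  assumes S: "\<And>n. sq_integrable M (S n)" and Z: "sq_integrable M Z"
  shows "l2_lim M S Z \<longleftrightarrow> (\<lambda>n. \<integral>x. (S n x - Z x)\<^sup>2 \<partial>M) \<longlonglongrightarrow> 0"
  unfolding l2_lim_def nn_integral_sq[OF sq_integrable_diff[OF S Z]]
  by (auto simp flip: ennreal_0)

lemma integral_square_add_le:
  assumes X: "sq_integrable M X" and Y: "sq_integrable M Y"
  shows "(\<integral>x. (X x + Y x)\<^sup>2 \<partial>M) \<le> 2 * (\<integral>x. (X x)\<^sup>2 \<partial>M) + 2 * (\<integral>x. (Y x)\<^sup>2 \<partial>M)"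
proof -
  have "(\<integral>x. (X x + Y x)\<^sup>2 \<partial>M) \<le> (\<integral>x. 2 * (X x)\<^sup>2 + 2 * (Y x)\<^sup>2 \<partial>M)"
  proof (rule integral_mono)
    show "integrable M (\<lambda>x. (X x + Y x)\<^sup>2)" by (intro sq_integrable_square sq_integrable_add X Y)
    show "(X x + Y x)\<^sup>2 \<le> 2 * (X x)\<^sup>2 + 2 * (Y x)\<^sup>2" for x
      using sum_squares_bound[of "X x" "Y x"] by (simp add: power2_sum)
  qed (auto simp: X Y sq_integrable_square)
  then show ?thesis using X Y by (simp add: sq_integrable_square)
qed

lemma l2_lim_cmult:
  assumes "\<And>n. sq_integrable M (S n)" "sq_integrable M Z" "l2_lim M S Z"
  shows "l2_lim M (\<lambda>n x. c * S n x) (\<lambda>x. c * Z x)"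
proof -
  have "(\<lambda>n. c\<^sup>2 * (\<integral>x. (S n x - Z x)\<^sup>2 \<partial>M)) \<longlonglongrightarrow> c\<^sup>2 * 0"
    using assms(3) unfolding l2_lim_iff[OF assms(1,2)] by (intro tendsto_intros)
  then show ?thesis
    using assms by (simp add: l2_lim_iff sq_integrable_cmult power_mult_distrib flip: right_diff_distrib)
qed

lemma l2_lim_add:
  assumes S: "\<And>n. sq_integrable M (S n)" "sq_integrable M Z" "l2_lim M S Z"
    and S': "\<And>n. sq_integrable M (S' n)" "sq_integrable M Z'" "l2_lim M S' Z'"
  shows "l2_lim M (\<lambda>n x. S n x + S' n x) (\<lambda>x. Z x + Z' x)"
proof -
  have eq: "S n x + S' n x - (Z x + Z' x) = (S n x - Z x) + (S' n x - Z' x)" for n x by simp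
  have "(\<lambda>n. \<integral>x. (S n x + S' n x - (Z x + Z' x))\<^sup>2 \<partial>M) \<longlonglongrightarrow> 0"
  proof (rule Lim_null_comparison[OF always_eventually])
    have "(\<lambda>n. 2 * (\<integral>x. (S n x - Z x)\<^sup>2 \<partial>M) + 2 * (\<integral>x. (S' n x - Z' x)\<^sup>2 \<partial>M)) \<longlonglongrightarrow> 2 * 0 + 2 * 0"
      using S(3) S'(3) unfolding l2_lim_iff[OF S(1,2)] l2_lim_iff[OF S'(1,2)] by (intro tendsto_intros)
    then show "(\<lambda>n. 2 * (\<integral>x. (S n x - Z x)\<^sup>2 \<partial>M) + 2 * (\<integral>x. (S' n x - Z' x)\<^sup>2 \<partial>M)) \<longlonglongrightarrow> 0"
      by simp
    show "\<forall>n. norm (\<integral>x. (S n x + S' n x - (Z x + Z' x))\<^sup>2 \<partial>M)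
      \<le> 2 * (\<integral>x. (S n x - Z x)\<^sup>2 \<partial>M) + 2 * (\<integral>x. (S' n x - Z' x)\<^sup>2 \<partial>M)"
      unfolding eq
      using integral_square_add_le[OF sq_integrable_diff[OF S(1,2)] sq_integrable_diff[OF S'(1,2)]]
      by simp
  qed
  then show ?thesis
    by (subst l2_lim_iff) (auto intro: sq_integrable_add S S')
qed

text \<open>The difference of the products splits into one term of second order and two of first
  order in the distances; Cauchy-Schwarz bounds each of them.\<close>

lemma l2_lim_inner:
  assumes S: "\<And>n. sq_integrable M (S n)" "sq_integrable M Z" "l2_lim M S Z"
    and S': "\<And>n. sq_integrable M (S' n)" "sq_integrable M Z'" "l2_lim M S' Z'"
  shows "(\<lambda>n. \<integral>x. S n x * S' n x \<partial>M) \<longlonglongrightarrow> (\<integral>x. Z x * Z' x \<partial>M)"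
proof -
  define d where "d n = sqrt (\<integral>x. (S n x - Z x)\<^sup>2 \<partial>M)" for n
  define d' where "d' n = sqrt (\<integral>x. (S' n x - Z' x)\<^sup>2 \<partial>M)" for n
  define z z' where "z = sqrt (\<integral>x. (Z x)\<^sup>2 \<partial>M)" and "z' = sqrt (\<integral>x. (Z' x)\<^sup>2 \<partial>M)"
  have "(\<lambda>n. sqrt (\<integral>x. (S n x - Z x)\<^sup>2 \<partial>M)) \<longlonglongrightarrow> sqrt 0"
    "(\<lambda>n. sqrt (\<integral>x. (S' n x - Z' x)\<^sup>2 \<partial>M)) \<longlonglongrightarrow> sqrt 0"
    using S(3) S'(3) unfolding l2_lim_iff[OF S(1,2)] l2_lim_iff[OF S'(1,2)]
    by (auto intro!: tendsto_real_sqrt simp del: real_sqrt_zero)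
  then have d: "d \<longlonglongrightarrow> 0" "d' \<longlonglongrightarrow> 0" by (simp_all add: d_def[abs_def] d'_def[abs_def])
  have b: "norm ((\<integral>x. S n x * S' n x \<partial>M) - (\<integral>x. Z x * Z' x \<partial>M)) \<le> d n * d' n + d n * z' + z * d' n" for n
  proof -
    have D: "sq_integrable M (\<lambda>x. S n x - Z x)" "sq_integrable M (\<lambda>x. S' n x - Z' x)"
      using assms by (auto intro: sq_integrable_diff)
    have "(\<integral>x. S n x * S' n x \<partial>M) - (\<integral>x. Z x * Z' x \<partial>M) = (\<integral>x. S n x * S' n x - Z x * Z' x \<partial>M)"
      using assms by (simp add: sq_integrable_mult)
    also have "\<dots> = (\<integral>x. (S n x - Z x) * (S' n x - Z' x) + ((S n x - Z x) * Z' x + Z x * (S' n x - Z' x)) \<partial>M)"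
      by (intro Bochner_Integration.integral_cong) (auto simp: algebra_simps)
    also have "\<dots> = (\<integral>x. (S n x - Z x) * (S' n x - Z' x) \<partial>M) +
       ((\<integral>x. (S n x - Z x) * Z' x \<partial>M) + (\<integral>x. Z x * (S' n x - Z' x) \<partial>M))"
      using sq_integrable_mult[OF D] sq_integrable_mult[OF D(1) S'(2)] sq_integrable_mult[OF S(2) D(2)]
      by simp
    finally show ?thesis
      using l2_Cauchy_Schwarz[OF D] l2_Cauchy_Schwarz[OF D(1) S'(2)] l2_Cauchy_Schwarz[OF S(2) D(2)]
      unfolding d_def d'_def z_def z'_def real_norm_def by linarith
  qed
  have "(\<lambda>n. d n * d' n + d n * z' + z * d' n) \<longlonglongrightarrow> 0 * 0 + 0 * z' + z * 0"
    using d by (intro tendsto_intros)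
  then have "(\<lambda>n. d n * d' n + d n * z' + z * d' n) \<longlonglongrightarrow> 0" by simp
  with always_eventually[OF allI[OF b]]
  have "(\<lambda>n. (\<integral>x. S n x * S' n x \<partial>M) - (\<integral>x. Z x * Z' x \<partial>M)) \<longlonglongrightarrow> 0"
    by (rule Lim_null_comparison)
  then show ?thesis by (simp add: LIM_zero_iff)
qed

lemma integral_sq_eq_0_AE:
  assumes Z: "sq_integrable M Z" and "(\<integral>x. (Z x)\<^sup>2 \<partial>M) = 0"
  shows "AE x in M. Z x = 0"
  using assms integral_nonneg_eq_0_iff_AE[OF sq_integrable_square[OF Z]] by simp

lemma l2_lim_unique:
  assumes S: "\<And>n. sq_integrable M (S n)" and Z: "sq_integrable M Z" "l2_lim M S Z"
    and Z': "sq_integrable M Z'" "l2_lim M S Z'"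
  shows "AE x in M. Z x = Z' x"
proof -
  \<comment> \<open>\<open>S n - S n\<close> is the zero sequence, so its limit
    \<open>Z - Z'\<close> has norm zero.\<close>
  have 1: "l2_lim M (\<lambda>n x. S n x + - 1 * S n x) (\<lambda>x. Z x + - 1 * Z' x)"
    by (rule l2_lim_add[OF S Z sq_integrable_cmult[OF S] sq_integrable_cmult[OF Z'(1)] l2_lim_cmult[OF S Z']])
  have d: "sq_integrable M (\<lambda>x. Z x - Z' x)" by (rule sq_integrable_diff[OF Z(1) Z'(1)])
  from 1 have "(\<integral>x. (Z x - Z' x)\<^sup>2 \<partial>M) = 0"
    using l2_lim_iff[OF sq_integrable_0 d] by (simp add: power2_commute LIMSEQ_const_iff)
  from integral_sq_eq_0_AE[OF d this] show ?thesis by simp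
qed

section \<open>Continuity of cosine moments under L^2 convergence\<close>

lemma abs_cos_diff_le: "\<bar>cos x - cos y\<bar> \<le> \<bar>x - y :: real\<bar>"
proof -
  have "\<bar>cos x - cos y\<bar> = 2 * \<bar>sin ((x + y) / 2)\<bar> * \<bar>sin ((y - x) / 2)\<bar>"
    by (simp add: cos_diff_cos abs_mult)
  also have "\<dots> \<le> 2 * 1 * \<bar>(y - x) / 2\<bar>"
    by (intro mult_mono abs_sin_x_le_abs_x) auto
  finally show ?thesis by simp
qed

text \<open>The cosine is 1-Lipschitz, and the L^1 distance is at most the L^2 distance. The phase
  \<open>c\<close> is carried along because shifting it by a quarter period turns cosines into
  sines.\<close>

lemma (in prob_space) l2_lim_cos:
  assumes S: "\<And>n. sq_integrable M (S n)" and Z: "sq_integrable M Z" "l2_lim M S Z"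
  shows "(\<lambda>n. \<integral>x. cos (c + S n x) \<partial>M) \<longlonglongrightarrow> (\<integral>x. cos (c + Z x) \<partial>M)"
proof -
  have i: "integrable M (\<lambda>x. cos (c + X x))" if "sq_integrable M X" for X
    using that by (intro integrable_const_bound[where B=1]) (auto simp: sq_integrable_def)
  have b: "norm ((\<integral>x. cos (c + S n x) \<partial>M) - (\<integral>x. cos (c + Z x) \<partial>M)) \<le> sqrt (\<integral>x. (S n x - Z x)\<^sup>2 \<partial>M)" for n
  proof -
    have D: "sq_integrable M (\<lambda>x. S n x - Z x)" by (intro sq_integrable_diff S Z)
    have "(\<integral>x. cos (c + S n x) \<partial>M) - (\<integral>x. cos (c + Z x) \<partial>M) = (\<integral>x. cos (c + S n x) - cos (c + Z x) \<partial>M)"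
      using i[OF S[of n]] i[OF Z(1)] by simp
    also have "norm \<dots> \<le> (\<integral>x. norm (cos (c + S n x) - cos (c + Z x)) \<partial>M)" by simp
    also have "\<dots> \<le> (\<integral>x. \<bar>S n x - Z x\<bar> \<partial>M)"
      using i[OF S[of n]] i[OF Z(1)] sq_integrable_integrable[OF D]
      by (intro integral_mono integrable_norm) (auto intro: order_trans[OF abs_cos_diff_le])
    also have "\<dots> \<le> sqrt (\<integral>x. (S n x - Z x)\<^sup>2 \<partial>M)" by (rule l2_abs_expectation_le[OF D])
    finally show ?thesis .
  qed
  have "(\<lambda>n. sqrt (\<integral>x. (S n x - Z x)\<^sup>2 \<partial>M)) \<longlonglongrightarrow> sqrt 0"
    using Z(2) unfolding l2_lim_iff[OF S Z(1)] by (rule tendsto_real_sqrt)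
  then have "(\<lambda>n. sqrt (\<integral>x. (S n x - Z x)\<^sup>2 \<partial>M)) \<longlonglongrightarrow> 0" by simp
  with always_eventually[OF allI[OF b]]
  have "(\<lambda>n. (\<integral>x. cos (c + S n x) \<partial>M) - (\<integral>x. cos (c + Z x) \<partial>M)) \<longlonglongrightarrow> 0"
    by (rule Lim_null_comparison)
  then show ?thesis by (simp add: LIM_zero_iff)
qed

section \<open>Laws of families of random variables are determined by cosine moments\<close>

text \<open>The nonnegative weights are normalised to probability densities. The hypotheses then say
  that the images under \<open>X\<close> and \<open>Y\<close> have equal characteristic functions,
  and Levy's uniqueness theorem applies.\<close>

lemma weighted_law_unique:
  fixes X :: "'p \<Rightarrow> real" and Y :: "'q \<Rightarrow> real" and G :: "'p \<Rightarrow> real" and H :: "'q \<Rightarrow> real"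
  assumes P: "prob_space P" and Q: "prob_space Q"
    and [measurable]: "X \<in> borel_measurable P" "Y \<in> borel_measurable Q"
      "G \<in> borel_measurable P" "H \<in> borel_measurable Q"
    and G: "\<And>x. 0 \<le> G x" "\<And>x. G x \<le> C" and H: "\<And>x. 0 \<le> H x" "\<And>x. H x \<le> C"
    and c: "\<And>l. (\<integral>x. G x * cos (l * X x) \<partial>P) = (\<integral>x. H x * cos (l * Y x) \<partial>Q)"
    and s: "\<And>l. (\<integral>x. G x * sin (l * X x) \<partial>P) = (\<integral>x. H x * sin (l * Y x) \<partial>Q)"
    and [measurable]: "B \<in> sets borel"
  shows "(\<integral>x. G x * indicator B (X x) \<partial>P) = (\<integral>x. H x * indicator B (Y x) \<partial>Q)"
proof -
  interpret P: prob_space P by fact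
  interpret Q: prob_space Q by fact
  define m where "m = (\<integral>x. G x \<partial>P)"
  have mH: "m = (\<integral>x. H x \<partial>Q)" using c[of 0] by (simp add: m_def)
  have iG: "integrable P (\<lambda>x. G x * g x)" if [measurable]: "g \<in> borel_measurable P" and "\<And>x. \<bar>g x\<bar> \<le> 1" for g
  proof (rule P.integrable_const_bound[where B=C])
    have "G x * \<bar>g x\<bar> \<le> C" for x
      using mult_mono[of "G x" C "\<bar>g x\<bar>" 1] that(2)[of x] G[of x] by auto
    then show "AE x in P. norm (G x * g x) \<le> C" using G(1) by (auto simp: abs_mult)
  qed measurable
  have iH: "integrable Q (\<lambda>x. H x * g x)" if [measurable]: "g \<in> borel_measurable Q" and "\<And>x. \<bar>g x\<bar> \<le> 1" for g
  proof (rule Q.integrable_const_bound[where B=C])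
    have "H x * \<bar>g x\<bar> \<le> C" for x
      using mult_mono[of "H x" C "\<bar>g x\<bar>" 1] that(2)[of x] H[of x] by auto
    then show "AE x in Q. norm (H x * g x) \<le> C" using H(1) by (auto simp: abs_mult)
  qed measurable
  have iG1: "integrable P G" using iG[of "\<lambda>_. 1"] by simp
  have iH1: "integrable Q H" using iH[of "\<lambda>_. 1"] by simp
  have "m \<ge> 0" using G by (auto simp: m_def)
  show ?thesis
  proof (cases "m = 0")
    \<comment> \<open>With total mass zero no normalisation is possible, but then both weights
      vanish almost everywhere.\<close>
    case True
    have "AE x in P. G x = 0" using True iG1 G integral_nonneg_eq_0_iff_AE[OF iG1] by (auto simp: m_def)
    then have "(\<integral>x. G x * indicator B (X x) \<partial>P) = (\<integral>x. 0 \<partial>P)" by (intro integral_cong_AE) auto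
    moreover have "AE x in Q. H x = 0" using True iH1 H integral_nonneg_eq_0_iff_AE[OF iH1] by (auto simp: mH)
    then have "(\<integral>x. H x * indicator B (Y x) \<partial>Q) = (\<integral>x. 0 \<partial>Q)" by (intro integral_cong_AE) auto
    ultimately show ?thesis by simp
  next
    case False
    with \<open>m \<ge> 0\<close> have m: "m > 0" by simp
    define \<mu> where "\<mu> = distr (density P (\<lambda>x. ennreal (G x / m))) borel X"
    define \<nu> where "\<nu> = distr (density Q (\<lambda>x. ennreal (H x / m))) borel Y"
    have "(\<integral>\<^sup>+ x. ennreal (G x / m) \<partial>P) = ennreal (\<integral>x. G x / m \<partial>P)"
      using iG1 G m by (intro nn_integral_eq_integral) auto
    also have "\<dots> = 1" using m by (simp add: m_def)
    finally have "prob_space (density P (\<lambda>x. ennreal (G x / m)))"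
      by (intro prob_spaceI) (auto simp: emeasure_density cong: nn_integral_cong)
    then interpret \<mu>: real_distribution \<mu>
      unfolding \<mu>_def by (auto simp: prob_space.real_distribution_distr)
    have "(\<integral>\<^sup>+ x. ennreal (H x / m) \<partial>Q) = ennreal (\<integral>x. H x / m \<partial>Q)"
      using iH1 H m by (intro nn_integral_eq_integral) auto
    also have "\<dots> = 1" using m by (simp add: mH)
    finally have "prob_space (density Q (\<lambda>x. ennreal (H x / m)))"
      by (intro prob_spaceI) (auto simp: emeasure_density cong: nn_integral_cong)
    then interpret \<nu>: real_distribution \<nu>
      unfolding \<nu>_def by (auto simp: prob_space.real_distribution_distr)
    have int\<mu>: "(\<integral>y. g y \<partial>\<mu>) = (\<integral>x. G x * g (X x) \<partial>P) / m" if [measurable]: "g \<in> borel_measurable borel" for g :: "real \<Rightarrow> real"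
      using G m by (simp add: \<mu>_def integral_distr integral_density)
    have int\<nu>: "(\<integral>y. g y \<partial>\<nu>) = (\<integral>x. H x * g (Y x) \<partial>Q) / m" if [measurable]: "g \<in> borel_measurable borel" for g :: "real \<Rightarrow> real"
      using H m by (simp add: \<nu>_def integral_distr integral_density)
    have "char \<mu> t = char \<nu> t" for t
    proof (rule complex_eqI)
      have e: "Re (char \<mu> t) = (\<integral>y. cos (t * y) \<partial>\<mu>)" "Im (char \<mu> t) = (\<integral>y. sin (t * y) \<partial>\<mu>)"
        using \<mu>.integrable_iexp[of "\<lambda>x. t * x"]
        by (simp_all add: char_def Re_exp Im_exp flip: integral_Re integral_Im)
      have e': "Re (char \<nu> t) = (\<integral>y. cos (t * y) \<partial>\<nu>)" "Im (char \<nu> t) = (\<integral>y. sin (t * y) \<partial>\<nu>)"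
        using \<nu>.integrable_iexp[of "\<lambda>x. t * x"]
        by (simp_all add: char_def Re_exp Im_exp flip: integral_Re integral_Im)
      show "Re (char \<mu> t) = Re (char \<nu> t)" unfolding e e' by (simp add: int\<mu> int\<nu> c)
      show "Im (char \<mu> t) = Im (char \<nu> t)" unfolding e e' by (simp add: int\<mu> int\<nu> s)
    qed
    then have "\<mu> = \<nu>" by (intro Levy_uniqueness \<mu>.real_distribution_axioms \<nu>.real_distribution_axioms) auto
    with int\<mu>[of "indicator B"] int\<nu>[of "indicator B"] m show ?thesis by simp
  qed
qed

text \<open>Cosine factors are traded for indicators one coordinate at a time, so that only
  one-dimensional characteristic functions occur. For the new coordinate \<open>k\<close>, the
  induction hypothesis with all phases and frequencies yields the characteristic function of
  \<open>A k\<close> under the weight collected so far. The remaining factor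
  \<open>cos (c + u x)\<close> changes sign; the nonnegative weight \<open>1 + cos (c + u x)\<close>
  is used in its place, and the part belonging to \<open>1\<close> is subtracted at the end.\<close>

lemma cos_moments_box:
  fixes A :: "'i \<Rightarrow> 'p \<Rightarrow> real" and B :: "'i \<Rightarrow> 'q \<Rightarrow> real"
  assumes P: "prob_space P" and Q: "prob_space Q"
    and A: "\<And>i. i \<in> I \<Longrightarrow> A i \<in> borel_measurable P" and B: "\<And>i. i \<in> I \<Longrightarrow> B i \<in> borel_measurable Q"
    and eq: "\<And>J c l. finite J \<Longrightarrow> J \<subseteq> I \<Longrightarrow>
      (\<integral>x. cos (c + (\<Sum>j\<in>J. l j * A j x)) \<partial>P) = (\<integral>x. cos (c + (\<Sum>j\<in>J. l j * B j x)) \<partial>Q)"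
    and K: "finite K" "K \<subseteq> I" and E: "\<And>i. i \<in> K \<Longrightarrow> E i \<in> sets borel"
    and J: "finite J" "J \<subseteq> I"
  shows "(\<integral>x. (\<Prod>i\<in>K. indicator (E i) (A i x)) * cos (c + (\<Sum>j\<in>J. l j * A j x)) \<partial>P) =
         (\<integral>x. (\<Prod>i\<in>K. indicator (E i) (B i x)) * cos (c + (\<Sum>j\<in>J. l j * B j x)) \<partial>Q)"
  using K E J
proof (induction K arbitrary: J c l rule: finite_induct)
  case empty
  then show ?case using eq by simp
next
  case (insert k K)
  interpret P: prob_space P by fact
  interpret Q: prob_space Q by fact
  have kI: "k \<in> I" and KI: "K \<subseteq> I" using insert by auto
  have Em: "\<And>i. i \<in> K \<Longrightarrow> E i \<in> sets borel" "E k \<in> sets borel" using insert by auto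
  have [measurable]: "A k \<in> borel_measurable P" "B k \<in> borel_measurable Q" using A B kI by auto
  define \<pi>P where "\<pi>P x = (\<Prod>i\<in>K. indicator (E i) (A i x) :: real)" for x
  define \<pi>Q where "\<pi>Q x = (\<Prod>i\<in>K. indicator (E i) (B i x) :: real)" for x
  define u where "u x = (\<Sum>j\<in>J. l j * A j x)" for x
  define v where "v x = (\<Sum>j\<in>J. l j * B j x)" for x
  have [measurable]: "\<pi>P \<in> borel_measurable P"
    unfolding \<pi>P_def[abs_def] by (intro borel_measurable_prod measurable_compose[OF A borel_measurable_indicator]) (use KI Em in auto)
  have [measurable]: "\<pi>Q \<in> borel_measurable Q"
    unfolding \<pi>Q_def[abs_def] by (intro borel_measurable_prod measurable_compose[OF B borel_measurable_indicator]) (use KI Em in auto)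
  have [measurable]: "u \<in> borel_measurable P" "v \<in> borel_measurable Q"
    unfolding u_def[abs_def] v_def[abs_def] using A B insert.prems(4)
    by (auto intro!: borel_measurable_sum borel_measurable_times)
  have \<pi>: "0 \<le> \<pi>P x" "\<pi>P x \<le> 1" "0 \<le> \<pi>Q y" "\<pi>Q y \<le> 1" for x y
    unfolding \<pi>P_def \<pi>Q_def by (auto intro!: prod_nonneg prod_le_1 simp: indicator_def)
  have IH1: "(\<integral>x. \<pi>P x * cos (c' + l' * A k x) \<partial>P) = (\<integral>x. \<pi>Q x * cos (c' + l' * B k x) \<partial>Q)" for c' l'
    using insert.IH[OF KI Em(1), of "{k}" c' "\<lambda>_. l'"] kI by (simp add: \<pi>P_def \<pi>Q_def)
  have IH2: "(\<integral>x. \<pi>P x * cos (c' + u x + l' * A k x) \<partial>P) = (\<integral>x. \<pi>Q x * cos (c' + v x + l' * B k x) \<partial>Q)" for c' l'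
  proof -
    \<comment> \<open>\<open>k\<close> may already belong to \<open>J\<close>; its two coefficients
      are then added.\<close>
    define m where "m j = (if j \<in> J then l j else 0) + (if j = k then l' else 0)" for j
    have "(\<Sum>j\<in>insert k J. m j * z j) = (\<Sum>j\<in>J. l j * z j) + l' * z k" for z :: "'i \<Rightarrow> real"
    proof -
      have "(\<Sum>j\<in>insert k J. m j * z j) =
        (\<Sum>j\<in>insert k J. (if j \<in> J then l j * z j else 0)) + (\<Sum>j\<in>insert k J. if j = k then l' * z j else 0)"
        unfolding sum.distrib[symmetric] by (intro sum.cong) (auto simp: m_def algebra_simps)
      also have "(\<Sum>j\<in>insert k J. if j = k then l' * z j else 0) = l' * z k"
        using insert.prems(3) by simp
      also have "(\<Sum>j\<in>insert k J. (if j \<in> J then l j * z j else 0)) = (\<Sum>j\<in>J. l j * z j)"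
        using insert.prems(3) by (intro sum.mono_neutral_cong_right) auto
      finally show ?thesis .
    qed
    then show ?thesis
      using insert.IH[OF KI Em(1), of "insert k J" c' m] kI insert.prems(3,4)
      by (simp add: \<pi>P_def \<pi>Q_def u_def v_def add.assoc)
  qed
  have bP: "integrable P (\<lambda>x. \<pi>P x * g x)" if [measurable]: "g \<in> borel_measurable P" and "\<And>x. \<bar>g x\<bar> \<le> 1" for g
    using that(2) \<pi> by (intro P.integrable_const_bound[where B=1] AE_I2) (auto simp: abs_mult mult_le_one)
  have bQ: "integrable Q (\<lambda>x. \<pi>Q x * g x)" if [measurable]: "g \<in> borel_measurable Q" and "\<And>x. \<bar>g x\<bar> \<le> 1" for g
    using that(2) \<pi> by (intro Q.integrable_const_bound[where B=1] AE_I2) (auto simp: abs_mult mult_le_one)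
  have iP: "integrable P (\<lambda>x. \<pi>P x * cos (c' + u x + l' * A k x))" for c' l' by (intro bP) auto
  have iQ: "integrable Q (\<lambda>x. \<pi>Q x * cos (c' + v x + l' * B k x))" for c' l' by (intro bQ) auto
  have s0: "(\<integral>x. \<pi>P x * sin (l' * A k x) \<partial>P) = (\<integral>x. \<pi>Q x * sin (l' * B k x) \<partial>Q)" for l'
  proof -
    \<comment> \<open>The arbitrary phase in the hypothesis covers sines as shifted cosines.\<close>
    have "sin y = cos (- (pi / 2) + y)" for y :: real by (simp add: cos_diff)
    then show ?thesis by (simp only: IH1)
  qed
  have c0: "(\<integral>x. \<pi>P x * cos (l' * A k x) \<partial>P) = (\<integral>x. \<pi>Q x * cos (l' * B k x) \<partial>Q)" for l'
    using IH1[of 0 l'] by simp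
  \<comment> \<open>The product-to-sum formula returns the product to the single cosines covered by
    \<open>IH2\<close>.\<close>
  have cc: "(\<integral>x. \<pi>P x * (cos (c + u x) * cos (l' * A k x)) \<partial>P) = (\<integral>x. \<pi>Q x * (cos (c + v x) * cos (l' * B k x)) \<partial>Q)" for l'
  proof -
    have "(\<integral>x. \<pi>P x * (cos (c + u x) * cos (l' * A k x)) \<partial>P) =
       (\<integral>x. (1/2) * (\<pi>P x * cos (c + u x + (-l') * A k x)) + (1/2) * (\<pi>P x * cos (c + u x + l' * A k x)) \<partial>P)"
      by (intro Bochner_Integration.integral_cong refl) (simp add: cos_times_cos algebra_simps add_divide_distrib)
    also have "\<dots> = (\<integral>x. (1/2) * (\<pi>Q x * cos (c + v x + (-l') * B k x)) + (1/2) * (\<pi>Q x * cos (c + v x + l' * B k x)) \<partial>Q)"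
      using iP[of c l'] iP[of c "-l'"] iQ[of c l'] iQ[of c "-l'"] IH2[of c l'] IH2[of c "-l'"] by simp
    also have "\<dots> = (\<integral>x. \<pi>Q x * (cos (c + v x) * cos (l' * B k x)) \<partial>Q)"
      by (intro Bochner_Integration.integral_cong refl) (simp add: cos_times_cos algebra_simps add_divide_distrib)
    finally show ?thesis .
  qed
  have cs: "(\<integral>x. \<pi>P x * (cos (c + u x) * sin (l' * A k x)) \<partial>P) = (\<integral>x. \<pi>Q x * (cos (c + v x) * sin (l' * B k x)) \<partial>Q)" for l'
  proof -
    have sn: "sin y = cos (- (pi / 2) + y)" for y :: real by (simp add: cos_diff)
    have t: "cos a * sin b = (1/2) * cos ((c - pi/2) + (a - c) + b) + (-1/2) * cos ((c - pi/2) + (a - c) + - b)" for a b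
      unfolding cos_times_sin sn[of "a + b"] sn[of "a - b"] by (simp add: algebra_simps diff_divide_distrib)
    have "(\<integral>x. \<pi>P x * (cos (c + u x) * sin (l' * A k x)) \<partial>P) =
       (\<integral>x. (1/2) * (\<pi>P x * cos ((c - pi/2) + u x + l' * A k x)) + (-1/2) * (\<pi>P x * cos ((c - pi/2) + u x + (-l') * A k x)) \<partial>P)"
      by (intro Bochner_Integration.integral_cong refl, subst t) (simp add: algebra_simps)
    also have "\<dots> = (\<integral>x. (1/2) * (\<pi>Q x * cos ((c - pi/2) + v x + l' * B k x)) + (-1/2) * (\<pi>Q x * cos ((c - pi/2) + v x + (-l') * B k x)) \<partial>Q)"
      using iP[of "c - pi/2" l'] iP[of "c - pi/2" "-l'"] iQ[of "c - pi/2" l'] iQ[of "c - pi/2" "-l'"] IH2[of "c - pi/2" l'] IH2[of "c - pi/2" "-l'"] by simp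
    also have "\<dots> = (\<integral>x. \<pi>Q x * (cos (c + v x) * sin (l' * B k x)) \<partial>Q)"
      by (intro Bochner_Integration.integral_cong refl, subst t) (simp add: algebra_simps)
    finally show ?thesis .
  qed
  have split: "(\<integral>x. \<pi>P x * (1 + cos (c + u x)) * g x \<partial>P) = (\<integral>x. \<pi>P x * g x \<partial>P) + (\<integral>x. \<pi>P x * (cos (c + u x) * g x) \<partial>P)"
    if [measurable]: "g \<in> borel_measurable P" and g: "\<And>x. \<bar>g x\<bar> \<le> 1" for g
  proof -
    have "\<bar>cos (c + u x) * g x\<bar> \<le> 1" for x using g[of x] by (simp add: abs_mult mult_le_one)
    then have "integrable P (\<lambda>x. \<pi>P x * (cos (c + u x) * g x))" "integrable P (\<lambda>x. \<pi>P x * g x)"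
      using g by (auto intro!: bP)
    then show ?thesis by (subst Bochner_Integration.integral_add[symmetric]) (auto simp: algebra_simps)
  qed
  have split': "(\<integral>x. \<pi>Q x * (1 + cos (c + v x)) * g x \<partial>Q) = (\<integral>x. \<pi>Q x * g x \<partial>Q) + (\<integral>x. \<pi>Q x * (cos (c + v x) * g x) \<partial>Q)"
    if [measurable]: "g \<in> borel_measurable Q" and g: "\<And>x. \<bar>g x\<bar> \<le> 1" for g
  proof -
    have "\<bar>cos (c + v x) * g x\<bar> \<le> 1" for x using g[of x] by (simp add: abs_mult mult_le_one)
    then have "integrable Q (\<lambda>x. \<pi>Q x * (cos (c + v x) * g x))" "integrable Q (\<lambda>x. \<pi>Q x * g x)"
      using g by (auto intro!: bQ)
    then show ?thesis by (subst Bochner_Integration.integral_add[symmetric]) (auto simp: algebra_simps)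
  qed
  have nn: "0 \<le> \<pi>P x * (1 + cos (c + u x))" "\<pi>P x * (1 + cos (c + u x)) \<le> 2"
    "0 \<le> \<pi>Q y * (1 + cos (c + v y))" "\<pi>Q y * (1 + cos (c + v y)) \<le> 2" for x y
  proof -
    have "0 \<le> 1 + cos (c + u x)" "1 + cos (c + u x) \<le> 2" "0 \<le> 1 + cos (c + v y)" "1 + cos (c + v y) \<le> 2"
      using cos_ge_minus_one[of "c + u x"] cos_le_one[of "c + u x"] cos_ge_minus_one[of "c + v y"] cos_le_one[of "c + v y"]
      by linarith+
    then show "0 \<le> \<pi>P x * (1 + cos (c + u x))" "\<pi>P x * (1 + cos (c + u x)) \<le> 2"
    "0 \<le> \<pi>Q y * (1 + cos (c + v y))" "\<pi>Q y * (1 + cos (c + v y)) \<le> 2"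
      using \<pi>(1,2)[of x] \<pi>(3,4)[of y] mult_mono[of "\<pi>P x" 1 "1 + cos (c + u x)" 2] mult_mono[of "\<pi>Q y" 1 "1 + cos (c + v y)" 2] by auto
  qed
  have r0: "(\<integral>x. \<pi>P x * indicator (E k) (A k x) \<partial>P) = (\<integral>x. \<pi>Q x * indicator (E k) (B k x) \<partial>Q)"
    by (rule weighted_law_unique[OF P Q, where C=1]) (use \<pi> c0 s0 Em in auto)
  have r1: "(\<integral>x. \<pi>P x * (1 + cos (c + u x)) * indicator (E k) (A k x) \<partial>P) =
      (\<integral>x. \<pi>Q x * (1 + cos (c + v x)) * indicator (E k) (B k x) \<partial>Q)"
  proof (rule weighted_law_unique[OF P Q, where C=2])
    show "(\<integral>x. \<pi>P x * (1 + cos (c + u x)) * cos (l * A k x) \<partial>P) = (\<integral>x. \<pi>Q x * (1 + cos (c + v x)) * cos (l * B k x) \<partial>Q)" for l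
      using split[of "\<lambda>x. cos (l * A k x)"] split'[of "\<lambda>x. cos (l * B k x)"] by (simp add: c0 cc)
    show "(\<integral>x. \<pi>P x * (1 + cos (c + u x)) * sin (l * A k x) \<partial>P) = (\<integral>x. \<pi>Q x * (1 + cos (c + v x)) * sin (l * B k x) \<partial>Q)" for l
      using split[of "\<lambda>x. sin (l * A k x)"] split'[of "\<lambda>x. sin (l * B k x)"] by (simp add: s0 cs)
  qed (use nn Em in auto)
  have [measurable]: "E k \<in> sets borel" by fact
  have "(\<integral>x. \<pi>P x * (cos (c + u x) * indicator (E k) (A k x)) \<partial>P) = (\<integral>x. \<pi>Q x * (cos (c + v x) * indicator (E k) (B k x)) \<partial>Q)"
  proof -
    have "\<bar>indicator (E k) y :: real\<bar> \<le> 1" for y by (simp add: indicator_def)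
    with split[of "\<lambda>x. indicator (E k) (A k x)"] split'[of "\<lambda>x. indicator (E k) (B k x)"] r0 r1
    show ?thesis by simp
  qed
  then show ?case
    using insert.hyps by (simp add: \<pi>P_def \<pi>Q_def u_def v_def mult_ac)
qed

text \<open>A finite measure on the infinite product is determined by the finite-dimensional boxes,
  whose masses \<open>cos_moments_box\<close> compares.\<close>

lemma cos_moments_law_unique:
  fixes A :: "'i \<Rightarrow> 'p \<Rightarrow> real" and B :: "'i \<Rightarrow> 'q \<Rightarrow> real"
  assumes P: "prob_space P" and Q: "prob_space Q"
    and A: "\<And>i. i \<in> I \<Longrightarrow> A i \<in> borel_measurable P" and B: "\<And>i. i \<in> I \<Longrightarrow> B i \<in> borel_measurable Q"
    and eq: "\<And>J c l. finite J \<Longrightarrow> J \<subseteq> I \<Longrightarrow>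
      (\<integral>x. cos (c + (\<Sum>j\<in>J. l j * A j x)) \<partial>P) = (\<integral>x. cos (c + (\<Sum>j\<in>J. l j * B j x)) \<partial>Q)"
  shows "distr P (\<Pi>\<^sub>M i\<in>I. borel) (\<lambda>x. \<lambda>i\<in>I. A i x) = distr Q (\<Pi>\<^sub>M i\<in>I. borel) (\<lambda>x. \<lambda>i\<in>I. B i x)"
proof -
  interpret P: prob_space P by fact
  interpret Q: prob_space Q by fact
  have mA[measurable]: "(\<lambda>x. \<lambda>i\<in>I. A i x) \<in> measurable P (\<Pi>\<^sub>M i\<in>I. borel)" by (intro measurable_restrict A)
  have mB[measurable]: "(\<lambda>x. \<lambda>i\<in>I. B i x) \<in> measurable Q (\<Pi>\<^sub>M i\<in>I. borel)" by (intro measurable_restrict B)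
  show ?thesis
  proof (rule measure_eqI_PiM_infinite)
    show "finite_measure (distr P (\<Pi>\<^sub>M i\<in>I. borel) (\<lambda>x. \<lambda>i\<in>I. A i x))"
      by (rule prob_space.finite_measure[OF P.prob_space_distr[OF mA]])
  next
    fix E :: "'i \<Rightarrow> real set" and J assume J: "finite J" "J \<subseteq> I" and E: "\<And>j. j \<in> J \<Longrightarrow> E j \<in> sets borel"
    let ?S = "prod_emb I (\<lambda>i. borel) J (Pi\<^sub>E J E)"
    have S: "?S \<in> sets (\<Pi>\<^sub>M i\<in>I. borel)" using J E by (intro sets_PiM_I) auto
    have "emeasure (distr P (\<Pi>\<^sub>M i\<in>I. borel) (\<lambda>x. \<lambda>i\<in>I. A i x)) ?S =
       ennreal (\<integral>x. (\<Prod>i\<in>J. indicator (E i) (A i x)) \<partial>P)"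
    proof -
      let ?V = "(\<lambda>x. \<lambda>i\<in>I. A i x) -` ?S \<inter> space P"
      have "(\<Prod>i\<in>J. indicator (E i) (A i x)) = (indicator ?V x :: real)" if "x \<in> space P" for x
        using that J by (auto simp: prod_emb_def indicator_def PiE_iff space_PiM prod_zero_iff subset_eq extensional_def split: if_splits)
      then have "(\<integral>x. (\<Prod>i\<in>J. indicator (E i) (A i x)) \<partial>P) = (\<integral>x. (indicator ?V x :: real) \<partial>P)"
        by (intro Bochner_Integration.integral_cong) auto
      also have "\<dots> = measure P ?V" using S by simp
      finally show ?thesis using S by (simp add: emeasure_distr P.emeasure_eq_measure)
    qed
    moreover have "emeasure (distr Q (\<Pi>\<^sub>M i\<in>I. borel) (\<lambda>x. \<lambda>i\<in>I. B i x)) ?S =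
       ennreal (\<integral>x. (\<Prod>i\<in>J. indicator (E i) (B i x)) \<partial>Q)"
    proof -
      let ?V = "(\<lambda>x. \<lambda>i\<in>I. B i x) -` ?S \<inter> space Q"
      have "(\<Prod>i\<in>J. indicator (E i) (B i x)) = (indicator ?V x :: real)" if "x \<in> space Q" for x
        using that J by (auto simp: prod_emb_def indicator_def PiE_iff space_PiM prod_zero_iff subset_eq extensional_def split: if_splits)
      then have "(\<integral>x. (\<Prod>i\<in>J. indicator (E i) (B i x)) \<partial>Q) = (\<integral>x. (indicator ?V x :: real) \<partial>Q)"
        by (intro Bochner_Integration.integral_cong) auto
      also have "\<dots> = measure Q ?V" using S by simp
      finally show ?thesis using S by (simp add: emeasure_distr Q.emeasure_eq_measure)
    qed
    \<comment> \<open>With no variables left in the cosine and phase 0, the cosine factor is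
      1.\<close>
    moreover have "(\<integral>x. (\<Prod>i\<in>J. indicator (E i) (A i x)) \<partial>P) = (\<integral>x. (\<Prod>i\<in>J. indicator (E i) (B i x) :: real) \<partial>Q)"
      using cos_moments_box[OF P Q A B eq J E, where J="{}" and c=0] by simp
    ultimately show "emeasure (distr P (\<Pi>\<^sub>M i\<in>I. borel) (\<lambda>x. \<lambda>i\<in>I. A i x)) ?S =
      emeasure (distr Q (\<Pi>\<^sub>M i\<in>I. borel) (\<lambda>x. \<lambda>i\<in>I. B i x)) ?S" by simp
  qed simp_all
qed

section \<open>Bounded Borel functions of time and their primitives\<close>

text \<open>Bounded on the whole line, so that changing the interval of integration needs no side
  conditions; vector values cover the pair-valued kernels.\<close>

definition bounded_borel :: "(real \<Rightarrow> 'b::euclidean_space) \<Rightarrow> bool" where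
  "bounded_borel g \<longleftrightarrow> g \<in> borel_measurable borel \<and> bounded (range g)"

lemma bounded_borel_measurable: "bounded_borel g \<Longrightarrow> g \<in> borel_measurable borel"
  by (simp add: bounded_borel_def)

lemma bounded_borelI:
  "g \<in> borel_measurable borel \<Longrightarrow> (\<And>x. norm (g x) \<le> C) \<Longrightarrow> bounded_borel g"
  by (auto simp: bounded_borel_def bounded_iff)

lemma bounded_borel_bound:
  assumes "bounded_borel g"
  obtains C where "C \<ge> 0" "\<And>x. norm (g x) \<le> C"
proof -
  obtain C where "\<And>x. norm (g x) \<le> C" using assms by (auto simp: bounded_borel_def bounded_iff)
  moreover from this[of 0] have "C \<ge> 0" using norm_ge_zero order_trans by blast
  ultimately show ?thesis using that by blast
qed

lemma bounded_borel_const[simp, intro!]: "bounded_borel (\<lambda>x. c)"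
  by (auto simp: bounded_borel_def)

lemma bounded_borel_add[intro]:
  assumes "bounded_borel g" "bounded_borel h" shows "bounded_borel (\<lambda>x. g x + h x)"
proof -
  obtain C where C: "\<And>x. norm (g x) \<le> C" using assms(1) bounded_borel_bound by blast
  obtain D where D: "\<And>x. norm (h x) \<le> D" using assms(2) bounded_borel_bound by blast
  show ?thesis using assms C D norm_triangle_mono[OF C D]
    by (intro bounded_borelI[where C="C + D"]) (auto simp: bounded_borel_def)
qed

lemma bounded_borel_scaleR[intro]:
  assumes "bounded_borel g" "bounded_borel h" shows "bounded_borel (\<lambda>x. g x *\<^sub>R h x)"
proof -
  obtain C where C: "C \<ge> 0" "\<And>x. norm (g x) \<le> C" using assms(1) bounded_borel_bound by blast
  obtain D where D: "D \<ge> 0" "\<And>x. norm (h x) \<le> D" using assms(2) bounded_borel_bound by blast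
  have "norm (g x *\<^sub>R h x) \<le> C * D" for x
    using mult_mono[OF C(2)[of x] D(2)[of x] C(1)] by simp
  then show ?thesis using assms
    by (intro bounded_borelI[where C="C * D"]) (auto simp: bounded_borel_def)
qed

lemma bounded_borel_mult[intro]:
  fixes g h :: "real \<Rightarrow> real"
  shows "bounded_borel g \<Longrightarrow> bounded_borel h \<Longrightarrow> bounded_borel (\<lambda>x. g x * h x)"
  using bounded_borel_scaleR[of g h] by simp

lemma bounded_borel_uminus[intro]: "bounded_borel g \<Longrightarrow> bounded_borel (\<lambda>x. - g x)"
  using bounded_borel_scaleR[of "\<lambda>_. -1" g] by simp

lemma bounded_borel_diff[intro]:
  "bounded_borel g \<Longrightarrow> bounded_borel h \<Longrightarrow> bounded_borel (\<lambda>x. g x - h x)"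
  using bounded_borel_add[of g "\<lambda>x. - h x"] bounded_borel_uminus[of h] by simp

lemma bounded_borel_power2[intro]:
  fixes g :: "real \<Rightarrow> real"
  shows "bounded_borel g \<Longrightarrow> bounded_borel (\<lambda>x. (g x)\<^sup>2)"
  by (simp add: power2_eq_square bounded_borel_mult)

lemma bounded_borel_if[intro]:
  assumes "bounded_borel g" "bounded_borel h" "A \<in> sets borel"
  shows "bounded_borel (\<lambda>x. if x \<in> A then g x else h x)"
proof -
  obtain C where C: "C \<ge> 0" "\<And>x. norm (g x) \<le> C" using assms(1) bounded_borel_bound by blast
  obtain D where D: "D \<ge> 0" "\<And>x. norm (h x) \<le> D" using assms(2) bounded_borel_bound by blast
  have m[measurable]: "g \<in> borel_measurable borel" "h \<in> borel_measurable borel" "A \<in> sets borel"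
    using assms by (auto simp: bounded_borel_def)
  show ?thesis
  proof (rule bounded_borelI[where C="max C D"])
    show "norm (if x \<in> A then g x else h x) \<le> max C D" for x
      using C(2)[of x] D(2)[of x] by auto
  qed measurable
qed

lemma bounded_borel_Pair[intro]:
  assumes "bounded_borel g" "bounded_borel h"
  shows "bounded_borel (\<lambda>x. (g x, h x))"
proof -
  obtain C where C: "\<And>x. norm (g x) \<le> C" using assms(1) bounded_borel_bound by blast
  obtain D where D: "\<And>x. norm (h x) \<le> D" using assms(2) bounded_borel_bound by blast
  have "norm (g x, h x) \<le> C + D" for x
    using norm_Pair_le[of "g x" "h x"] C[of x] D[of x] by linarith
  then show ?thesis using assms
    by (intro bounded_borelI[where C="C + D"]) (auto simp: bounded_borel_def)
qed

lemma bounded_borel_fst[intro]: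
  fixes k :: "real \<Rightarrow> 'b::euclidean_space \<times> 'c::euclidean_space"
  assumes "bounded_borel k" shows "bounded_borel (\<lambda>x. fst (k x))"
proof -
  obtain C where C: "\<And>x. norm (k x) \<le> C" using assms(1) bounded_borel_bound by blast
  have "norm (fst (k x)) \<le> C" for x using norm_fst_le[of "fst (k x)" "snd (k x)"] C[of x] by simp
  moreover have "fst \<in> borel_measurable (borel :: ('b \<times> 'c) measure)"
    by (intro borel_measurable_continuous_onI continuous_intros)
  then have "(\<lambda>x. fst (k x)) \<in> borel_measurable borel"
    using assms by (auto simp: bounded_borel_def intro: measurable_compose)
  ultimately show ?thesis by (intro bounded_borelI[where C=C])
qed

lemma bounded_borel_snd[intro]:
  fixes k :: "real \<Rightarrow> 'b::euclidean_space \<times> 'c::euclidean_space"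
  assumes "bounded_borel k" shows "bounded_borel (\<lambda>x. snd (k x))"
proof -
  obtain C where C: "\<And>x. norm (k x) \<le> C" using assms(1) bounded_borel_bound by blast
  have "norm (snd (k x)) \<le> C" for x using norm_snd_le[of "snd (k x)" "fst (k x)"] C[of x] by simp
  moreover have "snd \<in> borel_measurable (borel :: ('b \<times> 'c) measure)"
    by (intro borel_measurable_continuous_onI continuous_intros)
  then have "(\<lambda>x. snd (k x)) \<in> borel_measurable borel"
    using assms by (auto simp: bounded_borel_def intro: measurable_compose)
  ultimately show ?thesis by (intro bounded_borelI[where C=C])
qed

lemma bounded_borel_inner[intro]:
  assumes "bounded_borel g" "bounded_borel h" shows "bounded_borel (\<lambda>x. g x \<bullet> h x)"
proof -
  obtain C where C: "C \<ge> 0" "\<And>x. norm (g x) \<le> C" using assms(1) bounded_borel_bound by blast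
  obtain D where D: "D \<ge> 0" "\<And>x. norm (h x) \<le> D" using assms(2) bounded_borel_bound by blast
  have "norm (g x \<bullet> h x) \<le> C * D" for x
    using mult_mono[OF C(2)[of x] D(2)[of x] C(1)] Cauchy_Schwarz_ineq2[of "g x" "h x"] by simp
  then show ?thesis using assms
    by (intro bounded_borelI[where C="C * D"]) (auto simp: bounded_borel_def)
qed

lemma bounded_borel_exp[intro]:
  fixes g :: "real \<Rightarrow> real"
  assumes "bounded_borel g" shows "bounded_borel (\<lambda>x. exp (g x))"
proof -
  obtain C where C: "\<And>x. norm (g x) \<le> C" using assms(1) bounded_borel_bound by blast
  have "norm (exp (g x)) \<le> exp C" for x using C[of x] by simp
  then show ?thesis using assms
    by (intro bounded_borelI[where C="exp C"]) (auto simp: bounded_borel_def)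
qed

lemma bounded_borel_set_integrable:
  assumes "bounded_borel g" shows "set_integrable lborel {u..v} g"
proof -
  obtain C where C: "\<And>x. norm (g x) \<le> C" using assms(1) bounded_borel_bound by blast
  have [measurable]: "g \<in> borel_measurable borel" using assms by (simp add: bounded_borel_def)
  show ?thesis unfolding set_integrable_def
  proof (rule Bochner_Integration.integrable_bound)
    show "integrable lborel (\<lambda>x. indicator {u..v} x * C)"
      by (intro integrable_mult_left integrable_real_indicator) (auto simp: emeasure_lborel_Icc_eq)
    show "AE x in lborel. norm (indicator {u..v} x *\<^sub>R g x) \<le> norm (indicator {u..v} x * C)"
      using C by (auto simp: indicator_def intro: order_trans[OF _ abs_ge_self])
  qed simp
qed

lemma norm_set_integral_Icc_le:
  fixes g :: "real \<Rightarrow> 'b::euclidean_space"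
  assumes g: "bounded_borel g" and le: "u \<le> v" and C: "\<And>x. x \<in> {u..v} \<Longrightarrow> norm (g x) \<le> C"
  shows "norm (LINT r:{u..v}|lborel. g r) \<le> C * (v - u)"
proof -
  have "norm (LINT r:{u..v}|lborel. g r) \<le> (\<integral>x. norm (indicator {u..v} x *\<^sub>R g x) \<partial>lborel)"
    unfolding set_lebesgue_integral_def by (rule integral_norm_bound)
  also have "\<dots> \<le> (\<integral>x. indicator {u..v} x * C \<partial>lborel)"
  proof (rule integral_mono)
    show "integrable lborel (\<lambda>x. norm (indicator {u..v} x *\<^sub>R g x))"
      using bounded_borel_set_integrable[OF g] unfolding set_integrable_def by (rule integrable_norm)
    show "integrable lborel (\<lambda>x. indicator {u..v} x * C)"
      by (intro integrable_mult_left integrable_real_indicator) (auto simp: emeasure_lborel_Icc_eq)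
  qed (use C in \<open>auto simp: indicator_def\<close>)
  also have "\<dots> = C * (v - u)" using le by simp
  finally show ?thesis .
qed

lemma set_integral_Icc_split:
  fixes g :: "real \<Rightarrow> 'b::euclidean_space"
  assumes g: "bounded_borel g" and "u \<le> v" "v \<le> w"
  shows "(LINT r:{u..w}|lborel. g r) = (LINT r:{u..v}|lborel. g r) + (LINT r:{v..w}|lborel. g r)"
proof -
  have "AE x in lborel. x \<noteq> v" by (rule AE_lborel_singleton)
  then have "AE x in lborel. \<not> (x \<in> {u..v} \<and> x \<in> {v..w})" by eventually_elim auto
  then have "(LINT r:{u..v} \<union> {v..w}|lborel. g r) = (LINT r:{u..v}|lborel. g r) + (LINT r:{v..w}|lborel. g r)"
    by (intro set_integral_Un_AE bounded_borel_set_integrable g) auto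
  moreover have "{u..v} \<union> {v..w} = {u..w}" using assms by auto
  ultimately show ?thesis by simp
qed

lemma set_integral_Icc_refl: "(LINT r:{u..u::real}|lborel. g r) = (0 :: 'b::euclidean_space)"
proof -
  have "AE r in lborel. r \<noteq> u" by (rule AE_lborel_singleton)
  then have "AE r in lborel. indicator {u..u} r *\<^sub>R g r = 0" by eventually_elim auto
  then show ?thesis unfolding set_lebesgue_integral_def by (rule integral_eq_zero_AE)
qed

lemma set_integral_singleton[simp]: "(LINT r:{u::real}|lborel. g r) = (0 :: 'b::euclidean_space)"
  using set_integral_Icc_refl[of u g] by simp

text \<open>Telescoping over \<open>n\<close> equal pieces bounds the total change by
  \<open>C * t\<^sup>2 / n\<close>. This takes the place of derivatives: an identity between
  Lipschitz functions follows once it holds up to a quadratic error on every subinterval.\<close>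

lemma eq_initial_if_quadratic_increments:
  fixes D :: "real \<Rightarrow> real"
  assumes q: "\<And>s t. 0 \<le> s \<Longrightarrow> s \<le> t \<Longrightarrow> t \<le> T \<Longrightarrow> \<bar>D t - D s\<bar> \<le> C * (t - s)\<^sup>2" and t: "t \<in> {0..T}"
  shows "D t = D 0"
proof -
  have b: "\<bar>D t - D 0\<bar> * real n \<le> C * t\<^sup>2" if n: "n > 0" for n :: nat
  proof -
    define \<tau> where "\<tau> k = real k * t / real n" for k
    have "\<tau> n = t" "\<tau> 0 = 0" using n by (auto simp: \<tau>_def)
    then have "D t - D 0 = (\<Sum>k<n. D (\<tau> (Suc k)) - D (\<tau> k))"
      using sum_lessThan_telescope[of "\<lambda>k. D (\<tau> k)" n] by simp
    also have "\<bar>\<dots>\<bar> \<le> (\<Sum>k<n. \<bar>D (\<tau> (Suc k)) - D (\<tau> k)\<bar>)" by (rule sum_abs)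
    also have "\<dots> \<le> (\<Sum>k<n. C * (t / real n)\<^sup>2)"
    proof (rule sum_mono)
      fix k assume "k \<in> {..<n}"
      then have "\<tau> (Suc k) \<le> \<tau> n" unfolding \<tau>_def using t by (intro divide_right_mono mult_right_mono) auto
      also have "\<tau> n \<le> T" using n t by (simp add: \<tau>_def)
      finally have "\<bar>D (\<tau> (Suc k)) - D (\<tau> k)\<bar> \<le> C * (\<tau> (Suc k) - \<tau> k)\<^sup>2"
        using t n by (intro q) (auto simp: \<tau>_def field_simps)
      also have "\<tau> (Suc k) - \<tau> k = t / real n"
        by (simp add: \<tau>_def distrib_right add_divide_distrib)
      finally show "\<bar>D (\<tau> (Suc k)) - D (\<tau> k)\<bar> \<le> C * (t / real n)\<^sup>2" .
    qed
    also have "\<dots> = C * t\<^sup>2 / real n" using n by (simp add: power2_eq_square field_simps)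
    finally show ?thesis using n by (simp add: field_simps)
  qed
  show ?thesis
  proof (rule ccontr)
    assume "D t \<noteq> D 0"
    then have pos: "\<bar>D t - D 0\<bar> > 0" by simp
    obtain n :: nat where n: "C * t\<^sup>2 < real n * \<bar>D t - D 0\<bar>" using ex_less_of_nat_mult[OF pos] by blast
    show False
    proof (cases "n = 0")
      case True
      then have "C * t\<^sup>2 < 0" using n by simp
      then show False using b[of 1] by simp
    next
      case False
      then show False using b[of n] n by (simp add: mult.commute)
    qed
  qed
qed

text \<open>The Caratheodory form of \<open>F' = \<phi>\<close> on [0,T]: \<open>F\<close> is
  Lipschitz there, but need not be differentiable at every point.\<close>

definition has_primitive :: "real \<Rightarrow> (real \<Rightarrow> real) \<Rightarrow> (real \<Rightarrow> real) \<Rightarrow> bool" where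
  "has_primitive T F \<phi> \<longleftrightarrow> bounded_borel F \<and> bounded_borel \<phi> \<and>
     (\<forall>s\<in>{0..T}. F s = F 0 + (LINT r:{0..s}|lborel. \<phi> r))"

lemma has_primitiveD:
  "has_primitive T F \<phi> \<Longrightarrow> s \<in> {0..T} \<Longrightarrow> F s = F 0 + (LINT r:{0..s}|lborel. \<phi> r)"
  unfolding has_primitive_def by blast

lemma has_primitive_bounded_borel:
  "has_primitive T F \<phi> \<Longrightarrow> bounded_borel F" "has_primitive T F \<phi> \<Longrightarrow> bounded_borel \<phi>"
  unfolding has_primitive_def by blast+

lemma has_primitive_increment:
  assumes "has_primitive T F \<phi>" "0 \<le> s" "s \<le> t" "t \<le> T"
  shows "F t - F s = (LINT r:{s..t}|lborel. \<phi> r)"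
proof -
  have "F t = F 0 + (LINT r:{0..t}|lborel. \<phi> r)" "F s = F 0 + (LINT r:{0..s}|lborel. \<phi> r)"
    using has_primitiveD[OF assms(1), of t] has_primitiveD[OF assms(1), of s] assms(2-4) by auto
  then show ?thesis
    using set_integral_Icc_split[OF has_primitive_bounded_borel(2)[OF assms(1)] assms(2,3)] by linarith
qed

lemma has_primitive_lipschitz:
  assumes "has_primitive T F \<phi>"
  obtains C where "C \<ge> 0" "\<And>s t. 0 \<le> s \<Longrightarrow> s \<le> t \<Longrightarrow> t \<le> T \<Longrightarrow> \<bar>F t - F s\<bar> \<le> C * (t - s)"
proof -
  have p: "bounded_borel \<phi>" using assms by (simp add: has_primitive_def)
  then obtain C where C: "C \<ge> 0" "\<And>x. norm (\<phi> x) \<le> C" using bounded_borel_bound by blast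
  have "\<bar>F t - F s\<bar> \<le> C * (t - s)" if "0 \<le> s" "s \<le> t" "t \<le> T" for s t
    unfolding has_primitive_increment[OF assms that]
    using norm_set_integral_Icc_le[OF p that(2), of C] C by simp
  then show ?thesis using that C by blast
qed

text \<open>Reduces the product rule and the chain rule to a local error estimate.\<close>

lemma has_primitiveI_quadratic:
  assumes F: "bounded_borel F" and p: "bounded_borel \<phi>"
    and q: "\<And>s t. 0 \<le> s \<Longrightarrow> s \<le> t \<Longrightarrow> t \<le> T \<Longrightarrow> \<bar>F t - F s - (LINT r:{s..t}|lborel. \<phi> r)\<bar> \<le> C * (t - s)\<^sup>2"
  shows "has_primitive T F \<phi>"
  unfolding has_primitive_def
proof (intro conjI ballI F p)
  fix s assume s: "s \<in> {0..T}"
  let ?D = "\<lambda>s. F s - (LINT r:{0..s}|lborel. \<phi> r)"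
  have "?D s = ?D 0"
  proof (rule eq_initial_if_quadratic_increments[OF _ s])
    fix u v assume uv: "0 \<le> u" "u \<le> v" "v \<le> T"
    show "\<bar>?D v - ?D u\<bar> \<le> C * (v - u)\<^sup>2"
      using q[OF uv] set_integral_Icc_split[OF p uv(1,2)] by (simp add: algebra_simps)
  qed
  then show "F s = F 0 + (LINT r:{0..s}|lborel. \<phi> r)"
    by simp
qed

section \<open>Calculus rules for primitives\<close>

lemma has_primitive_const: "has_primitive T (\<lambda>_. c) (\<lambda>_. 0)"
  by (simp add: has_primitive_def)

lemma has_primitive_add:
  assumes "has_primitive T F \<phi>" "has_primitive T G \<psi>"
  shows "has_primitive T (\<lambda>s. F s + G s) (\<lambda>s. \<phi> s + \<psi> s)"
  unfolding has_primitive_def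
proof (intro conjI ballI)
  note m = has_primitive_bounded_borel[OF assms(1)] has_primitive_bounded_borel[OF assms(2)]
  show "bounded_borel (\<lambda>s. F s + G s)" "bounded_borel (\<lambda>s. \<phi> s + \<psi> s)" using m by auto
  fix s assume s: "s \<in> {0..T}"
  have "(LINT r:{0..s}|lborel. \<phi> r + \<psi> r) = (LINT r:{0..s}|lborel. \<phi> r) + (LINT r:{0..s}|lborel. \<psi> r)"
    using m by (intro set_integral_add bounded_borel_set_integrable)
  then show "F s + G s = F 0 + G 0 + (LINT r:{0..s}|lborel. \<phi> r + \<psi> r)"
    using has_primitiveD[OF assms(1) s] has_primitiveD[OF assms(2) s] by linarith
qed

text \<open>After freezing \<open>F\<close> and \<open>G\<close> at the left endpoint, the three
  remaining terms are quadratic in the length of the interval because both functions are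
  Lipschitz.\<close>

lemma has_primitive_mult:
  assumes F: "has_primitive T F \<phi>" and G: "has_primitive T G \<psi>"
  shows "has_primitive T (\<lambda>s. F s * G s) (\<lambda>s. \<phi> s * G s + F s * \<psi> s)"
proof -
  have m: "bounded_borel F" "bounded_borel G" "bounded_borel \<phi>" "bounded_borel \<psi>"
    using F G by (auto simp: has_primitive_def)
  obtain K where K: "K \<ge> 0" "\<And>s t. 0 \<le> s \<Longrightarrow> s \<le> t \<Longrightarrow> t \<le> T \<Longrightarrow> \<bar>F t - F s\<bar> \<le> K * (t - s)"
    using has_primitive_lipschitz[OF F] by blast
  obtain L where L: "L \<ge> 0" "\<And>s t. 0 \<le> s \<Longrightarrow> s \<le> t \<Longrightarrow> t \<le> T \<Longrightarrow> \<bar>G t - G s\<bar> \<le> L * (t - s)"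
    using has_primitive_lipschitz[OF G] by blast
  obtain C where C: "C \<ge> 0" "\<And>x. norm (\<phi> x) \<le> C" using m bounded_borel_bound by blast
  obtain D where D: "D \<ge> 0" "\<And>x. norm (\<psi> x) \<le> D" using m bounded_borel_bound by blast
  show ?thesis
  proof (rule has_primitiveI_quadratic[where C="K * L + C * L + K * D"])
    fix s t assume st: "0 \<le> s" "s \<le> t" "t \<le> T"
    let ?h = "t - s"
    have i1: "(LINT r:{s..t}|lborel. \<phi> r * G r + F r * \<psi> r) =
       (LINT r:{s..t}|lborel. \<phi> r * (G r - G s)) + G s * (LINT r:{s..t}|lborel. \<phi> r) +
       ((LINT r:{s..t}|lborel. (F r - F s) * \<psi> r) + F s * (LINT r:{s..t}|lborel. \<psi> r))"
    proof -
      have "(LINT r:{s..t}|lborel. \<phi> r * G r + F r * \<psi> r) =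
        (LINT r:{s..t}|lborel. (\<phi> r * (G r - G s) + G s * \<phi> r) + ((F r - F s) * \<psi> r + F s * \<psi> r))"
        by (intro set_lebesgue_integral_cong) (auto simp: algebra_simps)
      also have "\<dots> = (LINT r:{s..t}|lborel. \<phi> r * (G r - G s)) + (LINT r:{s..t}|lborel. G s * \<phi> r) +
        ((LINT r:{s..t}|lborel. (F r - F s) * \<psi> r) + (LINT r:{s..t}|lborel. F s * \<psi> r))"
      proof -
        have "set_integrable lborel {s..t} (\<lambda>r. \<phi> r * (G r - G s))" "set_integrable lborel {s..t} (\<lambda>r. G s * \<phi> r)"
          "set_integrable lborel {s..t} (\<lambda>r. (F r - F s) * \<psi> r)" "set_integrable lborel {s..t} (\<lambda>r. F s * \<psi> r)"
          using m by (auto intro!: bounded_borel_set_integrable bounded_borel_mult bounded_borel_diff)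
        then show ?thesis by (simp only: set_integral_add)
      qed
      finally show ?thesis by simp
    qed
    have b1: "\<bar>LINT r:{s..t}|lborel. \<phi> r * (G r - G s)\<bar> \<le> C * (L * ?h) * ?h"
    proof -
      have "norm (LINT r:{s..t}|lborel. \<phi> r * (G r - G s)) \<le> (C * (L * ?h)) * ?h"
      proof (rule norm_set_integral_Icc_le)
        fix x assume x: "x \<in> {s..t}"
        have "\<bar>G x - G s\<bar> \<le> L * (x - s)" using x st by (intro L(2)) auto
        also have "\<dots> \<le> L * ?h" using x L(1) by (intro mult_left_mono) auto
        finally show "norm (\<phi> x * (G x - G s)) \<le> C * (L * ?h)"
          using C by (auto simp: abs_mult intro!: mult_mono)
      qed (use m st in auto)
      then show ?thesis by simp
    qed
    have b2: "\<bar>LINT r:{s..t}|lborel. (F r - F s) * \<psi> r\<bar> \<le> (K * ?h) * D * ?h"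
    proof -
      have "norm (LINT r:{s..t}|lborel. (F r - F s) * \<psi> r) \<le> ((K * ?h) * D) * ?h"
      proof (rule norm_set_integral_Icc_le)
        fix x assume x: "x \<in> {s..t}"
        have "\<bar>F x - F s\<bar> \<le> K * (x - s)" using x st by (intro K(2)) auto
        also have "\<dots> \<le> K * ?h" using x K(1) by (intro mult_left_mono) auto
        finally show "norm ((F x - F s) * \<psi> x) \<le> (K * ?h) * D"
          using D K(1) st by (auto simp: abs_mult intro!: mult_mono)
      qed (use m st in auto)
      then show ?thesis by simp
    qed
    have b3: "\<bar>(F t - F s) * (G t - G s)\<bar> \<le> (K * ?h) * (L * ?h)"
      unfolding abs_mult using K(2)[OF st] L(2)[OF st] K(1) st by (intro mult_mono) auto
    have "F t * G t - F s * G s - (LINT r:{s..t}|lborel. \<phi> r * G r + F r * \<psi> r) =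
      (F t - F s) * (G t - G s) - (LINT r:{s..t}|lborel. \<phi> r * (G r - G s)) - (LINT r:{s..t}|lborel. (F r - F s) * \<psi> r)"
      unfolding i1 has_primitive_increment[OF F st, symmetric] has_primitive_increment[OF G st, symmetric]
      by (simp add: algebra_simps)
    also have "\<bar>\<dots>\<bar> \<le> (K * ?h) * (L * ?h) + C * (L * ?h) * ?h + (K * ?h) * D * ?h"
      using b1 b2 b3 by linarith
    also have "\<dots> = (K * L + C * L + K * D) * ?h\<^sup>2" by (simp add: power2_eq_square algebra_simps)
    finally show "\<bar>F t * G t - F s * G s - (LINT r:{s..t}|lborel. \<phi> r * G r + F r * \<psi> r)\<bar> \<le> (K * L + C * L + K * D) * ?h\<^sup>2" .
  qed (use m in auto)
qed

text \<open>Both bounds follow from \<open>1 + x \<le> exp x\<close>, applied to \<open>x\<close>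
  and to \<open>- x\<close>.\<close>

lemma exp_bounds_quadratic:
  fixes x :: real
  shows "\<bar>exp x - 1\<bar> \<le> \<bar>x\<bar> * exp \<bar>x\<bar>" "\<bar>exp x - 1 - x\<bar> \<le> x\<^sup>2 * exp \<bar>x\<bar>"
proof -
  have lo: "exp x \<ge> 1 + x" by (rule exp_ge_add_one_self)
  have "1 - x \<le> exp (- x)" using exp_ge_add_one_self[of "- x"] by simp
  then have "exp x * (1 - x) \<le> exp x * exp (- x)" by (intro mult_left_mono) auto
  then have up: "exp x - 1 \<le> x * exp x" by (simp add: exp_minus algebra_simps)
  have e: "exp x \<le> exp \<bar>x\<bar>" "1 \<le> exp \<bar>x\<bar>" by auto
  have "x * exp x \<le> \<bar>x\<bar> * exp \<bar>x\<bar>" by (intro mult_mono) auto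
  moreover have "\<bar>x\<bar> * 1 \<le> \<bar>x\<bar> * exp \<bar>x\<bar>" by (intro mult_left_mono) auto
  ultimately show 1: "\<bar>exp x - 1\<bar> \<le> \<bar>x\<bar> * exp \<bar>x\<bar>" unfolding abs_le_iff using lo up abs_ge_minus_self[of x] by linarith
  have "\<bar>exp x - 1 - x\<bar> = exp x - 1 - x" using lo by (intro abs_of_nonneg) linarith
  also have "\<dots> \<le> x * (exp x - 1)" using up by (simp add: algebra_simps)
  also have "\<dots> \<le> \<bar>x\<bar> * \<bar>exp x - 1\<bar>" by (metis abs_ge_self abs_mult)
  also have "\<dots> \<le> \<bar>x\<bar> * (\<bar>x\<bar> * exp \<bar>x\<bar>)" by (intro mult_left_mono 1) auto
  finally show "\<bar>exp x - 1 - x\<bar> \<le> x\<^sup>2 * exp \<bar>x\<bar>" by (simp add: power2_eq_square)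
qed

lemma has_primitive_exp:
  assumes F: "has_primitive T F \<phi>"
  shows "has_primitive T (\<lambda>s. exp (F s)) (\<lambda>s. \<phi> s * exp (F s))"
proof -
  have m: "bounded_borel F" "bounded_borel \<phi>" using F by (auto simp: has_primitive_def)
  obtain K where K: "K \<ge> 0" "\<And>s t. 0 \<le> s \<Longrightarrow> s \<le> t \<Longrightarrow> t \<le> T \<Longrightarrow> \<bar>F t - F s\<bar> \<le> K * (t - s)"
    using has_primitive_lipschitz[OF F] by blast
  obtain B where B: "B \<ge> 0" "\<And>x. norm (F x) \<le> B" using m bounded_borel_bound by blast
  obtain C where C: "C \<ge> 0" "\<And>x. norm (\<phi> x) \<le> C" using m bounded_borel_bound by blast
  \<comment> \<open>\<open>exp B\<close> bounds the value at the left endpoint,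
    \<open>exp (2 * B)\<close> the exponential of an increment of \<open>F\<close>.\<close>
  define E where "E = exp B * exp (2 * B)"
  have dF: "\<bar>F t - F s\<bar> \<le> 2 * B" for s t using B(2)[of s] B(2)[of t] by (simp add: abs_le_iff)
  have eF: "exp (F s) \<le> exp B" for s using B(2)[of s] by simp
  show ?thesis
  proof (rule has_primitiveI_quadratic[where C="E * K\<^sup>2 + C * (E * K)"])
    fix s t assume st: "0 \<le> s" "s \<le> t" "t \<le> T"
    let ?h = "t - s"
    have d1: "\<bar>exp (F r) - exp (F s)\<bar> \<le> E * K * ?h" if r: "r \<in> {s..t}" for r
    proof -
      have "exp (F r) - exp (F s) = exp (F s) * (exp (F r - F s) - 1)" by (simp add: exp_diff field_simps)
      then have "\<bar>exp (F r) - exp (F s)\<bar> = exp (F s) * \<bar>exp (F r - F s) - 1\<bar>" by (simp add: abs_mult)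
      also have "\<dots> \<le> exp B * (\<bar>F r - F s\<bar> * exp (2 * B))"
        using eF[of s] exp_bounds_quadratic(1)[of "F r - F s"] dF[of r s]
        by (intro mult_mono order_trans[OF exp_bounds_quadratic(1)] mult_left_mono) auto
      also have "\<dots> = E * \<bar>F r - F s\<bar>" by (simp add: E_def)
      also have "\<dots> \<le> E * (K * ?h)"
      proof (rule mult_left_mono)
        have "\<bar>F r - F s\<bar> \<le> K * (r - s)" using r st by (intro K(2)) auto
        also have "\<dots> \<le> K * ?h" using r K(1) by (intro mult_left_mono) auto
        finally show "\<bar>F r - F s\<bar> \<le> K * ?h" .
      qed (simp add: E_def)
      finally show ?thesis by simp
    qed
    have b1: "\<bar>LINT r:{s..t}|lborel. \<phi> r * (exp (F r) - exp (F s))\<bar> \<le> C * (E * K * ?h) * ?h"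
    proof -
      have "norm (LINT r:{s..t}|lborel. \<phi> r * (exp (F r) - exp (F s))) \<le> C * (E * K * ?h) * ?h"
      proof (rule norm_set_integral_Icc_le)
        fix x assume "x \<in> {s..t}"
        then show "norm (\<phi> x * (exp (F x) - exp (F s))) \<le> C * (E * K * ?h)"
          using C d1 by (auto simp: abs_mult intro!: mult_mono)
      qed (use m st in \<open>auto intro!: bounded_borel_mult bounded_borel_diff\<close>)
      then show ?thesis by simp
    qed
    have b2: "\<bar>exp (F s) * (exp (F t - F s) - 1 - (F t - F s))\<bar> \<le> E * K\<^sup>2 * ?h\<^sup>2"
    proof -
      have "(F t - F s)\<^sup>2 \<le> (K * ?h)\<^sup>2" using K(2)[OF st] by (simp add: abs_le_square_iff[symmetric] abs_of_nonneg K(1) st)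
      have "\<bar>exp (F s) * (exp (F t - F s) - 1 - (F t - F s))\<bar> = exp (F s) * \<bar>exp (F t - F s) - 1 - (F t - F s)\<bar>"
        by (simp add: abs_mult)
      also have "\<dots> \<le> exp B * ((F t - F s)\<^sup>2 * exp (2 * B))"
        using eF[of s] dF[of t s]
        by (intro mult_mono order_trans[OF exp_bounds_quadratic(2)] mult_left_mono) auto
      also have "\<dots> = E * (F t - F s)\<^sup>2" by (simp add: E_def)
      also have "\<dots> \<le> E * (K * ?h)\<^sup>2" by (intro mult_left_mono) (fact, simp add: E_def)
      finally show ?thesis by (simp add: power_mult_distrib)
    qed
    have i1: "(LINT r:{s..t}|lborel. \<phi> r * exp (F r)) =
       (LINT r:{s..t}|lborel. \<phi> r * (exp (F r) - exp (F s))) + exp (F s) * (LINT r:{s..t}|lborel. \<phi> r)"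
    proof -
      have "(LINT r:{s..t}|lborel. \<phi> r * exp (F r)) =
        (LINT r:{s..t}|lborel. \<phi> r * (exp (F r) - exp (F s)) + exp (F s) * \<phi> r)"
        by (intro set_lebesgue_integral_cong) (auto simp: algebra_simps)
      also have "\<dots> = (LINT r:{s..t}|lborel. \<phi> r * (exp (F r) - exp (F s))) + (LINT r:{s..t}|lborel. exp (F s) * \<phi> r)"
        using m by (intro set_integral_add bounded_borel_set_integrable bounded_borel_mult bounded_borel_diff) auto
      finally show ?thesis by simp
    qed
    have "exp (F t) - exp (F s) - (LINT r:{s..t}|lborel. \<phi> r * exp (F r)) =
      exp (F s) * (exp (F t - F s) - 1 - (F t - F s)) - (LINT r:{s..t}|lborel. \<phi> r * (exp (F r) - exp (F s)))"
      unfolding i1 has_primitive_increment[OF F st, symmetric] by (simp add: exp_diff field_simps)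
    also have "\<bar>\<dots>\<bar> \<le> E * K\<^sup>2 * ?h\<^sup>2 + C * (E * K * ?h) * ?h" using b1 b2 by linarith
    also have "\<dots> = (E * K\<^sup>2 + C * (E * K)) * ?h\<^sup>2" by (simp add: power2_eq_square algebra_simps)
    finally show "\<bar>exp (F t) - exp (F s) - (LINT r:{s..t}|lborel. \<phi> r * exp (F r))\<bar> \<le> (E * K\<^sup>2 + C * (E * K)) * ?h\<^sup>2" .
  qed (use m in auto)
qed

lemma has_primitive_cmult: "has_primitive T F \<phi> \<Longrightarrow> has_primitive T (\<lambda>s. c * F s) (\<lambda>s. c * \<phi> s)"
  using has_primitive_mult[OF has_primitive_const[of T c]] by simp

lemma has_primitive_diff:
  "has_primitive T F \<phi> \<Longrightarrow> has_primitive T G \<psi> \<Longrightarrow> has_primitive T (\<lambda>s. F s - G s) (\<lambda>s. \<phi> s - \<psi> s)"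
  using has_primitive_add[OF _ has_primitive_cmult[of T G \<psi> "-1"]] by simp

lemma has_primitive_cong:
  assumes F: "has_primitive T F \<phi>" and p: "bounded_borel \<psi>" "\<And>s. s \<in> {0..T} \<Longrightarrow> \<phi> s = \<psi> s"
  shows "has_primitive T F \<psi>"
  unfolding has_primitive_def
proof (intro conjI ballI p has_primitive_bounded_borel(1)[OF F])
  fix s assume s: "s \<in> {0..T}"
  have "(LINT r:{0..s}|lborel. \<phi> r) = (LINT r:{0..s}|lborel. \<psi> r)"
    using s p(2) by (intro set_lebesgue_integral_cong) auto
  then show "F s = F 0 + (LINT r:{0..s}|lborel. \<psi> r)" using has_primitiveD[OF F s] by simp
qed

text \<open>The working form of the fundamental theorem: a closed formula is verified by comparing
  derivatives and the value at 0.\<close>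

lemma has_primitive_unique:
  assumes F: "has_primitive T F \<phi>" and G: "has_primitive T G \<psi>"
    and eq: "\<And>s. s \<in> {0..T} \<Longrightarrow> \<phi> s = \<psi> s" "F 0 = G 0" and s: "s \<in> {0..T}"
  shows "F s = G s"
  using has_primitiveD[OF has_primitive_cong[OF F has_primitive_bounded_borel(2)[OF G] eq(1)] s]
    has_primitiveD[OF G s] eq(2) by simp

text \<open>Capping the upper limit at \<open>T\<close> keeps the function bounded on the whole
  line; a negative \<open>s\<close> gives the empty interval.\<close>

definition primitive_upto :: "real \<Rightarrow> (real \<Rightarrow> real) \<Rightarrow> real \<Rightarrow> real" where
  "primitive_upto T \<phi> s = (LINT r:{0..min s T}|lborel. \<phi> r)"

lemma has_primitive_upto:
  assumes p: "bounded_borel \<phi>" and T: "0 \<le> T"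
  shows "has_primitive T (primitive_upto T \<phi>) \<phi>"
proof -
  have [measurable]: "\<phi> \<in> borel_measurable borel" using p by (simp add: bounded_borel_def)
  have eq: "primitive_upto T \<phi> = (\<lambda>s. \<integral>r. (if 0 \<le> r \<and> r \<le> min s T then \<phi> r else 0) \<partial>lborel)"
    unfolding primitive_upto_def set_lebesgue_integral_def
    by (intro ext Bochner_Integration.integral_cong) auto
  obtain C where C: "C \<ge> 0" "\<And>x. norm (\<phi> x) \<le> C" using p bounded_borel_bound by blast
  have "bounded_borel (primitive_upto T \<phi>)"
  proof (rule bounded_borelI[where C="C * T"])
    show "primitive_upto T \<phi> \<in> borel_measurable borel" unfolding eq by measurable
    fix s show "norm (primitive_upto T \<phi> s) \<le> C * T"
    proof (cases "0 \<le> min s T")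
      case True
      have "norm (primitive_upto T \<phi> s) \<le> C * (min s T - 0)"
        unfolding primitive_upto_def using C True by (intro norm_set_integral_Icc_le p) auto
      also have "\<dots> \<le> C * T" using C(1) by (intro mult_left_mono) auto
      finally show ?thesis .
    next
      case False
      then have "{0..min s T} = {}" by auto
      then have "primitive_upto T \<phi> s = 0" unfolding primitive_upto_def by (simp add: set_lebesgue_integral_def)
      then show ?thesis using C T by simp
    qed
  qed
  moreover have "primitive_upto T \<phi> 0 = 0"
    using T by (simp add: primitive_upto_def min_def)
  ultimately show ?thesis unfolding has_primitive_def
  proof (intro conjI ballI p)
    fix s assume s: "s \<in> {0..T}"
    then have "min s T = s" by simp
    then have "primitive_upto T \<phi> s = (LINT r:{0..s}|lborel. \<phi> r)" by (simp add: primitive_upto_def)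
    with \<open>primitive_upto T \<phi> 0 = 0\<close>
    show "primitive_upto T \<phi> s = primitive_upto T \<phi> 0 + (LINT r:{0..s}|lborel. \<phi> r)" by simp
  qed
qed

lemma primitive_upto_0: "0 \<le> T \<Longrightarrow> primitive_upto T \<phi> 0 = 0"
  by (simp add: primitive_upto_def min_def)

section \<open>Step functions and Wiener-type integrals of bounded functions\<close>

definition valid_steps :: "real \<Rightarrow> (real \<times> real \<times> real) list \<Rightarrow> bool" where
  "valid_steps t p \<longleftrightarrow> (\<forall>(c, u, v)\<in>set p. 0 \<le> u \<and> u \<le> v \<and> v \<le> t)"

text \<open>Stopping at time \<open>s\<close>: an interval beyond \<open>s\<close> collapses to a
  point and contributes nothing to a step integral.\<close>

definition trunc_steps :: "real \<Rightarrow> (real \<times> real \<times> real) list \<Rightarrow> (real \<times> real \<times> real) list" where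
  "trunc_steps s p = map (\<lambda>(c, u, v). (c, min u s, min v s)) p"

definition scale_steps :: "real \<Rightarrow> (real \<times> real \<times> real) list \<Rightarrow> (real \<times> real \<times> real) list" where
  "scale_steps d p = map (\<lambda>(c, u, v). (d * c, u, v)) p"

text \<open>Taking the evaluation maps as the process turns a step integral into a functional of a
  single path \<open>z\<close>.\<close>

abbreviation step_sum :: "(real \<times> real \<times> real) list \<Rightarrow> (real \<Rightarrow> real) \<Rightarrow> real" where
  "step_sum p z \<equiv> step_integral p (\<lambda>r z. z r) z"

lemma step_fun_simps[simp]:
  "step_fun [] r = 0" "step_fun ((c, u, v) # p) r = c * indicator {u<..v} r + step_fun p r"
  "step_fun (p @ q) r = step_fun p r + step_fun q r"
  by (simp_all add: step_fun_def)

lemma step_integral_simps[simp]: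
  "step_integral [] Z \<omega> = 0"
  "step_integral ((c, u, v) # p) Z \<omega> = c * (Z v \<omega> - Z u \<omega>) + step_integral p Z \<omega>"
  "step_integral (p @ q) Z \<omega> = step_integral p Z \<omega> + step_integral q Z \<omega>"
  by (simp_all add: step_integral_def)

lemma step_fun_scale[simp]: "step_fun (scale_steps d p) r = d * step_fun p r"
  by (induction p) (auto simp: scale_steps_def algebra_simps)

lemma step_integral_scale[simp]: "step_integral (scale_steps d p) Z \<omega> = d * step_integral p Z \<omega>"
  by (induction p) (auto simp: scale_steps_def algebra_simps)

lemma step_fun_trunc: "step_fun (trunc_steps s p) r = (if r \<le> s then step_fun p r else 0)"
  by (induction p) (auto simp: trunc_steps_def indicator_def)

lemma valid_steps_simps[simp]:
  "valid_steps t []" "valid_steps t ((c, u, v) # p) \<longleftrightarrow> 0 \<le> u \<and> u \<le> v \<and> v \<le> t \<and> valid_steps t p"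
  "valid_steps t (p @ q) \<longleftrightarrow> valid_steps t p \<and> valid_steps t q"
  by (simp_all add: valid_steps_def ball_Un)

lemma valid_steps_scale[simp]: "valid_steps t (scale_steps d p) \<longleftrightarrow> valid_steps t p"
  by (auto simp: valid_steps_def scale_steps_def)

lemma valid_steps_trunc: "valid_steps t p \<Longrightarrow> 0 \<le> s \<Longrightarrow> valid_steps s (trunc_steps s p)"
  by (fastforce simp: valid_steps_def trunc_steps_def)

lemma valid_steps_mono: "valid_steps s p \<Longrightarrow> s \<le> t \<Longrightarrow> valid_steps t p"
  by (fastforce simp: valid_steps_def)

lemma step_sum_path_upto: "valid_steps t p \<Longrightarrow> step_sum p (path_upto t Z \<omega>) = step_integral p Z \<omega>"
  by (induction p) (auto simp: path_upto_def)

lemma step_fun_outside: "valid_steps t p \<Longrightarrow> r \<notin> {0..t} \<Longrightarrow> step_fun p r = 0"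
  by (induction p) (auto simp: indicator_def)

lemma bounded_borel_step_fun: "bounded_borel (step_fun p)"
proof (induction p)
  case Nil
  have "step_fun [] = (\<lambda>_. 0)" by auto
  then show ?case by simp
next
  case (Cons x p)
  obtain c u v where x: "x = (c, u, v)" by (cases x)
  have "bounded_borel (\<lambda>r. if r \<in> {u<..v} then c else 0)" by (intro bounded_borel_if) auto
  moreover have "step_fun (x # p) = (\<lambda>r. (if r \<in> {u<..v} then c else 0) + step_fun p r)" by (auto simp: x)
  ultimately show ?case using Cons by auto
qed

lemma step_integral_measurable:
  assumes "\<And>s. s \<in> {0..t} \<Longrightarrow> Z s \<in> borel_measurable M" "valid_steps t p"
  shows "step_integral p Z \<in> borel_measurable M"
  using assms(2)
proof (induction p)
  case Nil
  have "step_integral [] Z = (\<lambda>_. 0)" by auto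
  then show ?case by simp
next
  case (Cons x p)
  obtain c u v where x: "x = (c, u, v)" by (cases x)
  have "step_integral (x # p) Z = (\<lambda>\<omega>. c * (Z v \<omega> - Z u \<omega>) + step_integral p Z \<omega>)" by (auto simp: x)
  moreover have "Z u \<in> borel_measurable M" "Z v \<in> borel_measurable M" using Cons.prems x assms(1) by auto
  ultimately show ?case using Cons x by simp
qed

section \<open>Density of step functions in L^2 of a time interval\<close>

abbreviation time_measure :: "real \<Rightarrow> real measure" where
  "time_measure t \<equiv> restrict_space lborel {0..t}"

lemma integral_time_measure:
  fixes g :: "real \<Rightarrow> 'b::{banach, second_countable_topology}"
  shows "integral\<^sup>L (time_measure t) g = (LINT r:{0..t}|lborel. g r)"
  by (simp add: integral_restrict_space set_lebesgue_integral_def)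

lemma finite_time_measure: "finite_measure (time_measure t)"
  by (rule finite_measureI) (simp add: space_restrict_space emeasure_restrict_space emeasure_lborel_Icc_eq)

lemma sq_integrable_time_measure:
  assumes "bounded_borel g" shows "sq_integrable (time_measure t) g"
proof -
  interpret finite_measure "time_measure t" by (rule finite_time_measure)
  obtain C where C: "\<And>x. norm (g x) \<le> C" using assms bounded_borel_bound by blast
  show ?thesis
  proof (rule sq_integrable_bounded)
    show "g \<in> borel_measurable (time_measure t)"
      using bounded_borel_measurable[OF assms] by (intro measurable_restrict_space1) auto
    show "\<bar>g x\<bar> \<le> C" for x using C[of x] by simp
  qed
qed

lemma nn_integral_sq_time:
  assumes "bounded_borel g"
  shows "(\<integral>\<^sup>+ r\<in>{0..t}. ennreal ((g r)\<^sup>2) \<partial>lborel) = ennreal (LINT r:{0..t}|lborel. (g r)\<^sup>2)"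
  using nn_integral_sq[OF sq_integrable_time_measure[OF assms, of t]]
  by (simp add: integral_time_measure nn_integral_restrict_space)

lemma set_integral_square_add_le:
  fixes g h :: "real \<Rightarrow> real"
  assumes "bounded_borel g" "bounded_borel h"
  shows "(LINT r:{0..t}|lborel. (g r + h r)\<^sup>2) \<le> 2 * (LINT r:{0..t}|lborel. (g r)\<^sup>2) + 2 * (LINT r:{0..t}|lborel. (h r)\<^sup>2)"
  using integral_square_add_le[OF sq_integrable_time_measure[OF assms(1), of t] sq_integrable_time_measure[OF assms(2), of t]]
  by (simp only: integral_time_measure)

lemma set_integral_square_nonneg: "0 \<le> (LINT r:{0..t}|lborel. (g r :: real)\<^sup>2)"
  unfolding set_lebesgue_integral_def by (rule Bochner_Integration.integral_nonneg) simp

lemma is_stoch_integral_iff: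
  assumes "bounded_borel g"
  shows "is_stoch_integral M Z g t J \<longleftrightarrow> J \<in> borel_measurable M \<and>
    (\<exists>p. (\<forall>n. valid_steps t (p n)) \<and>
      (\<lambda>n. LINT r:{0..t}|lborel. (step_fun (p n) r - g r)\<^sup>2) \<longlonglongrightarrow> 0 \<and>
      l2_lim M (\<lambda>n. step_integral (p n) Z) J)"
proof -
  have "((\<lambda>n. \<integral>\<^sup>+ s\<in>{0..t}. ennreal ((step_fun (p n) s - g s)\<^sup>2) \<partial>lborel) \<longlonglongrightarrow> 0) \<longleftrightarrow>
    ((\<lambda>n. LINT r:{0..t}|lborel. (step_fun (p n) r - g r)\<^sup>2) \<longlonglongrightarrow> 0)" for p
  proof -
    have "(\<integral>\<^sup>+ s\<in>{0..t}. ennreal ((step_fun (p n) s - g s)\<^sup>2) \<partial>lborel) =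
      ennreal (LINT r:{0..t}|lborel. (step_fun (p n) r - g r)\<^sup>2)" for n
      by (intro nn_integral_sq_time bounded_borel_diff bounded_borel_step_fun assms)
    then show ?thesis
      by (simp add: ennreal_0[symmetric] set_integral_square_nonneg del: ennreal_0)
  qed
  then show ?thesis
    unfolding is_stoch_integral_def valid_steps_def l2_lim_def by (simp only: conj_assoc)
qed

text \<open>Uniform continuity, with the left-endpoint value on each cell of an equidistant grid.
  The point 0 is excluded because steps live on left-open intervals.\<close>

lemma continuous_step_approx:
  fixes g :: "real \<Rightarrow> real"
  assumes g: "continuous_on {0..t} g" and t: "0 < t" and e: "e > 0"
  shows "\<exists>p. valid_steps t p \<and> (\<forall>r\<in>{0<..t}. \<bar>step_fun p r - g r\<bar> \<le> e)"
proof -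
  have "uniformly_continuous_on {0..t} g" using g by (intro compact_uniformly_continuous) auto
  then obtain d where d: "d > 0" "\<And>x y. x \<in> {0..t} \<Longrightarrow> y \<in> {0..t} \<Longrightarrow> dist y x < d \<Longrightarrow> dist (g y) (g x) < e"
    using e unfolding uniformly_continuous_on_def by metis
  obtain n :: nat where n: "t < real n * d" using ex_less_of_nat_mult[OF d(1)] by blast
  then have n0: "n > 0" using t d(1) by (cases n) auto
  define \<tau> where "\<tau> k = real k * t / real n" for k :: nat
  have \<tau>n: "\<tau> n = t" "\<tau> 0 = 0" using n0 by (auto simp: \<tau>_def)
  have \<tau>m: "\<tau> i \<le> \<tau> j" if "i \<le> j" for i j
    unfolding \<tau>_def using that t by (intro divide_right_mono mult_right_mono) auto
  have \<tau>d: "\<tau> (Suc k) - \<tau> k < d" for k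
  proof -
    have "\<tau> (Suc k) - \<tau> k = t / real n" by (simp add: \<tau>_def distrib_right add_divide_distrib)
    also have "\<dots> < d" using n n0 by (simp add: field_simps)
    finally show ?thesis .
  qed
  define p where "p = map (\<lambda>k. (g (\<tau> k), \<tau> k, \<tau> (Suc k))) [0..<n]"
  have v: "valid_steps t p"
    using \<tau>m[of 0] \<tau>m[of _ n] \<tau>m \<tau>n by (auto simp: p_def valid_steps_def Suc_le_eq)
  have "\<bar>step_fun p r - g r\<bar> \<le> e" if r: "r \<in> {0<..t}" for r
  proof -
    \<comment> \<open>The index of the cell \<open>{\<tau> k<..\<tau> (Suc k)}\<close> containing
      \<open>r\<close>.\<close>
    define k where "k = (LEAST k. r \<le> \<tau> (Suc k))"
    have ex: "r \<le> \<tau> (Suc (n - 1))" using r \<tau>n n0 by simp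
    have k1: "r \<le> \<tau> (Suc k)" unfolding k_def by (rule LeastI[where P="\<lambda>k. r \<le> \<tau> (Suc k)", OF ex])
    have kn: "k < n" using Least_le[where P="\<lambda>k. r \<le> \<tau> (Suc k)", OF ex] n0 by (simp add: k_def)
    have k0: "\<tau> k < r"
    proof (cases k)
      case 0 then show ?thesis using r \<tau>n by simp
    next
      case (Suc j)
      then have "\<not> r \<le> \<tau> (Suc j)" using not_less_Least[of j "\<lambda>k. r \<le> \<tau> (Suc k)"] by (simp add: k_def)
      then show ?thesis using Suc by simp
    qed
    have ind: "indicator {\<tau> j<..\<tau> (Suc j)} r = (if j = k then 1 else 0 :: real)" for j
    proof -
      consider "j < k" | "j = k" | "j > k" by linarith
      then show ?thesis
      proof cases
        case 1 then show ?thesis using \<tau>m[of "Suc j" k] k0 by (auto simp: indicator_def)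
      next
        case 2 then show ?thesis using k0 k1 by simp
      next
        case 3 then show ?thesis using \<tau>m[of "Suc k" j] k1 by (auto simp: indicator_def)
      qed
    qed
    have "step_fun p r = (\<Sum>j<n. g (\<tau> j) * indicator {\<tau> j<..\<tau> (Suc j)} r)"
      by (simp add: step_fun_def p_def comp_def interv_sum_list_conv_sum_set_nat atLeast0LessThan)
    also have "\<dots> = g (\<tau> k)" using kn by (simp add: ind if_distrib cong: if_cong)
    finally have s: "step_fun p r = g (\<tau> k)" .
    have "dist (g (\<tau> k)) (g r) < e"
      using d(2)[of r "\<tau> k"] \<tau>d[of k] k0 k1 r \<tau>m[of 0 k] \<tau>m[of k n] kn \<tau>n by (auto simp: dist_real_def)
    then show ?thesis by (simp add: s dist_real_def)
  qed
  with v show ?thesis by blast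
qed

text \<open>A measurable function is an almost everywhere limit of continuous ones, and continuous
  functions are uniformly approximated by steps away from 0.\<close>

lemma step_dense:
  fixes g :: "real \<Rightarrow> real"
  assumes g: "bounded_borel g" and t: "0 < t" and e: "e > 0"
  shows "\<exists>p. valid_steps t p \<and> (LINT r:{0..t}|lborel. (step_fun p r - g r)\<^sup>2) \<le> e"
proof -
  have [measurable]: "g \<in> borel_measurable borel" using g by (simp add: bounded_borel_def)
  obtain C where C: "C \<ge> 0" "\<And>x. norm (g x) \<le> C" using g bounded_borel_bound by blast
  have "g measurable_on UNIV"
  proof (rule lebesgue_measurable_imp_measurable_on_real)
    show "g \<in> borel_measurable lebesgue" by (rule measurable_completion) simp
  qed simp
  then obtain N h where N: "negligible N" and h: "\<And>n. continuous_on UNIV (h n)"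
    and lim: "\<And>x. x \<notin> N \<Longrightarrow> (\<lambda>n. h n x) \<longlonglongrightarrow> g x"
    unfolding measurable_on_def by auto
  \<comment> \<open>Clipping at the bound of \<open>g\<close> does not disturb the limit and
    supplies the dominating constant.\<close>
  define k where "k n x = max (- C) (min C (h n x))" for n x
  have kc: "continuous_on UNIV (k n)" for n unfolding k_def by (intro continuous_intros h)
  then have [measurable]: "k n \<in> borel_measurable borel" for n by (rule borel_measurable_continuous_onI)
  have kC: "\<bar>k n x\<bar> \<le> C" for n x using C(1) by (auto simp: k_def)
  have klim: "(\<lambda>n. k n x) \<longlonglongrightarrow> g x" if "x \<notin> N" for x
  proof -
    have "(\<lambda>n. max (- C) (min C (h n x))) \<longlonglongrightarrow> max (- C) (min C (g x))"
      by (intro tendsto_max tendsto_min tendsto_const lim that)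
    moreover have "max (- C) (min C (g x)) = g x" using C(2)[of x] by (auto simp: abs_le_iff)
    ultimately show ?thesis by (simp add: k_def)
  qed
  have kb: "bounded_borel (k n)" for n by (rule bounded_borelI[where C=C]) (use kC in auto)
  have AEN: "AE x in lborel. x \<notin> N"
  proof -
    have "N \<in> null_sets lebesgue" using N by (simp add: negligible_iff_null_sets)
    then have "AE x in lebesgue. x \<notin> N" by (rule AE_not_in)
    then show ?thesis by (simp add: AE_completion_iff)
  qed
  have "(\<lambda>n. LINT r:{0..t}|lborel. (k n r - g r)\<^sup>2) \<longlonglongrightarrow> (LINT r:{0..t}|lborel. 0)"
    unfolding set_lebesgue_integral_def
  proof (rule integral_dominated_convergence[where w="\<lambda>x. indicator {0..t} x * (2 * C)\<^sup>2"])
    show "integrable lborel (\<lambda>x. indicator {0..t} x * (2 * C)\<^sup>2)"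
      by (intro integrable_mult_left integrable_real_indicator) (auto simp: emeasure_lborel_Icc_eq)
    show "AE x in lborel. (\<lambda>n. indicator {0..t} x *\<^sub>R (k n x - g x)\<^sup>2) \<longlonglongrightarrow> indicator {0..t} x *\<^sub>R 0"
      using AEN
    proof eventually_elim
      fix x assume "x \<notin> N"
      then have "(\<lambda>n. (k n x - g x)\<^sup>2) \<longlonglongrightarrow> (g x - g x)\<^sup>2" by (intro tendsto_power tendsto_diff klim tendsto_const)
      then show "(\<lambda>n. indicator {0..t} x *\<^sub>R (k n x - g x)\<^sup>2) \<longlonglongrightarrow> indicator {0..t} x *\<^sub>R 0"
        by (intro tendsto_scaleR tendsto_const) simp
    qed
    show "AE x in lborel. norm (indicator {0..t} x *\<^sub>R (k n x - g x)\<^sup>2) \<le> indicator {0..t} x * (2 * C)\<^sup>2" for n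
    proof (rule AE_I2)
      fix x
      have "\<bar>k n x - g x\<bar> \<le> 2 * C" using kC[of n x] C(2)[of x] by simp
      then have "\<bar>k n x - g x\<bar>\<^sup>2 \<le> (2 * C)\<^sup>2" by (intro power_mono) auto
      then show "norm (indicator {0..t} x *\<^sub>R (k n x - g x)\<^sup>2) \<le> indicator {0..t} x * (2 * C)\<^sup>2"
        by (auto simp: indicator_def)
    qed
  qed measurable
  then have "\<forall>\<^sub>F n in sequentially. (LINT r:{0..t}|lborel. (k n r - g r)\<^sup>2) < e / 4"
    using e by (intro order_tendstoD(2)) auto
  then obtain n where n: "(LINT r:{0..t}|lborel. (k n r - g r)\<^sup>2) < e / 4"
    using eventually_happens'[OF sequentially_bot] by blast
  \<comment> \<open>Each of the two squared errors may be \<open>e / 4\<close>, since squaring a sum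
    costs a factor 2; a uniform error \<open>d\<close> on an interval of length \<open>t\<close>
    gives \<open>d\<^sup>2 * t\<close>.\<close>
  define d where "d = sqrt (e / (4 * t))"
  have d: "d > 0" "d\<^sup>2 * t = e / 4" using e t by (auto simp: d_def)
  obtain p where p: "valid_steps t p" "\<And>r. r \<in> {0<..t} \<Longrightarrow> \<bar>step_fun p r - k n r\<bar> \<le> d"
    using continuous_step_approx[OF continuous_on_subset[OF kc subset_UNIV] t d(1), of n] by blast
  have "(LINT r:{0..t}|lborel. (step_fun p r - k n r)\<^sup>2) \<le> e / 4"
  proof -
    have "(LINT r:{0..t}|lborel. (step_fun p r - k n r)\<^sup>2) \<le> (\<integral>r. indicator {0..t} r * d\<^sup>2 \<partial>lborel)"
      unfolding set_lebesgue_integral_def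
    proof (rule integral_mono_AE)
      show "integrable lborel (\<lambda>r. indicator {0..t} r *\<^sub>R (step_fun p r - k n r)\<^sup>2)"
        unfolding set_integrable_def[symmetric]
        by (intro bounded_borel_set_integrable bounded_borel_power2 bounded_borel_diff kb bounded_borel_step_fun)
      show "integrable lborel (\<lambda>r. indicator {0..t} r * d\<^sup>2)"
        by (intro integrable_mult_left integrable_real_indicator) (auto simp: emeasure_lborel_Icc_eq)
      have "AE r in lborel. r \<noteq> (0::real)" by (rule AE_lborel_singleton)
      then show "AE r in lborel. indicator {0..t} r *\<^sub>R (step_fun p r - k n r)\<^sup>2 \<le> indicator {0..t} r * d\<^sup>2"
      proof eventually_elim
        fix r :: real assume "r \<noteq> 0"
        then show "indicator {0..t} r *\<^sub>R (step_fun p r - k n r)\<^sup>2 \<le> indicator {0..t} r * d\<^sup>2"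
          using p(2)[of r] d(1) power_mono[of "\<bar>step_fun p r - k n r\<bar>" d 2] by (cases "r \<in> {0..t}") auto
      qed
    qed
    also have "\<dots> = e / 4" using t d(2) by (simp add: ac_simps)
    finally show ?thesis .
  qed
  moreover have "(LINT r:{0..t}|lborel. ((step_fun p r - k n r) + (k n r - g r))\<^sup>2)
     \<le> 2 * (LINT r:{0..t}|lborel. (step_fun p r - k n r)\<^sup>2) + 2 * (LINT r:{0..t}|lborel. (k n r - g r)\<^sup>2)"
    by (intro set_integral_square_add_le bounded_borel_diff bounded_borel_step_fun kb g)
  ultimately have "(LINT r:{0..t}|lborel. (step_fun p r - g r)\<^sup>2) \<le> e" using n by simp
  with p(1) show ?thesis by blast
qed

text \<open>An approximating sequence that is fast enough for the step integrals to converge almost surely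
  for every \<open>L\<^sup>2\<close>-integrator, so that a single functional of the path represents the integral in all
  the models at once.\<close>

definition fast_steps :: "real \<Rightarrow> (real \<Rightarrow> real) \<Rightarrow> (nat \<Rightarrow> (real \<times> real \<times> real) list) \<Rightarrow> bool" where
  "fast_steps t g p \<longleftrightarrow> (\<forall>n. valid_steps t (p n)) \<and>
     (\<forall>n. (LINT r:{0..t}|lborel. (step_fun (p n) r - g r)\<^sup>2) \<le> (1 / 4) ^ n)"

text \<open>\<open>lim\<close> is unspecified where the sums diverge. For an
  \<open>l2_integrator\<close> this happens only on a null set, while the functional itself refers
  to no model.\<close>

definition path_integral :: "(nat \<Rightarrow> (real \<times> real \<times> real) list) \<Rightarrow> real \<Rightarrow> (real \<Rightarrow> real) \<Rightarrow> real" where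
  "path_integral p s z = lim (\<lambda>n. step_sum (trunc_steps s (p n)) z)"

text \<open>The one property needed to construct integrals: step integrals are controlled in L^2 by
  their integrands. Wiener processes have it by the isometry, and \<open>X\<close> has it in spite
  of its random drift.\<close>

definition l2_integrator :: "'w measure \<Rightarrow> (real \<Rightarrow> 'w \<Rightarrow> real) \<Rightarrow> real \<Rightarrow> bool" where
  "l2_integrator M Z t \<longleftrightarrow> (\<forall>s\<in>{0..t}. Z s \<in> borel_measurable M) \<and>
     (\<exists>C\<ge>0. \<forall>p. valid_steps t p \<longrightarrow> sq_integrable M (step_integral p Z) \<and>
        (\<integral>\<omega>. (step_integral p Z \<omega>)\<^sup>2 \<partial>M) \<le> C * (LINT r:{0..t}|lborel. (step_fun p r)\<^sup>2))"

section \<open>Stochastic integrals as almost sure limits along fixed step sequences\<close>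

lemma fast_steps_exist:
  assumes "bounded_borel g" "0 < t" obtains p where "fast_steps t g p"
proof -
  have "\<forall>n. \<exists>p. valid_steps t p \<and> (LINT r:{0..t}|lborel. (step_fun p r - g r)\<^sup>2) \<le> (1 / 4) ^ n"
    using step_dense[OF assms] by simp
  then show ?thesis using that unfolding fast_steps_def by metis
qed

text \<open>Truncation only discards error, so one sequence chosen for \<open>t\<close> serves all
  earlier times.\<close>

lemma fast_steps_trunc:
  assumes f: "fast_steps t g p" and g: "bounded_borel g" and s: "s \<in> {0..t}"
  shows "fast_steps s g (\<lambda>n. trunc_steps s (p n))"
  unfolding fast_steps_def
proof (intro conjI allI)
  show "valid_steps s (trunc_steps s (p n))" for n
    using f s valid_steps_trunc unfolding fast_steps_def by auto
  fix n
  have bb: "bounded_borel (\<lambda>r. (step_fun (p n) r - g r)\<^sup>2)"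
    by (intro bounded_borel_power2 bounded_borel_diff bounded_borel_step_fun g)
  have "(LINT r:{0..s}|lborel. (step_fun (trunc_steps s (p n)) r - g r)\<^sup>2) =
        (LINT r:{0..s}|lborel. (step_fun (p n) r - g r)\<^sup>2)"
    by (intro set_lebesgue_integral_cong) (auto simp: step_fun_trunc)
  also have "\<dots> \<le> (LINT r:{0..t}|lborel. (step_fun (p n) r - g r)\<^sup>2)"
  proof -
    have "0 \<le> (LINT r:{s..t}|lborel. (step_fun (p n) r - g r)\<^sup>2)"
      unfolding set_lebesgue_integral_def by (rule Bochner_Integration.integral_nonneg) simp
    then show ?thesis using set_integral_Icc_split[OF bb, of 0 s t] s by simp
  qed
  finally show "(LINT r:{0..s}|lborel. (step_fun (trunc_steps s (p n)) r - g r)\<^sup>2) \<le> (1 / 4) ^ n"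
    using f unfolding fast_steps_def by (meson order_trans)
qed

lemma l2_integrator_mono:
  assumes Z: "l2_integrator M Z t" and s: "s \<in> {0..t}"
  shows "l2_integrator M Z s"
proof -
  obtain C where C: "C \<ge> 0" "\<And>p. valid_steps t p \<Longrightarrow> sq_integrable M (step_integral p Z) \<and>
        (\<integral>\<omega>. (step_integral p Z \<omega>)\<^sup>2 \<partial>M) \<le> C * (LINT r:{0..t}|lborel. (step_fun p r)\<^sup>2)"
    and m: "\<forall>s\<in>{0..t}. Z s \<in> borel_measurable M"
    using Z unfolding l2_integrator_def by blast
  have "(LINT r:{0..t}|lborel. (step_fun p r)\<^sup>2) = (LINT r:{0..s}|lborel. (step_fun p r)\<^sup>2)" if p: "valid_steps s p" for p
  proof -
    have "(LINT r:{s..t}|lborel. (step_fun p r)\<^sup>2) = 0"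
    proof -
      have "AE r in lborel. r \<noteq> s" by (rule AE_lborel_singleton)
      then have "AE r in lborel. indicator {s..t} r *\<^sub>R (step_fun p r)\<^sup>2 = 0"
        by eventually_elim (use step_fun_outside[OF p] in \<open>auto simp: indicator_def\<close>)
      then show ?thesis unfolding set_lebesgue_integral_def by (rule integral_eq_zero_AE)
    qed
    then show ?thesis
      using set_integral_Icc_split[OF bounded_borel_power2[OF bounded_borel_step_fun[of p]], of 0 s t] s by simp
  qed
  then have "sq_integrable M (step_integral p Z) \<and>
        (\<integral>\<omega>. (step_integral p Z \<omega>)\<^sup>2 \<partial>M) \<le> C * (LINT r:{0..s}|lborel. (step_fun p r)\<^sup>2)"
    if p: "valid_steps s p" for p
    using C(2)[OF valid_steps_mono[OF p, of t]] s that by simp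
  then show ?thesis using C(1) m s unfolding l2_integrator_def by auto
qed

text \<open>Squared errors of size \<open>(1 / 4) ^ n\<close> make the L^1 norms of consecutive
  differences at most a multiple of \<open>(1 / 2) ^ n\<close>. These are summable, so the step
  integrals converge absolutely almost surely, and Fatou's lemma upgrades this to L^2
  convergence.\<close>

lemma (in prob_space) is_stoch_integral_fast:
  assumes Z: "l2_integrator M Z t" and f: "fast_steps t g p" and g: "bounded_borel g"
    and J: "\<And>\<omega>. \<omega> \<in> space M \<Longrightarrow> J \<omega> = lim (\<lambda>n. step_integral (p n) Z \<omega>)"
  shows "is_stoch_integral M Z g t J \<and> l2_lim M (\<lambda>n. step_integral (p n) Z) J"
proof -
  obtain C where C: "C \<ge> 0" "\<And>p. valid_steps t p \<Longrightarrow> sq_integrable M (step_integral p Z) \<and>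
        (\<integral>\<omega>. (step_integral p Z \<omega>)\<^sup>2 \<partial>M) \<le> C * (LINT r:{0..t}|lborel. (step_fun p r)\<^sup>2)"
    using Z unfolding l2_integrator_def by blast
  define S where "S n = step_integral (p n) Z" for n
  have v: "valid_steps t (p n)" for n using f by (simp add: fast_steps_def)
  have Sq: "sq_integrable M (S n)" for n using C(2)[OF v] by (simp add: S_def)
  have Sm[measurable]: "S n \<in> borel_measurable M" for n using Sq by (simp add: sq_integrable_def)
  have D: "(\<integral>\<omega>. (S m \<omega> - S n \<omega>)\<^sup>2 \<partial>M) \<le> C * (4 * (1 / 4) ^ n)" if "n \<le> m" for m n
  proof -
    \<comment> \<open>Concatenation with the negated list represents \<open>S m - S n\<close> as one
      step integral.\<close>
    let ?q = "p m @ scale_steps (-1) (p n)"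
    have "(\<integral>\<omega>. (S m \<omega> - S n \<omega>)\<^sup>2 \<partial>M) = (\<integral>\<omega>. (step_integral ?q Z \<omega>)\<^sup>2 \<partial>M)" by (simp add: S_def)
    also have "\<dots> \<le> C * (LINT r:{0..t}|lborel. (step_fun ?q r)\<^sup>2)" using C(2)[of ?q] v by simp
    also have "(LINT r:{0..t}|lborel. (step_fun ?q r)\<^sup>2) =
      (LINT r:{0..t}|lborel. ((step_fun (p m) r - g r) + (g r - step_fun (p n) r))\<^sup>2)" by simp
    also have "\<dots> \<le> 2 * (LINT r:{0..t}|lborel. (step_fun (p m) r - g r)\<^sup>2) + 2 * (LINT r:{0..t}|lborel. (g r - step_fun (p n) r)\<^sup>2)"
      by (intro set_integral_square_add_le bounded_borel_diff bounded_borel_step_fun g)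
    also have "\<dots> \<le> 2 * (1 / 4) ^ m + 2 * (1 / 4) ^ n"
      using f unfolding fast_steps_def by (intro add_mono mult_left_mono) (auto simp: power2_commute)
    also have "\<dots> \<le> 4 * (1 / 4) ^ n" using power_decreasing[OF that, of "1/4::real"] by simp
    finally show ?thesis using C(1) by (simp add: mult_left_mono)
  qed
  define d where "d n \<omega> = S (Suc n) \<omega> - S n \<omega>" for n \<omega>
  have dq: "sq_integrable M (d n)" for n unfolding d_def[abs_def] by (intro sq_integrable_diff Sq)
  have [measurable]: "d n \<in> borel_measurable M" for n using dq by (simp add: sq_integrable_def)
  have d1: "(\<integral>\<omega>. \<bar>d n \<omega>\<bar> \<partial>M) \<le> 2 * sqrt C * (1 / 2) ^ n" for n
  proof -
    have "(\<integral>\<omega>. \<bar>d n \<omega>\<bar> \<partial>M) \<le> sqrt (\<integral>\<omega>. (d n \<omega>)\<^sup>2 \<partial>M)" by (rule l2_abs_expectation_le[OF dq])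
    also have "\<dots> \<le> sqrt (C * (4 * (1 / 4) ^ n))" using D[of n "Suc n"] by (simp add: d_def)
    also have "\<dots> = 2 * sqrt C * (1 / 2) ^ n"
    proof -
      have "(1 / 4 :: real) ^ n = ((1 / 2) ^ n)\<^sup>2" by (simp add: power2_eq_square flip: power_mult_distrib)
      then show ?thesis by (simp add: real_sqrt_mult)
    qed
    finally show ?thesis .
  qed
  have "(\<integral>\<^sup>+ \<omega>. (\<Sum>n. ennreal \<bar>d n \<omega>\<bar>) \<partial>M) = (\<Sum>n. \<integral>\<^sup>+ \<omega>. ennreal \<bar>d n \<omega>\<bar> \<partial>M)"
    by (rule nn_integral_suminf) measurable
  also have "\<dots> = (\<Sum>n. ennreal (\<integral>\<omega>. \<bar>d n \<omega>\<bar> \<partial>M))"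
    using sq_integrable_integrable[OF dq] by (intro suminf_cong nn_integral_eq_integral) auto
  also have "\<dots> \<le> (\<Sum>n. ennreal (2 * sqrt C * (1 / 2) ^ n))"
    by (intro suminf_le ennreal_leI d1) auto
  also have "\<dots> = ennreal (\<Sum>n. 2 * sqrt C * (1 / 2) ^ n)"
    using C(1) by (intro suminf_ennreal2) (auto intro!: summable_mult summable_geometric)
  also have "\<dots> < \<infinity>" by simp
  finally have "AE \<omega> in M. (\<Sum>n. ennreal \<bar>d n \<omega>\<bar>) \<noteq> \<infinity>"
    by (intro nn_integral_noteq_infinite) auto
  then have conv: "AE \<omega> in M. (\<lambda>n. S n \<omega>) \<longlonglongrightarrow> J \<omega>"
    using AE_space
  proof eventually_elim
    fix \<omega> assume a: "(\<Sum>n. ennreal \<bar>d n \<omega>\<bar>) \<noteq> \<infinity>" and \<omega>: "\<omega> \<in> space M"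
    have "summable (\<lambda>n. \<bar>d n \<omega>\<bar>)" using a by (intro summable_suminf_not_top) auto
    then have "summable (\<lambda>n. d n \<omega>)" by (rule summable_rabs_cancel)
    then have "convergent (\<lambda>n. \<Sum>k<n. d k \<omega>)" by (simp add: summable_iff_convergent)
    moreover have "(\<Sum>k<n. d k \<omega>) = S n \<omega> - S 0 \<omega>" for n unfolding d_def by (rule sum_lessThan_telescope)
    ultimately have "convergent (\<lambda>n. S n \<omega> - S 0 \<omega>)" by simp
    then have "convergent (\<lambda>n. S n \<omega>)" by (simp add: convergent_diff_const_right_iff)
    then show "(\<lambda>n. S n \<omega>) \<longlonglongrightarrow> J \<omega>" unfolding J[OF \<omega>] S_def by (simp add: convergent_LIMSEQ_iff)
  qed
  have Jm[measurable]: "J \<in> borel_measurable M"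
  proof -
    have "(\<lambda>\<omega>. lim (\<lambda>n. S n \<omega>)) \<in> borel_measurable M" by measurable
    then show ?thesis using J by (subst measurable_cong[of M J "\<lambda>\<omega>. lim (\<lambda>n. S n \<omega>)"]) (auto simp: S_def)
  qed
  \<comment> \<open>Fatou's lemma in \<open>m\<close>: the bound on \<open>S n - S m\<close>
    survives when \<open>S m\<close> is replaced by its almost sure limit \<open>J\<close>.\<close>
  have le: "(\<integral>\<^sup>+ \<omega>. ennreal ((S n \<omega> - J \<omega>)\<^sup>2) \<partial>M) \<le> ennreal (C * (4 * (1 / 4) ^ n))" for n
  proof -
    have "(\<integral>\<^sup>+ \<omega>. ennreal ((S n \<omega> - J \<omega>)\<^sup>2) \<partial>M) =
      (\<integral>\<^sup>+ \<omega>. liminf (\<lambda>m. ennreal ((S n \<omega> - S m \<omega>)\<^sup>2)) \<partial>M)"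
    proof (rule nn_integral_cong_AE)
      show "AE \<omega> in M. ennreal ((S n \<omega> - J \<omega>)\<^sup>2) = liminf (\<lambda>m. ennreal ((S n \<omega> - S m \<omega>)\<^sup>2))"
        using conv
      proof eventually_elim
        fix \<omega> assume "(\<lambda>n. S n \<omega>) \<longlonglongrightarrow> J \<omega>"
        then have "(\<lambda>m. ennreal ((S n \<omega> - S m \<omega>)\<^sup>2)) \<longlonglongrightarrow> ennreal ((S n \<omega> - J \<omega>)\<^sup>2)"
          by (intro tendsto_ennrealI tendsto_power tendsto_diff tendsto_const)
        then show "ennreal ((S n \<omega> - J \<omega>)\<^sup>2) = liminf (\<lambda>m. ennreal ((S n \<omega> - S m \<omega>)\<^sup>2))"
          using lim_imp_Liminf[OF sequentially_bot] by metis
      qed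
    qed
    also have "\<dots> \<le> liminf (\<lambda>m. \<integral>\<^sup>+ \<omega>. ennreal ((S n \<omega> - S m \<omega>)\<^sup>2) \<partial>M)"
      by (rule nn_integral_liminf) measurable
    also have "\<dots> \<le> ennreal (C * (4 * (1 / 4) ^ n))"
    proof (rule Liminf_le)
      show "\<forall>\<^sub>F m in sequentially. (\<integral>\<^sup>+ \<omega>. ennreal ((S n \<omega> - S m \<omega>)\<^sup>2) \<partial>M) \<le> ennreal (C * (4 * (1 / 4) ^ n))"
        using eventually_ge_at_top[of n]
      proof eventually_elim
        fix m assume "n \<le> m"
        from D[OF this] show "(\<integral>\<^sup>+ \<omega>. ennreal ((S n \<omega> - S m \<omega>)\<^sup>2) \<partial>M) \<le> ennreal (C * (4 * (1 / 4) ^ n))"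
          unfolding nn_integral_sq[OF sq_integrable_diff[OF Sq Sq]] by (simp add: power2_commute ennreal_leI)
      qed
    qed simp
    finally show ?thesis .
  qed
  have lim: "l2_lim M S J"
    unfolding l2_lim_def
  proof (rule tendsto_sandwich[OF always_eventually always_eventually tendsto_const])
    have "(\<lambda>n. C * (4 * (1 / 4) ^ n)) \<longlonglongrightarrow> C * (4 * 0)" by (intro tendsto_intros LIMSEQ_power_zero) simp
    then show "(\<lambda>n. ennreal (C * (4 * (1 / 4) ^ n))) \<longlonglongrightarrow> 0"
      using tendsto_ennrealI[of "\<lambda>n. C * (4 * (1 / 4) ^ n)" 0 sequentially] by simp
  qed (use le in auto)
  have "(\<lambda>n. LINT r:{0..t}|lborel. (step_fun (p n) r - g r)\<^sup>2) \<longlonglongrightarrow> 0"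
  proof (rule tendsto_sandwich[OF always_eventually always_eventually tendsto_const LIMSEQ_power_zero])
    show "\<forall>n. (LINT r:{0..t}|lborel. (step_fun (p n) r - g r)\<^sup>2) \<le> (1 / 4) ^ n"
      using f by (simp add: fast_steps_def)
  qed (auto simp: set_integral_square_nonneg)
  then show ?thesis
    using lim v Jm unfolding is_stoch_integral_iff[OF g] S_def[abs_def] by blast
qed

lemma (in prob_space) path_integral_is_stoch_integral:
  assumes Z: "l2_integrator M Z t" and f: "fast_steps t g p" and g: "bounded_borel g" and s: "s \<in> {0..t}"
  shows "is_stoch_integral M Z g s (\<lambda>\<omega>. path_integral p s (path_upto t Z \<omega>))"
proof -
  have "step_sum (trunc_steps s (p n)) (path_upto t Z \<omega>) = step_integral (trunc_steps s (p n)) Z \<omega>" for n \<omega>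
    using f s unfolding fast_steps_def
    by (intro step_sum_path_upto valid_steps_mono[OF valid_steps_trunc]) auto
  then show ?thesis
    using is_stoch_integral_fast[OF l2_integrator_mono[OF Z s] fast_steps_trunc[OF f g s] g]
    by (simp add: path_integral_def)
qed

lemma path_integral_measurable:
  assumes "fast_steps t g p" "s \<in> {0..t}"
  shows "path_integral p s \<in> borel_measurable (path_space t)"
proof -
  have "step_sum (trunc_steps s (p n)) \<in> borel_measurable (path_space t)" for n
    using assms unfolding fast_steps_def
    by (intro step_integral_measurable[where t=t] valid_steps_mono[OF valid_steps_trunc]) auto
  then show ?thesis unfolding path_integral_def[abs_def] by measurable
qed

lemma is_stoch_integral_cmult:
  assumes Z: "l2_integrator M Z t" and g: "bounded_borel g" and J: "is_stoch_integral M Z g t J"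
  shows "is_stoch_integral M Z (\<lambda>r. c * g r) t (\<lambda>\<omega>. c * J \<omega>)"
proof -
  obtain p where p: "\<And>n. valid_steps t (p n)" "(\<lambda>n. LINT r:{0..t}|lborel. (step_fun (p n) r - g r)\<^sup>2) \<longlonglongrightarrow> 0"
    "l2_lim M (\<lambda>n. step_integral (p n) Z) J" "J \<in> borel_measurable M"
    using J unfolding is_stoch_integral_iff[OF g] by blast
  have sq: "sq_integrable M (step_integral (p n) Z)" for n
    using Z p(1) unfolding l2_integrator_def by blast
  have cg: "bounded_borel (\<lambda>r. c * g r)" using g by auto
  have "l2_lim M (\<lambda>n. step_integral (scale_steps c (p n)) Z) (\<lambda>\<omega>. c * J \<omega>)"
    using l2_lim_cmult[OF sq sq_integrable_lim[OF sq p(4,3)] p(3), of c] by (simp add: l2_lim_def)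
  moreover have "(\<lambda>n. LINT r:{0..t}|lborel. (step_fun (scale_steps c (p n)) r - c * g r)\<^sup>2) \<longlonglongrightarrow> 0"
  proof -
    have "(\<lambda>n. c\<^sup>2 * (LINT r:{0..t}|lborel. (step_fun (p n) r - g r)\<^sup>2)) \<longlonglongrightarrow> c\<^sup>2 * 0"
      by (intro tendsto_intros p)
    moreover have "(LINT r:{0..t}|lborel. (step_fun (scale_steps c (p n)) r - c * g r)\<^sup>2) =
       c\<^sup>2 * (LINT r:{0..t}|lborel. (step_fun (p n) r - g r)\<^sup>2)" for n
      by (simp add: power_mult_distrib flip: right_diff_distrib)
    ultimately show ?thesis by simp
  qed
  ultimately show ?thesis
    unfolding is_stoch_integral_iff[OF cg] using p by (intro conjI exI[of _ "\<lambda>n. scale_steps c (p n)"]) auto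
qed

lemma is_stoch_integral_cong:
  assumes "\<And>r. r \<in> {0..t} \<Longrightarrow> g r = h r"
  shows "is_stoch_integral M Z g t J \<longleftrightarrow> is_stoch_integral M Z h t J"
proof -
  have "(\<integral>\<^sup>+ s\<in>{0..t}. ennreal ((step_fun p s - g s)\<^sup>2) \<partial>lborel) = (\<integral>\<^sup>+ s\<in>{0..t}. ennreal ((step_fun p s - h s)\<^sup>2) \<partial>lborel)" for p
    by (intro nn_integral_cong) (auto simp: indicator_def assms)
  then show ?thesis by (simp add: is_stoch_integral_def)
qed

section \<open>Gaussian functionals of two independent Wiener processes\<close>

text \<open>By bilinearity, inner products of step integrals depend on the process only through its
  covariances, so processes with equal covariances may be exchanged.\<close>

lemma step_integral_inner_cong:
  fixes Z :: "real \<Rightarrow> 'a \<Rightarrow> real" and Z' :: "real \<Rightarrow> 'b \<Rightarrow> real"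
  assumes Z: "\<And>s. s \<in> {0..T} \<Longrightarrow> sq_integrable M (Z s)" and Z': "\<And>s. s \<in> {0..T} \<Longrightarrow> sq_integrable N (Z' s)"
    and eq: "\<And>u v. u \<in> {0..T} \<Longrightarrow> v \<in> {0..T} \<Longrightarrow> (\<integral>x. Z u x * Z v x \<partial>M) = (\<integral>x. Z' u x * Z' v x \<partial>N)"
    and p: "valid_steps T p" and q: "valid_steps T q"
  shows "(\<integral>x. step_integral p Z x * step_integral q Z x \<partial>M) = (\<integral>x. step_integral p Z' x * step_integral q Z' x \<partial>N)"
    and "sq_integrable M (step_integral p Z)"
proof -
  have sq: "sq_integrable M (step_integral p Z)" "sq_integrable N (step_integral p Z')" if "valid_steps T p" for p
  proof -
    have "sq_integrable M (\<lambda>x. step_integral p Z x) \<and> sq_integrable N (\<lambda>x. step_integral p Z' x)"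
      using that
    proof (induction p)
      case Nil
      then show ?case by simp
    next
      case (Cons a p)
      obtain c u v where a: "a = (c, u, v)" by (cases a)
      show ?case using Cons a
        by (auto intro!: sq_integrable_add sq_integrable_cmult sq_integrable_diff Z Z')
    qed
    then show "sq_integrable M (step_integral p Z)" "sq_integrable N (step_integral p Z')" by auto
  qed
  show "sq_integrable M (step_integral p Z)" by (rule sq[OF p])
  have lin: "(\<integral>x. (c * (A x - B x) + S x) * R x \<partial>L) = c * ((\<integral>x. A x * R x \<partial>L) - (\<integral>x. B x * R x \<partial>L)) + (\<integral>x. S x * R x \<partial>L)"
    if "sq_integrable L A" "sq_integrable L B" "sq_integrable L S" "sq_integrable L R"
    for c and A B S R :: "'c \<Rightarrow> real" and L
  proof -
    have "(\<integral>x. (c * (A x - B x) + S x) * R x \<partial>L) = (\<integral>x. c * (A x * R x - B x * R x) + S x * R x \<partial>L)"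
      by (simp add: algebra_simps)
    then show ?thesis using that by (simp add: sq_integrable_mult)
  qed
  have one: "(\<integral>x. step_integral q Z x * Z s x \<partial>M) = (\<integral>x. step_integral q Z' x * Z' s x \<partial>N)"
    if s: "s \<in> {0..T}" and "valid_steps T q" for s q
    using that(2)
  proof (induction q)
    case Nil
    then show ?case by simp
  next
    case (Cons a q)
    obtain c u v where a: "a = (c, u, v)" by (cases a)
    have uv: "u \<in> {0..T}" "v \<in> {0..T}" "valid_steps T q" using Cons.prems a by auto
    show ?case
      unfolding a step_integral_simps
      using lin[OF Z[OF uv(2)] Z[OF uv(1)] sq(1)[OF uv(3)] Z[OF s], of c]
        lin[OF Z'[OF uv(2)] Z'[OF uv(1)] sq(2)[OF uv(3)] Z'[OF s], of c]
      by (simp only: Cons.IH[OF uv(3)] eq[OF uv(1) s] eq[OF uv(2) s])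
  qed
  show "(\<integral>x. step_integral p Z x * step_integral q Z x \<partial>M) = (\<integral>x. step_integral p Z' x * step_integral q Z' x \<partial>N)"
    using p
  proof (induction p)
    case Nil
    then show ?case by simp
  next
    case (Cons a p)
    obtain c u v where a: "a = (c, u, v)" by (cases a)
    have uv: "u \<in> {0..T}" "v \<in> {0..T}" "valid_steps T p" using Cons.prems a by auto
    show ?case
      unfolding a step_integral_simps
      using lin[OF Z[OF uv(2)] Z[OF uv(1)] sq(1)[OF uv(3)] sq(1)[OF q], of c]
        lin[OF Z'[OF uv(2)] Z'[OF uv(1)] sq(2)[OF uv(3)] sq(2)[OF q], of c]
        one[OF uv(1) q] one[OF uv(2) q] Cons.IH[OF uv(3)]
      by (simp only: mult.commute[of "Z _ _" "step_integral q _ _"] mult.commute[of "Z' _ _" "step_integral q _ _"])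
  qed
qed

text \<open>The indicator of \<open>u < r \<le> v\<close> is the increment from \<open>u\<close> to
  \<open>v\<close> of the indicator of \<open>r \<le> v\<close>. In L^2[0,T] this family has the
  covariances \<open>min u v\<close> of a Wiener process.\<close>

lemma step_fun_eq_step_integral:
  "valid_steps T p \<Longrightarrow> step_fun p r = step_integral p (\<lambda>v r. indicator {r..} v) r"
  by (induction p) (auto simp: indicator_def)

text \<open>The case \<open>s = u\<close> is treated separately, since \<open>wiener_process\<close>
  prescribes the normal law for distinct times.\<close>

lemma wiener_increment:
  assumes W: "wiener_process M T W" and su: "0 \<le> s" "s \<le> u" "u \<le> T"
  shows "sq_integrable M (\<lambda>\<omega>. W u \<omega> - W s \<omega>)" "(\<integral>\<omega>. (W u \<omega> - W s \<omega>)\<^sup>2 \<partial>M) = u - s"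
    "(\<integral>\<omega>. W u \<omega> - W s \<omega> \<partial>M) = 0" "char (distr M borel (\<lambda>\<omega>. d * (W u \<omega> - W s \<omega>))) 1 = exp (- (d\<^sup>2 * (u - s)) / 2)"
proof -
  interpret prob_space M using W by (simp add: wiener_process_def)
  have m[measurable]: "W u \<in> borel_measurable M" "W s \<in> borel_measurable M" using W su by (auto simp: wiener_process_def)
  have "sq_integrable M (\<lambda>\<omega>. W u \<omega> - W s \<omega>) \<and> (\<integral>\<omega>. (W u \<omega> - W s \<omega>)\<^sup>2 \<partial>M) = u - s \<and>
    (\<integral>\<omega>. W u \<omega> - W s \<omega> \<partial>M) = 0 \<and> char (distr M borel (\<lambda>\<omega>. d * (W u \<omega> - W s \<omega>))) 1 = exp (- (d\<^sup>2 * (u - s)) / 2)"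
  proof (cases "s = u")
    case True
    have "char (distr M borel (\<lambda>\<omega>. 0::real)) 1 = 1" unfolding char_def by (subst integral_distr) (auto simp: prob_space)
    then show ?thesis using True by (simp add: sq_integrable_def)
  next
    case False
    with su have lt: "s < u" by simp
    define X where "X \<omega> = W u \<omega> - W s \<omega>" for \<omega>
    have [measurable]: "X \<in> borel_measurable M" unfolding X_def[abs_def] by measurable
    have D: "distributed M lborel X (normal_density 0 (sqrt (u - s)))"
      using W su lt unfolding wiener_process_def X_def[abs_def] by blast
    have pos: "0 < sqrt (u - s)" using lt by simp
    have e: "expectation X = 0" by (rule normal_distributed_expectation[OF pos D])
    have v: "expectation (\<lambda>\<omega>. (X \<omega>)\<^sup>2) = u - s" using normal_distributed_variance[OF pos D] e lt by simp
    have "integrable lborel (\<lambda>x. normal_density 0 (sqrt (u - s)) x * x\<^sup>2)"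
      using integrable_normal_moment[OF pos, of 0 2] by simp
    then have "integrable M (\<lambda>\<omega>. (X \<omega>)\<^sup>2)"
      using distributed_integrable[OF D, of "\<lambda>x. x\<^sup>2"] by simp
    then have sq: "sq_integrable M X" by (simp add: sq_integrable_def)
    have D1: "distributed M lborel (\<lambda>\<omega>. X \<omega> / sqrt (u - s)) std_normal_density"
      using D normal_standard_normal_convert[OF pos, of X 0] by simp
    have "distr M lborel (\<lambda>\<omega>. X \<omega> / sqrt (u - s)) = std_normal_distribution"
      using distributed_distr_eq_density[OF D1] by simp
    moreover have "distr M lborel (\<lambda>\<omega>. X \<omega> / sqrt (u - s)) = distr M borel (\<lambda>\<omega>. X \<omega> / sqrt (u - s))"
      by (rule distr_cong) auto
    ultimately have "char (distr M borel (\<lambda>\<omega>. X \<omega> / sqrt (u - s))) (d * sqrt (u - s)) = exp (- ((d * sqrt (u - s))\<^sup>2) / 2)"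
      by (simp add: char_std_normal_distribution)
    moreover have "char (distr M borel (\<lambda>\<omega>. X \<omega> / sqrt (u - s))) (d * sqrt (u - s)) = char (distr M borel (\<lambda>\<omega>. d * X \<omega>)) 1"
    proof -
      have "d * sqrt (u - s) * (x / sqrt (u - s)) = d * x" for x using pos by simp
      then show ?thesis unfolding char_def by (subst (1 2) integral_distr) auto
    qed
    ultimately have "char (distr M borel (\<lambda>\<omega>. d * X \<omega>)) 1 = exp (- (d\<^sup>2 * (u - s)) / 2)"
      using lt by (simp add: power_mult_distrib)
    then show ?thesis using sq v e unfolding X_def by simp
  qed
  then show "sq_integrable M (\<lambda>\<omega>. W u \<omega> - W s \<omega>)" "(\<integral>\<omega>. (W u \<omega> - W s \<omega>)\<^sup>2 \<partial>M) = u - s"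
    "(\<integral>\<omega>. W u \<omega> - W s \<omega> \<partial>M) = 0" "char (distr M borel (\<lambda>\<omega>. d * (W u \<omega> - W s \<omega>))) 1 = exp (- (d\<^sup>2 * (u - s)) / 2)" by auto
qed

text \<open>Polarisation of the variance \<open>\<bar>u - v\<bar>\<close> of
  \<open>W u - W v\<close>.\<close>

lemma wiener_covariance:
  assumes W: "wiener_process M T W" and uv: "u \<in> {0..T}" "v \<in> {0..T}"
  shows "(\<integral>\<omega>. (W u \<omega> - W 0 \<omega>) * (W v \<omega> - W 0 \<omega>) \<partial>M) = min u v"
proof -
  define B where "B u \<omega> = W u \<omega> - W 0 \<omega>" for u \<omega>
  have sq: "sq_integrable M (B u)" "sq_integrable M (B v)"
    using wiener_increment(1)[OF W] uv by (auto simp: B_def[abs_def])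
  have b: "(\<integral>\<omega>. (B u \<omega>)\<^sup>2 \<partial>M) = u" "(\<integral>\<omega>. (B v \<omega>)\<^sup>2 \<partial>M) = v"
    using wiener_increment(2)[OF W, of 0 u] wiener_increment(2)[OF W, of 0 v] uv by (auto simp: B_def[abs_def])
  have "(\<integral>\<omega>. (1 * B u \<omega> + (-1) * B v \<omega>)\<^sup>2 \<partial>M) = \<bar>u - v\<bar>"
  proof (cases "v \<le> u")
    case True
    then show ?thesis using wiener_increment(2)[OF W, of v u] uv by (simp add: B_def)
  next
    case False
    then show ?thesis using wiener_increment(2)[OF W, of u v] uv by (simp add: B_def power2_commute)
  qed
  then show ?thesis
    using b unfolding integral_square_lin2[OF sq] by (auto simp: B_def[abs_def] min_def abs_if split: if_splits)
qed

text \<open>Ito's isometry for steps is an instance of \<open>step_integral_inner_cong\<close>: the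
  increments from time 0 and the indicators on [0,T] have the same covariances.\<close>

lemma wiener_step_isometry:
  assumes W: "wiener_process M T W" and p: "valid_steps T p" and q: "valid_steps T q"
  shows "sq_integrable M (step_integral p W)"
    "(\<integral>\<omega>. step_integral p W \<omega> * step_integral q W \<omega> \<partial>M) = (LINT r:{0..T}|lborel. step_fun p r * step_fun q r)"
proof -
  interpret time: finite_measure "time_measure T" by (rule finite_time_measure)
  define B where "B u \<omega> = W u \<omega> - W 0 \<omega>" for u \<omega>
  define G where "G v r = (indicator {r..} v :: real)" for v r :: real
  have BW: "step_integral p W = step_integral p B" for p by (rule ext, induction p) (auto simp: B_def)
  have sqB: "sq_integrable M (B u)" if "u \<in> {0..T}" for u
    using wiener_increment(1)[OF W, of 0 u] that by (simp add: B_def[abs_def])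
  have sqG: "sq_integrable (time_measure T) (G v)" for v
  proof -
    have "bounded_borel (\<lambda>r. if r \<in> {..v} then 1 else 0 :: real)" by (intro bounded_borel_if) auto
    moreover have "(\<lambda>r. if r \<in> {..v} then 1 else 0 :: real) = G v" by (auto simp: G_def)
    ultimately show ?thesis using sq_integrable_time_measure by metis
  qed
  have "(\<integral>x. B u x * B v x \<partial>M) = (\<integral>x. G u x * G v x \<partial>time_measure T)" if uv: "u \<in> {0..T}" "v \<in> {0..T}" for u v
  proof -
    have "(\<integral>x. G u x * G v x \<partial>time_measure T) = (\<integral>r. indicator {0..min u v} r \<partial>lborel)"
      unfolding integral_time_measure set_lebesgue_integral_def
      using uv by (intro Bochner_Integration.integral_cong) (auto simp: G_def indicator_def)
    also have "\<dots> = min u v" using uv by simp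
    finally show ?thesis using wiener_covariance[OF W uv] by (simp add: B_def)
  qed
  note eq = step_integral_inner_cong[OF sqB sqG this p q]
  show "sq_integrable M (step_integral p W)" unfolding BW by (rule eq(2))
  show "(\<integral>\<omega>. step_integral p W \<omega> * step_integral q W \<omega> \<partial>M) = (LINT r:{0..T}|lborel. step_fun p r * step_fun q r)"
  proof -
    have G: "G = (\<lambda>v r. indicator {r..} v)" by (simp add: G_def[abs_def])
    have "(\<integral>\<omega>. step_integral p W \<omega> * step_integral q W \<omega> \<partial>M) = (\<integral>\<omega>. step_integral p B \<omega> * step_integral q B \<omega> \<partial>M)"
      by (simp only: BW)
    also have "\<dots> = (\<integral>r. step_integral p G r * step_integral q G r \<partial>time_measure T)" by (rule eq(1))
    also have "\<dots> = (LINT r:{0..T}|lborel. step_fun p r * step_fun q r)"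
      unfolding integral_time_measure step_fun_eq_step_integral[OF p] step_fun_eq_step_integral[OF q] G ..
    finally show ?thesis .
  qed
qed

lemma wiener_step_mean:
  assumes W: "wiener_process M T W" and p: "valid_steps T p"
  shows "(\<integral>\<omega>. step_integral p W \<omega> \<partial>M) = 0"
  using p
proof (induction p)
  case Nil
  have "step_integral [] W = (\<lambda>_. 0)" by auto
  then show ?case by simp
next
  case (Cons a p)
  interpret prob_space M using W by (simp add: wiener_process_def)
  obtain c u v where a: "a = (c, u, v)" by (cases a)
  have uv: "0 \<le> u" "u \<le> v" "v \<le> T" "valid_steps T p" using Cons.prems a by auto
  have i: "integrable M (\<lambda>\<omega>. W v \<omega> - W u \<omega>)" "integrable M (step_integral p W)"
    using wiener_increment(1)[OF W uv(1-3)] wiener_step_isometry(1)[OF W uv(4,4)] by (auto intro: sq_integrable_integrable)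
  have "(\<integral>\<omega>. step_integral (a # p) W \<omega> \<partial>M) = (\<integral>\<omega>. c * (W v \<omega> - W u \<omega>) + step_integral p W \<omega> \<partial>M)"
    unfolding a step_integral_simps ..
  also have "\<dots> = c * (\<integral>\<omega>. W v \<omega> - W u \<omega> \<partial>M) + (\<integral>\<omega>. step_integral p W \<omega> \<partial>M)"
    using i by (subst Bochner_Integration.integral_add) auto
  finally show ?case using Cons.IH[OF uv(4)] wiener_increment(3)[OF W uv(1-3)] by simp
qed

text \<open>Common refinement: with all endpoints sorted, a sum over overlapping intervals becomes a
  sum over consecutive increments, which is the form in which independence of increments
  applies.\<close>

lemma step_integral_grid:
  assumes p: "valid_steps T p" and T: "0 < T"
  shows "\<exists>n (\<tau> :: nat \<Rightarrow> real) d. 0 \<le> \<tau> 0 \<and> (\<forall>i<n. \<tau> i \<le> \<tau> (Suc i)) \<and> \<tau> n \<le> T \<and>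
    (\<forall>Z \<omega>. step_integral p Z \<omega> = (\<Sum>k<n. d k * (Z (\<tau> (Suc k)) \<omega> - Z (\<tau> k) (\<omega> :: 'a))))"
proof -
  \<comment> \<open>Adding 0 keeps the grid nonempty for an empty list.\<close>
  define P where "P = insert 0 ((\<lambda>(c, u, v). u) ` set p \<union> (\<lambda>(c, u, v). v) ` set p)"
  have fin: "finite P" by (simp add: P_def)
  have PT: "P \<subseteq> {0..T}" using p T unfolding P_def valid_steps_def by fastforce
  define xs where "xs = sorted_list_of_set P"
  have set: "set xs = P" and sorted: "sorted xs" using fin by (auto simp: xs_def)
  have ne: "xs \<noteq> []" using set by (auto simp: P_def)
  define n where "n = length xs - 1"
  define \<tau> where "\<tau> i = xs ! i" for i
  have len: "length xs = Suc n" using ne by (simp add: n_def)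
  have in_P: "\<tau> i \<in> P" if "i \<le> n" for i using that len set by (auto simp: \<tau>_def)
  have mono: "\<tau> i \<le> \<tau> j" if "i \<le> j" "j \<le> n" for i j
    using sorted that len by (auto simp: \<tau>_def sorted_nth_mono)
  have idx: "\<exists>i\<le>n. x = \<tau> i" if "x \<in> P" for x
    using that set len by (auto simp: \<tau>_def in_set_conv_nth less_Suc_eq_le)
  have "\<exists>d. \<forall>Z \<omega>. step_integral q Z \<omega> = (\<Sum>k<n. d k * (Z (\<tau> (Suc k)) \<omega> - Z (\<tau> k) (\<omega> :: 'a)))"
    if "set q \<subseteq> set p" for q
    using that
  proof (induction q)
    case Nil
    show ?case by (rule exI[of _ "\<lambda>_. 0"]) simp
  next
    case (Cons a q)
    obtain c u v where a: "a = (c, u, v)" by (cases a)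
    obtain d where d: "\<And>Z \<omega>. step_integral q Z \<omega> = (\<Sum>k<n. d k * (Z (\<tau> (Suc k)) \<omega> - Z (\<tau> k) (\<omega> :: 'a)))"
      using Cons by auto
    have mem: "(c, u, v) \<in> set p" using Cons.prems a by auto
    have uvP: "u \<in> P" "v \<in> P" "u \<le> v"
    proof -
      show "u \<in> P" unfolding P_def using imageI[OF mem, of "\<lambda>(c, u, v). u"] by simp
      show "v \<in> P" unfolding P_def using imageI[OF mem, of "\<lambda>(c, u, v). v"] by simp
      show "u \<le> v" using p mem unfolding valid_steps_def by auto
    qed
    obtain i j where ij: "i \<le> n" "j \<le> n" "u = \<tau> i" "v = \<tau> j" using idx uvP by metis
    have tel: "Z v \<omega> - Z u \<omega> = (\<Sum>k<n. (if i \<le> k \<and> k < j then 1 else 0) * (Z (\<tau> (Suc k)) \<omega> - Z (\<tau> k) \<omega>))"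
      for Z :: "real \<Rightarrow> 'a \<Rightarrow> real" and \<omega>
    proof (cases "i \<le> j")
      case True
      have "(\<Sum>k<n. (if i \<le> k \<and> k < j then 1 else 0) * (Z (\<tau> (Suc k)) \<omega> - Z (\<tau> k) \<omega>)) =
        (\<Sum>k\<in>{i..<j}. Z (\<tau> (Suc k)) \<omega> - Z (\<tau> k) \<omega>)"
        using ij by (intro sum.mono_neutral_cong_right) auto
      also have "\<dots> = Z (\<tau> j) \<omega> - Z (\<tau> i) \<omega>" using True by (rule sum_Suc_diff')
      finally show ?thesis using ij by simp
    next
      case False
      then have "v \<le> u" using mono[of j i] ij by simp
      then have "u = v" using uvP by simp
      moreover have "(\<Sum>k<n. (if i \<le> k \<and> k < j then 1 else 0) * (Z (\<tau> (Suc k)) \<omega> - Z (\<tau> k) \<omega>)) = 0"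
        using False by (intro sum.neutral) auto
      ultimately show ?thesis by simp
    qed
    show ?case
      by (rule exI[of _ "\<lambda>k. c * (if i \<le> k \<and> k < j then 1 else 0) + d k"])
        (simp add: a d tel sum_distrib_left sum.distrib distrib_right mult.assoc)
  qed
  then obtain d where "\<And>Z \<omega>. step_integral p Z \<omega> = (\<Sum>k<n. d k * (Z (\<tau> (Suc k)) \<omega> - Z (\<tau> k) (\<omega> :: 'a)))"
    by blast
  moreover have "0 \<le> \<tau> 0" "\<tau> n \<le> T" using in_P[of 0] in_P[of n] PT by auto
  moreover have "\<forall>i<n. \<tau> i \<le> \<tau> (Suc i)" using mono by simp
  ultimately show ?thesis by blast
qed

text \<open>On a common grid the characteristic function factors over independent normal increments.
  The variances add up to the second moment because increments over different cells are
  uncorrelated.\<close>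

lemma wiener_step_char:
  fixes M :: "'a measure"
  assumes W: "wiener_process M T W" and p: "valid_steps T p" and T: "0 < T"
  shows "char (distr M borel (step_integral p W)) 1 = exp (- (\<integral>\<omega>. (step_integral p W \<omega>)\<^sup>2 \<partial>M) / 2)"
proof -
  interpret prob_space M using W by (simp add: wiener_process_def)
  obtain n and \<tau> :: "nat \<Rightarrow> real" and d where grid: "0 \<le> \<tau> 0 \<and> (\<forall>i<n. \<tau> i \<le> \<tau> (Suc i)) \<and> \<tau> n \<le> T \<and>
    (\<forall>Z \<omega>. step_integral p Z \<omega> = (\<Sum>k<n. d k * (Z (\<tau> (Suc k)) \<omega> - Z (\<tau> k) (\<omega> :: 'a))))"
    using step_integral_grid[OF p T, where 'a='a] by (elim exE) (rule that)
  then have \<tau>: "0 \<le> \<tau> 0" "\<And>i. i < n \<Longrightarrow> \<tau> i \<le> \<tau> (Suc i)" "\<tau> n \<le> T" by auto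
  have eq: "step_integral p Z \<omega> = (\<Sum>k<n. d k * (Z (\<tau> (Suc k)) \<omega> - Z (\<tau> k) (\<omega> :: 'a)))" for Z \<omega>
    using grid by blast
  have mono: "\<tau> i \<le> \<tau> j" if "i \<le> j" "j \<le> n" for i j
    using that by (induction j) (auto simp: le_Suc_eq intro: order_trans[OF _ \<tau>(2)])
  have rng: "\<tau> i \<in> {0..T}" if "i \<le> n" for i using mono[of 0 i] mono[of i n] that \<tau> by auto
  define \<Delta> where "\<Delta> k \<omega> = W (\<tau> (Suc k)) \<omega> - W (\<tau> k) \<omega>" for k \<omega>
  have ind: "indep_vars (\<lambda>_. borel) \<Delta> {..<n}"
    using W \<tau> unfolding wiener_process_def \<Delta>_def[abs_def] by blast
  have ind2: "indep_vars (\<lambda>_. borel) (\<lambda>k \<omega>. d k * \<Delta> k \<omega>) {..<n}"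
    by (rule indep_vars_compose2[OF ind]) auto
  have S: "step_integral p W = (\<lambda>\<omega>. \<Sum>k<n. d k * \<Delta> k \<omega>)" by (auto simp: eq \<Delta>_def)
  have "char (distr M borel (step_integral p W)) 1 = (\<Prod>k<n. char (distr M borel (\<lambda>\<omega>. d k * \<Delta> k \<omega>)) 1)"
    unfolding S by (rule char_distr_sum[OF ind2])
  also have "\<dots> = (\<Prod>k<n. complex_of_real (exp (- ((d k)\<^sup>2 * (\<tau> (Suc k) - \<tau> k)) / 2)))"
  proof (rule prod.cong)
    fix k assume "k \<in> {..<n}"
    then have k: "0 \<le> \<tau> k" "\<tau> k \<le> \<tau> (Suc k)" "\<tau> (Suc k) \<le> T" using rng[of k] rng[of "Suc k"] \<tau>(2) by auto
    show "char (distr M borel (\<lambda>\<omega>. d k * \<Delta> k \<omega>)) 1 = complex_of_real (exp (- ((d k)\<^sup>2 * (\<tau> (Suc k) - \<tau> k)) / 2))"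
      using wiener_increment(4)[OF W k, of "d k"] unfolding \<Delta>_def .
  qed simp
  also have "\<dots> = complex_of_real (exp (- (\<Sum>k<n. (d k)\<^sup>2 * (\<tau> (Suc k) - \<tau> k)) / 2))"
    by (simp only: of_real_prod[symmetric] exp_sum[OF finite_lessThan, symmetric] sum_negf sum_divide_distrib[symmetric])
  also have "(\<Sum>k<n. (d k)\<^sup>2 * (\<tau> (Suc k) - \<tau> k)) = (\<integral>\<omega>. (step_integral p W \<omega>)\<^sup>2 \<partial>M)"
  proof -
    have sq: "sq_integrable M (\<Delta> k)" if "k < n" for k
      using wiener_increment(1)[OF W, of "\<tau> k" "\<tau> (Suc k)"] rng[of k] rng[of "Suc k"] \<tau>(2)[of k] that by (simp add: \<Delta>_def[abs_def])
    have cov: "(\<integral>\<omega>. \<Delta> j \<omega> * \<Delta> k \<omega> \<partial>M) = (if j = k then \<tau> (Suc k) - \<tau> k else 0)" if "j < n" "k < n" for j k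
    proof -
      have v: "valid_steps T [(1, \<tau> k, \<tau> (Suc k))]" if "k < n" for k
        using rng[of k] rng[of "Suc k"] \<tau>(2)[of k] that by simp
      have "(\<integral>\<omega>. \<Delta> j \<omega> * \<Delta> k \<omega> \<partial>M) =
        (LINT r:{0..T}|lborel. indicat_real {\<tau> j<..\<tau> (Suc j)} r * indicat_real {\<tau> k<..\<tau> (Suc k)} r)"
        using wiener_step_isometry(2)[OF W v[OF that(1)] v[OF that(2)]] by (simp add: \<Delta>_def)
      also have "\<dots> = (\<integral>r. indicat_real (if j = k then {\<tau> k<..\<tau> (Suc k)} else {}) r \<partial>lborel)"
        unfolding set_lebesgue_integral_def
      proof (rule Bochner_Integration.integral_cong)
        fix r
        have "Suc j \<le> k \<Longrightarrow> \<tau> (Suc j) \<le> \<tau> k" "Suc k \<le> j \<Longrightarrow> \<tau> (Suc k) \<le> \<tau> j" using mono that by auto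
        then show "indicat_real {0..T} r *\<^sub>R (indicat_real {\<tau> j<..\<tau> (Suc j)} r * indicat_real {\<tau> k<..\<tau> (Suc k)} r) =
          indicat_real (if j = k then {\<tau> k<..\<tau> (Suc k)} else {}) r"
          using rng[of k] rng[of "Suc k"] that by (cases j k rule: linorder_cases) (auto simp: indicator_def)
      qed simp
      also have "\<dots> = (if j = k then \<tau> (Suc k) - \<tau> k else 0)" using \<tau>(2) that by simp
      finally show ?thesis .
    qed
    have "(\<integral>\<omega>. (step_integral p W \<omega>)\<^sup>2 \<partial>M) = (\<integral>\<omega>. (\<Sum>j<n. \<Sum>k<n. d j * d k * (\<Delta> j \<omega> * \<Delta> k \<omega>)) \<partial>M)"
      unfolding S by (intro Bochner_Integration.integral_cong) (auto simp: power2_eq_square sum_product mult_ac)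
    also have "\<dots> = (\<Sum>j<n. \<Sum>k<n. d j * d k * (\<integral>\<omega>. \<Delta> j \<omega> * \<Delta> k \<omega> \<partial>M))"
      using sq by (subst Bochner_Integration.integral_sum integral_mult_right_zero[symmetric]; auto intro!: Bochner_Integration.integrable_sum integrable_mult_right sq_integrable_mult sum.cong Bochner_Integration.integral_sum simp flip: integral_mult_right_zero)
    also have "\<dots> = (\<Sum>j<n. \<Sum>k<n. (if j = k then (d k)\<^sup>2 * (\<tau> (Suc k) - \<tau> k) else 0))"
      by (intro sum.cong) (auto simp: cov power2_eq_square)
    also have "\<dots> = (\<Sum>k<n. (d k)\<^sup>2 * (\<tau> (Suc k) - \<tau> k))" by (intro sum.cong) auto
    finally show ?thesis by simp
  qed
  finally show ?thesis .
qed

lemma wiener_l2_integrator: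
  assumes W: "wiener_process M T W"
  shows "l2_integrator M W T"
proof -
  have "sq_integrable M (step_integral p W) \<and>
        (\<integral>\<omega>. (step_integral p W \<omega>)\<^sup>2 \<partial>M) \<le> 1 * (LINT r:{0..T}|lborel. (step_fun p r)\<^sup>2)" if "valid_steps T p" for p
    using wiener_step_isometry[OF W that that] by (simp add: power2_eq_square)
  moreover have "\<forall>s\<in>{0..T}. W s \<in> borel_measurable M" using W by (simp add: wiener_process_def)
  ultimately show ?thesis unfolding l2_integrator_def by (intro conjI exI[of _ 1]) auto
qed

section \<open>Wiener integrals with respect to an independent pair\<close>

locale wiener_pair = prob_space M for M :: "'w measure" +
  fixes T :: real and W V :: "real \<Rightarrow> 'w \<Rightarrow> real"
  assumes T_pos: "0 < T" and W: "wiener_process M T W" and V: "wiener_process M T V"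
    and indep_WV: "indep_var (path_space T) (path_upto T W) (path_space T) (path_upto T V)"
begin

lemma indep_step_integrals:
  assumes "valid_steps T p" "valid_steps T q"
  shows "indep_var borel (step_integral p W) borel (step_integral q V)"
proof -
  have m: "step_sum p \<in> measurable (path_space T) borel" if "valid_steps T p" for p
    using that by (intro step_integral_measurable[where t=T]) auto
  have "indep_var borel (step_sum p \<circ> path_upto T W) borel (step_sum q \<circ> path_upto T V)"
    by (rule indep_var_compose[OF indep_WV m m]) fact+
  moreover have "step_sum p \<circ> path_upto T W = step_integral p W" "step_sum q \<circ> path_upto T V = step_integral q V"
    using assms by (auto simp: step_sum_path_upto)
  ultimately show ?thesis by simp
qed

definition pair_step :: "(real \<times> real \<times> real) list \<Rightarrow> (real \<times> real \<times> real) list \<Rightarrow> 'w \<Rightarrow> real" where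
  "pair_step p q \<omega> = step_integral p W \<omega> + step_integral q V \<omega>"

lemma pair_step_sq: "valid_steps T p \<Longrightarrow> valid_steps T q \<Longrightarrow> sq_integrable M (pair_step p q)"
  unfolding pair_step_def[abs_def]
  using wiener_step_isometry(1)[OF W, of p p] wiener_step_isometry(1)[OF V, of q q] by (intro sq_integrable_add)

text \<open>The mixed terms vanish: step integrals against \<open>W\<close> and \<open>V\<close> are
  independent, and those against \<open>W\<close> have mean 0.\<close>

lemma pair_step_inner:
  assumes p: "valid_steps T p" "valid_steps T p'" and q: "valid_steps T q" "valid_steps T q'"
  shows "(\<integral>\<omega>. pair_step p q \<omega> * pair_step p' q' \<omega> \<partial>M) =
    (LINT r:{0..T}|lborel. step_fun p r * step_fun p' r) + (LINT r:{0..T}|lborel. step_fun q r * step_fun q' r)"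
proof -
  have sq: "sq_integrable M (step_integral p W)" "sq_integrable M (step_integral p' W)"
    "sq_integrable M (step_integral q V)" "sq_integrable M (step_integral q' V)"
    using wiener_step_isometry(1)[OF W] wiener_step_isometry(1)[OF V] p q by auto
  have cross: "(\<integral>\<omega>. step_integral p W \<omega> * step_integral q V \<omega> \<partial>M) = 0"
    if "valid_steps T p" "valid_steps T q" for p q
  proof -
    have "integrable M (step_integral p W)" "integrable M (step_integral q V)"
      using wiener_step_isometry(1)[OF W that(1,1)] wiener_step_isometry(1)[OF V that(2,2)] by (auto intro: sq_integrable_integrable)
    from indep_var_lebesgue_integral[OF indep_step_integrals[OF that] this]
    show ?thesis using wiener_step_mean[OF W that(1)] by simp
  qed
  have "(\<integral>\<omega>. pair_step p q \<omega> * pair_step p' q' \<omega> \<partial>M) =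
    (\<integral>\<omega>. (step_integral p W \<omega> * step_integral p' W \<omega> + step_integral p W \<omega> * step_integral q' V \<omega>) +
       (step_integral p' W \<omega> * step_integral q V \<omega> + step_integral q V \<omega> * step_integral q' V \<omega>) \<partial>M)"
    by (simp add: pair_step_def algebra_simps)
  also have "\<dots> = ((\<integral>\<omega>. step_integral p W \<omega> * step_integral p' W \<omega> \<partial>M) + (\<integral>\<omega>. step_integral p W \<omega> * step_integral q' V \<omega> \<partial>M)) +
       ((\<integral>\<omega>. step_integral p' W \<omega> * step_integral q V \<omega> \<partial>M) + (\<integral>\<omega>. step_integral q V \<omega> * step_integral q' V \<omega> \<partial>M))"
    using sq by (simp add: sq_integrable_mult)
  finally show ?thesis
    using cross p q wiener_step_isometry(2)[OF W p] wiener_step_isometry(2)[OF V q] by simp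
qed

text \<open>The characteristic function is real, so the sine part in the expansion of
  \<open>cos (c + pair_step p q \<omega>)\<close> has mean 0.\<close>

lemma pair_step_cos:
  assumes p: "valid_steps T p" and q: "valid_steps T q"
  shows "(\<integral>\<omega>. cos (c + pair_step p q \<omega>) \<partial>M) = cos c * exp (- (\<integral>\<omega>. (pair_step p q \<omega>)\<^sup>2 \<partial>M) / 2)"
proof -
  let ?S = "pair_step p q"
  have [measurable]: "?S \<in> borel_measurable M" using pair_step_sq[OF p q] by (simp add: sq_integrable_def)
  have expab: "exp (- a / 2) * exp (- b / 2) = exp (- (a + b) / 2)" for a b :: real
    unfolding exp_add[symmetric] by (simp add: add_divide_distrib)
  have "char (distr M borel ?S) 1 = char (distr M borel (step_integral p W)) 1 * char (distr M borel (step_integral q V)) 1"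
    unfolding pair_step_def[abs_def] by (rule char_distr_add[OF indep_step_integrals[OF p q]])
  also have "\<dots> = complex_of_real (exp (- (\<integral>\<omega>. (?S \<omega>)\<^sup>2 \<partial>M) / 2))"
    unfolding wiener_step_char[OF W p T_pos] wiener_step_char[OF V q T_pos] power2_eq_square
      wiener_step_isometry(2)[OF W p p] wiener_step_isometry(2)[OF V q q] pair_step_inner[OF p p q q]
    by (simp only: of_real_mult[symmetric] expab)
  finally have ch: "char (distr M borel ?S) 1 = complex_of_real (exp (- (\<integral>\<omega>. (?S \<omega>)\<^sup>2 \<partial>M) / 2))" .
  have i: "integrable M (\<lambda>\<omega>. iexp (?S \<omega>))" by (rule integrable_iexp) simp_all
  have eq: "char (distr M borel ?S) 1 = (CLINT \<omega>|M. iexp (?S \<omega>))"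
    unfolding char_def by (subst integral_distr) auto
  have "(\<integral>\<omega>. cos (?S \<omega>) \<partial>M) = Re (CLINT \<omega>|M. iexp (?S \<omega>))" "(\<integral>\<omega>. sin (?S \<omega>) \<partial>M) = Im (CLINT \<omega>|M. iexp (?S \<omega>))"
    using i by (simp_all add: Re_exp Im_exp flip: integral_Re integral_Im)
  then have cs: "(\<integral>\<omega>. cos (?S \<omega>) \<partial>M) = exp (- (\<integral>\<omega>. (?S \<omega>)\<^sup>2 \<partial>M) / 2)" "(\<integral>\<omega>. sin (?S \<omega>) \<partial>M) = 0"
    using ch eq by simp_all
  have "integrable M (\<lambda>\<omega>. cos (?S \<omega>))" "integrable M (\<lambda>\<omega>. sin (?S \<omega>))"
    by (auto intro!: integrable_const_bound[where B=1])
  then show ?thesis by (simp add: cos_add cs)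
qed

text \<open>\<open>wiener_rep Z k\<close>: \<open>Z\<close> is a version of \<open>\<integral>\<^sub>0\<^sup>T fst k dW + \<integral>\<^sub>0\<^sup>T snd k dV\<close>.\<close>

definition wiener_rep :: "('w \<Rightarrow> real) \<Rightarrow> (real \<Rightarrow> real \<times> real) \<Rightarrow> bool" where
  "wiener_rep Z k \<longleftrightarrow> bounded_borel k \<and> Z \<in> borel_measurable M \<and>
     (\<exists>p q. (\<forall>n. valid_steps T (p n)) \<and> (\<forall>n. valid_steps T (q n)) \<and>
       (\<lambda>n. LINT r:{0..T}|lborel. (step_fun (p n) r - fst (k r))\<^sup>2) \<longlonglongrightarrow> 0 \<and>
       (\<lambda>n. LINT r:{0..T}|lborel. (step_fun (q n) r - snd (k r))\<^sup>2) \<longlonglongrightarrow> 0 \<and>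
       l2_lim M (\<lambda>n. pair_step (p n) (q n)) Z)"

lemma wiener_rep_bounded_borel: "wiener_rep Z k \<Longrightarrow> bounded_borel k"
  by (simp add: wiener_rep_def)

lemma wiener_repE:
  assumes "wiener_rep Z k"
  obtains p q where "\<And>n. valid_steps T (p n)" "\<And>n. valid_steps T (q n)"
    "l2_lim (time_measure T) (\<lambda>n. step_fun (p n)) (\<lambda>r. fst (k r))" "l2_lim (time_measure T) (\<lambda>n. step_fun (q n)) (\<lambda>r. snd (k r))"
    "l2_lim M (\<lambda>n. pair_step (p n) (q n)) Z" "sq_integrable M Z"
proof -
  obtain p q where pq: "\<forall>n. valid_steps T (p n)" "\<forall>n. valid_steps T (q n)"
    "(\<lambda>n. LINT r:{0..T}|lborel. (step_fun (p n) r - fst (k r))\<^sup>2) \<longlonglongrightarrow> 0"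
    "(\<lambda>n. LINT r:{0..T}|lborel. (step_fun (q n) r - snd (k r))\<^sup>2) \<longlonglongrightarrow> 0"
    "l2_lim M (\<lambda>n. pair_step (p n) (q n)) Z" and Zm: "Z \<in> borel_measurable M" and k: "bounded_borel k"
    using assms unfolding wiener_rep_def by blast
  have "l2_lim (time_measure T) (\<lambda>n. step_fun (p n)) (\<lambda>r. fst (k r))" "l2_lim (time_measure T) (\<lambda>n. step_fun (q n)) (\<lambda>r. snd (k r))"
    using pq(3,4) k by (subst l2_lim_iff; auto intro!: sq_integrable_time_measure bounded_borel_step_fun simp: integral_time_measure)+
  moreover have "sq_integrable M Z" using sq_integrable_lim[OF pair_step_sq Zm pq(5)] pq(1,2) by simp
  ultimately show ?thesis using that pq(1,2,5) by blast
qed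

lemma wiener_rep_sq: "wiener_rep Z k \<Longrightarrow> sq_integrable M Z"
  by (erule wiener_repE)

text \<open>Both sides are limits of the identity for steps, by continuity of inner products in
  L^2(M) and in L^2[0,T].\<close>

lemma wiener_rep_inner:
  assumes Z: "wiener_rep Z k" and Z': "wiener_rep Z' k'"
  shows "(\<integral>\<omega>. Z \<omega> * Z' \<omega> \<partial>M) = (LINT r:{0..T}|lborel. k r \<bullet> k' r)"
proof -
  have k: "bounded_borel k" "bounded_borel k'" using Z Z' by (auto simp: wiener_rep_def)
  obtain p q where pq: "\<And>n. valid_steps T (p n)" "\<And>n. valid_steps T (q n)"
    "l2_lim (time_measure T) (\<lambda>n. step_fun (p n)) (\<lambda>r. fst (k r))" "l2_lim (time_measure T) (\<lambda>n. step_fun (q n)) (\<lambda>r. snd (k r))"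
    "l2_lim M (\<lambda>n. pair_step (p n) (q n)) Z" "sq_integrable M Z" using wiener_repE[OF Z] by blast
  obtain p' q' where pq': "\<And>n. valid_steps T (p' n)" "\<And>n. valid_steps T (q' n)"
    "l2_lim (time_measure T) (\<lambda>n. step_fun (p' n)) (\<lambda>r. fst (k' r))" "l2_lim (time_measure T) (\<lambda>n. step_fun (q' n)) (\<lambda>r. snd (k' r))"
    "l2_lim M (\<lambda>n. pair_step (p' n) (q' n)) Z'" "sq_integrable M Z'" using wiener_repE[OF Z'] by blast
  have 1: "(\<lambda>n. \<integral>\<omega>. pair_step (p n) (q n) \<omega> * pair_step (p' n) (q' n) \<omega> \<partial>M) \<longlonglongrightarrow> (\<integral>\<omega>. Z \<omega> * Z' \<omega> \<partial>M)"
    by (rule l2_lim_inner[OF pair_step_sq[OF pq(1,2)] pq(6,5) pair_step_sq[OF pq'(1,2)] pq'(6,5)])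
  have 2: "(\<lambda>n. \<integral>r. step_fun (p n) r * step_fun (p' n) r \<partial>time_measure T) \<longlonglongrightarrow> (\<integral>r. fst (k r) * fst (k' r) \<partial>time_measure T)"
    using k by (intro l2_lim_inner pq pq' sq_integrable_time_measure bounded_borel_step_fun bounded_borel_fst)
  have 3: "(\<lambda>n. \<integral>r. step_fun (q n) r * step_fun (q' n) r \<partial>time_measure T) \<longlonglongrightarrow> (\<integral>r. snd (k r) * snd (k' r) \<partial>time_measure T)"
    using k by (intro l2_lim_inner pq pq' sq_integrable_time_measure bounded_borel_step_fun bounded_borel_snd)
  have "(\<integral>\<omega>. Z \<omega> * Z' \<omega> \<partial>M) = (LINT r:{0..T}|lborel. fst (k r) * fst (k' r)) + (LINT r:{0..T}|lborel. snd (k r) * snd (k' r))"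
    using LIMSEQ_unique[OF 1] tendsto_add[OF 2 3] pair_step_inner pq(1,2) pq'(1,2)
    by (simp add: integral_time_measure)
  also have "\<dots> = (LINT r:{0..T}|lborel. fst (k r) * fst (k' r) + snd (k r) * snd (k' r))"
    using k by (intro set_integral_add(2)[symmetric] bounded_borel_set_integrable) auto
  finally show ?thesis by (simp add: inner_prod_def)
qed

text \<open>Gaussianity in the only form used later: cosine moments depend on the norm of the kernel
  alone.\<close>

lemma wiener_rep_cos:
  assumes Z: "wiener_rep Z k"
  shows "(\<integral>\<omega>. cos (c + Z \<omega>) \<partial>M) = cos c * exp (- (LINT r:{0..T}|lborel. k r \<bullet> k r) / 2)"
proof -
  obtain p q where pq: "\<And>n. valid_steps T (p n)" "\<And>n. valid_steps T (q n)"
    "l2_lim (time_measure T) (\<lambda>n. step_fun (p n)) (\<lambda>r. fst (k r))" "l2_lim (time_measure T) (\<lambda>n. step_fun (q n)) (\<lambda>r. snd (k r))"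
    "l2_lim M (\<lambda>n. pair_step (p n) (q n)) Z" "sq_integrable M Z" using wiener_repE[OF Z] by blast
  note sq = pair_step_sq[OF pq(1,2)]
  have "(\<lambda>n. \<integral>\<omega>. (pair_step (p n) (q n) \<omega>)\<^sup>2 \<partial>M) \<longlonglongrightarrow> (\<integral>\<omega>. (Z \<omega>)\<^sup>2 \<partial>M)"
    using l2_lim_inner[OF sq pq(6,5) sq pq(6,5)] by (simp add: power2_eq_square)
  then have "(\<lambda>n. cos c * exp (- (\<integral>\<omega>. (pair_step (p n) (q n) \<omega>)\<^sup>2 \<partial>M) / 2)) \<longlonglongrightarrow> cos c * exp (- (\<integral>\<omega>. (Z \<omega>)\<^sup>2 \<partial>M) / 2)"
    by (intro tendsto_intros) auto
  then have 1: "(\<lambda>n. \<integral>\<omega>. cos (c + pair_step (p n) (q n) \<omega>) \<partial>M) \<longlonglongrightarrow> cos c * exp (- (\<integral>\<omega>. (Z \<omega>)\<^sup>2 \<partial>M) / 2)"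
    unfolding pair_step_cos[OF pq(1,2)] .
  have 2: "(\<lambda>n. \<integral>\<omega>. cos (c + pair_step (p n) (q n) \<omega>) \<partial>M) \<longlonglongrightarrow> (\<integral>\<omega>. cos (c + Z \<omega>) \<partial>M)"
    by (rule l2_lim_cos[OF sq pq(6,5)])
  show ?thesis
    using LIMSEQ_unique[OF 2 1] wiener_rep_inner[OF Z Z] by (simp only: power2_eq_square)
qed

lemma wiener_rep_AE_cong:
  assumes Z: "wiener_rep Z k" and Z': "Z' \<in> borel_measurable M" and eq: "AE \<omega> in M. Z' \<omega> = Z \<omega>"
  shows "wiener_rep Z' k"
proof -
  have "(\<integral>\<^sup>+ \<omega>. ennreal ((S \<omega> - Z \<omega>)\<^sup>2) \<partial>M) = (\<integral>\<^sup>+ \<omega>. ennreal ((S \<omega> - Z' \<omega>)\<^sup>2) \<partial>M)" for S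
    using eq by (intro nn_integral_cong_AE) auto
  then have "l2_lim M S Z \<longleftrightarrow> l2_lim M S Z'" for S by (simp add: l2_lim_def)
  then show ?thesis using Z Z' by (simp add: wiener_rep_def)
qed

text \<open>The distance in L^2(M) equals the distance of the kernels. In this way different
  versions and different formulas for one integral are identified.\<close>

lemma wiener_rep_unique:
  assumes Z: "wiener_rep Z k" and Z': "wiener_rep Z' k'" and eq: "\<And>r. r \<in> {0..T} \<Longrightarrow> k r = k' r"
  shows "AE \<omega> in M. Z \<omega> = Z' \<omega>"
proof -
  note sq = wiener_rep_sq[OF Z] wiener_rep_sq[OF Z']
  have e: "(LINT r:{0..T}|lborel. k r \<bullet> k r) = (LINT r:{0..T}|lborel. k r \<bullet> k' r)"
    "(LINT r:{0..T}|lborel. k' r \<bullet> k' r) = (LINT r:{0..T}|lborel. k r \<bullet> k' r)"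
    using eq by (auto intro!: set_lebesgue_integral_cong)
  have "(\<integral>\<omega>. (1 * Z \<omega> + (-1) * Z' \<omega>)\<^sup>2 \<partial>M) = 0"
    unfolding integral_square_lin2[OF sq] power2_eq_square[of "Z _"] power2_eq_square[of "Z' _"]
      wiener_rep_inner[OF Z Z] wiener_rep_inner[OF Z Z'] wiener_rep_inner[OF Z' Z'] e by simp
  then show ?thesis using integral_sq_eq_0_AE[OF sq_integrable_diff[OF sq]] by simp
qed

lemma wiener_rep_kernel_cong:
  assumes Z: "wiener_rep Z k" and k': "bounded_borel k'" and eq: "\<And>r. r \<in> {0..T} \<Longrightarrow> k r = k' r"
  shows "wiener_rep Z k'"
proof -
  have "(LINT r:{0..T}|lborel. (step_fun p r - fst (k r))\<^sup>2) = (LINT r:{0..T}|lborel. (step_fun p r - fst (k' r))\<^sup>2)"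
    "(LINT r:{0..T}|lborel. (step_fun p r - snd (k r))\<^sup>2) = (LINT r:{0..T}|lborel. (step_fun p r - snd (k' r))\<^sup>2)" for p
    using eq by (auto intro!: set_lebesgue_integral_cong)
  then show ?thesis using Z k' by (simp add: wiener_rep_def)
qed

lemma wiener_rep_lin:
  assumes Z: "wiener_rep Z k" and Z': "wiener_rep Z' k'"
  shows "wiener_rep (\<lambda>\<omega>. c * Z \<omega> + d * Z' \<omega>) (\<lambda>r. c *\<^sub>R k r + d *\<^sub>R k' r)"
proof -
  have k: "bounded_borel k" "bounded_borel k'" using Z Z' by (auto simp: wiener_rep_def)
  have kk: "bounded_borel (\<lambda>r. c *\<^sub>R k r + d *\<^sub>R k' r)"
    using k by (intro bounded_borel_add bounded_borel_scaleR bounded_borel_const)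
  obtain p q where pq: "\<And>n. valid_steps T (p n)" "\<And>n. valid_steps T (q n)"
    "l2_lim (time_measure T) (\<lambda>n. step_fun (p n)) (\<lambda>r. fst (k r))" "l2_lim (time_measure T) (\<lambda>n. step_fun (q n)) (\<lambda>r. snd (k r))"
    "l2_lim M (\<lambda>n. pair_step (p n) (q n)) Z" "sq_integrable M Z" using wiener_repE[OF Z] by blast
  obtain p' q' where pq': "\<And>n. valid_steps T (p' n)" "\<And>n. valid_steps T (q' n)"
    "l2_lim (time_measure T) (\<lambda>n. step_fun (p' n)) (\<lambda>r. fst (k' r))" "l2_lim (time_measure T) (\<lambda>n. step_fun (q' n)) (\<lambda>r. snd (k' r))"
    "l2_lim M (\<lambda>n. pair_step (p' n) (q' n)) Z'" "sq_integrable M Z'" using wiener_repE[OF Z'] by blast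
  let ?P = "\<lambda>n. scale_steps c (p n) @ scale_steps d (p' n)" and ?Q = "\<lambda>n. scale_steps c (q n) @ scale_steps d (q' n)"
  have lin: "l2_lim N (\<lambda>n x. c * S n x + d * S' n x) (\<lambda>x. c * A x + d * A' x)"
    if "\<And>n. sq_integrable N (S n)" "sq_integrable N A" "l2_lim N S A"
     "\<And>n. sq_integrable N (S' n)" "sq_integrable N A'" "l2_lim N S' A'" for N :: "'b measure" and S S' A A'
    by (rule l2_lim_add[OF sq_integrable_cmult[OF that(1)] sq_integrable_cmult[OF that(2)] l2_lim_cmult[OF that(1-3)]
        sq_integrable_cmult[OF that(4)] sq_integrable_cmult[OF that(5)] l2_lim_cmult[OF that(4-6)]])
  note sqt = sq_integrable_time_measure[OF bounded_borel_step_fun, of T]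
    sq_integrable_time_measure[OF bounded_borel_fst, of _ T] sq_integrable_time_measure[OF bounded_borel_snd, of _ T]
  have "l2_lim M (\<lambda>n \<omega>. c * pair_step (p n) (q n) \<omega> + d * pair_step (p' n) (q' n) \<omega>) (\<lambda>\<omega>. c * Z \<omega> + d * Z' \<omega>)"
    by (rule lin[OF pair_step_sq[OF pq(1,2)] pq(6,5) pair_step_sq[OF pq'(1,2)] pq'(6,5)])
  then have 1: "l2_lim M (\<lambda>n. pair_step (?P n) (?Q n)) (\<lambda>\<omega>. c * Z \<omega> + d * Z' \<omega>)"
    by (simp add: pair_step_def[abs_def] algebra_simps)
  have "l2_lim (time_measure T) (\<lambda>n r. c * step_fun (p n) r + d * step_fun (p' n) r) (\<lambda>r. c * fst (k r) + d * fst (k' r))"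
    using k by (intro lin sqt pq pq')
  then have 2: "(\<lambda>n. LINT r:{0..T}|lborel. (step_fun (?P n) r - fst (c *\<^sub>R k r + d *\<^sub>R k' r))\<^sup>2) \<longlonglongrightarrow> 0"
    using k by (subst (asm) l2_lim_iff) (auto intro!: sq_integrable_add sq_integrable_cmult sqt simp: integral_time_measure)
  have "l2_lim (time_measure T) (\<lambda>n r. c * step_fun (q n) r + d * step_fun (q' n) r) (\<lambda>r. c * snd (k r) + d * snd (k' r))"
    using k by (intro lin sqt pq pq')
  then have 3: "(\<lambda>n. LINT r:{0..T}|lborel. (step_fun (?Q n) r - snd (c *\<^sub>R k r + d *\<^sub>R k' r))\<^sup>2) \<longlonglongrightarrow> 0"
    using k by (subst (asm) l2_lim_iff) (auto intro!: sq_integrable_add sq_integrable_cmult sqt simp: integral_time_measure)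
  have m: "(\<lambda>\<omega>. c * Z \<omega> + d * Z' \<omega>) \<in> borel_measurable M"
    using Z Z' by (auto simp: wiener_rep_def)
  show ?thesis
    unfolding wiener_rep_def
    by (intro conjI kk m, rule exI[of _ ?P], rule exI[of _ ?Q], intro conjI 1 2 3) (use pq pq' in auto)
qed

lemma wiener_rep_0: "wiener_rep (\<lambda>_. 0) (\<lambda>_. 0)"
proof -
  have "pair_step [] [] = (\<lambda>_. 0)" by (auto simp: pair_step_def)
  then have "l2_lim M (\<lambda>n. pair_step [] []) (\<lambda>_. 0)" by (simp add: l2_lim_def)
  then show ?thesis unfolding wiener_rep_def
    by (intro conjI exI[of _ "\<lambda>_. []"]) auto
qed

lemma wiener_rep_cmult: "wiener_rep Z k \<Longrightarrow> wiener_rep (\<lambda>\<omega>. c * Z \<omega>) (\<lambda>r. c *\<^sub>R k r)"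
  using wiener_rep_lin[of Z k "\<lambda>_. 0" "\<lambda>_. 0" c 0] wiener_rep_0 by simp

lemma wiener_rep_sum:
  assumes "\<And>j. j \<in> J \<Longrightarrow> wiener_rep (Z j) (k j)"
  shows "wiener_rep (\<lambda>\<omega>. \<Sum>j\<in>J. l j * Z j \<omega>) (\<lambda>r. \<Sum>j\<in>J. l j *\<^sub>R k j r)"
  using assms
proof (induction J rule: infinite_finite_induct)
  case (insert j J)
  then show ?case using wiener_rep_lin[of "Z j" "k j" _ _ "l j" 1] by simp
qed (simp_all add: wiener_rep_0)

text \<open>Supplies reference variables: a random variable is identified by comparing it with a
  Wiener integral of the kernel that it ought to have.\<close>

lemma wiener_rep_exists:
  assumes k: "bounded_borel k" obtains Z where "wiener_rep Z k"
proof -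
  obtain p where p: "fast_steps T (\<lambda>r. fst (k r)) p" using fast_steps_exist[OF bounded_borel_fst[OF k] T_pos] by blast
  obtain q where q: "fast_steps T (\<lambda>r. snd (k r)) q" using fast_steps_exist[OF bounded_borel_snd[OF k] T_pos] by blast
  define J where "J \<omega> = lim (\<lambda>n. step_integral (p n) W \<omega>)" for \<omega>
  define L where "L \<omega> = lim (\<lambda>n. step_integral (q n) V \<omega>)" for \<omega>
  have J: "is_stoch_integral M W (\<lambda>r. fst (k r)) T J \<and> l2_lim M (\<lambda>n. step_integral (p n) W) J"
    by (rule is_stoch_integral_fast[OF wiener_l2_integrator[OF W] p bounded_borel_fst[OF k]]) (simp add: J_def)
  have L: "is_stoch_integral M V (\<lambda>r. snd (k r)) T L \<and> l2_lim M (\<lambda>n. step_integral (q n) V) L"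
    by (rule is_stoch_integral_fast[OF wiener_l2_integrator[OF V] q bounded_borel_snd[OF k]]) (simp add: L_def)
  have v: "valid_steps T (p n)" "valid_steps T (q n)" for n using p q by (auto simp: fast_steps_def)
  have mm: "J \<in> borel_measurable M" "L \<in> borel_measurable M" using J L by (auto simp: is_stoch_integral_def)
  have sqs: "sq_integrable M (step_integral (p n) W)" "sq_integrable M (step_integral (q n) V)" for n
    using wiener_step_isometry(1)[OF W v(1,1)] wiener_step_isometry(1)[OF V v(2,2)] by auto
  have JL: "sq_integrable M J" "sq_integrable M L"
    using sq_integrable_lim[OF sqs(1) mm(1)] sq_integrable_lim[OF sqs(2) mm(2)] J L by auto
  have "l2_lim M (\<lambda>n. pair_step (p n) (q n)) (\<lambda>\<omega>. J \<omega> + L \<omega>)"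
    unfolding pair_step_def[abs_def]
    by (rule l2_lim_add[OF sqs(1) JL(1) _ sqs(2) JL(2)]) (use J L in auto)
  moreover have "(\<lambda>n. LINT r:{0..T}|lborel. (step_fun (p n) r - fst (k r))\<^sup>2) \<longlonglongrightarrow> 0"
    by (rule tendsto_sandwich[OF always_eventually always_eventually tendsto_const LIMSEQ_power_zero[of "1/4"]])
      (use p in \<open>auto simp: fast_steps_def set_integral_square_nonneg\<close>)
  moreover have "(\<lambda>n. LINT r:{0..T}|lborel. (step_fun (q n) r - snd (k r))\<^sup>2) \<longlonglongrightarrow> 0"
    by (rule tendsto_sandwich[OF always_eventually always_eventually tendsto_const LIMSEQ_power_zero[of "1/4"]])
      (use q in \<open>auto simp: fast_steps_def set_integral_square_nonneg\<close>)
  moreover have "(\<lambda>\<omega>. J \<omega> + L \<omega>) \<in> borel_measurable M" using mm by simp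
  ultimately have "wiener_rep (\<lambda>\<omega>. J \<omega> + L \<omega>) k"
    unfolding wiener_rep_def using v k by blast
  then show ?thesis using that by blast
qed

lemma set_integral_extend_zero:
  fixes g h :: "real \<Rightarrow> real"
  assumes "s \<in> {0..T}" "\<And>r. r \<in> {0..s} \<Longrightarrow> g r = h r" "\<And>r. r \<in> {0..T} \<Longrightarrow> r \<notin> {0..s} \<Longrightarrow> g r = 0"
  shows "(LINT r:{0..T}|lborel. g r) = (LINT r:{0..s}|lborel. h r)"
  unfolding set_lebesgue_integral_def
  by (intro Bochner_Integration.integral_cong) (use assms in \<open>auto simp: indicator_def\<close>)

lemma is_stoch_integral_wiener_rep:
  assumes s: "s \<in> {0..T}" and c: "bounded_borel c"
  shows "is_stoch_integral M W c s J \<Longrightarrow> wiener_rep J (\<lambda>r. if r \<in> {0..s} then (c r, 0) else 0)"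
    and "is_stoch_integral M V c s J \<Longrightarrow> wiener_rep J (\<lambda>r. if r \<in> {0..s} then (0, c r) else 0)"
proof -
  have bb: "bounded_borel (\<lambda>r. if r \<in> {0..s} then (c r, 0 :: real) else 0)" "bounded_borel (\<lambda>r. if r \<in> {0..s} then (0 :: real, c r) else 0)"
    using c by (intro bounded_borel_if bounded_borel_Pair bounded_borel_const; simp)+
  have z: "(LINT r:{0..T}|lborel. (step_fun [] r - (0 :: real))\<^sup>2) = 0" by simp
  have ext: "(LINT r:{0..T}|lborel. (step_fun p r - (if r \<in> {0..s} then c r else 0))\<^sup>2) = (LINT r:{0..s}|lborel. (step_fun p r - c r)\<^sup>2)"
    if "valid_steps s p" for p
    using s step_fun_outside[OF that] by (intro set_integral_extend_zero) auto
  show "wiener_rep J (\<lambda>r. if r \<in> {0..s} then (c r, 0) else 0)" if J: "is_stoch_integral M W c s J"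
  proof -
    obtain p where p: "\<And>n. valid_steps s (p n)" "(\<lambda>n. LINT r:{0..s}|lborel. (step_fun (p n) r - c r)\<^sup>2) \<longlonglongrightarrow> 0"
      "l2_lim M (\<lambda>n. step_integral (p n) W) J" "J \<in> borel_measurable M"
      using J unfolding is_stoch_integral_iff[OF c] by blast
    show ?thesis unfolding wiener_rep_def
    proof (intro conjI bb p(4), rule exI[of _ p], rule exI[of _ "\<lambda>_. []"], intro conjI)
      show "\<forall>n. valid_steps T (p n)" using valid_steps_mono[OF p(1)] s by auto
      show "(\<lambda>n. LINT r:{0..T}|lborel. (step_fun (p n) r - fst (if r \<in> {0..s} then (c r, 0 :: real) else 0))\<^sup>2) \<longlonglongrightarrow> 0"
        using p(2) unfolding ext[OF p(1), symmetric] by (simp add: if_distrib[of fst] cong: if_cong)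
      show "(\<lambda>n. LINT r:{0..T}|lborel. (step_fun [] r - snd (if r \<in> {0..s} then (c r, 0 :: real) else 0))\<^sup>2) \<longlonglongrightarrow> 0"
        by (simp add: if_distrib[of snd] cong: if_cong)
      show "l2_lim M (\<lambda>n. pair_step (p n) []) J" using p(3) by (simp add: pair_step_def[abs_def])
    qed simp
  qed
  show "wiener_rep J (\<lambda>r. if r \<in> {0..s} then (0, c r) else 0)" if J: "is_stoch_integral M V c s J"
  proof -
    obtain p where p: "\<And>n. valid_steps s (p n)" "(\<lambda>n. LINT r:{0..s}|lborel. (step_fun (p n) r - c r)\<^sup>2) \<longlonglongrightarrow> 0"
      "l2_lim M (\<lambda>n. step_integral (p n) V) J" "J \<in> borel_measurable M"
      using J unfolding is_stoch_integral_iff[OF c] by blast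
    show ?thesis unfolding wiener_rep_def
    proof (intro conjI bb p(4), rule exI[of _ "\<lambda>_. []"], rule exI[of _ p], intro conjI)
      show "\<forall>n. valid_steps T (p n)" using valid_steps_mono[OF p(1)] s by auto
      show "(\<lambda>n. LINT r:{0..T}|lborel. (step_fun (p n) r - snd (if r \<in> {0..s} then (0 :: real, c r) else 0))\<^sup>2) \<longlonglongrightarrow> 0"
        using p(2) unfolding ext[OF p(1), symmetric] by (simp add: if_distrib[of snd] cong: if_cong)
      show "(\<lambda>n. LINT r:{0..T}|lborel. (step_fun [] r - fst (if r \<in> {0..s} then (0 :: real, c r) else 0))\<^sup>2) \<longlonglongrightarrow> 0"
        by (simp add: if_distrib[of fst] cong: if_cong)
      show "l2_lim M (\<lambda>n. pair_step [] (p n)) J" using p(3) by (simp add: pair_step_def[abs_def])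
    qed simp
  qed
qed

end

section \<open>Joint measurability and a stochastic Fubini theorem\<close>

lemma time_coordinate_measurable: "(\<lambda>s. s) \<in> measurable (time_measure t) borel"
  by (rule measurable_restrict_space1) simp

lemma fst_time_measurable: "fst \<in> measurable (time_measure t \<Otimes>\<^sub>M N) borel"
  using measurable_compose[OF measurable_fst time_coordinate_measurable] .

text \<open>Sampling the path at grid times makes it depend on \<open>s\<close> through a countable
  index only, hence jointly measurable; path continuity gives the limit.\<close>

lemma joint_measurable_if_continuous:
  fixes Z :: "real \<Rightarrow> 'w \<Rightarrow> real"
  assumes t: "0 < t" and Z: "\<And>s. s \<in> {0..t} \<Longrightarrow> Z s \<in> borel_measurable M"
    and c: "\<And>\<omega>. \<omega> \<in> space M \<Longrightarrow> continuous_on {0..t} (\<lambda>s. Z s \<omega>)"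
  shows "(\<lambda>(s, \<omega>). Z s \<omega>) \<in> borel_measurable (time_measure t \<Otimes>\<^sub>M M)"
proof -
  \<comment> \<open>For \<open>s\<close> in [0,t] and \<open>n > 0\<close> this is the last multiple
    of \<open>1 / n\<close> up to \<open>s\<close>; the cap keeps the sampling time in [0,t] for
    every \<open>s\<close> and \<open>n\<close>.\<close>
  define g where "g n s = min t (real (nat \<lfloor>real n * s\<rfloor>) / real n)" for n :: nat and s
  have g: "g n s \<in> {0..t}" for n s using t by (auto simp: g_def)
  have glim: "(\<lambda>n. g n s) \<longlonglongrightarrow> s" if s: "s \<in> {0..t}" for s
  proof -
    have b: "s - 1 / real n \<le> g n s" "g n s \<le> s" if n: "n > 0" for n
    proof -
      have "real n * s \<ge> 0" using s by simp
      then have f: "real (nat \<lfloor>real n * s\<rfloor>) \<le> real n * s" "real n * s - 1 \<le> real (nat \<lfloor>real n * s\<rfloor>)"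
        by (auto simp: of_nat_nat)
      have "real (nat \<lfloor>real n * s\<rfloor>) / real n \<le> s" using f(1) n by (simp add: field_simps)
      moreover have "s - 1 / real n \<le> real (nat \<lfloor>real n * s\<rfloor>) / real n" 
      proof -
        have "s - 1 / real n = (real n * s - 1) / real n" using n by (simp add: field_simps)
        also have "\<dots> \<le> real (nat \<lfloor>real n * s\<rfloor>) / real n" using f(2) by (rule divide_right_mono) simp
        finally show ?thesis .
      qed
      moreover have "0 \<le> 1 / real n" by simp
      ultimately show "s - 1 / real n \<le> g n s" "g n s \<le> s" using s unfolding g_def by auto
    qed
    have l: "(\<lambda>n. s - 1 / real n) \<longlonglongrightarrow> s - 0" by (intro tendsto_diff tendsto_const lim_1_over_n)
    show ?thesis
    proof (rule tendsto_sandwich[OF _ _ _ tendsto_const])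
      show "(\<lambda>n. s - 1 / real n) \<longlonglongrightarrow> s" using l by simp
      show "\<forall>\<^sub>F n in sequentially. s - 1 / real n \<le> g n s" "\<forall>\<^sub>F n in sequentially. g n s \<le> s"
        using eventually_gt_at_top[of "0::nat"] by (eventually_elim, use b in auto)+
    qed
  qed
  have m: "(\<lambda>(s, \<omega>). Z (g n s) \<omega>) \<in> borel_measurable (time_measure t \<Otimes>\<^sub>M M)" for n
  proof -
    have 1: "(\<lambda>x. Z (min t (real k / real n)) (snd x)) \<in> borel_measurable (time_measure t \<Otimes>\<^sub>M M)" for k :: nat
      by (rule measurable_compose[OF measurable_snd Z]) (use t in auto)
    have 2: "(\<lambda>x. nat \<lfloor>real n * fst x\<rfloor>) \<in> measurable (time_measure t \<Otimes>\<^sub>M M) (count_space UNIV)"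
      by (rule measurable_compose[OF fst_time_measurable, where g="\<lambda>s. nat \<lfloor>real n * s\<rfloor>"]) measurable
    from measurable_compose_countable[OF 1 2] show ?thesis by (simp add: g_def case_prod_beta')
  qed
  show ?thesis
  proof (rule borel_measurable_LIMSEQ_real[OF _ m])
    fix x assume "x \<in> space (time_measure t \<Otimes>\<^sub>M M)"
    then obtain s \<omega> where x: "x = (s, \<omega>)" "s \<in> {0..t}" "\<omega> \<in> space M"
      by (auto simp: space_pair_measure space_restrict_space)
    have "(\<lambda>n. Z (g n s) \<omega>) \<longlonglongrightarrow> Z s \<omega>"
      using continuous_on_tendsto_compose[OF c[OF x(3)] glim[OF x(2)] x(2)] g by simp
    then show "(\<lambda>n. case x of (s, \<omega>) \<Rightarrow> Z (g n s) \<omega>) \<longlonglongrightarrow> (case x of (s, \<omega>) \<Rightarrow> Z s \<omega>)" by (simp add: x)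
  qed
qed

context wiener_pair
begin

lemma wiener_rep_cos_sum:
  assumes A: "\<And>j. j \<in> J \<Longrightarrow> wiener_rep (A j) (k j)"
  shows "(\<integral>\<omega>. cos (c + (\<Sum>j\<in>J. l j * A j \<omega>)) \<partial>M) =
    cos c * exp (- (\<Sum>i\<in>J. \<Sum>j\<in>J. l i * l j * (LINT r:{0..T}|lborel. k i r \<bullet> k j r)) / 2)"
proof -
  note S = wiener_rep_sum[of J A k l, OF A]
  note sq = wiener_rep_sq[OF A]
  have "(LINT r:{0..T}|lborel. (\<Sum>j\<in>J. l j *\<^sub>R k j r) \<bullet> (\<Sum>j\<in>J. l j *\<^sub>R k j r)) =
     (\<integral>\<omega>. (\<Sum>i\<in>J. l i * A i \<omega>) * (\<Sum>j\<in>J. l j * A j \<omega>) \<partial>M)"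
    using wiener_rep_inner[OF S S] by simp
  also have "\<dots> = (\<integral>\<omega>. (\<Sum>i\<in>J. \<Sum>j\<in>J. l i * l j * (A i \<omega> * A j \<omega>)) \<partial>M)"
    unfolding sum_product by (simp add: mult_ac)
  also have "\<dots> = (\<Sum>i\<in>J. \<integral>\<omega>. (\<Sum>j\<in>J. l i * l j * (A i \<omega> * A j \<omega>)) \<partial>M)"
    by (intro Bochner_Integration.integral_sum Bochner_Integration.integrable_sum integrable_mult_right sq_integrable_mult sq)
  also have "\<dots> = (\<Sum>i\<in>J. \<Sum>j\<in>J. \<integral>\<omega>. l i * l j * (A i \<omega> * A j \<omega>) \<partial>M)"
    by (intro sum.cong refl Bochner_Integration.integral_sum integrable_mult_right sq_integrable_mult sq)
  also have "\<dots> = (\<Sum>i\<in>J. \<Sum>j\<in>J. l i * l j * (LINT r:{0..T}|lborel. k i r \<bullet> k j r))"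
    by (intro sum.cong refl) (simp add: wiener_rep_inner[OF A A])
  finally show ?thesis using wiener_rep_cos[OF S] by simp
qed

text \<open>The pathwise time integral \<open>A\<close> is compared with a Wiener integral
  \<open>\<Xi>\<close> of the averaged kernel \<open>Kbar\<close>. Fubini on time and probability
  space computes the second moment of \<open>A\<close> and its mixed moment with
  \<open>\<Xi>\<close>; both equal the squared norm of \<open>Kbar\<close>, as does the second
  moment of \<open>\<Xi>\<close>, so the two agree almost surely.\<close>

lemma stochastic_fubini:
  fixes Z :: "real \<Rightarrow> 'w \<Rightarrow> real" and K :: "real \<Rightarrow> real \<Rightarrow> real \<times> real"
  assumes t: "t \<in> {0..T}"
    and Zm: "(\<lambda>(s, \<omega>). Z s \<omega>) \<in> borel_measurable (time_measure t \<Otimes>\<^sub>M M)"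
    and ZK: "\<And>s. s \<in> {0..t} \<Longrightarrow> wiener_rep (Z s) (K s)"
    and Km[measurable]: "(\<lambda>(s, r). K s r) \<in> borel_measurable (borel \<Otimes>\<^sub>M borel)" and KC: "\<And>s r. norm (K s r) \<le> C"
    and \<kappa>: "bounded_borel \<kappa>"
  shows "wiener_rep (\<lambda>\<omega>. LINT s:{0..t}|lborel. \<kappa> s * Z s \<omega>) (\<lambda>r. LINT s:{0..t}|lborel. \<kappa> s *\<^sub>R K s r)"
    and "AE \<omega> in M. integrable (time_measure t) (\<lambda>s. \<kappa> s * Z s \<omega>)"
proof -
  let ?N = "time_measure t"
  let ?N' = "time_measure T"
  interpret N: finite_measure ?N by (rule finite_time_measure)
  interpret N': finite_measure ?N' by (rule finite_time_measure)
  interpret P: pair_sigma_finite ?N M ..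
  interpret NN: pair_sigma_finite ?N ?N' ..
  interpret NNf: finite_measure "?N \<Otimes>\<^sub>M ?N'" by (rule finite_measure_pair_measure) unfold_locales
  have sp: "space ?N = {0..t}" by (simp add: space_restrict_space)
  have fin: "emeasure ?N {0..t} < top" using N.emeasure_finite[of "{0..t}"] by (simp add: less_top[symmetric] infinity_ennreal_def del: infinity_ennreal_def)
  obtain D where D: "D \<ge> 0" "\<And>x. norm (\<kappa> x) \<le> D" using \<kappa> bounded_borel_bound by blast
  have C: "C \<ge> 0" using KC[of 0 0] norm_ge_zero order_trans by blast
  have \<kappa>m[measurable]: "\<kappa> \<in> borel_measurable borel" using \<kappa> by (simp add: bounded_borel_def)
  have Kb: "bounded_borel (K s)" for s
  proof (rule bounded_borelI[where C=C])
    have "(\<lambda>r. case (s, r) of (s, r) \<Rightarrow> K s r) \<in> borel_measurable borel"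
      by (rule measurable_compose[OF _ Km]) measurable
    then show "K s \<in> borel_measurable borel" by simp
  qed (rule KC)
  define Kbar where "Kbar r = (LINT s:{0..t}|lborel. \<kappa> s *\<^sub>R K s r)" for r
  have Kbar_eq: "Kbar r = (\<integral>s. \<kappa> s *\<^sub>R K s r \<partial>?N)" for r by (simp add: Kbar_def integral_time_measure)
  have bKs: "bounded_borel (\<lambda>s. \<kappa> s *\<^sub>R K s r)" for r
  proof (rule bounded_borelI[where C="D * C"])
    have "(\<lambda>s. case (s, r) of (s, r) \<Rightarrow> K s r) \<in> borel_measurable borel"
      by (rule measurable_compose[OF _ Km]) measurable
    then show "(\<lambda>s. \<kappa> s *\<^sub>R K s r) \<in> borel_measurable borel" by simp
    show "norm (\<kappa> s *\<^sub>R K s r) \<le> D * C" for s using mult_mono[OF D(2)[of s] KC[of s r] D(1)] by simp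
  qed
  have Kbar: "bounded_borel Kbar"
  proof (rule bounded_borelI[where C="D * C * t"])
    have "(\<lambda>(r, s). indicator {0..t} s *\<^sub>R (\<kappa> s *\<^sub>R K s r)) \<in> borel_measurable (borel \<Otimes>\<^sub>M lborel)" by measurable
    then show "Kbar \<in> borel_measurable borel"
      unfolding Kbar_def[abs_def] set_lebesgue_integral_def by (rule lborel.borel_measurable_lebesgue_integral)
    show "norm (Kbar r) \<le> D * C * t" for r
    proof -
      have "norm (\<kappa> s *\<^sub>R K s r) \<le> D * C" for s using mult_mono[OF D(2)[of s] KC[of s r] D(1)] by simp
      then show ?thesis using norm_set_integral_Icc_le[OF bKs[of r], of 0 t "D * C"] t by (simp add: Kbar_def)
    qed
  qed
  \<comment> \<open>Fubini in the two time variables: averaging inner products over \<open>s\<close>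
    averages the kernel.\<close>
  have det: "(\<integral>s. \<kappa> s * (LINT r:{0..T}|lborel. K s r \<bullet> k r) \<partial>?N) = (LINT r:{0..T}|lborel. Kbar r \<bullet> k r)"
    if k: "bounded_borel k" for k
  proof -
    obtain L where L: "L \<ge> 0" "\<And>x. norm (k x) \<le> L" using k bounded_borel_bound by blast
    have km[measurable]: "k \<in> borel_measurable borel" using k by (simp add: bounded_borel_def)
    have int: "integrable (?N \<Otimes>\<^sub>M ?N') (\<lambda>(s, r). \<kappa> s * (K s r \<bullet> k r))"
    proof (rule NNf.integrable_const_bound[where B="D * (C * L)"])
      have "norm (\<kappa> s * (K s r \<bullet> k r)) \<le> D * (C * L)" for s r
        using mult_mono[OF D(2)[of s] order_trans[OF Cauchy_Schwarz_ineq2 mult_mono[OF KC[of s r] L(2)[of r] C norm_ge_zero]] D(1)]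
        by (simp add: abs_mult)
      then show "AE x in ?N \<Otimes>\<^sub>M ?N'. norm (case x of (s, r) \<Rightarrow> \<kappa> s * (K s r \<bullet> k r)) \<le> D * (C * L)" by auto
      have idm: "(\<lambda>z. (fst z, snd z)) \<in> measurable (?N \<Otimes>\<^sub>M ?N') (borel \<Otimes>\<^sub>M borel)"
        by (intro measurable_Pair measurable_compose[OF measurable_fst time_coordinate_measurable]
            measurable_compose[OF measurable_snd time_coordinate_measurable])
      have "(\<lambda>(s, r). \<kappa> s * (K s r \<bullet> k r)) \<in> borel_measurable (borel \<Otimes>\<^sub>M borel)" by measurable
      from measurable_compose[OF idm this]
      show "(\<lambda>(s, r). \<kappa> s * (K s r \<bullet> k r)) \<in> borel_measurable (?N \<Otimes>\<^sub>M ?N')" by (simp add: case_prod_beta')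
    qed
    have "(\<integral>s. \<kappa> s * (LINT r:{0..T}|lborel. K s r \<bullet> k r) \<partial>?N) = (\<integral>s. \<integral>r. \<kappa> s * (K s r \<bullet> k r) \<partial>?N' \<partial>?N)"
      by (simp add: integral_time_measure)
    also have "\<dots> = (\<integral>r. \<integral>s. \<kappa> s * (K s r \<bullet> k r) \<partial>?N \<partial>?N')"
      using NN.Fubini_integral[OF int] by simp
    also have "\<dots> = (\<integral>r. Kbar r \<bullet> k r \<partial>?N')"
    proof (rule Bochner_Integration.integral_cong)
      fix r
      have "integrable ?N (\<lambda>s. \<kappa> s *\<^sub>R K s r)"
        using bounded_borel_set_integrable[OF bKs[of r], of 0 t] set_integrable_restrict_space
        by (simp add: integrable_restrict_space set_integrable_def)
      then show "(\<integral>s. \<kappa> s * (K s r \<bullet> k r) \<partial>?N) = Kbar r \<bullet> k r"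
        unfolding Kbar_eq by (subst integral_inner_left[symmetric]) auto
    qed simp
    finally show ?thesis by (simp add: integral_time_measure)
  qed
  obtain \<Xi> where \<Xi>: "wiener_rep \<Xi> Kbar" using wiener_rep_exists[OF Kbar] by blast
  define F where "F s \<omega> = \<kappa> s * Z s \<omega>" for s \<omega>
  have Fm[measurable]: "(\<lambda>(s, \<omega>). F s \<omega>) \<in> borel_measurable (?N \<Otimes>\<^sub>M M)"
  proof -
    have "(\<lambda>x. \<kappa> (fst x)) \<in> borel_measurable (?N \<Otimes>\<^sub>M M)" by (rule measurable_compose[OF fst_time_measurable \<kappa>m])
    from borel_measurable_times[OF this Zm] show ?thesis by (simp add: F_def case_prod_beta')
  qed
  have EZ: "(\<integral>\<omega>. (Z s \<omega>)\<^sup>2 \<partial>M) \<le> C\<^sup>2 * T" if s: "s \<in> {0..t}" for s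
  proof -
    have "(\<integral>\<omega>. (Z s \<omega>)\<^sup>2 \<partial>M) = (LINT r:{0..T}|lborel. K s r \<bullet> K s r)"
      using wiener_rep_inner[OF ZK[OF s] ZK[OF s]] by (simp add: power2_eq_square)
    also have "\<dots> \<le> norm (LINT r:{0..T}|lborel. K s r \<bullet> K s r)" by simp
    also have "\<dots> \<le> C\<^sup>2 * (T - 0)"
    proof (rule norm_set_integral_Icc_le)
      show "bounded_borel (\<lambda>r. K s r \<bullet> K s r)" using Kb by auto
      show "norm (K s x \<bullet> K s x) \<le> C\<^sup>2" for x
        using power_mono[OF KC[of s x] norm_ge_zero, of 2] by (simp add: power2_norm_eq_inner)
    qed (use T_pos in simp)
    finally show ?thesis by simp
  qed
  \<comment> \<open>The uniform bound on the kernels bounds the second moments of \<open>Z s\<close>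
    uniformly in \<open>s\<close>; this justifies every exchange of integrals below.\<close>
  have Fsq: "sq_integrable (?N \<Otimes>\<^sub>M M) (\<lambda>(s, \<omega>). F s \<omega>)"
  proof (rule sq_integrableI_nn_integral[OF Fm])
    have "(\<integral>\<^sup>+ x. ennreal ((case x of (s, \<omega>) \<Rightarrow> F s \<omega>)\<^sup>2) \<partial>(?N \<Otimes>\<^sub>M M)) =
      (\<integral>\<^sup>+ s. \<integral>\<^sup>+ \<omega>. ennreal ((F s \<omega>)\<^sup>2) \<partial>M \<partial>?N)"
      by (subst nn_integral_fst[symmetric]) (simp_all add: case_prod_beta')
    also have "\<dots> \<le> (\<integral>\<^sup>+ s. ennreal (D\<^sup>2 * (C\<^sup>2 * T)) \<partial>?N)"
    proof (rule nn_integral_mono)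
      fix s assume "s \<in> space ?N"
      then have s: "s \<in> {0..t}" by (simp add: sp)
      have "(\<integral>\<^sup>+ \<omega>. ennreal ((F s \<omega>)\<^sup>2) \<partial>M) = ennreal ((\<kappa> s)\<^sup>2 * (\<integral>\<omega>. (Z s \<omega>)\<^sup>2 \<partial>M))"
        using nn_integral_sq[OF sq_integrable_cmult[OF wiener_rep_sq[OF ZK[OF s]], of "\<kappa> s"]]
        by (simp add: F_def power_mult_distrib)
      also have "\<dots> \<le> ennreal (D\<^sup>2 * (C\<^sup>2 * T))"
        using EZ[OF s] power_mono[OF D(2)[of s] norm_ge_zero, of 2] by (intro ennreal_leI mult_mono) auto
      finally show "(\<integral>\<^sup>+ \<omega>. ennreal ((F s \<omega>)\<^sup>2) \<partial>M) \<le> ennreal (D\<^sup>2 * (C\<^sup>2 * T))" .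
    qed
    also have "\<dots> < \<infinity>" using fin by (simp add: ennreal_mult_less_top sp)
    finally show "(\<integral>\<^sup>+ x. ennreal ((case x of (s, \<omega>) \<Rightarrow> F s \<omega>)\<^sup>2) \<partial>(?N \<Otimes>\<^sub>M M)) < \<infinity>" .
  qed
  define A where "A \<omega> = (LINT s:{0..t}|lborel. \<kappa> s * Z s \<omega>)" for \<omega>
  have A_eq: "A \<omega> = (\<integral>s. F s \<omega> \<partial>?N)" for \<omega> by (simp add: A_def F_def integral_time_measure)
  have Am[measurable]: "A \<in> borel_measurable M"
  proof -
    have "(\<lambda>(\<omega>, s). F s \<omega>) \<in> borel_measurable (M \<Otimes>\<^sub>M ?N)"
      using measurable_compose[OF measurable_pair_swap' Fm] by (simp add: case_prod_beta')
    then show ?thesis unfolding A_eq[abs_def] by (rule N.borel_measurable_lebesgue_integral)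
  qed
  have F2: "integrable (?N \<Otimes>\<^sub>M M) (\<lambda>(s, \<omega>). (F s \<omega>)\<^sup>2)" using sq_integrable_square[OF Fsq] by (simp add: case_prod_beta')
  have Asq: "sq_integrable M A"
  proof -
    have "integrable M (\<lambda>\<omega>. (A \<omega>)\<^sup>2)"
    proof (rule Bochner_Integration.integrable_bound)
      show "integrable M (\<lambda>\<omega>. (\<integral>s. (F s \<omega>)\<^sup>2 \<partial>?N) * measure ?N (space ?N))"
        using P.integrable_snd[OF F2] by simp
      show "AE \<omega> in M. norm ((A \<omega>)\<^sup>2) \<le> norm ((\<integral>s. (F s \<omega>)\<^sup>2 \<partial>?N) * measure ?N (space ?N))"
        using P.AE_integrable_snd[OF F2] AE_space
      proof eventually_elim
        fix \<omega> assume i: "integrable ?N (\<lambda>s. (F s \<omega>)\<^sup>2)" and \<omega>: "\<omega> \<in> space M"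
        have "(\<lambda>s. F s \<omega>) \<in> borel_measurable ?N" using measurable_compose[OF measurable_Pair2'[OF \<omega>] Fm] by simp
        with i have sq: "sq_integrable ?N (\<lambda>s. F s \<omega>)" by (simp add: sq_integrable_def)
        have "\<bar>A \<omega>\<bar> \<le> sqrt (\<integral>s. (F s \<omega>)\<^sup>2 \<partial>?N) * sqrt (measure ?N (space ?N))"
          using l2_Cauchy_Schwarz[OF sq N.sq_integrable_const, of 1] by (simp add: A_eq)
        then have "\<bar>A \<omega>\<bar>\<^sup>2 \<le> (sqrt (\<integral>s. (F s \<omega>)\<^sup>2 \<partial>?N) * sqrt (measure ?N (space ?N)))\<^sup>2" by (intro power_mono) auto
        then show "norm ((A \<omega>)\<^sup>2) \<le> norm ((\<integral>s. (F s \<omega>)\<^sup>2 \<partial>?N) * measure ?N (space ?N))"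
          by (simp add: power_mult_distrib)
      qed
    qed simp
    then show ?thesis by (simp add: sq_integrable_def)
  qed
  have E: "(\<integral>\<omega>. A \<omega> * B \<omega> \<partial>M) = (\<integral>s. \<kappa> s * (\<integral>\<omega>. Z s \<omega> * B \<omega> \<partial>M) \<partial>?N)" if B: "sq_integrable M B" for B
  proof -
    have Bm[measurable]: "B \<in> borel_measurable M" using B by (simp add: sq_integrable_def)
    have "sq_integrable (?N \<Otimes>\<^sub>M M) (\<lambda>(s, \<omega>). B \<omega>)"
    proof (rule sq_integrableI_nn_integral)
      show "(\<lambda>(s, \<omega>). B \<omega>) \<in> borel_measurable (?N \<Otimes>\<^sub>M M)" by measurable
      have "(\<integral>\<^sup>+ x. ennreal ((case x of (s, \<omega>) \<Rightarrow> B \<omega>)\<^sup>2) \<partial>(?N \<Otimes>\<^sub>M M)) = (\<integral>\<^sup>+ s. \<integral>\<^sup>+ \<omega>. ennreal ((B \<omega>)\<^sup>2) \<partial>M \<partial>?N)"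
        by (subst nn_integral_fst[symmetric]) (simp_all add: case_prod_beta')
      also have "\<dots> < \<infinity>" using nn_integral_sq[OF B] fin by (simp add: ennreal_mult_less_top sp)
      finally show "(\<integral>\<^sup>+ x. ennreal ((case x of (s, \<omega>) \<Rightarrow> B \<omega>)\<^sup>2) \<partial>(?N \<Otimes>\<^sub>M M)) < \<infinity>" .
    qed
    from sq_integrable_mult[OF Fsq this]
    have int: "integrable (?N \<Otimes>\<^sub>M M) (\<lambda>(s, \<omega>). F s \<omega> * B \<omega>)" by (simp add: case_prod_beta')
    have "(\<integral>\<omega>. A \<omega> * B \<omega> \<partial>M) = (\<integral>\<omega>. \<integral>s. F s \<omega> * B \<omega> \<partial>?N \<partial>M)" by (simp add: A_eq)
    also have "\<dots> = (\<integral>s. \<integral>\<omega>. F s \<omega> * B \<omega> \<partial>M \<partial>?N)" by (rule P.Fubini_integral[OF int])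
    also have "\<dots> = (\<integral>s. \<kappa> s * (\<integral>\<omega>. Z s \<omega> * B \<omega> \<partial>M) \<partial>?N)" by (simp add: F_def mult.assoc)
    finally show ?thesis .
  qed
  have E1: "(\<integral>\<omega>. A \<omega> * B \<omega> \<partial>M) = (LINT r:{0..T}|lborel. Kbar r \<bullet> k r)" if B: "wiener_rep B k" for B k
  proof -
    have "(\<integral>\<omega>. A \<omega> * B \<omega> \<partial>M) = (\<integral>s. \<kappa> s * (\<integral>\<omega>. Z s \<omega> * B \<omega> \<partial>M) \<partial>?N)" by (rule E[OF wiener_rep_sq[OF B]])
    also have "\<dots> = (\<integral>s. \<kappa> s * (LINT r:{0..T}|lborel. K s r \<bullet> k r) \<partial>?N)"
      by (intro Bochner_Integration.integral_cong refl) (simp add: sp wiener_rep_inner[OF ZK B])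
    also have "\<dots> = (LINT r:{0..T}|lborel. Kbar r \<bullet> k r)" by (rule det[OF wiener_rep_bounded_borel[OF B]])
    finally show ?thesis .
  qed
  \<comment> \<open>One exchange leaves the mixed moments of \<open>Z s\<close> with
    \<open>A\<close>, and these are known from \<open>E1\<close> because \<open>Z s\<close> is
    itself a Wiener integral.\<close>
  have "(\<integral>\<omega>. A \<omega> * A \<omega> \<partial>M) = (\<integral>s. \<kappa> s * (\<integral>\<omega>. Z s \<omega> * A \<omega> \<partial>M) \<partial>?N)" by (rule E[OF Asq])
  also have "\<dots> = (\<integral>s. \<kappa> s * (LINT r:{0..T}|lborel. K s r \<bullet> Kbar r) \<partial>?N)"
    by (intro Bochner_Integration.integral_cong refl) (simp add: sp mult.commute[of "Z _ _"] E1[OF ZK] inner_commute)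
  also have "\<dots> = (LINT r:{0..T}|lborel. Kbar r \<bullet> Kbar r)" by (rule det[OF Kbar])
  finally have AA: "(\<integral>\<omega>. A \<omega> * A \<omega> \<partial>M) = (LINT r:{0..T}|lborel. Kbar r \<bullet> Kbar r)" .
  have "(\<integral>\<omega>. (1 * A \<omega> + (-1) * \<Xi> \<omega>)\<^sup>2 \<partial>M) = 0"
    unfolding integral_square_lin2[OF Asq wiener_rep_sq[OF \<Xi>]] power2_eq_square[of "A _"] power2_eq_square[of "\<Xi> _"]
      AA E1[OF \<Xi>] wiener_rep_inner[OF \<Xi> \<Xi>] by simp
  then have "AE \<omega> in M. A \<omega> = \<Xi> \<omega>"
    using integral_sq_eq_0_AE[OF sq_integrable_diff[OF Asq wiener_rep_sq[OF \<Xi>]]] by simp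
  from wiener_rep_AE_cong[OF \<Xi> Am this]
  show "wiener_rep (\<lambda>\<omega>. LINT s:{0..t}|lborel. \<kappa> s * Z s \<omega>) (\<lambda>r. LINT s:{0..t}|lborel. \<kappa> s *\<^sub>R K s r)"
    unfolding A_def[abs_def] Kbar_def[abs_def] .
  interpret NM: finite_measure "?N \<Otimes>\<^sub>M M" by (rule finite_measure_pair_measure) unfold_locales
  have "integrable (?N \<Otimes>\<^sub>M M) (\<lambda>(s, \<omega>). F s \<omega>)" by (rule NM.sq_integrable_integrable[OF Fsq])
  from P.AE_integrable_snd[OF this] show "AE \<omega> in M. integrable ?N (\<lambda>s. \<kappa> s * Z s \<omega>)"
    unfolding F_def .
qed

end

text \<open>Centred Gaussian families with equal covariances have equal laws. This serves two
  purposes: one noise law common to all models, and sign symmetry as a substitute for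
  independence.\<close>

lemma wiener_rep_law_eq:
  assumes P: "wiener_pair M T W V" and Q: "wiener_pair M' T W' V'"
    and A: "\<And>i. i \<in> I \<Longrightarrow> wiener_pair.wiener_rep M T W V (A i) (k i)"
    and B: "\<And>i. i \<in> I \<Longrightarrow> wiener_pair.wiener_rep M' T W' V' (B i) (k' i)"
    and eq: "\<And>i j. i \<in> I \<Longrightarrow> j \<in> I \<Longrightarrow> (LINT r:{0..T}|lborel. k i r \<bullet> k j r) = (LINT r:{0..T}|lborel. k' i r \<bullet> k' j r)"
  shows "distr M (\<Pi>\<^sub>M i\<in>I. borel) (\<lambda>x. \<lambda>i\<in>I. A i x) = distr M' (\<Pi>\<^sub>M i\<in>I. borel) (\<lambda>x. \<lambda>i\<in>I. B i x)"
proof -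
  interpret P: wiener_pair M T W V by fact
  interpret Q: wiener_pair M' T W' V' by fact
  show ?thesis
  proof (rule cos_moments_law_unique)
    show "prob_space M" "prob_space M'" by unfold_locales
    show "A i \<in> borel_measurable M" if "i \<in> I" for i using P.wiener_rep_sq[OF A[OF that]] by (simp add: sq_integrable_def)
    show "B i \<in> borel_measurable M'" if "i \<in> I" for i using Q.wiener_rep_sq[OF B[OF that]] by (simp add: sq_integrable_def)
    fix J c l assume J: "finite J" "J \<subseteq> I"
    have "(\<integral>x. cos (c + (\<Sum>j\<in>J. l j * A j x)) \<partial>M) =
      cos c * exp (- (\<Sum>i\<in>J. \<Sum>j\<in>J. l i * l j * (LINT r:{0..T}|lborel. k i r \<bullet> k j r)) / 2)"
      using J A by (intro P.wiener_rep_cos_sum) auto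
    also have "(\<Sum>i\<in>J. \<Sum>j\<in>J. l i * l j * (LINT r:{0..T}|lborel. k i r \<bullet> k j r)) =
      (\<Sum>i\<in>J. \<Sum>j\<in>J. l i * l j * (LINT r:{0..T}|lborel. k' i r \<bullet> k' j r))"
      using J by (intro sum.cong refl) (auto simp: eq subset_iff)
    also have "cos c * exp (- \<dots> / 2) = (\<integral>x. cos (c + (\<Sum>j\<in>J. l j * B j x)) \<partial>M')"
      using J B by (intro Q.wiener_rep_cos_sum[symmetric]) auto
    finally show "(\<integral>x. cos (c + (\<Sum>j\<in>J. l j * A j x)) \<partial>M) = (\<integral>x. cos (c + (\<Sum>j\<in>J. l j * B j x)) \<partial>M')" .
  qed
qed

section \<open>Deterministic Kalman--Bucy identities\<close>

lemma has_primitive_continuous: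
  assumes "has_primitive T F \<phi>" shows "continuous_on {0..T} F"
proof -
  obtain C where C: "C \<ge> 0" "\<And>s t. 0 \<le> s \<Longrightarrow> s \<le> t \<Longrightarrow> t \<le> T \<Longrightarrow> \<bar>F t - F s\<bar> \<le> C * (t - s)"
    using has_primitive_lipschitz[OF assms] by blast
  have "C-lipschitz_on {0..T} F"
  proof (rule lipschitz_onI[OF _ C(1)])
    fix s t assume st: "s \<in> {0..T}" "t \<in> {0..T}"
    show "dist (F s) (F t) \<le> C * dist s t"
    proof (cases "s \<le> t")
      case True
      then show ?thesis using C(2)[of s t] st by (simp add: dist_real_def abs_minus_commute)
    next
      case False
      then show ?thesis using C(2)[of t s] st by (simp add: dist_real_def)
    qed
  qed
  then show ?thesis by (rule lipschitz_on_continuous_on)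
qed

lemma primitive_upto_eq: "s \<in> {0..T} \<Longrightarrow> primitive_upto T \<phi> s = (LINT r:{0..s}|lborel. \<phi> r)"
  by (simp add: primitive_upto_def)

lemma primitive_upto_increment:
  assumes "bounded_borel \<phi>" "0 \<le> s" "s \<le> t" "t \<le> T"
  shows "(LINT r:{s..t}|lborel. \<phi> r) = primitive_upto T \<phi> t - primitive_upto T \<phi> s"
  using has_primitive_increment[OF has_primitive_upto[OF assms(1)] assms(2-4)] assms(2-4) by simp

lemma bounded_borel_primitive_upto: "bounded_borel \<phi> \<Longrightarrow> 0 \<le> T \<Longrightarrow> bounded_borel (primitive_upto T \<phi>)"
  by (rule has_primitive_bounded_borel(1)[OF has_primitive_upto])

lemma primitive_upto_lin:
  assumes "bounded_borel g" "bounded_borel h" "0 \<le> T" "s \<in> {0..T}"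
  shows "primitive_upto T (\<lambda>r. c * g r + d * h r) s = c * primitive_upto T g s + d * primitive_upto T h s"
proof -
  note P = has_primitive_upto[OF assms(1,3)] has_primitive_upto[OF assms(2,3)]
  have "bounded_borel (\<lambda>r. c * g r + d * h r)"
    using assms(1,2) by (intro bounded_borel_add bounded_borel_mult bounded_borel_const)
  note Q = has_primitive_upto[OF this assms(3)]
  show ?thesis
    by (rule has_primitive_unique[OF Q has_primitive_add[OF has_primitive_cmult[OF P(1), of c] has_primitive_cmult[OF P(2), of d]] refl _ assms(4)])
      (simp add: primitive_upto_0 assms(3))
qed

text \<open>The triangle \<open>r \<le> u \<le> s\<close> seen from \<open>r\<close>; it arises
  because the kernel of an adapted process vanishes beyond the current time.\<close>

lemma set_integral_triangle:
  fixes L :: "real \<Rightarrow> real \<Rightarrow> 'b::euclidean_space"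
  shows "(LINT u:{0..s}|lborel. \<kappa> u *\<^sub>R (if r \<in> {0..u} then L u r else 0)) =
    (if r \<in> {0..s} then LINT u:{r..s}|lborel. \<kappa> u *\<^sub>R L u r else 0)"
proof (cases "r \<in> {0..s}")
  case True
  then have "(LINT u:{0..s}|lborel. \<kappa> u *\<^sub>R (if r \<in> {0..u} then L u r else 0)) = (LINT u:{r..s}|lborel. \<kappa> u *\<^sub>R L u r)"
    unfolding set_lebesgue_integral_def
    by (intro Bochner_Integration.integral_cong) (auto simp: indicator_def)
  then show ?thesis using True by simp
next
  case False
  then have "(LINT u:{0..s}|lborel. \<kappa> u *\<^sub>R (if r \<in> {0..u} then L u r else 0)) = (LINT u:{0..s}|lborel. 0)"
    by (intro set_lebesgue_integral_cong) auto
  then show ?thesis using False by auto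
qed

text \<open>The coefficients live on the whole line and \<open>\<sigma>\<close> vanishes nowhere, so
  quotients need no case distinctions. \<open>ric\<close> and \<open>g0\<close> form the integrated
  Riccati equation with its initial value.\<close>

locale kb_coefficients =
  fixes T :: real and f \<sigma> a b \<gamma> :: "real \<Rightarrow> real"
  assumes T_pos': "0 < T"
    and bf: "bounded_borel f" and ba: "bounded_borel a" and bb: "bounded_borel b"
    and bs: "bounded_borel \<sigma>" and bis: "bounded_borel (\<lambda>s. 1 / \<sigma> s)" and s0: "\<And>s. \<sigma> s \<noteq> 0"
    and f0: "\<And>s. s \<in> {0..T} \<Longrightarrow> f s \<noteq> 0"
    and ric: "has_primitive T \<gamma> (\<lambda>s. 2 * a s * \<gamma> s - (f s)\<^sup>2 * (\<gamma> s)\<^sup>2 / (\<sigma> s)\<^sup>2 + (b s)\<^sup>2)"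
    and g0: "\<gamma> 0 = 0"
begin

lemma bg: "bounded_borel \<gamma>" using has_primitive_bounded_borel(1)[OF ric] .

lemma T_nonneg: "0 \<le> T" using T_pos' by simp

lemma bounded_borel_over_sigma[intro]: "bounded_borel h \<Longrightarrow> bounded_borel (\<lambda>s. h s / \<sigma> s)"
  using bounded_borel_mult[OF _ bis, of h] by simp

lemma bounded_borel_over_sigma2[intro]: "bounded_borel h \<Longrightarrow> bounded_borel (\<lambda>s. h s / (\<sigma> s)\<^sup>2)"
  using bounded_borel_over_sigma[OF bounded_borel_over_sigma, of h] by (simp add: power2_eq_square)

abbreviation A where "A \<equiv> KB_A f \<sigma> a \<gamma>"

text \<open>For \<open>\<theta> = 1\<close> the means of \<open>Y\<close> and \<open>X\<close> are
  \<open>flow\<close> and \<open>xbar\<close>; \<open>Phi0\<close> and \<open>info\<close> stand for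
  \<Phi>(0,s) and the information up to time \<open>s\<close>.\<close>

definition "flow s = exp (primitive_upto T a s)"
definition "Phi0 s = exp (primitive_upto T A s)"
definition "xbar = primitive_upto T (\<lambda>s. f s * flow s)"
definition "info = primitive_upto T (\<lambda>s. (f s)\<^sup>2 * (Phi0 s)\<^sup>2 / (\<sigma> s)\<^sup>2)"

lemma bA: "bounded_borel A"
  unfolding KB_A_def[abs_def] by (intro bounded_borel_diff bounded_borel_over_sigma2 bounded_borel_mult bounded_borel_power2 ba bf bg)

lemma pos: "flow s > 0" "Phi0 s > 0" by (auto simp: flow_def Phi0_def)
lemma nz[simp]: "flow s \<noteq> 0" "Phi0 s \<noteq> 0" using pos[of s] by auto
lemma at0[simp]: "flow 0 = 1" "Phi0 0 = 1" "xbar 0 = 0" "info 0 = 0"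
  using T_pos' by (auto simp: flow_def Phi0_def xbar_def info_def primitive_upto_0)

lemma prim_flow: "has_primitive T flow (\<lambda>s. a s * flow s)"
  unfolding flow_def[abs_def] by (rule has_primitive_exp[OF has_primitive_upto[OF ba T_nonneg]])

lemma prim_Phi0: "has_primitive T Phi0 (\<lambda>s. A s * Phi0 s)"
  unfolding Phi0_def[abs_def] by (rule has_primitive_exp[OF has_primitive_upto[OF bA T_nonneg]])

lemma prim_inv_flow: "has_primitive T (\<lambda>s. 1 / flow s) (\<lambda>s. - a s / flow s)"
  using has_primitive_exp[OF has_primitive_cmult[OF has_primitive_upto[OF ba T_nonneg], of "-1"]]
  by (simp add: flow_def exp_minus field_simps)

lemma prim_inv_Phi0: "has_primitive T (\<lambda>s. 1 / Phi0 s) (\<lambda>s. - A s / Phi0 s)"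
  using has_primitive_exp[OF has_primitive_cmult[OF has_primitive_upto[OF bA T_nonneg], of "-1"]]
  by (simp add: Phi0_def exp_minus field_simps)

lemmas b_flow = has_primitive_bounded_borel(1)[OF prim_flow]
lemmas b_Phi0 = has_primitive_bounded_borel(1)[OF prim_Phi0]

lemma bounded_borel_over_flow[intro]: "bounded_borel h \<Longrightarrow> bounded_borel (\<lambda>s. h s / flow s)"
  using bounded_borel_mult[OF _ has_primitive_bounded_borel(1)[OF prim_inv_flow], of h] by simp

lemma bounded_borel_over_Phi0[intro]: "bounded_borel h \<Longrightarrow> bounded_borel (\<lambda>s. h s / Phi0 s)"
  using bounded_borel_mult[OF _ has_primitive_bounded_borel(1)[OF prim_inv_Phi0], of h] by simp

lemmas bbs = bf ba bb bs bg bA b_flow b_Phi0 bounded_borel_over_flow bounded_borel_over_Phi0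
  bounded_borel_over_sigma bounded_borel_over_sigma2 bounded_borel_mult bounded_borel_add bounded_borel_diff
  bounded_borel_power2 bounded_borel_uminus bounded_borel_const

lemma prim_xbar: "has_primitive T xbar (\<lambda>s. f s * flow s)"
  unfolding xbar_def by (rule has_primitive_upto[OF _ T_nonneg]) (intro bbs)

lemma prim_info: "has_primitive T info (\<lambda>s. (f s)\<^sup>2 * (Phi0 s)\<^sup>2 / (\<sigma> s)\<^sup>2)"
  unfolding info_def by (rule has_primitive_upto[OF _ T_nonneg]) (intro bbs)

lemmas b_xbar = has_primitive_bounded_borel(1)[OF prim_xbar]
lemmas b_info = has_primitive_bounded_borel(1)[OF prim_info]

lemma prim_flow_over_Phi0:
  "has_primitive T (\<lambda>s. flow s / Phi0 s) (\<lambda>s. (f s)\<^sup>2 * \<gamma> s / (\<sigma> s)\<^sup>2 * (flow s / Phi0 s))"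
proof -
  have "has_primitive T (\<lambda>s. flow s * (1 / Phi0 s)) (\<lambda>s. (f s)\<^sup>2 * \<gamma> s / (\<sigma> s)\<^sup>2 * (flow s / Phi0 s))"
    by (rule has_primitive_cong[OF has_primitive_mult[OF prim_flow prim_inv_Phi0]])
      ((intro bbs), (simp add: KB_A_def field_simps))
  then show ?thesis by simp
qed

lemma prim_Phi0_over_flow:
  "has_primitive T (\<lambda>s. Phi0 s / flow s) (\<lambda>s. - ((f s)\<^sup>2 * \<gamma> s / (\<sigma> s)\<^sup>2 * (Phi0 s / flow s)))"
proof -
  have "has_primitive T (\<lambda>s. Phi0 s * (1 / flow s)) (\<lambda>s. - ((f s)\<^sup>2 * \<gamma> s / (\<sigma> s)\<^sup>2 * (Phi0 s / flow s)))"
    by (rule has_primitive_cong[OF has_primitive_mult[OF prim_Phi0 prim_inv_flow]])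
      ((intro bbs), (simp add: KB_A_def field_simps))
  then show ?thesis by simp
qed

text \<open>The Riccati equation is linearised by \<open>P = \<gamma> / (flow Phi0)\<close>, whose derivative does not involve \<open>P\<close>.\<close>

definition "P s = \<gamma> s / (flow s * Phi0 s)"

lemma P0[simp]: "P 0 = 0" by (simp add: P_def g0)

text \<open>Since \<open>a + A = 2 * a - f\<^sup>2 * \<gamma> / \<sigma>\<^sup>2\<close>, the linear
  and the quadratic term of the Riccati equation cancel and only \<open>b\<^sup>2\<close>
  survives.\<close>

lemma prim_P: "has_primitive T P (\<lambda>s. (b s)\<^sup>2 / flow s / Phi0 s)"
proof -
  have "has_primitive T (\<lambda>s. \<gamma> s * ((1 / flow s) * (1 / Phi0 s))) (\<lambda>s. (b s)\<^sup>2 / flow s / Phi0 s)"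
    by (rule has_primitive_cong[OF has_primitive_mult[OF ric has_primitive_mult[OF prim_inv_flow prim_inv_Phi0]]])
      ((intro bbs), (simp add: KB_A_def s0 field_simps power2_eq_square))
  then show ?thesis by (simp add: P_def[abs_def])
qed

lemma KB_Phi_eq:
  assumes "0 \<le> r" "r \<le> s" "s \<le> T" shows "KB_Phi f \<sigma> a \<gamma> r s = Phi0 s / Phi0 r"
  using primitive_upto_increment[OF bA assms] by (simp add: KB_Phi_def Phi0_def exp_diff)

lemma KB_info_eq:
  assumes "t \<in> {0..T}" shows "KB_info f \<sigma> a \<gamma> t = info t"
proof -
  have "KB_info f \<sigma> a \<gamma> t = (LINT s:{0..t}|lborel. (f s)\<^sup>2 * (Phi0 s)\<^sup>2 / (\<sigma> s)\<^sup>2)"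
    unfolding KB_info_def using assms KB_Phi_eq[of 0] by (intro set_lebesgue_integral_cong) auto
  then show ?thesis using primitive_upto_eq[OF assms] by (simp add: info_def)
qed

text \<open>The integrand is strictly positive on an interval of positive length; here
  \<open>f\<close> being nonzero on [0,T] enters.\<close>

lemma info_pos:
  assumes "t \<in> {0<..T}" shows "info t > 0"
proof -
  let ?h = "\<lambda>s. (f s)\<^sup>2 * (Phi0 s)\<^sup>2 / (\<sigma> s)\<^sup>2"
  have h: "bounded_borel ?h" by (intro bbs)
  have int: "integrable lborel (\<lambda>s. indicator {0..t} s *\<^sub>R ?h s)"
    using bounded_borel_set_integrable[OF h, of 0 t] by (simp add: set_integrable_def)
  have e: "info t = (\<integral>s. indicator {0..t} s *\<^sub>R ?h s \<partial>lborel)"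
    using assms by (simp add: info_def primitive_upto_def set_lebesgue_integral_def)
  have nn: "AE s in lborel. 0 \<le> indicator {0..t} s *\<^sub>R ?h s" by simp
  have "info t \<noteq> 0"
  proof
    assume "info t = 0"
    then have "AE s in lborel. indicator {0..t} s *\<^sub>R ?h s = 0"
      using integral_nonneg_eq_0_iff_AE[OF int nn] e by simp
    then have "AE s in lborel. s \<notin> {0..t}"
    proof eventually_elim
      fix s assume *: "indicator {0..t} s *\<^sub>R ?h s = 0"
      show "s \<notin> {0..t}"
      proof
        assume "s \<in> {0..t}"
        then show False using * f0[of s] s0[of s] assms by simp
      qed
    qed
    then have "emeasure lborel {0..t} = 0"
      using AE_iff_null_sets[of "{0..t}" lborel] by auto
    then show False using assms by simp
  qed
  moreover have "info t \<ge> 0" unfolding e by (rule Bochner_Integration.integral_nonneg) simp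
  ultimately show ?thesis by simp
qed

text \<open>For \<open>\<theta> = 1\<close> and times in [0,T], the mean of the integral of
  \<open>g\<close> with respect to \<open>X\<close>, since the drift of \<open>X\<close> has mean
  \<open>f * flow\<close>.\<close>

definition mean_int :: "(real \<Rightarrow> real) \<Rightarrow> real \<Rightarrow> real" where
  "mean_int g = primitive_upto T (\<lambda>s. g s * f s * flow s)"

text \<open>With respect to \<open>(W, V)\<close> the kernels of \<open>(Y\<^sub>s - E Y\<^sub>s)/\<epsilon>\<close>, \<open>(X\<^sub>s - E X\<^sub>s)/\<epsilon>\<close>, of the centred and
  scaled \<open>\<integral>\<^sub>0\<^sup>t g dX\<close> and \<open>H\<^sub>s\<close>, of the filtering error and of \<open>info t\<close> times the estimation error of the
  initial value.\<close>

definition signal_kernel :: "real \<Rightarrow> real \<Rightarrow> real \<times> real" where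
  "signal_kernel s r = (if r \<in> {0..s} then (0, b r * flow s / flow r) else 0)"

definition obs_kernel :: "real \<Rightarrow> real \<Rightarrow> real \<times> real" where
  "obs_kernel s r = (if r \<in> {0..s} then (\<sigma> r, b r / flow r * (xbar s - xbar r)) else 0)"

definition int_kernel :: "(real \<Rightarrow> real) \<Rightarrow> real \<Rightarrow> real \<Rightarrow> real \<times> real" where
  "int_kernel g t r = (if r \<in> {0..t} then (g r * \<sigma> r, b r / flow r * (mean_int g t - mean_int g r)) else 0)"

definition H_kernel :: "real \<Rightarrow> real \<Rightarrow> real \<times> real" where
  "H_kernel s r = (if r \<in> {0..s} then (Phi0 s * (f r * \<gamma> r / \<sigma> r / Phi0 r), b r * (flow s / flow r - Phi0 s / Phi0 r)) else 0)"

definition error_kernel :: "real \<Rightarrow> real \<Rightarrow> real \<times> real" where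
  "error_kernel s r = (if r \<in> {0..s} then (- (Phi0 s * (f r * \<gamma> r / \<sigma> r / Phi0 r)), b r * Phi0 s / Phi0 r) else 0)"

definition est_kernel :: "real \<Rightarrow> real \<Rightarrow> real \<times> real" where
  "est_kernel t r = (if r \<in> {0..t} then
     (f r * Phi0 r / \<sigma> r - f r * \<gamma> r / \<sigma> r / Phi0 r * (info t - info r), b r / Phi0 r * (info t - info r)) else 0)"

lemma bounded_borel_zero_vec: "bounded_borel (\<lambda>_. 0 :: real \<times> real)" by simp

lemma bounded_borel_kernels:
  "bounded_borel (signal_kernel s)" "bounded_borel (obs_kernel s)" "bounded_borel g \<Longrightarrow> bounded_borel (int_kernel g t)"
  "bounded_borel (H_kernel s)" "bounded_borel (error_kernel s)" "bounded_borel (est_kernel t)"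
proof -
  have m: "bounded_borel (mean_int g)" if "bounded_borel g"
    unfolding mean_int_def using that by (intro bounded_borel_primitive_upto T_nonneg bbs)
  show "bounded_borel (signal_kernel s)" "bounded_borel (obs_kernel s)" "bounded_borel g \<Longrightarrow> bounded_borel (int_kernel g t)"
    "bounded_borel (H_kernel s)" "bounded_borel (error_kernel s)" "bounded_borel (est_kernel t)"
    unfolding signal_kernel_def[abs_def] obs_kernel_def[abs_def] int_kernel_def[abs_def] H_kernel_def[abs_def]
      error_kernel_def[abs_def] est_kernel_def[abs_def]
    by (intro bounded_borel_if bounded_borel_Pair bounded_borel_zero_vec bbs b_xbar b_info m; simp)+
qed

text \<open>The gain of \<open>H\<close> is \<open>Phi0 s\<close> times \<open>gain\<close>; \<open>est_weight t\<close> is the integrand of \<open>info t\<close> times the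
  estimator after exchanging the order of integration.\<close>

definition "gain r = f r * \<gamma> r / (\<sigma> r)\<^sup>2 / Phi0 r"
definition "score r = f r * Phi0 r / (\<sigma> r)\<^sup>2"
definition "est_weight t r = score r - gain r * (info t - info r)"

lemma b_gain: "bounded_borel gain" unfolding gain_def[abs_def] by (intro bbs)
lemma b_score: "bounded_borel score" unfolding score_def[abs_def] by (intro bbs)
lemma b_est_weight: "bounded_borel (est_weight t)"
  unfolding est_weight_def[abs_def] by (intro bbs b_gain b_score b_info)

lemma prim_mean_int:
  assumes "bounded_borel g" shows "has_primitive T (mean_int g) (\<lambda>s. g s * f s * flow s)"
  unfolding mean_int_def using assms by (intro has_primitive_upto T_nonneg bbs)

lemma mean_int_0: "mean_int g 0 = 0" using T_pos' by (simp add: mean_int_def primitive_upto_0)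

text \<open>The derivative of \<open>flow / Phi0\<close> is \<open>gain * f * flow\<close>, because
  \<open>a - A = f\<^sup>2 * \<gamma> / \<sigma>\<^sup>2\<close>. Hence \<open>H\<close> at time
  \<open>s\<close> has mean \<open>\<theta> * (flow s - Phi0 s)\<close>.\<close>

lemma mean_int_gain: "s \<in> {0..T} \<Longrightarrow> mean_int gain s = flow s / Phi0 s - 1"
  by (rule has_primitive_unique[OF prim_mean_int[OF b_gain] has_primitive_diff[OF prim_flow_over_Phi0 has_primitive_const[of T 1]]])
    (auto simp: mean_int_0 gain_def field_simps power2_eq_square)

text \<open>At \<open>s = t\<close> the value is \<open>info t\<close>, which expresses that the
  estimator of the initial value is unbiased.\<close>

lemma mean_int_est_weight:
  assumes "s \<in> {0..T}"
  shows "mean_int (est_weight t) s = info t - (info t - info s) * (flow s / Phi0 s)"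
  by (rule has_primitive_unique[OF prim_mean_int[OF b_est_weight] has_primitive_diff[OF has_primitive_const[of T "info t"]
        has_primitive_mult[OF has_primitive_diff[OF has_primitive_const[of T "info t"] prim_info] prim_flow_over_Phi0]] _ _ assms])
    (auto simp: mean_int_0 est_weight_def gain_def score_def s0 field_simps power2_eq_square)

lemma int_kernel_gain:
  assumes "s \<in> {0..T}" shows "Phi0 s *\<^sub>R int_kernel gain s r = H_kernel s r"
proof (cases "r \<in> {0..s}")
  case True
  then have "r \<in> {0..T}" using assms by simp
  then show ?thesis using True assms s0[of r]
    by (simp add: int_kernel_def H_kernel_def mean_int_gain gain_def field_simps power2_eq_square)
next
  case False
  then show ?thesis by (auto simp: int_kernel_def H_kernel_def)
qed

lemma int_kernel_est_weight:
  assumes "t \<in> {0..T}" shows "int_kernel (est_weight t) t r = est_kernel t r"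
proof (cases "r \<in> {0..t}")
  case True
  then have "r \<in> {0..T}" using assms by simp
  then show ?thesis using True assms s0[of r]
    by (simp add: int_kernel_def est_kernel_def mean_int_est_weight est_weight_def gain_def score_def field_simps power2_eq_square)
next
  case False
  then show ?thesis by (auto simp: int_kernel_def est_kernel_def)
qed

lemma signal_minus_H_kernel: "signal_kernel s r - H_kernel s r = error_kernel s r"
  by (simp add: signal_kernel_def H_kernel_def error_kernel_def algebra_simps)

lemma set_integral_upto:
  fixes g h :: "real \<Rightarrow> real"
  assumes "s \<in> {0..T}" "has_primitive T \<Psi> h" "\<And>r. r \<in> {0..s} \<Longrightarrow> g r = h r" "\<And>r. r \<in> {0..T} \<Longrightarrow> r \<notin> {0..s} \<Longrightarrow> g r = 0"
  shows "(LINT r:{0..T}|lborel. g r) = \<Psi> s - \<Psi> 0"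
proof -
  have "(LINT r:{0..T}|lborel. g r) = (LINT r:{0..s}|lborel. h r)"
    unfolding set_lebesgue_integral_def
    by (intro Bochner_Integration.integral_cong) (use assms in \<open>auto simp: indicator_def\<close>)
  then show ?thesis using has_primitive_increment[OF assms(2), of 0 s] assms(1) by simp
qed

text \<open>The integrand is the derivative of \<open>Phi0 t * (P r * (xbar s - xbar r))\<close>,
  which vanishes at 0 because of \<open>P 0 = 0\<close> and at \<open>s\<close> because of the other
  factor. This orthogonality identifies the conditional mean.\<close>

lemma error_kernel_orthogonal:
  assumes s: "0 \<le> s" "s \<le> t" "t \<le> T"
  shows "(LINT r:{0..T}|lborel. error_kernel t r \<bullet> obs_kernel s r) = 0"
proof -
  have "(LINT r:{0..T}|lborel. error_kernel t r \<bullet> obs_kernel s r) =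
    Phi0 t * (P s * (xbar s - xbar s)) - Phi0 t * (P 0 * (xbar s - xbar 0))"
    by (rule set_integral_upto[OF _ has_primitive_cmult[OF has_primitive_mult[OF prim_P
          has_primitive_diff[OF has_primitive_const[of T "xbar s"] prim_xbar]]]])
      (use s in \<open>auto simp: error_kernel_def obs_kernel_def P_def s0 field_simps power2_eq_square\<close>)
  then show ?thesis by simp
qed

text \<open>Again an exact derivative; only the term \<open>Phi0 / flow * (xbar s - xbar)\<close> at
  time 0 survives. The covariance of the scaled noise in \<open>X s\<close> with
  \<open>info t\<close> times the scaled estimation error is thus the mean of \<open>X s\<close> per
  unit of \<open>\<theta>\<close>. The regression of the noise on the error has the shape of the
  signal, and the decomposition of the path rests on this coincidence.\<close>

lemma est_kernel_obs_kernel: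
  assumes s: "0 \<le> s" "s \<le> t" "t \<le> T"
  shows "(LINT r:{0..T}|lborel. est_kernel t r \<bullet> obs_kernel s r) = xbar s"
proof -
  note X = has_primitive_diff[OF has_primitive_const[of T "xbar s"] prim_xbar]
  note I = has_primitive_diff[OF has_primitive_const[of T "info t"] prim_info]
  have "(LINT r:{0..T}|lborel. est_kernel t r \<bullet> obs_kernel s r) =
    ((info t - info s) * (P s * (xbar s - xbar s)) - Phi0 s / flow s * (xbar s - xbar s)) -
    ((info t - info 0) * (P 0 * (xbar s - xbar 0)) - Phi0 0 / flow 0 * (xbar s - xbar 0))"
    by (rule set_integral_upto[OF _ has_primitive_diff[OF has_primitive_mult[OF I has_primitive_mult[OF prim_P X]]
           has_primitive_mult[OF prim_Phi0_over_flow X]]])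
      (use s in \<open>auto simp: est_kernel_def obs_kernel_def P_def s0 field_simps power2_eq_square\<close>)
  then show ?thesis by simp
qed

lemma prim_gamma_over_Phi0_sq:
  "has_primitive T (\<lambda>s. \<gamma> s * (1 / Phi0 s * (1 / Phi0 s))) (\<lambda>s. ((b s)\<^sup>2 + (f s)\<^sup>2 * (\<gamma> s)\<^sup>2 / (\<sigma> s)\<^sup>2) / Phi0 s / Phi0 s)"
  by (rule has_primitive_cong[OF has_primitive_mult[OF ric has_primitive_mult[OF prim_inv_Phi0 prim_inv_Phi0]]])
    ((intro bbs), (simp add: KB_A_def s0 field_simps power2_eq_square))

text \<open>The integrand is the derivative of
  \<open>info + \<gamma> / Phi0\<^sup>2 * (info t - info)\<^sup>2\<close>, whose second term
  vanishes at both ends. Division of the kernel by \<open>info t\<close> gives the error variance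
  \<open>1 / info t\<close>.\<close>

lemma est_kernel_norm:
  assumes t: "t \<in> {0..T}"
  shows "(LINT r:{0..T}|lborel. est_kernel t r \<bullet> est_kernel t r) = info t"
proof -
  note I = has_primitive_diff[OF has_primitive_const[of T "info t"] prim_info]
  have "(LINT r:{0..T}|lborel. est_kernel t r \<bullet> est_kernel t r) =
    (info t + \<gamma> t * (1 / Phi0 t * (1 / Phi0 t)) * ((info t - info t) * (info t - info t))) -
    (info 0 + \<gamma> 0 * (1 / Phi0 0 * (1 / Phi0 0)) * ((info t - info 0) * (info t - info 0)))"
    by (rule set_integral_upto[OF _ has_primitive_add[OF prim_info has_primitive_mult[OF prim_gamma_over_Phi0_sq has_primitive_mult[OF I I]]]])
      (use t in \<open>auto simp: est_kernel_def s0 field_simps power2_eq_square\<close>)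
  then show ?thesis by (simp add: g0)
qed

end

section \<open>Time integrals along continuous paths\<close>

lemma bounded_borel_continuous_on:
  fixes g :: "real \<Rightarrow> real"
  assumes "continuous_on {0..T} g" shows "bounded_borel (\<lambda>r. if r \<in> {0..T} then g r else 0)"
proof -
  have "compact (g ` {0..T})" using assms by (intro compact_continuous_image) auto
  then obtain C where C: "\<And>x. x \<in> {0..T} \<Longrightarrow> norm (g x) \<le> C" using compact_imp_bounded bounded_iff by (metis imageI)
  have "(\<lambda>r. indicator {0..T} r *\<^sub>R g r) \<in> borel_measurable borel"
    using assms by (intro borel_measurable_continuous_on_indicator) auto
  moreover have "(\<lambda>r. indicator {0..T} r *\<^sub>R g r) = (\<lambda>r. if r \<in> {0..T} then g r else 0)" by (auto simp: indicator_def)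
  ultimately show ?thesis
  proof (intro bounded_borelI[where C="max C 0"])
    show "norm (if x \<in> {0..T} then g x else 0) \<le> max C 0" for x using C[of x] by auto
  qed simp
qed

text \<open>A path is controlled on [0,T] only; setting it to 0 outside admits it to the calculus of
  primitives.\<close>

lemma set_integral_continuous_path:
  fixes g \<kappa> :: "real \<Rightarrow> real"
  assumes c: "continuous_on {0..T} g" and k: "bounded_borel \<kappa>" and T: "0 \<le> T"
  shows "has_primitive T (primitive_upto T (\<lambda>r. \<kappa> r * (if r \<in> {0..T} then g r else 0))) (\<lambda>r. \<kappa> r * (if r \<in> {0..T} then g r else 0))"
    and "s \<in> {0..T} \<Longrightarrow> primitive_upto T (\<lambda>r. \<kappa> r * (if r \<in> {0..T} then g r else 0)) s = (LINT r:{0..s}|lborel. \<kappa> r * g r)"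
proof -
  show "has_primitive T (primitive_upto T (\<lambda>r. \<kappa> r * (if r \<in> {0..T} then g r else 0))) (\<lambda>r. \<kappa> r * (if r \<in> {0..T} then g r else 0))"
    by (intro has_primitive_upto bounded_borel_mult k bounded_borel_continuous_on c T)
  assume s: "s \<in> {0..T}"
  show "primitive_upto T (\<lambda>r. \<kappa> r * (if r \<in> {0..T} then g r else 0)) s = (LINT r:{0..s}|lborel. \<kappa> r * g r)"
    unfolding primitive_upto_eq[OF s] using s by (intro set_lebesgue_integral_cong) auto
qed

lemma set_integral_joint_measurable:
  fixes Z :: "real \<Rightarrow> 'w \<Rightarrow> real"
  assumes Z: "(\<lambda>(s, \<omega>). Z s \<omega>) \<in> borel_measurable (time_measure t \<Otimes>\<^sub>M M)" and k: "bounded_borel \<kappa>"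
  shows "(\<lambda>\<omega>. LINT s:{0..t}|lborel. \<kappa> s * Z s \<omega>) \<in> borel_measurable M"
proof -
  interpret N: finite_measure "time_measure t" by (rule finite_time_measure)
  have 1: "(\<lambda>x. \<kappa> (fst x)) \<in> borel_measurable (time_measure t \<Otimes>\<^sub>M M)"
    by (rule measurable_compose[OF fst_time_measurable bounded_borel_measurable[OF k]])
  have "(\<lambda>(s, \<omega>). \<kappa> s * Z s \<omega>) \<in> borel_measurable (time_measure t \<Otimes>\<^sub>M M)"
    using borel_measurable_times[OF 1 Z] by (simp add: case_prod_beta')
  from measurable_compose[OF measurable_pair_swap' this]
  have "(\<lambda>(\<omega>, s). \<kappa> s * Z s \<omega>) \<in> borel_measurable (M \<Otimes>\<^sub>M time_measure t)"
    by (simp add: case_prod_beta')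
  then have "(\<lambda>\<omega>. \<integral>s. \<kappa> s * Z s \<omega> \<partial>time_measure t) \<in> borel_measurable M" by (rule N.borel_measurable_lebesgue_integral)
  then show ?thesis by (simp add: integral_time_measure)
qed

lemma set_integral_continuous_measurable:
  fixes Z :: "real \<Rightarrow> 'w \<Rightarrow> real"
  assumes Z: "\<And>s. s \<in> {0..T} \<Longrightarrow> Z s \<in> borel_measurable M"
    and c: "\<And>\<omega>. \<omega> \<in> space M \<Longrightarrow> continuous_on {0..T} (\<lambda>s. Z s \<omega>)" and k: "bounded_borel \<kappa>" and s: "s \<in> {0..T}"
  shows "(\<lambda>\<omega>. LINT r:{0..s}|lborel. \<kappa> r * Z r \<omega>) \<in> borel_measurable M"
proof (cases "s = 0")
  case False
  then have "0 < s" using s by simp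
  then show ?thesis
    using s by (intro set_integral_joint_measurable joint_measurable_if_continuous Z continuous_on_subset[OF c] k) auto
qed simp

lemma set_integral_scaleR_const:
  fixes g :: "real \<Rightarrow> real" and c :: "'b::euclidean_space"
  assumes "bounded_borel g"
  shows "(LINT u:{r..t}|lborel. g u *\<^sub>R c) = (LINT u:{r..t}|lborel. g u) *\<^sub>R c"
proof -
  have "integrable lborel (\<lambda>u. indicator {r..t} u *\<^sub>R g u)"
    using bounded_borel_set_integrable[OF assms, of r t] by (simp add: set_integrable_def)
  then have "(\<integral>u. (indicator {r..t} u *\<^sub>R g u) *\<^sub>R c \<partial>lborel) = (\<integral>u. indicator {r..t} u *\<^sub>R g u \<partial>lborel) *\<^sub>R c"
    by (intro integral_scaleR_left) simp
  then show ?thesis unfolding set_lebesgue_integral_def by simp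
qed

context wiener_pair
begin

text \<open>The kernels to be averaged over time have this separated form on a triangle. Two terms
  occur because the kernel of \<open>H\<close> combines \<open>Phi0\<close> and
  \<open>flow\<close>.\<close>

lemma stochastic_fubini_separable:
  fixes Z :: "real \<Rightarrow> 'w \<Rightarrow> real"
  assumes t: "t \<in> {0..T}"
    and Zm: "(\<lambda>(s, \<omega>). Z s \<omega>) \<in> borel_measurable (time_measure t \<Otimes>\<^sub>M M)"
    and ZK: "\<And>s. s \<in> {0..t} \<Longrightarrow> wiener_rep (Z s) (\<lambda>r. if r \<in> {0..s} then \<alpha> s *\<^sub>R k r + \<beta> s *\<^sub>R l r else 0)"
    and bd: "bounded_borel \<kappa>" "bounded_borel \<alpha>" "bounded_borel \<beta>" "bounded_borel k" "bounded_borel l"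
  shows "wiener_rep (\<lambda>\<omega>. LINT s:{0..t}|lborel. \<kappa> s * Z s \<omega>)
    (\<lambda>r. if r \<in> {0..t} then (LINT u:{r..t}|lborel. \<kappa> u * \<alpha> u) *\<^sub>R k r + (LINT u:{r..t}|lborel. \<kappa> u * \<beta> u) *\<^sub>R l r else 0)"
    and "AE \<omega> in M. integrable (time_measure t) (\<lambda>s. \<kappa> s * Z s \<omega>)"
proof -
  let ?K = "\<lambda>s r. if r \<in> {0..s} then \<alpha> s *\<^sub>R k r + \<beta> s *\<^sub>R l r else 0"
  obtain Ca where Ca: "Ca \<ge> 0" "\<And>x. norm (\<alpha> x) \<le> Ca" using bd(2) bounded_borel_bound by blast
  obtain Cb where Cb: "Cb \<ge> 0" "\<And>x. norm (\<beta> x) \<le> Cb" using bd(3) bounded_borel_bound by blast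
  obtain Ck where Ck: "Ck \<ge> 0" "\<And>x. norm (k x) \<le> Ck" using bd(4) bounded_borel_bound by blast
  obtain Cl where Cl: "Cl \<ge> 0" "\<And>x. norm (l x) \<le> Cl" using bd(5) bounded_borel_bound by blast
  have [measurable]: "\<alpha> \<in> borel_measurable borel" "\<beta> \<in> borel_measurable borel" "k \<in> borel_measurable borel" "l \<in> borel_measurable borel"
    using bd by (auto simp: bounded_borel_def)
  have Km: "(\<lambda>(s, r). ?K s r) \<in> borel_measurable (borel \<Otimes>\<^sub>M borel)" unfolding atLeastAtMost_iff by measurable
  have KC: "norm (?K s r) \<le> Ca * Ck + Cb * Cl" for s r
  proof -
    have "norm (\<alpha> s *\<^sub>R k r + \<beta> s *\<^sub>R l r) \<le> norm (\<alpha> s *\<^sub>R k r) + norm (\<beta> s *\<^sub>R l r)" by (rule norm_triangle_ineq)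
    also have "\<dots> \<le> Ca * Ck + Cb * Cl"
      using mult_mono[OF Ca(2)[of s] Ck(2)[of r] Ca(1)] mult_mono[OF Cb(2)[of s] Cl(2)[of r] Cb(1)] by simp
    finally show ?thesis using Ca(1) Cb(1) Ck(1) Cl(1) by auto
  qed
  have "(LINT s:{0..t}|lborel. \<kappa> s *\<^sub>R ?K s r) =
    (if r \<in> {0..t} then (LINT u:{r..t}|lborel. \<kappa> u * \<alpha> u) *\<^sub>R k r + (LINT u:{r..t}|lborel. \<kappa> u * \<beta> u) *\<^sub>R l r else 0)" for r
  proof -
    have "(LINT u:{r..t}|lborel. \<kappa> u *\<^sub>R (\<alpha> u *\<^sub>R k r + \<beta> u *\<^sub>R l r)) =
      (LINT u:{r..t}|lborel. (\<kappa> u * \<alpha> u) *\<^sub>R k r + (\<kappa> u * \<beta> u) *\<^sub>R l r)"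
      by (simp add: scaleR_add_right)
    also have "\<dots> = (LINT u:{r..t}|lborel. (\<kappa> u * \<alpha> u) *\<^sub>R k r) + (LINT u:{r..t}|lborel. (\<kappa> u * \<beta> u) *\<^sub>R l r)"
      using bd by (intro set_integral_add(2) bounded_borel_set_integrable bounded_borel_scaleR bounded_borel_mult bounded_borel_const)
    also have "\<dots> = (LINT u:{r..t}|lborel. \<kappa> u * \<alpha> u) *\<^sub>R k r + (LINT u:{r..t}|lborel. \<kappa> u * \<beta> u) *\<^sub>R l r"
      using bd by (simp add: set_integral_scaleR_const bounded_borel_mult)
    finally show ?thesis
      using set_integral_triangle[where \<kappa>=\<kappa> and L="\<lambda>u r. \<alpha> u *\<^sub>R k r + \<beta> u *\<^sub>R l r" and r=r and s=t] by (simp cong: if_cong)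
  qed
  with stochastic_fubini(1)[OF t Zm ZK Km KC bd(1)]
  show "wiener_rep (\<lambda>\<omega>. LINT s:{0..t}|lborel. \<kappa> s * Z s \<omega>)
    (\<lambda>r. if r \<in> {0..t} then (LINT u:{r..t}|lborel. \<kappa> u * \<alpha> u) *\<^sub>R k r + (LINT u:{r..t}|lborel. \<kappa> u * \<beta> u) *\<^sub>R l r else 0)"
    by simp
  show "AE \<omega> in M. integrable (time_measure t) (\<lambda>s. \<kappa> s * Z s \<omega>)"
    by (rule stochastic_fubini(2)[OF t Zm ZK Km KC bd(1)])
qed

end

section \<open>The observed system in terms of the Wiener processes\<close>

locale kb_system = kb_coefficients T f \<sigma> a b \<gamma> + wiener_pair M T W V
  for T f \<sigma> a b \<gamma> and M :: "'w measure" and W V +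
  fixes X Y :: "real \<Rightarrow> 'w \<Rightarrow> real" and \<epsilon> \<theta> :: real
  assumes eps: "0 < \<epsilon>"
    and X: "solves_sde M T 0 (\<lambda>s \<omega>. f s * Y s \<omega>) \<epsilon> \<sigma> W X"
    and Y: "solves_sde M T \<theta> (\<lambda>s \<omega>. a s * Y s \<omega>) \<epsilon> b V Y"
begin

lemma XY_measurable: "s \<in> {0..T} \<Longrightarrow> X s \<in> borel_measurable M" "s \<in> {0..T} \<Longrightarrow> Y s \<in> borel_measurable M"
  using X Y by (auto simp: solves_sde_def)

lemma XY_continuous: "\<omega> \<in> space M \<Longrightarrow> continuous_on {0..T} (\<lambda>s. X s \<omega>)" "\<omega> \<in> space M \<Longrightarrow> continuous_on {0..T} (\<lambda>s. Y s \<omega>)"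
  using X Y by (auto simp: solves_sde_def)

text \<open>Variation of constants, path by path: the noise term \<open>N\<close> is a Wiener
  integral of \<open>b\<close>, the linear equation expresses \<open>Y\<close> through
  \<open>N\<close>, and the stochastic Fubini theorem turns the time integral of \<open>N\<close>
  into a kernel.\<close>

lemma signal_rep:
  assumes s: "s \<in> {0..T}"
  shows "wiener_rep (\<lambda>\<omega>. (Y s \<omega> - \<theta> * flow s) / \<epsilon>) (signal_kernel s)"
proof -
  define U where "U \<omega> = primitive_upto T (\<lambda>r. a r * (if r \<in> {0..T} then Y r \<omega> else 0))" for \<omega>
  \<comment> \<open>Defined through the equation and not as the integral \<open>J\<close>, so that
    \<open>N\<close> is continuous in time for every \<open>\<omega>\<close>; the versions
    \<open>J\<close> at different times are chosen separately.\<close>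
  define N where "N s \<omega> = (Y s \<omega> - \<theta> - (LINT r:{0..s}|lborel. a r * Y r \<omega>)) / \<epsilon>" for s \<omega>
  note U = set_integral_continuous_path[OF XY_continuous(2) ba T_nonneg, folded U_def]
  have NU: "N s \<omega> = (Y s \<omega> - \<theta> - U \<omega> s) / \<epsilon>" if "s \<in> {0..T}" "\<omega> \<in> space M" for s \<omega>
    using U(2)[OF that(2,1)] by (simp add: N_def)
  have Nm: "N s \<in> borel_measurable M" if s: "s \<in> {0..T}" for s
    unfolding N_def[abs_def]
    using XY_measurable(2)[OF s] set_integral_continuous_measurable[OF XY_measurable(2) XY_continuous(2) ba s] by simp
  have Nc: "continuous_on {0..T} (\<lambda>s. N s \<omega>)" if \<omega>: "\<omega> \<in> space M" for \<omega>
  proof -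
    have "continuous_on {0..T} (\<lambda>s. (Y s \<omega> - \<theta> - U \<omega> s) / \<epsilon>)"
      using eps by (intro continuous_intros XY_continuous(2)[OF \<omega>] has_primitive_continuous[OF U(1)[OF \<omega>]]) auto
    then show ?thesis by (rule continuous_on_eq) (simp add: NU[OF _ \<omega>])
  qed
  have Nrep: "wiener_rep (N s) (\<lambda>r. if r \<in> {0..s} then 1 *\<^sub>R (0, b r) + 0 *\<^sub>R (0, 0) else 0)" if s: "s \<in> {0..T}" for s
  proof -
    obtain J where J: "is_stoch_integral M V b s J" and e: "AE \<omega> in M. Y s \<omega> = \<theta> + (LINT r:{0..s}|lborel. a r * Y r \<omega>) + \<epsilon> * J \<omega>"
      using Y s unfolding solves_sde_def by blast
    have "AE \<omega> in M. N s \<omega> = J \<omega>" using e by eventually_elim (use eps in \<open>simp add: N_def\<close>)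
    from wiener_rep_AE_cong[OF is_stoch_integral_wiener_rep(2)[OF s bb J] Nm[OF s] this] show ?thesis by (simp cong: if_cong)
  qed
  define \<kappa> where "\<kappa> r = a r / flow r" for r
  have \<kappa>: "bounded_borel \<kappa>" unfolding \<kappa>_def[abs_def] by (intro bbs)
  have path: "(Y s \<omega> - \<theta> * flow s) / \<epsilon> = N s \<omega> + flow s * (LINT r:{0..s}|lborel. \<kappa> r * N r \<omega>)" if \<omega>: "\<omega> \<in> space M" for \<omega>
  proof -
    \<comment> \<open>This is \<open>(U + \<theta>) / (\<epsilon> * flow)\<close>; its derivative
      reduces to \<open>\<kappa> * N\<close> because
      \<open>Y = \<theta> + U + \<epsilon> * N\<close>.\<close>
    let ?F = "\<lambda>s. 1 / \<epsilon> * (U \<omega> s * (1 / flow s) + \<theta> * (1 / flow s))"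
    let ?\<phi> = "\<lambda>r. 1 / \<epsilon> * (a r * (if r \<in> {0..T} then Y r \<omega> else 0) * (1 / flow r) + U \<omega> r * (- a r / flow r) + \<theta> * (- a r / flow r))"
    have F: "has_primitive T ?F ?\<phi>"
      by (intro has_primitive_cmult has_primitive_add has_primitive_mult U(1)[OF \<omega>] prim_inv_flow)
    have "(LINT r:{0..s}|lborel. \<kappa> r * N r \<omega>) = (LINT r:{0..s}|lborel. ?\<phi> r)"
    proof (rule set_lebesgue_integral_cong)
      show "\<forall>r. r \<in> {0..s} \<longrightarrow> \<kappa> r * N r \<omega> = ?\<phi> r"
      proof (intro allI impI)
        fix r assume r: "r \<in> {0..s}"
        then have "Y r \<omega> = \<theta> + U \<omega> r + \<epsilon> * N r \<omega>" using NU[OF _ \<omega>, of r] s eps by (simp add: field_simps)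
        then show "\<kappa> r * N r \<omega> = ?\<phi> r" using r s eps by (simp add: \<kappa>_def field_simps)
      qed
    qed simp
    also have "\<dots> = ?F s - ?F 0" using has_primitive_increment[OF F, of 0 s] s by simp
    also have "U \<omega> 0 = 0" using T_nonneg by (simp add: U_def primitive_upto_0)
    finally have L: "(LINT r:{0..s}|lborel. \<kappa> r * N r \<omega>) = (U \<omega> s + \<theta>) / (\<epsilon> * flow s) - \<theta> / \<epsilon>"
      by (simp add: add_divide_distrib mult.commute)
    show ?thesis unfolding L NU[OF s \<omega>] using eps by (simp add: field_simps)
  qed
  have "wiener_rep (\<lambda>\<omega>. LINT r:{0..s}|lborel. \<kappa> r * N r \<omega>)
     (\<lambda>r. if r \<in> {0..s} then (LINT u:{r..s}|lborel. \<kappa> u * 1) *\<^sub>R (0, b r) + (LINT u:{r..s}|lborel. \<kappa> u * 0) *\<^sub>R (0, 0) else 0)"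
  proof (cases "s = 0")
    \<comment> \<open>Joint measurability is established for intervals of positive length; at
      \<open>s = 0\<close> both the integral and the kernel vanish.\<close>
    case True
    have "(\<lambda>\<omega>. LINT r:{0..s}|lborel. \<kappa> r * N r \<omega>) = (\<lambda>_. 0)" using True by simp
    moreover have "wiener_rep (\<lambda>_. 0) (\<lambda>r. if r \<in> {0..s} then (LINT u:{r..s}|lborel. \<kappa> u * 1) *\<^sub>R (0, b r) + (LINT u:{r..s}|lborel. \<kappa> u * 0) *\<^sub>R (0, 0) else 0)"
      using True by (subst if_cong[OF refl _ refl, of _ _ 0]) (auto simp: wiener_rep_0 zero_prod_def[symmetric])
    ultimately show ?thesis by simp
  next
    case False
    have "continuous_on {0..s} (\<lambda>s. N s \<omega>)" if "\<omega> \<in> space M" for \<omega>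
      by (rule continuous_on_subset[OF Nc[OF that]]) (use s in auto)
    with False have "(\<lambda>(s, \<omega>). N s \<omega>) \<in> borel_measurable (time_measure s \<Otimes>\<^sub>M M)"
      using s Nm by (intro joint_measurable_if_continuous) auto
    then show ?thesis
      using s Nrep bb by (intro stochastic_fubini_separable(1) \<kappa>) auto
  qed
  from wiener_rep_lin[OF Nrep[OF s] this, of 1 "flow s"]
  have R: "wiener_rep (\<lambda>\<omega>. N s \<omega> + flow s * (LINT r:{0..s}|lborel. \<kappa> r * N r \<omega>))
    (\<lambda>r. 1 *\<^sub>R (if r \<in> {0..s} then 1 *\<^sub>R (0, b r) + 0 *\<^sub>R (0, 0) else 0) + flow s *\<^sub>R
     (if r \<in> {0..s} then (LINT u:{r..s}|lborel. \<kappa> u * 1) *\<^sub>R (0, b r) + (LINT u:{r..s}|lborel. \<kappa> u * 0) *\<^sub>R (0, 0) else 0))" by simp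
  have k: "(LINT u:{r..s}|lborel. \<kappa> u) = 1 / flow r - 1 / flow s" if r: "r \<in> {0..s}" for r
  proof -
    have "1 / flow s - 1 / flow r = (LINT u:{r..s}|lborel. - a u / flow u)"
      using has_primitive_increment[OF prim_inv_flow, of r s] r s by simp
    also have "\<dots> = - (LINT u:{r..s}|lborel. \<kappa> u)"
      using set_integral_uminus[OF bounded_borel_set_integrable[OF \<kappa>], of r s] by (simp add: \<kappa>_def)
    finally show ?thesis by simp
  qed
  have "wiener_rep (\<lambda>\<omega>. N s \<omega> + flow s * (LINT r:{0..s}|lborel. \<kappa> r * N r \<omega>)) (signal_kernel s)"
    by (rule wiener_rep_kernel_cong[OF R bounded_borel_kernels(1)])
      (auto simp: signal_kernel_def k field_simps zero_prod_def)
  moreover have "(\<lambda>\<omega>. (Y s \<omega> - \<theta> * flow s) / \<epsilon>) \<in> borel_measurable M" using XY_measurable(2)[OF s] by simp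
  ultimately show ?thesis by (rule wiener_rep_AE_cong) (use path in auto)
qed

text \<open>Inserting the decomposition of \<open>Y\<close> into the drift of \<open>X\<close>
  leaves a Wiener integral of \<open>\<sigma>\<close> and a time integral of the scaled noise of
  \<open>Y\<close>, which the stochastic Fubini theorem converts.\<close>

lemma obs_rep:
  assumes s: "s \<in> {0..T}"
  shows "wiener_rep (\<lambda>\<omega>. (X s \<omega> - \<theta> * xbar s) / \<epsilon>) (obs_kernel s)"
proof -
  define Z where "Z s \<omega> = (Y s \<omega> - \<theta> * flow s) / \<epsilon>" for s \<omega>
  have Zm: "Z s \<in> borel_measurable M" if "s \<in> {0..T}" for s using XY_measurable(2)[OF that] by (simp add: Z_def[abs_def])
  have Zc: "continuous_on {0..T} (\<lambda>s. Z s \<omega>)" if "\<omega> \<in> space M" for \<omega>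
    unfolding Z_def using eps by (intro continuous_intros XY_continuous(2)[OF that] has_primitive_continuous[OF prim_flow]) auto
  have Zrep: "wiener_rep (Z s) (\<lambda>r. if r \<in> {0..s} then flow s *\<^sub>R (0, b r / flow r) + 0 *\<^sub>R (0, 0) else 0)" if "s \<in> {0..T}" for s
    using signal_rep[OF that] unfolding Z_def[abs_def] signal_kernel_def[abs_def] by (simp add: mult.commute cong: if_cong)
  have F: "wiener_rep (\<lambda>\<omega>. LINT r:{0..s}|lborel. f r * Z r \<omega>)
     (\<lambda>r. if r \<in> {0..s} then (LINT u:{r..s}|lborel. f u * flow u) *\<^sub>R (0, b r / flow r) + (LINT u:{r..s}|lborel. f u * 0) *\<^sub>R (0, 0) else 0)"
  proof (cases "s = 0")
    case True
    have "(\<lambda>\<omega>. LINT r:{0..s}|lborel. f r * Z r \<omega>) = (\<lambda>_. 0)" using True by simp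
    moreover have "wiener_rep (\<lambda>_. 0) (\<lambda>r. if r \<in> {0..s} then (LINT u:{r..s}|lborel. f u * flow u) *\<^sub>R (0, b r / flow r) + (LINT u:{r..s}|lborel. f u * 0) *\<^sub>R (0, 0) else 0)"
      using True by (subst if_cong[OF refl _ refl, of _ _ 0]) (auto simp: wiener_rep_0 zero_prod_def[symmetric])
    ultimately show ?thesis by simp
  next
    case False
    have "continuous_on {0..s} (\<lambda>s. Z s \<omega>)" if "\<omega> \<in> space M" for \<omega>
      by (rule continuous_on_subset[OF Zc[OF that]]) (use s in auto)
    with False have "(\<lambda>(s, \<omega>). Z s \<omega>) \<in> borel_measurable (time_measure s \<Otimes>\<^sub>M M)"
      using s Zm by (intro joint_measurable_if_continuous) auto
    then show ?thesis
      using s Zrep by (intro stochastic_fubini_separable(1) bounded_borel_Pair bbs) auto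
  qed
  obtain J where J: "is_stoch_integral M W \<sigma> s J" and e: "AE \<omega> in M. X s \<omega> = 0 + (LINT r:{0..s}|lborel. f r * Y r \<omega>) + \<epsilon> * J \<omega>"
    using X s unfolding solves_sde_def by blast
  note R = wiener_rep_lin[OF is_stoch_integral_wiener_rep(1)[OF s bs J] F, of 1 1]
  have k: "(LINT u:{r..s}|lborel. f u * flow u) = xbar s - xbar r" if "r \<in> {0..s}" for r
    using has_primitive_increment[OF prim_xbar, of r s] that s by simp
  have R': "wiener_rep (\<lambda>\<omega>. 1 * J \<omega> + 1 * (LINT r:{0..s}|lborel. f r * Z r \<omega>)) (obs_kernel s)"
    by (rule wiener_rep_kernel_cong[OF R bounded_borel_kernels(2)])
      (auto simp: obs_kernel_def k field_simps zero_prod_def)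
  show ?thesis
  proof (rule wiener_rep_AE_cong[OF R'])
    show "(\<lambda>\<omega>. (X s \<omega> - \<theta> * xbar s) / \<epsilon>) \<in> borel_measurable M" using XY_measurable(1)[OF s] by simp
    show "AE \<omega> in M. (X s \<omega> - \<theta> * xbar s) / \<epsilon> = 1 * J \<omega> + 1 * (LINT r:{0..s}|lborel. f r * Z r \<omega>)"
      using e AE_space
    proof eventually_elim
      fix \<omega> assume x: "X s \<omega> = 0 + (LINT r:{0..s}|lborel. f r * Y r \<omega>) + \<epsilon> * J \<omega>" and \<omega>: "\<omega> \<in> space M"
      have "(LINT r:{0..s}|lborel. f r * Y r \<omega>) =
        (LINT r:{0..s}|lborel. \<theta> * (f r * flow r) + \<epsilon> * (f r * (if r \<in> {0..T} then Z r \<omega> else 0)))"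
        using s eps by (intro set_lebesgue_integral_cong) (auto simp: Z_def field_simps)
      also have "\<dots> = (LINT r:{0..s}|lborel. \<theta> * (f r * flow r)) + (LINT r:{0..s}|lborel. \<epsilon> * (f r * (if r \<in> {0..T} then Z r \<omega> else 0)))"
        by (intro set_integral_add(2) bounded_borel_set_integrable bbs bounded_borel_continuous_on Zc[OF \<omega>])
      also have "(LINT r:{0..s}|lborel. \<epsilon> * (f r * (if r \<in> {0..T} then Z r \<omega> else 0))) = \<epsilon> * (LINT r:{0..s}|lborel. f r * Z r \<omega>)"
        unfolding set_integral_mult_right using s by (intro arg_cong2[where f="(*)"] set_lebesgue_integral_cong) auto
      also have "(LINT r:{0..s}|lborel. \<theta> * (f r * flow r)) = \<theta> * xbar s"
        using primitive_upto_eq[OF s] by (simp add: xbar_def)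
      finally show "(X s \<omega> - \<theta> * xbar s) / \<epsilon> = 1 * J \<omega> + 1 * (LINT r:{0..s}|lborel. f r * Z r \<omega>)"
        using x eps by (simp add: field_simps)
    qed
  qed
qed

end

section \<open>Mean and kernel of integrals against the observation\<close>

context kb_coefficients
begin

lemma mean_int_lin:
  assumes "bounded_borel g" "bounded_borel h" "s \<in> {0..T}"
  shows "mean_int (\<lambda>r. c * g r + d * h r) s = c * mean_int g s + d * mean_int h s"
proof -
  have "(\<lambda>r. (c * g r + d * h r) * f r * flow r) = (\<lambda>r. c * (g r * f r * flow r) + d * (h r * f r * flow r))"
    by (auto simp: algebra_simps)
  then show ?thesis
    unfolding mean_int_def using assms by (simp only:) (intro primitive_upto_lin bbs T_nonneg)
qed

lemma int_kernel_lin: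
  assumes "bounded_borel g" "bounded_borel h" "t \<in> {0..T}"
  shows "int_kernel (\<lambda>r. c * g r + d * h r) t r = c *\<^sub>R int_kernel g t r + d *\<^sub>R int_kernel h t r"
proof (cases "r \<in> {0..t}")
  case True
  then have "r \<in> {0..T}" using assms(3) by simp
  then show ?thesis
    using True mean_int_lin[OF assms(1,2), of r c d] mean_int_lin[OF assms, of c d]
    by (simp add: int_kernel_def algebra_simps)
next
  case False
  then show ?thesis by (auto simp: int_kernel_def)
qed

lemma mean_int_indicator:
  assumes s: "s \<in> {0..T}" and uv: "0 \<le> u" "u \<le> v"
  shows "mean_int (indicat_real {u<..v}) s = xbar (min s v) - xbar (min s u)"
proof -
  have b: "bounded_borel (\<lambda>r. if r \<in> {..w} then f r * flow r else 0)" for w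
    by (intro bounded_borel_if bbs) auto
  have le: "(LINT r:{0..s}|lborel. (if r \<in> {..w} then f r * flow r else 0)) = xbar (min s w)" if "0 \<le> w" for w
  proof -
    have "(LINT r:{0..s}|lborel. (if r \<in> {..w} then f r * flow r else 0)) = (LINT r:{0..min s w}|lborel. f r * flow r)"
      unfolding set_lebesgue_integral_def by (intro Bochner_Integration.integral_cong) (auto simp: indicator_def)
    moreover have "min s w \<in> {0..T}" using s that by auto
    ultimately show ?thesis using primitive_upto_eq[of "min s w" T] by (simp add: xbar_def)
  qed
  have "mean_int (indicat_real {u<..v}) s =
    (LINT r:{0..s}|lborel. (if r \<in> {..v} then f r * flow r else 0) - (if r \<in> {..u} then f r * flow r else 0))"
    unfolding mean_int_def primitive_upto_eq[OF s] using uv by (intro set_lebesgue_integral_cong) (auto simp: indicator_def)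
  also have "\<dots> = xbar (min s v) - xbar (min s u)"
    unfolding set_integral_diff(2)[OF bounded_borel_set_integrable[OF b] bounded_borel_set_integrable[OF b]] using le uv by simp
  finally show ?thesis .
qed

lemma bounded_borel_indicator_Ioc: "bounded_borel (indicat_real {u<..v})"
proof -
  have "bounded_borel (\<lambda>r. if r \<in> {u<..v} then 1 else 0 :: real)" by (intro bounded_borel_if) auto
  moreover have "(\<lambda>r. if r \<in> {u<..v} then 1 else 0 :: real) = indicat_real {u<..v}" by (auto simp: indicator_def)
  ultimately show ?thesis by simp
qed

text \<open>The integral of this indicator against \<open>X\<close> is the increment
  \<open>X v - X u\<close>.\<close>

lemma int_kernel_indicator:
  assumes uv: "0 \<le> u" "u \<le> v" "v \<le> T" and r: "r \<in> {0..T}"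
  shows "int_kernel (indicat_real {u<..v}) T r = obs_kernel v r - obs_kernel u r"
proof -
  have m: "mean_int (indicat_real {u<..v}) T = xbar v - xbar u"
    "mean_int (indicat_real {u<..v}) r = xbar (min r v) - xbar (min r u)"
    using mean_int_indicator[of T u v] mean_int_indicator[OF r uv(1,2)] uv T_nonneg by (auto simp: min_def)
  show ?thesis unfolding int_kernel_def obs_kernel_def m using uv r
    by (auto simp: indicator_def min_def algebra_simps zero_prod_def)
qed

text \<open>Mean and variance of an integral against \<open>X\<close> are controlled by the squared
  norm of the integrand; Cauchy-Schwarz in time takes care of the drift.\<close>

lemma int_kernel_bound:
  obtains C where "C \<ge> 0" "\<And>g. bounded_borel g \<Longrightarrow> (mean_int g T)\<^sup>2 \<le> C * (LINT r:{0..T}|lborel. (g r)\<^sup>2)"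
    "\<And>g. bounded_borel g \<Longrightarrow> (LINT r:{0..T}|lborel. int_kernel g T r \<bullet> int_kernel g T r) \<le> C * (LINT r:{0..T}|lborel. (g r)\<^sup>2)"
proof -
  obtain D where D: "D \<ge> 0" "\<And>x. norm (f x * flow x) \<le> D"
    using bounded_borel_bound[OF bounded_borel_mult[OF bf b_flow]] by blast
  obtain S where S: "S \<ge> 0" "\<And>x. norm (\<sigma> x) \<le> S" using bounded_borel_bound[OF bs] by blast
  obtain B where B: "B \<ge> 0" "\<And>x. norm (b x / flow x) \<le> B"
    using bounded_borel_bound[OF bounded_borel_over_flow[OF bb]] by blast
  let ?n = "\<lambda>g. (LINT r:{0..T}|lborel. (g r :: real)\<^sup>2)"
  have nn: "0 \<le> ?n g" for g by (rule set_integral_square_nonneg)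
  have inc: "(mean_int g T - mean_int g r)\<^sup>2 \<le> D\<^sup>2 * T * ?n g" if g: "bounded_borel g" and r: "r \<in> {0..T}"
    for g :: "real \<Rightarrow> real" and r
  proof -
    define h where "h u = (if u \<in> {r..T} then f u * flow u else 0)" for u
    have h: "bounded_borel h" unfolding h_def[abs_def] by (intro bounded_borel_if bbs) auto
    have "mean_int g T - mean_int g r = (LINT u:{r..T}|lborel. g u * f u * flow u)"
      using has_primitive_increment[OF prim_mean_int[OF g], of r T] r by simp
    also have "\<dots> = (LINT u:{0..T}|lborel. g u * h u)"
      unfolding set_lebesgue_integral_def using r by (intro Bochner_Integration.integral_cong) (auto simp: h_def indicator_def)
    finally have e: "mean_int g T - mean_int g r = (LINT u:{0..T}|lborel. g u * h u)" .
    have "\<bar>LINT u:{0..T}|lborel. g u * h u\<bar> \<le> sqrt (?n g) * sqrt (?n h)"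
      using l2_Cauchy_Schwarz[OF sq_integrable_time_measure[OF g, of T] sq_integrable_time_measure[OF h, of T]]
      by (simp add: integral_time_measure)
    then have "\<bar>LINT u:{0..T}|lborel. g u * h u\<bar>\<^sup>2 \<le> (sqrt (?n g) * sqrt (?n h))\<^sup>2" by (intro power_mono) auto
    also have "\<dots> = ?n g * ?n h" using nn by (simp add: power_mult_distrib)
    also have "\<dots> \<le> ?n g * (D\<^sup>2 * T)"
    proof (intro mult_left_mono nn)
      have "norm (?n h) \<le> D\<^sup>2 * (T - 0)"
      proof (rule norm_set_integral_Icc_le[OF bounded_borel_power2[OF h]])
        show "norm ((h x)\<^sup>2) \<le> D\<^sup>2" for x
          using D power_mono[OF D(2)[of x] norm_ge_zero, of 2] by (auto simp: h_def)
      qed (rule T_nonneg)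
      then show "?n h \<le> D\<^sup>2 * T" by simp
    qed
    finally show ?thesis unfolding e by (simp add: mult_ac)
  qed
  \<comment> \<open>The first summand serves the mean, the second the \<open>W\<close> component of
    the kernel and the third its \<open>V\<close> component.\<close>
  define C where "C = D\<^sup>2 * T + S\<^sup>2 + B\<^sup>2 * (D\<^sup>2 * T) * T"
  have C: "C \<ge> 0" using T_nonneg by (simp add: C_def)
  have C1: "D\<^sup>2 * T \<le> C" "S\<^sup>2 + B\<^sup>2 * (D\<^sup>2 * T) * T \<le> C" using T_nonneg by (simp_all add: C_def)
  show ?thesis
  proof (rule that[OF C])
    fix g :: "real \<Rightarrow> real" assume g: "bounded_borel g"
    have "(mean_int g T)\<^sup>2 \<le> D\<^sup>2 * T * ?n g" using inc[OF g, of 0] T_nonneg by (simp add: mean_int_0)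
    also have "\<dots> \<le> C * ?n g" by (intro mult_right_mono C1 nn)
    finally show "(mean_int g T)\<^sup>2 \<le> C * ?n g" .
    have "(LINT r:{0..T}|lborel. int_kernel g T r \<bullet> int_kernel g T r) \<le> (LINT r:{0..T}|lborel. S\<^sup>2 * (g r)\<^sup>2 + B\<^sup>2 * (D\<^sup>2 * T * ?n g))"
    proof (rule set_integral_mono)
      show "set_integrable lborel {0..T} (\<lambda>r. int_kernel g T r \<bullet> int_kernel g T r)"
        by (intro bounded_borel_set_integrable bounded_borel_inner bounded_borel_kernels(3) g)
      show "set_integrable lborel {0..T} (\<lambda>r. S\<^sup>2 * (g r)\<^sup>2 + B\<^sup>2 * (D\<^sup>2 * T * ?n g))"
        by (intro bounded_borel_set_integrable bbs g)
      fix r assume r: "r \<in> {0..T}"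
      have "int_kernel g T r \<bullet> int_kernel g T r = (\<sigma> r)\<^sup>2 * (g r)\<^sup>2 + (b r / flow r)\<^sup>2 * (mean_int g T - mean_int g r)\<^sup>2"
        using r by (simp add: int_kernel_def power2_eq_square mult_ac)
      also have "\<dots> \<le> S\<^sup>2 * (g r)\<^sup>2 + B\<^sup>2 * (D\<^sup>2 * T * ?n g)"
        using power_mono[OF S(2)[of r] norm_ge_zero, of 2] power_mono[OF B(2)[of r] norm_ge_zero, of 2] inc[OF g r]
        unfolding real_norm_def power2_abs by (intro add_mono mult_mono) auto
      finally show "int_kernel g T r \<bullet> int_kernel g T r \<le> S\<^sup>2 * (g r)\<^sup>2 + B\<^sup>2 * (D\<^sup>2 * T * ?n g)" .
    qed
    also have "\<dots> = (LINT r:{0..T}|lborel. S\<^sup>2 * (g r)\<^sup>2) + (LINT r:{0..T}|lborel. B\<^sup>2 * (D\<^sup>2 * T * ?n g))"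
      by (intro set_integral_add(2) bounded_borel_set_integrable bbs g)
    also have "\<dots> = (S\<^sup>2 + B\<^sup>2 * (D\<^sup>2 * T) * T) * ?n g"
      using T_nonneg by (simp add: set_lebesgue_integral_def algebra_simps)
    also have "\<dots> \<le> C * ?n g" by (intro mult_right_mono C1 nn)
    finally show "(LINT r:{0..T}|lborel. int_kernel g T r \<bullet> int_kernel g T r) \<le> C * ?n g" .
  qed
qed

lemma mean_int_trunc:
  assumes g: "bounded_borel g" and t: "t \<in> {0..T}" and s: "s \<in> {0..T}"
  shows "mean_int (\<lambda>r. if r \<in> {0..t} then g r else 0) s = mean_int g (min s t)"
proof -
  have "(LINT r:{0..s}|lborel. (if r \<in> {0..t} then g r else 0) * f r * flow r) = (LINT r:{0..min s t}|lborel. g r * f r * flow r)"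
    unfolding set_lebesgue_integral_def by (intro Bochner_Integration.integral_cong) (auto simp: indicator_def)
  moreover have "min s t \<in> {0..T}" using s t by auto
  ultimately show ?thesis
    using primitive_upto_eq[OF s] primitive_upto_eq[of "min s t" T] by (simp add: mean_int_def)
qed

text \<open>An integral up to \<open>t\<close> is an integral up to \<open>T\<close> of the
  truncated integrand, so L^2 estimates are needed at \<open>T\<close> only.\<close>

lemma int_kernel_trunc:
  assumes g: "bounded_borel g" and t: "t \<in> {0..T}" and r: "r \<in> {0..T}"
  shows "int_kernel (\<lambda>r. if r \<in> {0..t} then g r else 0) T r = int_kernel g t r"
proof -
  have m: "mean_int (\<lambda>r. if r \<in> {0..t} then g r else 0) T = mean_int g t"
    "mean_int (\<lambda>r. if r \<in> {0..t} then g r else 0) r = mean_int g (min r t)"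
    using mean_int_trunc[OF g t, of T] mean_int_trunc[OF g t r] t by (auto simp: min_def)
  show ?thesis unfolding int_kernel_def m using r t by (auto simp: min_def zero_prod_def)
qed

end

context kb_system
begin

lemma obs_step_rep:
  assumes "valid_steps T p"
  shows "wiener_rep (\<lambda>\<omega>. (step_integral p X \<omega> - \<theta> * mean_int (step_fun p) T) / \<epsilon>) (int_kernel (step_fun p) T)"
  using assms
proof (induction p)
  case Nil
  have z: "step_fun [] = (\<lambda>_. 0)" by auto
  have m: "mean_int (\<lambda>_. 0) s = 0" for s by (simp add: mean_int_def primitive_upto_def)
  have k: "int_kernel (\<lambda>_. 0) T = (\<lambda>_. 0)" by (auto simp: int_kernel_def m zero_prod_def)
  show ?case unfolding z m k by (simp add: wiener_rep_0)
next
  case (Cons x p)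
  obtain c u v where x: "x = (c, u, v)" by (cases x)
  have uv: "0 \<le> u" "u \<le> v" "v \<le> T" and p: "valid_steps T p" using Cons.prems x by auto
  let ?i = "indicat_real {u<..v}"
  have sf: "step_fun (x # p) = (\<lambda>r. c * ?i r + 1 * step_fun p r)" by (auto simp: x)
  have mm: "mean_int (step_fun (x # p)) T = c * (xbar v - xbar u) + mean_int (step_fun p) T"
    unfolding sf using mean_int_lin[OF bounded_borel_indicator_Ioc bounded_borel_step_fun, of T c u v 1 p] mean_int_indicator[of T u v] uv T_nonneg
    by (simp add: min_def)
  have "wiener_rep (\<lambda>\<omega>. (X v \<omega> - \<theta> * xbar v) / \<epsilon>) (obs_kernel v)" "wiener_rep (\<lambda>\<omega>. (X u \<omega> - \<theta> * xbar u) / \<epsilon>) (obs_kernel u)"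
    using obs_rep uv by auto
  note lin = wiener_rep_lin[OF wiener_rep_lin[OF this, of 1 "-1"] Cons.IH[OF p], of c 1]
  have "(\<lambda>\<omega>. (step_integral (x # p) X \<omega> - \<theta> * mean_int (step_fun (x # p)) T) / \<epsilon>) =
    (\<lambda>\<omega>. c * (1 * ((X v \<omega> - \<theta> * xbar v) / \<epsilon>) + - 1 * ((X u \<omega> - \<theta> * xbar u) / \<epsilon>)) +
       1 * ((step_integral p X \<omega> - \<theta> * mean_int (step_fun p) T) / \<epsilon>))"
    unfolding mm using eps by (intro ext) (simp add: x field_simps)
  with lin
  have R: "wiener_rep (\<lambda>\<omega>. (step_integral (x # p) X \<omega> - \<theta> * mean_int (step_fun (x # p)) T) / \<epsilon>)
     (\<lambda>r. c *\<^sub>R (1 *\<^sub>R obs_kernel v r + (- 1) *\<^sub>R obs_kernel u r) + 1 *\<^sub>R int_kernel (step_fun p) T r)"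
    by (simp only:)
  show ?case
  proof (rule wiener_rep_kernel_cong[OF R bounded_borel_kernels(3)[OF bounded_borel_step_fun]])
    fix r assume r: "r \<in> {0..T}"
    show "c *\<^sub>R (1 *\<^sub>R obs_kernel v r + (- 1) *\<^sub>R obs_kernel u r) + 1 *\<^sub>R int_kernel (step_fun p) T r = int_kernel (step_fun (x # p)) T r"
      unfolding sf int_kernel_lin[OF bounded_borel_indicator_Ioc bounded_borel_step_fun, of T c u v 1 p r, simplified T_nonneg, simplified]
      using int_kernel_lin[OF bounded_borel_indicator_Ioc bounded_borel_step_fun, of T c u v 1 p r] int_kernel_indicator[OF uv r] T_nonneg by simp
  qed
qed

text \<open>\<open>\<theta> * mean_int g T + \<epsilon> * Z\<close> is the candidate for the
  integral of \<open>g\<close> against \<open>X\<close>. With \<open>g = 0\<close> the estimate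
  shows that \<open>X\<close> is an integrator; with \<open>g\<close> the limit of step functions it
  identifies the integral.\<close>

lemma step_integral_X_bound:
  obtains C where "C \<ge> 0"
    "\<And>p g Z. valid_steps T p \<Longrightarrow> bounded_borel g \<Longrightarrow> wiener_rep Z (int_kernel g T) \<Longrightarrow>
      sq_integrable M (\<lambda>\<omega>. step_integral p X \<omega> - (\<theta> * mean_int g T + \<epsilon> * Z \<omega>)) \<and>
      (\<integral>\<omega>. (step_integral p X \<omega> - (\<theta> * mean_int g T + \<epsilon> * Z \<omega>))\<^sup>2 \<partial>M) \<le> C * (LINT r:{0..T}|lborel. (step_fun p r - g r)\<^sup>2)"
proof -
  obtain C where C: "C \<ge> 0" "\<And>g. bounded_borel g \<Longrightarrow> (mean_int g T)\<^sup>2 \<le> C * (LINT r:{0..T}|lborel. (g r)\<^sup>2)"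
    "\<And>g. bounded_borel g \<Longrightarrow> (LINT r:{0..T}|lborel. int_kernel g T r \<bullet> int_kernel g T r) \<le> C * (LINT r:{0..T}|lborel. (g r)\<^sup>2)"
    using int_kernel_bound by blast
  have TT: "T \<in> {0..T}" using T_nonneg by simp
  have "sq_integrable M (\<lambda>\<omega>. step_integral p X \<omega> - (\<theta> * mean_int g T + \<epsilon> * Z \<omega>)) \<and>
      (\<integral>\<omega>. (step_integral p X \<omega> - (\<theta> * mean_int g T + \<epsilon> * Z \<omega>))\<^sup>2 \<partial>M) \<le> (2 * \<theta>\<^sup>2 * C + 2 * \<epsilon>\<^sup>2 * C) * (LINT r:{0..T}|lborel. (step_fun p r - g r)\<^sup>2)"
    if p: "valid_steps T p" and g: "bounded_borel g" and Z: "wiener_rep Z (int_kernel g T)" for p g Z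
  proof -
    let ?h = "\<lambda>r. 1 * step_fun p r + (-1) * g r"
    define D where "D \<omega> = 1 * ((step_integral p X \<omega> - \<theta> * mean_int (step_fun p) T) / \<epsilon>) + (-1) * Z \<omega>" for \<omega>
    have h: "bounded_borel ?h" by (intro bbs bounded_borel_step_fun g)
    have D: "wiener_rep D (int_kernel ?h T)"
      unfolding D_def[abs_def]
      by (rule wiener_rep_kernel_cong[OF wiener_rep_lin[OF obs_step_rep[OF p] Z] bounded_borel_kernels(3)[OF h]])
        (rule int_kernel_lin[OF bounded_borel_step_fun g TT, symmetric])
    have m: "mean_int ?h T = mean_int (step_fun p) T - mean_int g T"
      using mean_int_lin[OF bounded_borel_step_fun[of p] g TT, of 1 "-1"] by simp
    have eq: "step_integral p X \<omega> - (\<theta> * mean_int g T + \<epsilon> * Z \<omega>) = \<theta> * mean_int ?h T + \<epsilon> * D \<omega>" for \<omega>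
      unfolding m D_def using eps by (simp add: field_simps)
    have sq: "sq_integrable M (\<lambda>\<omega>. \<epsilon> * D \<omega>)" "sq_integrable M (\<lambda>\<omega>. \<theta> * mean_int ?h T)"
      using wiener_rep_sq[OF D] by (auto intro: sq_integrable_cmult)
    have "(\<integral>\<omega>. (\<theta> * mean_int ?h T + \<epsilon> * D \<omega>)\<^sup>2 \<partial>M) \<le> 2 * (\<integral>\<omega>. (\<theta> * mean_int ?h T)\<^sup>2 \<partial>M) + 2 * (\<integral>\<omega>. (\<epsilon> * D \<omega>)\<^sup>2 \<partial>M)"
      by (rule integral_square_add_le[OF sq(2,1)])
    also have "\<dots> = 2 * \<theta>\<^sup>2 * (mean_int ?h T)\<^sup>2 + 2 * \<epsilon>\<^sup>2 * (LINT r:{0..T}|lborel. int_kernel ?h T r \<bullet> int_kernel ?h T r)"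
      using wiener_rep_inner[OF D D] by (simp add: power_mult_distrib prob_space power2_eq_square[of "D _"])
    also have "\<dots> \<le> 2 * \<theta>\<^sup>2 * (C * (LINT r:{0..T}|lborel. (?h r)\<^sup>2)) + 2 * \<epsilon>\<^sup>2 * (C * (LINT r:{0..T}|lborel. (?h r)\<^sup>2))"
      by (intro add_mono mult_left_mono C(2)[OF h] C(3)[OF h]) auto
    also have "\<dots> = (2 * \<theta>\<^sup>2 * C + 2 * \<epsilon>\<^sup>2 * C) * (LINT r:{0..T}|lborel. (step_fun p r - g r)\<^sup>2)"
      by (simp add: algebra_simps)
    finally show ?thesis unfolding eq using sq_integrable_add[OF sq(2,1)] by simp
  qed
  moreover have "2 * \<theta>\<^sup>2 * C + 2 * \<epsilon>\<^sup>2 * C \<ge> 0" using C(1) by simp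
  ultimately show ?thesis using that by blast
qed

lemma X_l2_integrator: "l2_integrator M X T"
proof -
  obtain C where C: "C \<ge> 0"
    "\<And>p g Z. valid_steps T p \<Longrightarrow> bounded_borel g \<Longrightarrow> wiener_rep Z (int_kernel g T) \<Longrightarrow>
      sq_integrable M (\<lambda>\<omega>. step_integral p X \<omega> - (\<theta> * mean_int g T + \<epsilon> * Z \<omega>)) \<and>
      (\<integral>\<omega>. (step_integral p X \<omega> - (\<theta> * mean_int g T + \<epsilon> * Z \<omega>))\<^sup>2 \<partial>M) \<le> C * (LINT r:{0..T}|lborel. (step_fun p r - g r)\<^sup>2)"
    using step_integral_X_bound by blast
  have m: "mean_int (\<lambda>_. 0) s = 0" for s by (simp add: mean_int_def primitive_upto_def)
  have k: "int_kernel (\<lambda>_. 0) T = (\<lambda>_. 0)" by (auto simp: int_kernel_def m zero_prod_def)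
  have "sq_integrable M (step_integral p X) \<and> (\<integral>\<omega>. (step_integral p X \<omega>)\<^sup>2 \<partial>M) \<le> C * (LINT r:{0..T}|lborel. (step_fun p r)\<^sup>2)"
    if p: "valid_steps T p" for p
    using C(2)[OF p bounded_borel_const, of "\<lambda>_. 0" 0] wiener_rep_0 by (simp add: m k)
  then show ?thesis using C(1) XY_measurable(1) unfolding l2_integrator_def by blast
qed

text \<open>\<open>J\<close> and the candidate of \<open>step_integral_X_bound\<close> are L^2
  limits of the same step integrals.\<close>

lemma stoch_integral_X_rep:
  assumes t: "t \<in> {0..T}" and g: "bounded_borel g" and J: "is_stoch_integral M X g t J"
  shows "wiener_rep (\<lambda>\<omega>. (J \<omega> - \<theta> * mean_int g t) / \<epsilon>) (int_kernel g t)"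
proof -
  define h where "h r = (if r \<in> {0..t} then g r else 0)" for r
  have h: "bounded_borel h" unfolding h_def[abs_def] using g by (intro bounded_borel_if) auto
  obtain C where C: "C \<ge> 0"
    "\<And>p g Z. valid_steps T p \<Longrightarrow> bounded_borel g \<Longrightarrow> wiener_rep Z (int_kernel g T) \<Longrightarrow>
      sq_integrable M (\<lambda>\<omega>. step_integral p X \<omega> - (\<theta> * mean_int g T + \<epsilon> * Z \<omega>)) \<and>
      (\<integral>\<omega>. (step_integral p X \<omega> - (\<theta> * mean_int g T + \<epsilon> * Z \<omega>))\<^sup>2 \<partial>M) \<le> C * (LINT r:{0..T}|lborel. (step_fun p r - g r)\<^sup>2)"
    using step_integral_X_bound by blast
  obtain p where p: "\<And>n. valid_steps t (p n)" "(\<lambda>n. LINT r:{0..t}|lborel. (step_fun (p n) r - g r)\<^sup>2) \<longlonglongrightarrow> 0"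
    "l2_lim M (\<lambda>n. step_integral (p n) X) J" "J \<in> borel_measurable M"
    using J unfolding is_stoch_integral_iff[OF g] by blast
  have pT: "valid_steps T (p n)" for n using valid_steps_mono[OF p(1)] t by simp
  obtain Z where Z: "wiener_rep Z (int_kernel h T)" using wiener_rep_exists[OF bounded_borel_kernels(3)[OF h]] by blast
  have sq: "sq_integrable M (step_integral (p n) X)" for n
    using X_l2_integrator pT unfolding l2_integrator_def by blast
  have Jq: "sq_integrable M J" using sq_integrable_lim[OF sq p(4,3)] .
  have L: "sq_integrable M (\<lambda>\<omega>. \<theta> * mean_int h T + \<epsilon> * Z \<omega>)"
    by (intro sq_integrable_add sq_integrable_const sq_integrable_cmult wiener_rep_sq[OF Z])
  have "l2_lim M (\<lambda>n. step_integral (p n) X) (\<lambda>\<omega>. \<theta> * mean_int h T + \<epsilon> * Z \<omega>)"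
    unfolding l2_lim_iff[OF sq L]
  proof (rule tendsto_sandwich[OF always_eventually always_eventually tendsto_const])
    have "(\<lambda>n. C * (LINT r:{0..t}|lborel. (step_fun (p n) r - g r)\<^sup>2)) \<longlonglongrightarrow> C * 0" by (intro tendsto_intros p)
    then show "(\<lambda>n. C * (LINT r:{0..t}|lborel. (step_fun (p n) r - g r)\<^sup>2)) \<longlonglongrightarrow> 0" by simp
    show "\<forall>n. (\<integral>\<omega>. (step_integral (p n) X \<omega> - (\<theta> * mean_int h T + \<epsilon> * Z \<omega>))\<^sup>2 \<partial>M) \<le> C * (LINT r:{0..t}|lborel. (step_fun (p n) r - g r)\<^sup>2)"
    proof
      fix n
      have "(LINT r:{0..T}|lborel. (step_fun (p n) r - h r)\<^sup>2) = (LINT r:{0..t}|lborel. (step_fun (p n) r - g r)\<^sup>2)"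
        using t step_fun_outside[OF p(1)] by (intro set_integral_extend_zero) (auto simp: h_def)
      then show "(\<integral>\<omega>. (step_integral (p n) X \<omega> - (\<theta> * mean_int h T + \<epsilon> * Z \<omega>))\<^sup>2 \<partial>M) \<le> C * (LINT r:{0..t}|lborel. (step_fun (p n) r - g r)\<^sup>2)"
        using C(2)[OF pT h Z, of n] by simp
    qed
  qed auto
  from l2_lim_unique[OF sq Jq p(3) L this] have "AE \<omega> in M. J \<omega> = \<theta> * mean_int h T + \<epsilon> * Z \<omega>" .
  moreover have "mean_int h T = mean_int g t"
    using mean_int_trunc[OF g t, of T] t by (simp add: h_def[abs_def] min_absorb2)
  ultimately have ae: "AE \<omega> in M. (J \<omega> - \<theta> * mean_int g t) / \<epsilon> = Z \<omega>"
    by (elim AE_mp[rotated] AE_mp) (use eps in auto)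
  have Z': "wiener_rep Z (int_kernel g t)"
    by (rule wiener_rep_kernel_cong[OF Z bounded_borel_kernels(3)[OF g]])
      (use int_kernel_trunc[OF g t] in \<open>simp add: h_def[abs_def]\<close>)
  show ?thesis by (rule wiener_rep_AE_cong[OF Z' _ ae]) (use p(4) in simp)
qed

text \<open>Since \<open>KB_Phi\<close> from \<open>r\<close> to \<open>s\<close> is
  \<open>Phi0 s / Phi0 r\<close>, the factor \<open>Phi0 s\<close> leaves the integral, and the
  single integrand \<open>gain\<close> serves all times.\<close>

lemma H_rep:
  assumes s: "s \<in> {0..T}" and H: "is_stoch_integral M X (\<lambda>r. KB_Phi f \<sigma> a \<gamma> r s * (f r * \<gamma> r / (\<sigma> r)\<^sup>2)) s H"
  shows "wiener_rep (\<lambda>\<omega>. (H \<omega> - \<theta> * (flow s - Phi0 s)) / \<epsilon>) (H_kernel s)"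
proof -
  have "is_stoch_integral M X (\<lambda>r. Phi0 s * gain r) s H"
    using H s by (subst is_stoch_integral_cong[of s _ "\<lambda>r. KB_Phi f \<sigma> a \<gamma> r s * (f r * \<gamma> r / (\<sigma> r)\<^sup>2)"])
      (auto simp: KB_Phi_eq gain_def)
  then have "wiener_rep (\<lambda>\<omega>. (H \<omega> - \<theta> * mean_int (\<lambda>r. Phi0 s * gain r) s) / \<epsilon>) (int_kernel (\<lambda>r. Phi0 s * gain r) s)"
    by (rule stoch_integral_X_rep[OF s bounded_borel_mult[OF bounded_borel_const b_gain]])
  moreover have "mean_int (\<lambda>r. Phi0 s * gain r) s = flow s - Phi0 s"
  proof -
    have "mean_int (\<lambda>r. Phi0 s * gain r) s = Phi0 s * mean_int gain s"
      using mean_int_lin[OF b_gain b_gain s, of "Phi0 s" 0] by simp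
    also have "\<dots> = flow s - Phi0 s" by (simp add: mean_int_gain[OF s] right_diff_distrib)
    finally show ?thesis .
  qed
  moreover have "int_kernel (\<lambda>r. Phi0 s * gain r) s = H_kernel s"
    using int_kernel_lin[OF b_gain b_gain s, of "Phi0 s" 0] int_kernel_gain[OF s] by auto
  ultimately show ?thesis by simp
qed

end

section \<open>The filter as a functional of the observed path\<close>

text \<open>The sequences \<open>pg\<close> and \<open>pe\<close> are chosen from the coefficients
  alone, so the functionals built from them are the same for all \<open>\<epsilon>\<close> and
  \<open>\<theta>\<close>, as an estimator has to be.\<close>

locale kb_functionals = kb_coefficients +
  fixes t :: real and pg pe :: "nat \<Rightarrow> (real \<times> real \<times> real) list"
  assumes t: "t \<in> {0<..T}" and pg: "fast_steps t gain pg" and pe: "fast_steps t (est_weight t) pe"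
begin

definition "H_path s z = Phi0 s * path_integral pg s z"
definition "theta_path z = path_integral pe t z / info t"
definition "filter_path z = theta_path z * Phi0 t + H_path t z"

lemma tT: "t \<in> {0..T}" "0 < t" "t \<le> T" using t by auto

lemma filter_path_measurable:
  "H_path t \<in> borel_measurable (path_space t)" "filter_path \<in> borel_measurable (path_space t)"
proof -
  have "path_integral pg t \<in> borel_measurable (path_space t)" "path_integral pe t \<in> borel_measurable (path_space t)"
    using path_integral_measurable[OF pg] path_integral_measurable[OF pe] tT by auto
  then show "H_path t \<in> borel_measurable (path_space t)" "filter_path \<in> borel_measurable (path_space t)"
    unfolding H_path_def[abs_def] filter_path_def[abs_def] theta_path_def[abs_def] by measurable
qed

text \<open>The index \<open>-1\<close> carries the scaled error of the estimator of the initial value, an index \<open>s \<in> [0,t]\<close> the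
  part of the noise in \<open>X\<^sub>s\<close> that is independent of that error; \<open>obs_path\<close> puts the path together again.\<close>

definition dec_index :: "real set" where "dec_index = insert (-1) {0..t}"

definition dec_kernel :: "real \<Rightarrow> real \<Rightarrow> real \<times> real" where
  "dec_kernel i r = (if i = -1 then (1 / info t) *\<^sub>R est_kernel t r
     else obs_kernel i r - (xbar i / info t) *\<^sub>R est_kernel t r)"

definition obs_path :: "real \<Rightarrow> real \<Rightarrow> (real \<Rightarrow> real) \<Rightarrow> real \<Rightarrow> real" where
  "obs_path e w x = (\<lambda>s\<in>{0..t}. w * xbar s + e * x s)"

lemma b_dec_kernel: "bounded_borel (dec_kernel i)"
proof (cases "i = -1")
  case True
  then have "dec_kernel i = (\<lambda>r. (1 / info t) *\<^sub>R est_kernel t r)" by (auto simp: dec_kernel_def)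
  then show ?thesis using bounded_borel_kernels(6) by (simp only:) (intro bounded_borel_scaleR bounded_borel_const)
next
  case False
  then have "dec_kernel i = (\<lambda>r. obs_kernel i r - (xbar i / info t) *\<^sub>R est_kernel t r)" by (auto simp: dec_kernel_def)
  then show ?thesis
    using bounded_borel_kernels(2,6) by (simp only:) (intro bounded_borel_diff bounded_borel_scaleR bounded_borel_const)
qed

lemma info_t: "info t > 0" using info_pos[OF t] .

text \<open>\<open>dec_kernel s\<close> is \<open>obs_kernel s\<close> minus its orthogonal
  projection on \<open>est_kernel t\<close>, the inner product being \<open>xbar s\<close> and the
  squared norm \<open>info t\<close>.\<close>

lemma dec_kernel_orthogonal:
  assumes s: "s \<in> {0..t}"
  shows "(LINT r:{0..T}|lborel. dec_kernel (-1) r \<bullet> dec_kernel s r) = 0"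
proof -
  have "(LINT r:{0..T}|lborel. dec_kernel (-1) r \<bullet> dec_kernel s r) =
    (LINT r:{0..T}|lborel. (1 / info t) * (est_kernel t r \<bullet> obs_kernel s r) + - (xbar s / (info t)\<^sup>2) * (est_kernel t r \<bullet> est_kernel t r))"
    using s by (intro set_lebesgue_integral_cong) (auto simp: dec_kernel_def inner_diff_right power2_eq_square)
  also have "\<dots> = (LINT r:{0..T}|lborel. (1 / info t) * (est_kernel t r \<bullet> obs_kernel s r)) +
     (LINT r:{0..T}|lborel. - (xbar s / (info t)\<^sup>2) * (est_kernel t r \<bullet> est_kernel t r))"
    by (intro set_integral_add(2) bounded_borel_set_integrable bounded_borel_mult bounded_borel_const bounded_borel_inner bounded_borel_kernels)
  also have "\<dots> = (1 / info t) * xbar s + - (xbar s / (info t)\<^sup>2) * info t"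
    unfolding set_integral_mult_right est_kernel_norm[OF tT(1)]
    using est_kernel_obs_kernel[of s t] s tT by simp
  also have "\<dots> = 0" using info_t by (simp add: power2_eq_square)
  finally show ?thesis .
qed

end

locale kb_filter = kb_functionals T f \<sigma> a b \<gamma> t pg pe + kb_system T f \<sigma> a b \<gamma> M W V X Y \<epsilon> \<theta>
  for T f \<sigma> a b \<gamma> t pg pe and M :: "'w measure" and W V X Y \<epsilon> \<theta>
begin

lemma X_l2_integrator_t: "l2_integrator M X t"
  by (rule l2_integrator_mono[OF X_l2_integrator tT(1)])

lemma path_upto_measurable: "path_upto t X \<in> measurable M (path_space t)"
  unfolding path_upto_def[abs_def] using XY_measurable(1) tT by (intro measurable_restrict) auto

lemma H_path_version:
  assumes s: "s \<in> {0..t}"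
  shows "is_stoch_integral M X (\<lambda>r. KB_Phi f \<sigma> a \<gamma> r s * (f r * \<gamma> r / (\<sigma> r)\<^sup>2)) s (\<lambda>\<omega>. H_path s (path_upto t X \<omega>))"
proof -
  have "is_stoch_integral M X (\<lambda>r. Phi0 s * gain r) s (\<lambda>\<omega>. H_path s (path_upto t X \<omega>))"
    unfolding H_path_def
    by (rule is_stoch_integral_cmult[OF l2_integrator_mono[OF X_l2_integrator_t s] b_gain
        path_integral_is_stoch_integral[OF X_l2_integrator_t pg b_gain s]])
  then show ?thesis
    using s tT by (subst is_stoch_integral_cong[of s _ "\<lambda>r. Phi0 s * gain r"]) (auto simp: KB_Phi_eq gain_def)
qed

lemma H_path_unique:
  assumes s: "s \<in> {0..t}" and H: "is_stoch_integral M X (\<lambda>r. KB_Phi f \<sigma> a \<gamma> r s * (f r * \<gamma> r / (\<sigma> r)\<^sup>2)) s H"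
  shows "AE \<omega> in M. H \<omega> = H_path s (path_upto t X \<omega>)"
proof -
  have sT: "s \<in> {0..T}" using s tT by auto
  have "AE \<omega> in M. (H \<omega> - \<theta> * (flow s - Phi0 s)) / \<epsilon> = (H_path s (path_upto t X \<omega>) - \<theta> * (flow s - Phi0 s)) / \<epsilon>"
    by (rule wiener_rep_unique[OF H_rep[OF sT H] H_rep[OF sT H_path_version[OF s]] refl])
  then show ?thesis by eventually_elim (use eps in simp)
qed

subsection \<open>The conditional mean\<close>

lemma error_rep:
  "wiener_rep (\<lambda>\<omega>. (Y t \<omega> - (\<theta> * Phi0 t + H_path t (path_upto t X \<omega>))) / \<epsilon>) (error_kernel t)"
proof -
  have "wiener_rep (\<lambda>\<omega>. 1 * ((Y t \<omega> - \<theta> * flow t) / \<epsilon>) + (-1) * ((H_path t (path_upto t X \<omega>) - \<theta> * (flow t - Phi0 t)) / \<epsilon>))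
    (\<lambda>r. 1 *\<^sub>R signal_kernel t r + (-1) *\<^sub>R H_kernel t r)"
    using tT by (intro wiener_rep_lin signal_rep H_rep H_path_version) auto
  moreover have "(\<lambda>r. 1 *\<^sub>R signal_kernel t r + (-1) *\<^sub>R H_kernel t r) = error_kernel t"
    using signal_minus_H_kernel by auto
  moreover have "(\<lambda>\<omega>. 1 * ((Y t \<omega> - \<theta> * flow t) / \<epsilon>) + (-1) * ((H_path t (path_upto t X \<omega>) - \<theta> * (flow t - Phi0 t)) / \<epsilon>)) =
    (\<lambda>\<omega>. (Y t \<omega> - (\<theta> * Phi0 t + H_path t (path_upto t X \<omega>))) / \<epsilon>)"
    using eps by (intro ext) (simp add: field_simps)
  ultimately show ?thesis by simp
qed

text \<open>The scaled error \<open>D\<close> is uncorrelated with all observations up to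
  \<open>t\<close>, so changing its sign preserves the joint law with the path; the expectation
  equals its own negative.\<close>

lemma error_mean_zero:
  assumes B: "B \<in> sets (path_space t)"
  shows "(\<integral>\<omega>. (Y t \<omega> - (\<theta> * Phi0 t + H_path t (path_upto t X \<omega>))) / \<epsilon> * indicator B (path_upto t X \<omega>) \<partial>M) = 0"
proof -
  define D where "D \<omega> = (Y t \<omega> - (\<theta> * Phi0 t + H_path t (path_upto t X \<omega>))) / \<epsilon>" for \<omega>
  let ?S = "\<Pi>\<^sub>M i\<in>dec_index. (borel :: real measure)"
  \<comment> \<open>The index -1 carries \<open>D\<close> with the factor \<open>c\<close>, used for
    \<open>c = 1\<close> and \<open>c = -1\<close>; the other indices carry the centred
    observations.\<close>
  define A where "A c i \<omega> = (if i = -1 then c * D \<omega> else (X i \<omega> - \<theta> * xbar i) / \<epsilon>)" for c i \<omega>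
  define k where "k c i r = (if i = -1 then c *\<^sub>R error_kernel t r else obs_kernel i r)" for c :: real and i r
  have D: "wiener_rep D (error_kernel t)" using error_rep by (simp add: D_def[abs_def])
  have A: "wiener_rep (A c i) (k c i)" if "i \<in> dec_index" for c i
    using that wiener_rep_cmult[OF D, of c] obs_rep[of i] tT
    by (cases "i = -1") (auto simp: A_def[abs_def] k_def[abs_def] dec_index_def)
  have orth: "(LINT r:{0..T}|lborel. error_kernel t r \<bullet> obs_kernel i r) = 0"
    "(LINT r:{0..T}|lborel. obs_kernel i r \<bullet> error_kernel t r) = 0" if "i \<in> {0..t}" for i
    using error_kernel_orthogonal[of i t] that tT by (auto simp: inner_commute)
  have orth': "(LINT r:{0..T}|lborel. - (error_kernel t r \<bullet> obs_kernel i r)) = 0"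
    "(LINT r:{0..T}|lborel. - (obs_kernel i r \<bullet> error_kernel t r)) = 0" if "i \<in> {0..t}" for i
    using orth[OF that] set_integral_mult_right[of lborel "{0..T}" "-1" "\<lambda>r. error_kernel t r \<bullet> obs_kernel i r"]
      set_integral_mult_right[of lborel "{0..T}" "-1" "\<lambda>r. obs_kernel i r \<bullet> error_kernel t r"] by simp_all
  have WP: "wiener_pair M T W V" by unfold_locales
  have "distr M ?S (\<lambda>\<omega>. \<lambda>i\<in>dec_index. A 1 i \<omega>) = distr M ?S (\<lambda>\<omega>. \<lambda>i\<in>dec_index. A (-1) i \<omega>)"
  proof (rule wiener_rep_law_eq[OF WP WP A A])
    fix i j assume "i \<in> dec_index" "j \<in> dec_index"
    then show "(LINT r:{0..T}|lborel. k 1 i r \<bullet> k 1 j r) = (LINT r:{0..T}|lborel. k (-1) i r \<bullet> k (-1) j r)"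
      using orth orth' by (auto simp: k_def dec_index_def)
  qed
  then have E1: "(\<integral>x. x (-1) * indicator B (\<lambda>s\<in>{0..t}. \<theta> * xbar s + \<epsilon> * x s) \<partial>distr M ?S (\<lambda>\<omega>. \<lambda>i\<in>dec_index. A 1 i \<omega>)) =
    (\<integral>x. x (-1) * indicator B (\<lambda>s\<in>{0..t}. \<theta> * xbar s + \<epsilon> * x s) \<partial>distr M ?S (\<lambda>\<omega>. \<lambda>i\<in>dec_index. A (-1) i \<omega>))" by simp
  have E2: "(\<integral>x. x (-1) * indicator B (\<lambda>s\<in>{0..t}. \<theta> * xbar s + \<epsilon> * x s) \<partial>distr M ?S (\<lambda>\<omega>. \<lambda>i\<in>dec_index. A c i \<omega>)) =
    (\<integral>\<omega>. c * D \<omega> * indicator B (path_upto t X \<omega>) \<partial>M)" for c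
  proof -
    have m: "(\<lambda>\<omega>. \<lambda>i\<in>dec_index. A c i \<omega>) \<in> measurable M ?S"
      using wiener_rep_sq[OF A] by (intro measurable_restrict) (auto simp: sq_integrable_def)
    have g: "(\<lambda>x. \<lambda>s\<in>{0..t}. \<theta> * xbar s + \<epsilon> * x s) \<in> measurable ?S (path_space t)"
      by (intro measurable_restrict borel_measurable_add borel_measurable_times borel_measurable_const measurable_component_singleton)
        (auto simp: dec_index_def)
    have F: "(\<lambda>x. x (-1) * indicator B (\<lambda>s\<in>{0..t}. \<theta> * xbar s + \<epsilon> * x s)) \<in> borel_measurable ?S"
      by (intro borel_measurable_times measurable_component_singleton measurable_compose[OF g borel_measurable_indicator[OF B]])
        (auto simp: dec_index_def)
    have "(\<lambda>s\<in>{0..t}. \<theta> * xbar s + \<epsilon> * (\<lambda>i\<in>dec_index. A c i \<omega>) s) = path_upto t X \<omega>" for \<omega>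
      using eps by (auto simp: path_upto_def A_def dec_index_def fun_eq_iff)
    then show ?thesis
      by (subst integral_distr[OF m F]) (simp add: A_def dec_index_def)
  qed
  have "(\<integral>\<omega>. 1 * D \<omega> * indicator B (path_upto t X \<omega>) \<partial>M) = (\<integral>\<omega>. (-1) * D \<omega> * indicator B (path_upto t X \<omega>) \<partial>M)"
    using E1 unfolding E2 .
  then have "(\<integral>\<omega>. D \<omega> * indicator B (path_upto t X \<omega>) \<partial>M) = 0" by simp
  then show ?thesis by (simp add: D_def)
qed

text \<open>The Kalman-Bucy formula: the right-hand side is a functional of the path, and by
  \<open>error_mean_zero\<close> its difference from \<open>Y t\<close> integrates to 0 over every
  event of the observed path.\<close>

lemma cond_mean_eq: "AE \<omega> in M. cond_mean M X Y t \<omega> = \<theta> * Phi0 t + H_path t (path_upto t X \<omega>)"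
proof -
  let ?F = "path_sigma M X t"
  let ?g = "\<lambda>\<omega>. \<theta> * Phi0 t + H_path t (path_upto t X \<omega>)"
  have sp: "path_upto t X \<in> space M \<rightarrow> space (path_space t)" using measurable_space[OF path_upto_measurable] by auto
  have sets_F: "sets ?F = {path_upto t X -` B \<inter> space M |B. B \<in> sets (path_space t)}"
    unfolding path_sigma_def by (rule sets_vimage_algebra2[OF sp])
  have "subalgebra M ?F"
    unfolding subalgebra_def sets_F using measurable_sets[OF path_upto_measurable] by (auto simp: path_sigma_def)
  then interpret F: finite_measure_subalgebra M ?F by unfold_locales
  have Fm: "path_upto t X \<in> measurable ?F (path_space t)"
    unfolding path_sigma_def by (rule measurable_vimage_algebra1[OF sp])
  have Yi: "integrable M (Y t)"
  proof -
    have "integrable M (\<lambda>\<omega>. \<theta> * flow t + \<epsilon> * ((Y t \<omega> - \<theta> * flow t) / \<epsilon>))"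
      by (intro Bochner_Integration.integrable_add integrable_mult_right integrable_const
          sq_integrable_integrable[OF wiener_rep_sq[OF signal_rep[OF tT(1)]]])
    moreover have "(\<lambda>\<omega>. \<theta> * flow t + \<epsilon> * ((Y t \<omega> - \<theta> * flow t) / \<epsilon>)) = Y t" using eps by auto
    ultimately show ?thesis by simp
  qed
  have Di: "integrable M (\<lambda>\<omega>. (Y t \<omega> - ?g \<omega>) / \<epsilon>)" by (rule sq_integrable_integrable[OF wiener_rep_sq[OF error_rep]])
  have gi: "integrable M ?g"
  proof -
    have "integrable M (\<lambda>\<omega>. Y t \<omega> - \<epsilon> * ((Y t \<omega> - ?g \<omega>) / \<epsilon>))"
      by (intro Bochner_Integration.integrable_diff integrable_mult_right Yi Di)
    moreover have "(\<lambda>\<omega>. Y t \<omega> - \<epsilon> * ((Y t \<omega> - ?g \<omega>) / \<epsilon>)) = ?g" using eps by auto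
    ultimately show ?thesis by simp
  qed
  have gm: "?g \<in> borel_measurable ?F"
    using measurable_compose[OF Fm filter_path_measurable(1)] by simp
  show ?thesis
    unfolding cond_mean_def
  proof (rule F.real_cond_exp_charact[OF _ Yi gi gm])
    fix C assume "C \<in> sets ?F"
    then obtain B where B: "B \<in> sets (path_space t)" and C: "C = path_upto t X -` B \<inter> space M" unfolding sets_F by blast
    have Cm: "C \<in> sets M" unfolding C by (rule measurable_sets[OF path_upto_measurable B])
    have i: "integrable M (\<lambda>\<omega>. indicator C \<omega> *\<^sub>R Y t \<omega>)" "integrable M (\<lambda>\<omega>. indicator C \<omega> *\<^sub>R ?g \<omega>)"
      by (intro integrable_mult_indicator Cm Yi gi)+
    have "(\<integral>\<omega>. indicator C \<omega> *\<^sub>R Y t \<omega> \<partial>M) - (\<integral>\<omega>. indicator C \<omega> *\<^sub>R ?g \<omega> \<partial>M) =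
      (\<integral>\<omega>. indicator C \<omega> *\<^sub>R Y t \<omega> - indicator C \<omega> *\<^sub>R ?g \<omega> \<partial>M)" by (rule Bochner_Integration.integral_diff[symmetric, OF i])
    also have "\<dots> = (\<integral>\<omega>. \<epsilon> * ((Y t \<omega> - ?g \<omega>) / \<epsilon> * indicator B (path_upto t X \<omega>)) \<partial>M)"
      using eps by (intro Bochner_Integration.integral_cong) (auto simp: C indicator_def)
    also have "\<dots> = 0" unfolding integral_mult_right_zero error_mean_zero[OF B] by simp
    finally show "(\<integral>\<omega>\<in>C. Y t \<omega> \<partial>M) = (\<integral>\<omega>\<in>C. ?g \<omega> \<partial>M)" by (simp add: set_lebesgue_integral_def)
  qed
qed

subsection \<open>The estimator of the initial value\<close>

text \<open>For arbitrary versions of \<open>H\<close> and of the estimator: stochastic Fubini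
  converts the drift correction, the means combine to \<open>\<theta>\<close>, and the kernels
  combine to \<open>est_kernel t\<close> over \<open>info t\<close>.\<close>

lemma initial_estimator_rep:
  assumes H: "is_KB_H M f \<sigma> a \<gamma> X t H" and est: "is_initial_estimator M f \<sigma> a \<gamma> X t H \<theta>hat"
  obtains \<xi> where "wiener_rep \<xi> (dec_kernel (-1))" "AE \<omega> in M. \<theta>hat \<omega> = \<theta> + \<epsilon> * \<xi> \<omega>"
proof -
  define \<kappa> where "\<kappa> s = score s * f s" for s
  have \<kappa>: "bounded_borel \<kappa>" unfolding \<kappa>_def[abs_def] by (intro bbs b_score)
  define D where "D s \<omega> = (H s \<omega> - \<theta> * (flow s - Phi0 s)) / \<epsilon>" for s \<omega>
  have Hm: "(\<lambda>(s, \<omega>). H s \<omega>) \<in> borel_measurable (time_measure t \<Otimes>\<^sub>M M)" using H by (simp add: is_KB_H_def)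
  have Dm: "(\<lambda>(s, \<omega>). D s \<omega>) \<in> borel_measurable (time_measure t \<Otimes>\<^sub>M M)"
  proof -
    have "(\<lambda>x. flow (fst x) - Phi0 (fst x)) \<in> borel_measurable (time_measure t \<Otimes>\<^sub>M M)"
      by (rule measurable_compose[OF fst_time_measurable, where g="\<lambda>s. flow s - Phi0 s"])
        (intro bounded_borel_measurable bbs)
    then have "(\<lambda>x. ((case x of (s, \<omega>) \<Rightarrow> H s \<omega>) - \<theta> * (flow (fst x) - Phi0 (fst x))) / \<epsilon>) \<in> borel_measurable (time_measure t \<Otimes>\<^sub>M M)"
      using Hm by measurable
    then show ?thesis by (simp add: D_def case_prod_beta')
  qed
  let ?k = "\<lambda>r. (f r * \<gamma> r / \<sigma> r / Phi0 r, - b r / Phi0 r)" and ?l = "\<lambda>r. (0 :: real, b r / flow r)"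
  have Drep: "wiener_rep (D s) (\<lambda>r. if r \<in> {0..s} then Phi0 s *\<^sub>R ?k r + flow s *\<^sub>R ?l r else 0)" if s: "s \<in> {0..t}" for s
  proof -
    have "wiener_rep (D s) (H_kernel s)"
      unfolding D_def[abs_def] using H s tT by (intro H_rep) (auto simp: is_KB_H_def)
    moreover have "H_kernel s = (\<lambda>r. if r \<in> {0..s} then Phi0 s *\<^sub>R ?k r + flow s *\<^sub>R ?l r else 0)"
      by (auto simp: H_kernel_def fun_eq_iff algebra_simps)
    ultimately show ?thesis by simp
  qed
  have kl: "bounded_borel ?k" "bounded_borel ?l" by (intro bounded_borel_Pair bbs)+
  have fub: "wiener_rep (\<lambda>\<omega>. LINT s:{0..t}|lborel. \<kappa> s * D s \<omega>)
      (\<lambda>r. if r \<in> {0..t} then (LINT u:{r..t}|lborel. \<kappa> u * Phi0 u) *\<^sub>R ?k r + (LINT u:{r..t}|lborel. \<kappa> u * flow u) *\<^sub>R ?l r else 0)"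
    "AE \<omega> in M. integrable (time_measure t) (\<lambda>s. \<kappa> s * D s \<omega>)"
    by (rule stochastic_fubini_separable[OF tT(1) Dm Drep \<kappa> b_Phi0 b_flow kl]; assumption)+
  obtain J where J: "is_stoch_integral M X (\<lambda>s. f s * KB_Phi f \<sigma> a \<gamma> 0 s / (\<sigma> s)\<^sup>2) t J"
    and e: "AE \<omega> in M. \<theta>hat \<omega> = 1 / KB_info f \<sigma> a \<gamma> t *
           (J \<omega> - (LINT s:{0..t}|lborel. f s * KB_Phi f \<sigma> a \<gamma> 0 s / (\<sigma> s)\<^sup>2 * (f s * H s \<omega>)))"
    using est unfolding is_initial_estimator_def by blast
  have J': "is_stoch_integral M X score t J"
    using J tT by (subst is_stoch_integral_cong[of t _ "\<lambda>s. f s * KB_Phi f \<sigma> a \<gamma> 0 s / (\<sigma> s)\<^sup>2"]) (auto simp: score_def KB_Phi_eq)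
  note Jrep = stoch_integral_X_rep[OF tT(1) b_score J']
  have kP: "(LINT u:{r..t}|lborel. \<kappa> u * Phi0 u) = info t - info r" if "r \<in> {0..t}" for r
  proof -
    have "(\<lambda>u. \<kappa> u * Phi0 u) = (\<lambda>s. (f s)\<^sup>2 * (Phi0 s)\<^sup>2 / (\<sigma> s)\<^sup>2)"
      by (auto simp: \<kappa>_def score_def power2_eq_square)
    then show ?thesis using has_primitive_increment[OF prim_info, of r t] that tT by simp
  qed
  have kF: "(LINT u:{r..t}|lborel. \<kappa> u * flow u) = mean_int score t - mean_int score r" if "r \<in> {0..t}" for r
    using has_primitive_increment[OF prim_mean_int[OF b_score], of r t] that tT by (simp add: \<kappa>_def)
  let ?L = "\<lambda>\<omega>. LINT s:{0..t}|lborel. \<kappa> s * D s \<omega>"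
  \<comment> \<open>The centred stochastic integral minus the centred drift correction, both scaled
    by \<open>\<epsilon>\<close> and divided by \<open>info t\<close>.\<close>
  define \<xi> where "\<xi> \<omega> = 1 / info t * ((J \<omega> - \<theta> * mean_int score t) / \<epsilon>) + - (1 / info t) * ?L \<omega>" for \<omega>
  have "wiener_rep \<xi> (dec_kernel (-1))"
    unfolding \<xi>_def[abs_def]
  proof (rule wiener_rep_kernel_cong[OF wiener_rep_lin[OF Jrep fub(1)] b_dec_kernel])
    fix r assume r: "r \<in> {0..T}"
    show "(1 / info t) *\<^sub>R int_kernel score t r + - (1 / info t) *\<^sub>R (if r \<in> {0..t} then (LINT u:{r..t}|lborel. \<kappa> u * Phi0 u) *\<^sub>R ?k r
      + (LINT u:{r..t}|lborel. \<kappa> u * flow u) *\<^sub>R ?l r else 0) = dec_kernel (-1) r"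
    proof (cases "r \<in> {0..t}")
      case True
      have E: "int_kernel score t r - ((info t - info r) *\<^sub>R ?k r + (mean_int score t - mean_int score r) *\<^sub>R ?l r) = est_kernel t r"
        using True s0[of r] by (simp add: int_kernel_def est_kernel_def score_def power2_eq_square field_simps)
      show ?thesis
        unfolding if_P[OF True] kP[OF True] kF[OF True] scaleR_minus_left
          diff_conv_add_uminus[symmetric] scaleR_diff_right[symmetric] E by (simp add: dec_kernel_def)
    next
      case False
      then show ?thesis by (auto simp: int_kernel_def est_kernel_def dec_kernel_def)
    qed
  qed
  moreover have "AE \<omega> in M. \<theta>hat \<omega> = \<theta> + \<epsilon> * \<xi> \<omega>"
    using e fub(2)
  proof eventually_elim
    fix \<omega>
    assume h: "\<theta>hat \<omega> = 1 / KB_info f \<sigma> a \<gamma> t *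
           (J \<omega> - (LINT s:{0..t}|lborel. f s * KB_Phi f \<sigma> a \<gamma> 0 s / (\<sigma> s)\<^sup>2 * (f s * H s \<omega>)))"
      and i: "integrable (time_measure t) (\<lambda>s. \<kappa> s * D s \<omega>)"
    have iD: "set_integrable lborel {0..t} (\<lambda>s. \<kappa> s * D s \<omega>)"
      using i by (simp add: set_integrable_def integrable_restrict_space)
    have "(LINT s:{0..t}|lborel. f s * KB_Phi f \<sigma> a \<gamma> 0 s / (\<sigma> s)\<^sup>2 * (f s * H s \<omega>)) =
      (LINT s:{0..t}|lborel. (\<theta> * (\<kappa> s * flow s) - \<theta> * (\<kappa> s * Phi0 s)) + \<epsilon> * (\<kappa> s * D s \<omega>))"
    proof (rule set_lebesgue_integral_cong)
      show "\<forall>s. s \<in> {0..t} \<longrightarrow> f s * KB_Phi f \<sigma> a \<gamma> 0 s / (\<sigma> s)\<^sup>2 * (f s * H s \<omega>) =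
        (\<theta> * (\<kappa> s * flow s) - \<theta> * (\<kappa> s * Phi0 s)) + \<epsilon> * (\<kappa> s * D s \<omega>)"
      proof (intro allI impI)
        fix s assume s: "s \<in> {0..t}"
        have Hs: "H s \<omega> = \<theta> * (flow s - Phi0 s) + \<epsilon> * D s \<omega>" using eps by (simp add: D_def)
        have Ps: "KB_Phi f \<sigma> a \<gamma> 0 s = Phi0 s" using s tT KB_Phi_eq[of 0 s] by simp
        show "f s * KB_Phi f \<sigma> a \<gamma> 0 s / (\<sigma> s)\<^sup>2 * (f s * H s \<omega>) =
          (\<theta> * (\<kappa> s * flow s) - \<theta> * (\<kappa> s * Phi0 s)) + \<epsilon> * (\<kappa> s * D s \<omega>)"
          unfolding Hs Ps by (simp add: \<kappa>_def score_def algebra_simps)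
      qed
    qed simp
    also have "\<dots> = (LINT s:{0..t}|lborel. \<theta> * (\<kappa> s * flow s) - \<theta> * (\<kappa> s * Phi0 s)) + (LINT s:{0..t}|lborel. \<epsilon> * (\<kappa> s * D s \<omega>))"
    proof (rule set_integral_add(2))
      show "set_integrable lborel {0..t} (\<lambda>s. \<theta> * (\<kappa> s * flow s) - \<theta> * (\<kappa> s * Phi0 s))"
        by (intro bounded_borel_set_integrable bbs \<kappa>)
      show "set_integrable lborel {0..t} (\<lambda>s. \<epsilon> * (\<kappa> s * D s \<omega>))" using iD by (rule set_integrable_mult_right)
    qed
    also have "(LINT s:{0..t}|lborel. \<theta> * (\<kappa> s * flow s) - \<theta> * (\<kappa> s * Phi0 s)) =
      (LINT s:{0..t}|lborel. \<theta> * (\<kappa> s * flow s)) - (LINT s:{0..t}|lborel. \<theta> * (\<kappa> s * Phi0 s))"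
      by (intro set_integral_diff(2) bounded_borel_set_integrable bbs \<kappa>)
    \<comment> \<open>Subtracting the deterministic part
      \<open>\<theta> * (mean_int score t - info t)\<close> from the mean
      \<open>\<theta> * mean_int score t\<close> of \<open>J\<close> leaves
      \<open>\<theta> * info t\<close>.\<close>
    finally have L: "(LINT s:{0..t}|lborel. f s * KB_Phi f \<sigma> a \<gamma> 0 s / (\<sigma> s)\<^sup>2 * (f s * H s \<omega>)) =
      \<theta> * mean_int score t - \<theta> * info t + \<epsilon> * ?L \<omega>"
      using kP[of 0] kF[of 0] tT by (simp add: mean_int_0)
    show "\<theta>hat \<omega> = \<theta> + \<epsilon> * \<xi> \<omega>"
      unfolding h L KB_info_eq[OF tT(1)] \<xi>_def using info_t eps by (simp add: field_simps)
  qed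
  ultimately show ?thesis using that by blast
qed

text \<open>The weight \<open>est_weight t\<close> absorbs the drift correction, so a single
  integral against \<open>X\<close> has the kernel of the original estimator.\<close>

lemma theta_path_rep: "wiener_rep (\<lambda>\<omega>. (theta_path (path_upto t X \<omega>) - \<theta>) / \<epsilon>) (dec_kernel (-1))"
proof -
  have tt: "t \<in> {0..t}" using tT by simp
  have "is_stoch_integral M X (est_weight t) t (\<lambda>\<omega>. path_integral pe t (path_upto t X \<omega>))"
    by (rule path_integral_is_stoch_integral[OF X_l2_integrator_t pe b_est_weight tt])
  from wiener_rep_cmult[OF stoch_integral_X_rep[OF tT(1) b_est_weight this], of "1 / info t"]
  have "wiener_rep (\<lambda>\<omega>. 1 / info t * ((path_integral pe t (path_upto t X \<omega>) - \<theta> * info t) / \<epsilon>)) (\<lambda>r. (1 / info t) *\<^sub>R est_kernel t r)"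
    using mean_int_est_weight[OF tT(1), of t] int_kernel_est_weight[OF tT(1)] by simp
  moreover have "(\<lambda>\<omega>. 1 / info t * ((path_integral pe t (path_upto t X \<omega>) - \<theta> * info t) / \<epsilon>)) = (\<lambda>\<omega>. (theta_path (path_upto t X \<omega>) - \<theta>) / \<epsilon>)"
    using info_t by (intro ext) (simp add: theta_path_def field_simps)
  moreover have "(\<lambda>r. (1 / info t) *\<^sub>R est_kernel t r) = dec_kernel (-1)" by (auto simp: dec_kernel_def)
  ultimately show ?thesis by simp
qed

lemma dec_kernel_norm: "(LINT r:{0..T}|lborel. dec_kernel (-1) r \<bullet> dec_kernel (-1) r) = 1 / info t"
proof -
  have "(LINT r:{0..T}|lborel. dec_kernel (-1) r \<bullet> dec_kernel (-1) r) = (LINT r:{0..T}|lborel. 1 / (info t)\<^sup>2 * (est_kernel t r \<bullet> est_kernel t r))"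
    by (simp add: dec_kernel_def power2_eq_square)
  also have "\<dots> = 1 / (info t)\<^sup>2 * info t" using est_kernel_norm[OF tT(1)] by simp
  finally show ?thesis using info_t by (simp add: power2_eq_square)
qed

text \<open>The \<open>H\<close> terms of the filter and of the conditional mean cancel, leaving
  \<open>\<epsilon> * Phi0 t * \<xi>\<close> with \<open>\<xi>\<close> of variance
  \<open>1 / info t\<close>.\<close>

lemma adaptive_filter_risk:
  assumes "is_adaptive_filter M f \<sigma> a \<gamma> X t mstar"
  shows "filter_risk M X Y \<epsilon> t mstar = ennreal ((Phi0 t)\<^sup>2 / info t)"
proof -
  obtain H \<theta>hat where H: "is_KB_H M f \<sigma> a \<gamma> X t H" and est: "is_initial_estimator M f \<sigma> a \<gamma> X t H \<theta>hat"
    and m: "AE \<omega> in M. mstar \<omega> = \<theta>hat \<omega> * KB_Phi f \<sigma> a \<gamma> 0 t + H t \<omega>"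
    using assms unfolding is_adaptive_filter_def by blast
  obtain \<xi> where \<xi>: "wiener_rep \<xi> (dec_kernel (-1))" "AE \<omega> in M. \<theta>hat \<omega> = \<theta> + \<epsilon> * \<xi> \<omega>"
    using initial_estimator_rep[OF H est] by blast
  have Ht: "AE \<omega> in M. H t \<omega> = H_path t (path_upto t X \<omega>)"
    using H tT by (intro H_path_unique) (auto simp: is_KB_H_def)
  have "AE \<omega> in M. mstar \<omega> - cond_mean M X Y t \<omega> = \<epsilon> * Phi0 t * \<xi> \<omega>"
    using m \<xi>(2) Ht cond_mean_eq
    by eventually_elim (use KB_Phi_eq[of 0 t] tT in \<open>simp add: algebra_simps\<close>)
  then have "(\<integral>\<^sup>+ \<omega>. ennreal ((mstar \<omega> - cond_mean M X Y t \<omega>)\<^sup>2) \<partial>M) = (\<integral>\<^sup>+ \<omega>. ennreal ((\<epsilon> * Phi0 t * \<xi> \<omega>)\<^sup>2) \<partial>M)"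
    by (intro nn_integral_cong_AE) (auto elim: AE_mp)
  also have "\<dots> = ennreal ((\<epsilon> * Phi0 t)\<^sup>2 * (1 / info t))"
    using nn_integral_sq[OF sq_integrable_cmult[OF wiener_rep_sq[OF \<xi>(1)], of "\<epsilon> * Phi0 t"]] wiener_rep_inner[OF \<xi>(1) \<xi>(1)] dec_kernel_norm
    by (simp add: power_mult_distrib power2_eq_square[of "\<xi> _"])
  finally have "filter_risk M X Y \<epsilon> t mstar = ennreal (1 / \<epsilon>\<^sup>2) * ennreal ((\<epsilon> * Phi0 t)\<^sup>2 * (1 / info t))"
    by (simp add: filter_risk_def)
  also have "\<dots> = ennreal (1 / \<epsilon>\<^sup>2 * ((\<epsilon> * Phi0 t)\<^sup>2 * (1 / info t)))" by (rule ennreal_mult'[symmetric]) simp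
  also have "1 / \<epsilon>\<^sup>2 * ((\<epsilon> * Phi0 t)\<^sup>2 * (1 / info t)) = (Phi0 t)\<^sup>2 / info t"
    using eps by (simp add: power_mult_distrib)
  finally show ?thesis .
qed

text \<open>Stopping the steps at \<open>s\<close> brings in \<open>X (min v s)\<close>, which is
  jointly measurable by path continuity; the pointwise limit preserves this.\<close>

lemma H_path_joint_measurable:
  "(\<lambda>(s, \<omega>). H_path s (path_upto t X \<omega>)) \<in> borel_measurable (time_measure t \<Otimes>\<^sub>M M)"
proof -
  let ?N = "time_measure t \<Otimes>\<^sub>M M"
  have X1: "(\<lambda>(s, \<omega>). X (min v s) \<omega>) \<in> borel_measurable ?N" if v: "v \<in> {0..t}" for v
  proof (rule joint_measurable_if_continuous[OF tT(2)])
    show "X (min v s) \<in> borel_measurable M" if "s \<in> {0..t}" for s using v that tT by (intro XY_measurable) auto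
    fix \<omega> assume \<omega>: "\<omega> \<in> space M"
    have "continuous_on {0..t} (\<lambda>s. min v s)" by (intro continuous_intros)
    then show "continuous_on {0..t} (\<lambda>s. X (min v s) \<omega>)"
      by (rule continuous_on_compose2[OF XY_continuous(1)[OF \<omega>]]) (use v tT in auto)
  qed
  have S: "(\<lambda>(s, \<omega>). step_integral (trunc_steps s p) X \<omega>) \<in> borel_measurable ?N" if "valid_steps t p" for p
    using that
  proof (induction p)
    case Nil
    then show ?case by (simp add: trunc_steps_def)
  next
    case (Cons x p)
    obtain c u v where x: "x = (c, u, v)" by (cases x)
    have uv: "u \<in> {0..t}" "v \<in> {0..t}" "valid_steps t p" using Cons.prems x by auto
    have "(\<lambda>z. c * ((case z of (s, \<omega>) \<Rightarrow> X (min v s) \<omega>) - (case z of (s, \<omega>) \<Rightarrow> X (min u s) \<omega>)) +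
      (case z of (s, \<omega>) \<Rightarrow> step_integral (trunc_steps s p) X \<omega>)) \<in> borel_measurable ?N"
      by (intro borel_measurable_add borel_measurable_times borel_measurable_diff borel_measurable_const X1 uv Cons.IH)
    then show ?case by (simp add: x trunc_steps_def case_prod_beta')
  qed
  have L: "(\<lambda>z. lim (\<lambda>n. case z of (s, \<omega>) \<Rightarrow> step_integral (trunc_steps s (pg n)) X \<omega>)) \<in> borel_measurable ?N"
    using pg by (intro borel_measurable_lim_metric S) (simp add: fast_steps_def)
  have P: "(\<lambda>z. Phi0 (fst z)) \<in> borel_measurable ?N"
    by (rule measurable_compose[OF fst_time_measurable bounded_borel_measurable[OF b_Phi0]])
  have eq: "(case z of (s, \<omega>) \<Rightarrow> H_path s (path_upto t X \<omega>)) =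
    Phi0 (fst z) * lim (\<lambda>n. case z of (s, \<omega>) \<Rightarrow> step_integral (trunc_steps s (pg n)) X \<omega>)" if "z \<in> space ?N" for z
  proof -
    obtain s \<omega> where z: "z = (s, \<omega>)" "s \<in> {0..t}" using \<open>z \<in> space ?N\<close> by (auto simp: space_pair_measure space_restrict_space)
    have "step_sum (trunc_steps s (pg n)) (path_upto t X \<omega>) = step_integral (trunc_steps s (pg n)) X \<omega>" for n
      using pg z(2) unfolding fast_steps_def
      by (intro step_sum_path_upto valid_steps_mono[OF valid_steps_trunc]) auto
    then show ?thesis by (simp add: z(1) H_path_def path_integral_def)
  qed
  show ?thesis
    using measurable_cong[THEN iffD2, OF eq borel_measurable_times[OF P L]] by simp
qed

text \<open>\<open>filter_path\<close> uses one integral with the weight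
  \<open>est_weight t\<close>, the definition of the filter a time integral of \<open>H\<close>.
  Both estimators have the kernel \<open>dec_kernel (-1)\<close> and hence coincide almost
  surely.\<close>

lemma filter_path_is_adaptive_filter: "is_adaptive_filter M f \<sigma> a \<gamma> X t (\<lambda>\<omega>. filter_path (path_upto t X \<omega>))"
proof -
  let ?H = "\<lambda>s \<omega>. H_path s (path_upto t X \<omega>)"
  have KH: "is_KB_H M f \<sigma> a \<gamma> X t ?H"
    unfolding is_KB_H_def using H_path_joint_measurable H_path_version by auto
  obtain ps where ps: "fast_steps t score ps" using fast_steps_exist[OF b_score tT(2)] by blast
  define J where "J \<omega> = path_integral ps t (path_upto t X \<omega>)" for \<omega>
  have "is_stoch_integral M X score t J"
    unfolding J_def using tT by (intro path_integral_is_stoch_integral[OF X_l2_integrator_t ps b_score]) auto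
  then have J: "is_stoch_integral M X (\<lambda>s. f s * KB_Phi f \<sigma> a \<gamma> 0 s / (\<sigma> s)\<^sup>2) t J"
    using tT by (subst is_stoch_integral_cong[of t _ score]) (auto simp: score_def KB_Phi_eq)
  define \<theta>hat where "\<theta>hat \<omega> = 1 / KB_info f \<sigma> a \<gamma> t *
           (J \<omega> - (LINT s:{0..t}|lborel. f s * KB_Phi f \<sigma> a \<gamma> 0 s / (\<sigma> s)\<^sup>2 * (f s * ?H s \<omega>)))" for \<omega>
  have est: "is_initial_estimator M f \<sigma> a \<gamma> X t ?H \<theta>hat"
    unfolding is_initial_estimator_def using J by (intro exI[of _ J]) (simp add: \<theta>hat_def)
  obtain \<xi> where \<xi>: "wiener_rep \<xi> (dec_kernel (-1))" "AE \<omega> in M. \<theta>hat \<omega> = \<theta> + \<epsilon> * \<xi> \<omega>"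
    using initial_estimator_rep[OF KH est] by blast
  have "AE \<omega> in M. (theta_path (path_upto t X \<omega>) - \<theta>) / \<epsilon> = \<xi> \<omega>" by (rule wiener_rep_unique[OF theta_path_rep \<xi>(1) refl])
  then have "AE \<omega> in M. filter_path (path_upto t X \<omega>) = \<theta>hat \<omega> * KB_Phi f \<sigma> a \<gamma> 0 t + ?H t \<omega>"
    using \<xi>(2) by eventually_elim (use KB_Phi_eq[of 0 t] tT eps in \<open>simp add: filter_path_def field_simps\<close>)
  moreover have "(\<lambda>\<omega>. filter_path (path_upto t X \<omega>)) \<in> borel_measurable M"
    by (rule measurable_compose[OF path_upto_measurable filter_path_measurable(2)])
  ultimately show ?thesis unfolding is_adaptive_filter_def using KH est by blast
qed

subsection \<open>Decomposition of the observed path\<close>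

definition dec :: "real \<Rightarrow> 'w \<Rightarrow> real" where
  "dec i \<omega> = (if i = -1 then (theta_path (path_upto t X \<omega>) - \<theta>) / \<epsilon>
     else (X i \<omega> - \<theta> * xbar i) / \<epsilon> - xbar i * ((theta_path (path_upto t X \<omega>) - \<theta>) / \<epsilon>))"

lemma dec_rep:
  assumes "i \<in> dec_index" shows "wiener_rep (dec i) (dec_kernel i)"
proof (cases "i = -1")
  case True
  then show ?thesis using theta_path_rep by (simp add: dec_def[abs_def])
next
  case False
  with assms have i: "i \<in> {0..T}" using tT by (auto simp: dec_index_def)
  have "(\<lambda>r. 1 *\<^sub>R obs_kernel i r + (- xbar i) *\<^sub>R dec_kernel (-1) r) = dec_kernel i"
    using False by (auto simp: dec_kernel_def)
  moreover have "dec i = (\<lambda>\<omega>. 1 * ((X i \<omega> - \<theta> * xbar i) / \<epsilon>) + (- xbar i) * ((theta_path (path_upto t X \<omega>) - \<theta>) / \<epsilon>))"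
    using False by (auto simp: dec_def)
  ultimately show ?thesis using wiener_rep_lin[OF obs_rep[OF i] theta_path_rep, of 1 "- xbar i"] by simp
qed

definition dec_law :: "(real \<Rightarrow> real) measure" where
  "dec_law = distr M (\<Pi>\<^sub>M i\<in>dec_index. borel) (\<lambda>\<omega>. \<lambda>i\<in>dec_index. dec i \<omega>)"

lemma dec_measurable: "(\<lambda>\<omega>. \<lambda>i\<in>dec_index. dec i \<omega>) \<in> measurable M (\<Pi>\<^sub>M i\<in>dec_index. borel)"
  using wiener_rep_sq[OF dec_rep] by (intro measurable_restrict) (auto simp: sq_integrable_def)

lemma obs_path_measurable:
  "(\<lambda>(w, x). obs_path e w x) \<in> measurable (borel \<Otimes>\<^sub>M (\<Pi>\<^sub>M i\<in>dec_index. borel)) (path_space t)"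
  unfolding obs_path_def case_prod_beta'
  by (intro measurable_restrict borel_measurable_add borel_measurable_times borel_measurable_const measurable_fst
      measurable_compose[OF measurable_snd measurable_component_singleton]) (auto simp: dec_index_def)

text \<open>Solving the definition of \<open>dec\<close> for \<open>X\<close>: the parameter and the
  estimation error enter only through the sum
  \<open>\<theta> + \<epsilon> * dec (-1) \<omega>\<close>.\<close>

lemma path_eq_obs_path: "path_upto t X \<omega> = obs_path \<epsilon> (\<theta> + \<epsilon> * dec (-1) \<omega>) (\<lambda>i\<in>dec_index. dec i \<omega>)"
  using eps by (auto simp: path_upto_def obs_path_def dec_def dec_index_def fun_eq_iff field_simps)

text \<open>The model now enters only through \<open>dec_law\<close>, the conditional mean having
  become \<open>H_path t\<close> plus \<open>\<theta> * Phi0 t\<close>.\<close>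

lemma filter_risk_eq_dec_law:
  assumes h: "h \<in> borel_measurable (path_space t)"
  shows "filter_risk M X Y \<epsilon> t (\<lambda>\<omega>. h (path_upto t X \<omega>)) = ennreal (1 / \<epsilon>\<^sup>2) *
    (\<integral>\<^sup>+ x. ennreal ((h (obs_path \<epsilon> (\<theta> + \<epsilon> * x (-1)) x) - H_path t (obs_path \<epsilon> (\<theta> + \<epsilon> * x (-1)) x) - \<theta> * Phi0 t)\<^sup>2) \<partial>dec_law)"
proof -
  let ?S = "\<Pi>\<^sub>M i\<in>dec_index. (borel :: real measure)"
  have p: "(\<lambda>x. obs_path \<epsilon> (\<theta> + \<epsilon> * x (-1)) x) \<in> measurable ?S (path_space t)"
  proof -
    have "(\<lambda>x. (\<theta> + \<epsilon> * x (-1), x)) \<in> measurable ?S (borel \<Otimes>\<^sub>M ?S)"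
      by (intro measurable_Pair borel_measurable_add borel_measurable_times borel_measurable_const measurable_component_singleton)
        (auto simp: dec_index_def)
    from measurable_compose[OF this obs_path_measurable] show ?thesis by simp
  qed
  have m: "(\<lambda>x. ennreal ((h (obs_path \<epsilon> (\<theta> + \<epsilon> * x (-1)) x) - H_path t (obs_path \<epsilon> (\<theta> + \<epsilon> * x (-1)) x) - \<theta> * Phi0 t)\<^sup>2)) \<in> borel_measurable ?S"
    using measurable_compose[OF p h] measurable_compose[OF p filter_path_measurable(1)] by measurable
  have "(\<integral>\<^sup>+ \<omega>. ennreal ((h (path_upto t X \<omega>) - cond_mean M X Y t \<omega>)\<^sup>2) \<partial>M) =
    (\<integral>\<^sup>+ \<omega>. ennreal ((h (path_upto t X \<omega>) - H_path t (path_upto t X \<omega>) - \<theta> * Phi0 t)\<^sup>2) \<partial>M)"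
    using cond_mean_eq by (intro nn_integral_cong_AE) (auto elim!: AE_mp simp: algebra_simps)
  also have "\<dots> = (\<integral>\<^sup>+ x. ennreal ((h (obs_path \<epsilon> (\<theta> + \<epsilon> * x (-1)) x) - H_path t (obs_path \<epsilon> (\<theta> + \<epsilon> * x (-1)) x) - \<theta> * Phi0 t)\<^sup>2) \<partial>dec_law)"
  proof -
    have "-1 \<in> dec_index" by (simp add: dec_index_def)
    then show ?thesis
      unfolding dec_law_def
      by (subst nn_integral_distr[OF dec_measurable]) (simp_all add: m path_eq_obs_path[symmetric])
  qed
  finally show ?thesis by (simp add: filter_risk_def)
qed

end

section \<open>The lower bound\<close>

text \<open>The Bayes risk under the uniform prior on \<open>[\<theta>0 - \<eta>, \<theta>0 + \<eta>]\<close>: substituting \<open>w = \<theta> + \<epsilon> u\<close> and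
  restricting to \<open>\<bar>\<epsilon> u\<bar> \<le> \<delta>\<close> frees the domain of \<open>w\<close> from \<open>u\<close>, and then the symmetry of \<open>u\<close> removes the
  estimator from the quadratic loss.\<close>

lemma bayes_risk_lower_bound:
  fixes Q :: "'x measure" and K :: "real \<Rightarrow> 'x \<Rightarrow> real"
  assumes Q: "prob_space Q" and u: "sq_integrable Q u"
    and flip: "flip \<in> measurable Q Q" "distr Q Q flip = Q" "\<And>x. x \<in> space Q \<Longrightarrow> u (flip x) = - u x"
      "\<And>w x. x \<in> space Q \<Longrightarrow> K w (flip x) = K w x"
    and K: "(\<lambda>(w, x). K w x) \<in> borel_measurable (borel \<Otimes>\<^sub>M Q)"
    and d: "0 < \<delta>" "\<delta> < \<eta>" and e: "0 < \<epsilon>"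
  shows "ennreal ((1 - \<delta> / \<eta>) * c\<^sup>2 * (\<integral>x. (u x)\<^sup>2 * indicator {- (\<delta> / \<epsilon>)..\<delta> / \<epsilon>} (u x) \<partial>Q)) \<le>
    (SUP \<theta>\<in>{\<theta>0 - \<eta>..\<theta>0 + \<eta>}. ennreal (1 / \<epsilon>\<^sup>2) * (\<integral>\<^sup>+ x. ennreal ((K (\<theta> + \<epsilon> * u x) x - \<theta> * c)\<^sup>2) \<partial>Q))"
    (is "_ \<le> ?S")
proof -
  interpret Q: prob_space Q by fact
  interpret P: pair_sigma_finite lborel Q ..
  have um[measurable]: "u \<in> borel_measurable Q" using u by (simp add: sq_integrable_def)
  note K[measurable]
  define R where "R \<theta> = (\<integral>\<^sup>+ x. ennreal ((K (\<theta> + \<epsilon> * u x) x - \<theta> * c)\<^sup>2) \<partial>Q)" for \<theta>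
  define V where "V = (\<integral>x. (u x)\<^sup>2 * indicator {- (\<delta> / \<epsilon>)..\<delta> / \<epsilon>} (u x) \<partial>Q)"
  define J where "J = {\<theta>0 - \<eta>..\<theta>0 + \<eta>}"
  \<comment> \<open>The margin \<open>\<delta>\<close> keeps \<open>w - \<epsilon> * u\<close> in
    \<open>J\<close> whenever \<open>w\<close> is in \<open>J'\<close> and
    \<open>\<epsilon> * u\<close> is at most \<open>\<delta>\<close> in absolute value.\<close>
  define J' where "J' = {\<theta>0 - \<eta> + \<delta>..\<theta>0 + \<eta> - \<delta>}"
  define B where "B x = (indicator {- (\<delta> / \<epsilon>)..\<delta> / \<epsilon>} (u x) :: real)" for x
  have [measurable]: "J \<in> sets borel" "J' \<in> sets borel" by (auto simp: J_def J'_def)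
  have Bm[measurable]: "B \<in> borel_measurable Q" unfolding B_def[abs_def] by measurable
  have B01: "B x = 0 \<or> B x = 1" for x by (simp add: B_def indicator_def)
  have cancel: "ennreal (\<epsilon>\<^sup>2) * ennreal (1 / \<epsilon>\<^sup>2) = 1"
    using e by (simp flip: ennreal_mult')
  \<comment> \<open>The supremum dominates the average over the prior, here multiplied by the length
    \<open>2 * \<eta>\<close> of \<open>J\<close>.\<close>
  have up: "(\<integral>\<^sup>+ \<theta>. R \<theta> * indicator J \<theta> \<partial>lborel) \<le> ennreal (\<epsilon>\<^sup>2) * ?S * ennreal (2 * \<eta>)"
  proof -
    have "R \<theta> * indicator J \<theta> \<le> ennreal (\<epsilon>\<^sup>2) * ?S * indicator J \<theta>" for \<theta>
    proof (cases "\<theta> \<in> J")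
      case True
      have "ennreal (1 / \<epsilon>\<^sup>2) * R \<theta> \<le> ?S" using True unfolding R_def J_def by (rule SUP_upper)
      then have "ennreal (\<epsilon>\<^sup>2) * (ennreal (1 / \<epsilon>\<^sup>2) * R \<theta>) \<le> ennreal (\<epsilon>\<^sup>2) * ?S" by (rule mult_left_mono) simp
      then show ?thesis using True cancel by (simp add: mult.assoc[symmetric])
    qed simp
    then have "(\<integral>\<^sup>+ \<theta>. R \<theta> * indicator J \<theta> \<partial>lborel) \<le> (\<integral>\<^sup>+ \<theta>. ennreal (\<epsilon>\<^sup>2) * ?S * indicator J \<theta> \<partial>lborel)"
      by (rule nn_integral_mono)
    also have "\<dots> = ennreal (\<epsilon>\<^sup>2) * ?S * emeasure lborel J" by (rule nn_integral_cmult_indicator) simp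
    also have "emeasure lborel J = ennreal (2 * \<eta>)" using d by (simp add: J_def)
    finally show ?thesis .
  qed
  define G where "G \<theta> x = ennreal ((K (\<theta> + \<epsilon> * u x) x - \<theta> * c)\<^sup>2) * indicator J \<theta>" for \<theta> x
  \<comment> \<open>The loss in the variable \<open>w = \<theta> + \<epsilon> * u\<close>, where
    \<open>\<theta> * c = w * c - \<epsilon> * u * c\<close>, restricted to the truncation event and
    to \<open>J'\<close>.\<close>
  define g where "g w x = ennreal ((K w x - w * c + \<epsilon> * u x * c)\<^sup>2 * B x) * indicator J' w" for w x
  have Gm: "(\<lambda>(\<theta>, x). G \<theta> x) \<in> borel_measurable (lborel \<Otimes>\<^sub>M Q)"
  proof -
    have "(\<lambda>z. (fst z + \<epsilon> * u (snd z), snd z)) \<in> measurable (lborel \<Otimes>\<^sub>M Q) (borel \<Otimes>\<^sub>M Q)" by measurable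
    from measurable_compose[OF this K]
    have "(\<lambda>z. K (fst z + \<epsilon> * u (snd z)) (snd z)) \<in> borel_measurable (lborel \<Otimes>\<^sub>M Q)" by simp
    then show ?thesis unfolding G_def case_prod_beta' by measurable
  qed
  have gm: "(\<lambda>(w, x). g w x) \<in> borel_measurable (lborel \<Otimes>\<^sub>M Q)"
  proof -
    have "(\<lambda>z. (fst z, snd z)) \<in> measurable (lborel \<Otimes>\<^sub>M Q) (borel \<Otimes>\<^sub>M Q)" by measurable
    from measurable_compose[OF this K]
    have "(\<lambda>z. K (fst z) (snd z)) \<in> borel_measurable (lborel \<Otimes>\<^sub>M Q)" by simp
    then show ?thesis unfolding g_def case_prod_beta' by measurable
  qed
  have "(\<integral>\<^sup>+ w. \<integral>\<^sup>+ x. g w x \<partial>Q \<partial>lborel) = (\<integral>\<^sup>+ x. \<integral>\<^sup>+ w. g w x \<partial>lborel \<partial>Q)"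
    using P.Fubini'[OF gm] by simp
  also have "\<dots> \<le> (\<integral>\<^sup>+ x. \<integral>\<^sup>+ \<theta>. G \<theta> x \<partial>lborel \<partial>Q)"
  proof (rule nn_integral_mono)
    fix x assume x: "x \<in> space Q"
    have Gx: "(\<lambda>\<theta>. G \<theta> x) \<in> borel_measurable borel" using measurable_compose[OF measurable_Pair2'[OF x] Gm] by simp
    have "(\<integral>\<^sup>+ w. g w x \<partial>lborel) \<le> (\<integral>\<^sup>+ w. G (- (\<epsilon> * u x) + 1 * w) x \<partial>lborel)"
    proof (rule nn_integral_mono)
      fix w
      show "g w x \<le> G (- (\<epsilon> * u x) + 1 * w) x"
      proof (cases "B x = 1 \<and> w \<in> J'")
        case True
        then have "u x \<in> {- (\<delta> / \<epsilon>)..\<delta> / \<epsilon>}" by (auto simp: B_def indicator_def split: if_splits)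
        then have "- \<delta> \<le> \<epsilon> * u x" "\<epsilon> * u x \<le> \<delta>" using e by (auto simp: field_simps)
        then have "w - \<epsilon> * u x \<in> J" using True by (auto simp: J_def J'_def)
        then show ?thesis using True by (simp add: g_def G_def algebra_simps)
      next
        case False
        then have "g w x = 0" using B01[of x] by (auto simp: g_def)
        then show ?thesis by simp
      qed
    qed
    also have "\<dots> = (\<integral>\<^sup>+ \<theta>. G \<theta> x \<partial>lborel)" using nn_integral_real_affine[OF Gx, of 1 "- (\<epsilon> * u x)"] by simp
    finally show "(\<integral>\<^sup>+ w. g w x \<partial>lborel) \<le> (\<integral>\<^sup>+ \<theta>. G \<theta> x \<partial>lborel)" .
  qed
  also have "\<dots> = (\<integral>\<^sup>+ \<theta>. \<integral>\<^sup>+ x. G \<theta> x \<partial>Q \<partial>lborel)" by (rule P.Fubini'[OF Gm])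
  also have "\<dots> = (\<integral>\<^sup>+ \<theta>. R \<theta> * indicator J \<theta> \<partial>lborel)"
  proof (rule nn_integral_cong)
    fix \<theta>
    have "(\<integral>\<^sup>+ x. G \<theta> x \<partial>Q) = R \<theta> * indicator J \<theta>"
    proof -
      have "(\<lambda>x. (\<theta> + \<epsilon> * u x, x)) \<in> measurable Q (borel \<Otimes>\<^sub>M Q)" by measurable
      from measurable_compose[OF this K]
      have "(\<lambda>x. K (\<theta> + \<epsilon> * u x) x) \<in> borel_measurable Q" by simp
      then show ?thesis unfolding G_def R_def by (intro nn_integral_multc) measurable
    qed
    then show "(\<integral>\<^sup>+ x. G \<theta> x \<partial>Q) = R \<theta> * indicator J \<theta>" .
  qed
  finally have mid: "(\<integral>\<^sup>+ w. \<integral>\<^sup>+ x. g w x \<partial>Q \<partial>lborel) \<le> (\<integral>\<^sup>+ \<theta>. R \<theta> * indicator J \<theta> \<partial>lborel)" .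
  have usq: "integrable Q (\<lambda>x. (u x)\<^sup>2 * B x)"
  proof (rule Bochner_Integration.integrable_bound[OF sq_integrable_square[OF u]])
    show "AE x in Q. norm ((u x)\<^sup>2 * B x) \<le> norm ((u x)\<^sup>2)"
    proof (rule AE_I2)
      show "norm ((u x)\<^sup>2 * B x) \<le> norm ((u x)\<^sup>2)" for x using B01[of x] by auto
    qed
  qed measurable
  \<comment> \<open>For fixed \<open>w\<close> the flip keeps \<open>K w\<close> and reverses
    \<open>u\<close>, so the loss may be averaged over both signs. The identity \<open>(p +
    q)\<^sup>2 + (p - q)\<^sup>2 = 2 * p\<^sup>2 + 2 * q\<^sup>2\<close> then permits dropping the
    part that contains \<open>K\<close>.\<close>
  have low: "ennreal (\<epsilon>\<^sup>2 * c\<^sup>2 * V) * indicator J' w \<le> (\<integral>\<^sup>+ x. g w x \<partial>Q)" for w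
  proof -
    define F where "F x = (K w x - w * c + \<epsilon> * u x * c)\<^sup>2 * B x" for x
    define F' where "F' x = (K w x - w * c - \<epsilon> * u x * c)\<^sup>2 * B x" for x
    have Kw: "(\<lambda>x. K w x) \<in> borel_measurable Q" using measurable_compose[OF measurable_Pair1' K, of w] by simp
    then have Fm[measurable]: "F \<in> borel_measurable Q" "F' \<in> borel_measurable Q" unfolding F_def[abs_def] F'_def[abs_def] by measurable
    have Fl: "F (flip x) = F' x" if "x \<in> space Q" for x
      using flip(3,4)[OF that] by (auto simp: F_def F'_def B_def indicator_def)
    have "(\<integral>\<^sup>+ x. ennreal (F x) \<partial>Q) = (\<integral>\<^sup>+ x. ennreal (F x) \<partial>distr Q Q flip)" by (simp add: flip(2))
    also have "\<dots> = (\<integral>\<^sup>+ x. ennreal (F (flip x)) \<partial>Q)" by (rule nn_integral_distr[OF flip(1)]) (simp add: flip(2))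
    also have "\<dots> = (\<integral>\<^sup>+ x. ennreal (F' x) \<partial>Q)" by (intro nn_integral_cong) (simp add: Fl)
    finally have FF': "(\<integral>\<^sup>+ x. ennreal (F x) \<partial>Q) = (\<integral>\<^sup>+ x. ennreal (F' x) \<partial>Q)" .
    have nn: "0 \<le> F x" "0 \<le> F' x" "0 \<le> B x" for x using B01[of x] by (auto simp: F_def F'_def)
    have "ennreal (\<epsilon>\<^sup>2 * c\<^sup>2 * V) = ennreal (\<integral>x. \<epsilon>\<^sup>2 * c\<^sup>2 * ((u x)\<^sup>2 * B x) \<partial>Q)" by (simp add: V_def B_def)
    also have "\<dots> = (\<integral>\<^sup>+ x. ennreal (\<epsilon>\<^sup>2 * c\<^sup>2 * ((u x)\<^sup>2 * B x)) \<partial>Q)"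
      using usq nn(3) by (intro nn_integral_eq_integral[symmetric]) auto
    also have "\<dots> \<le> (\<integral>\<^sup>+ x. ennreal (1 / 2) * (ennreal (F x) + ennreal (F' x)) \<partial>Q)"
    proof (rule nn_integral_mono)
      fix x
      have "\<epsilon>\<^sup>2 * c\<^sup>2 * (u x)\<^sup>2 \<le> 1 / 2 * ((K w x - w * c + \<epsilon> * u x * c)\<^sup>2 + (K w x - w * c - \<epsilon> * u x * c)\<^sup>2)"
      proof -
        have "(p + q)\<^sup>2 + (p - q)\<^sup>2 = 2 * p\<^sup>2 + 2 * q\<^sup>2" for p q :: real by (simp add: power2_eq_square algebra_simps)
        then show ?thesis by (simp add: power_mult_distrib mult_ac)
      qed
      then have "\<epsilon>\<^sup>2 * c\<^sup>2 * (u x)\<^sup>2 * B x \<le> 1 / 2 * ((K w x - w * c + \<epsilon> * u x * c)\<^sup>2 + (K w x - w * c - \<epsilon> * u x * c)\<^sup>2) * B x"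
        using nn(3) by (rule mult_right_mono)
      also have "\<dots> = 1 / 2 * (F x + F' x)" unfolding F_def F'_def by (simp add: algebra_simps)
      finally have "\<epsilon>\<^sup>2 * c\<^sup>2 * ((u x)\<^sup>2 * B x) \<le> 1 / 2 * (F x + F' x)" by (simp only: mult.assoc)
      then have "ennreal (\<epsilon>\<^sup>2 * c\<^sup>2 * ((u x)\<^sup>2 * B x)) \<le> ennreal (1 / 2 * (F x + F' x))" by (rule ennreal_leI)
      also have "\<dots> = ennreal (1 / 2) * (ennreal (F x) + ennreal (F' x))"
        by (subst ennreal_mult) (auto simp: nn)
      finally show "ennreal (\<epsilon>\<^sup>2 * c\<^sup>2 * ((u x)\<^sup>2 * B x)) \<le> ennreal (1 / 2) * (ennreal (F x) + ennreal (F' x))" .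
    qed
    also have "\<dots> = ennreal (1 / 2) * ((\<integral>\<^sup>+ x. ennreal (F x) \<partial>Q) + (\<integral>\<^sup>+ x. ennreal (F' x) \<partial>Q))"
      by (subst nn_integral_cmult) (simp_all add: nn_integral_add)
    also have "\<dots> = (\<integral>\<^sup>+ x. ennreal (F x) \<partial>Q)"
    proof -
      have "ennreal (1 / 2) * 2 = ennreal (1 / 2) * ennreal 2" by simp
      also have "\<dots> = ennreal (1 / 2 * 2)" by (rule ennreal_mult'[symmetric]) simp
      also have "\<dots> = 1" by simp
      finally have h: "ennreal (1 / 2) * 2 = 1" .
      have "ennreal (1 / 2) * (z + z) = z" for z
        unfolding mult_2[symmetric] mult.assoc[symmetric] h by simp
      then show ?thesis by (simp only: FF'[symmetric])
    qed
    finally have "ennreal (\<epsilon>\<^sup>2 * c\<^sup>2 * V) \<le> (\<integral>\<^sup>+ x. ennreal (F x) \<partial>Q)" .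
    moreover have "(\<integral>\<^sup>+ x. g w x \<partial>Q) = (\<integral>\<^sup>+ x. ennreal (F x) \<partial>Q) * indicator J' w"
      unfolding g_def F_def[symmetric] by (rule nn_integral_multc) simp
    ultimately show ?thesis by (simp add: mult_right_mono)
  qed
  have "ennreal (\<epsilon>\<^sup>2 * c\<^sup>2 * V) * ennreal (2 * (\<eta> - \<delta>)) = (\<integral>\<^sup>+ w. ennreal (\<epsilon>\<^sup>2 * c\<^sup>2 * V) * indicator J' w \<partial>lborel)"
    using d by (subst nn_integral_cmult_indicator) (simp_all add: J'_def algebra_simps)
  also have "\<dots> \<le> (\<integral>\<^sup>+ w. \<integral>\<^sup>+ x. g w x \<partial>Q \<partial>lborel)" by (rule nn_integral_mono) (rule low)
  also have "\<dots> \<le> ennreal (\<epsilon>\<^sup>2) * ?S * ennreal (2 * \<eta>)" using mid up by (rule order_trans)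
  finally have fin: "ennreal (\<epsilon>\<^sup>2 * c\<^sup>2 * V) * ennreal (2 * (\<eta> - \<delta>)) \<le> ennreal (\<epsilon>\<^sup>2 * (2 * \<eta>)) * ?S"
    using e d by (simp add: ennreal_mult' mult_ac)
  have V0: "0 \<le> V" unfolding V_def by (rule Bochner_Integration.integral_nonneg) simp
  have "ennreal (\<epsilon>\<^sup>2 * c\<^sup>2 * V) * ennreal (2 * (\<eta> - \<delta>)) = ennreal (\<epsilon>\<^sup>2 * c\<^sup>2 * V * (2 * (\<eta> - \<delta>)))"
    using d by (intro ennreal_mult''[symmetric]) simp
  \<comment> \<open>The factor \<open>1 - \<delta> / \<eta>\<close> is the ratio of the lengths of
    \<open>J'\<close> and \<open>J\<close>.\<close>
  also have "\<epsilon>\<^sup>2 * c\<^sup>2 * V * (2 * (\<eta> - \<delta>)) = \<epsilon>\<^sup>2 * (2 * \<eta>) * ((1 - \<delta> / \<eta>) * c\<^sup>2 * V)"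
    using d by (simp add: field_simps)
  also have "ennreal (\<epsilon>\<^sup>2 * (2 * \<eta>) * ((1 - \<delta> / \<eta>) * c\<^sup>2 * V)) = ennreal (\<epsilon>\<^sup>2 * (2 * \<eta>)) * ennreal ((1 - \<delta> / \<eta>) * c\<^sup>2 * V)"
    using d by (intro ennreal_mult') simp
  finally have eq: "ennreal (\<epsilon>\<^sup>2 * c\<^sup>2 * V) * ennreal (2 * (\<eta> - \<delta>)) = ennreal (\<epsilon>\<^sup>2 * (2 * \<eta>)) * ennreal ((1 - \<delta> / \<eta>) * c\<^sup>2 * V)" .
  have k: "ennreal (\<epsilon>\<^sup>2 * (2 * \<eta>)) \<noteq> 0" "ennreal (\<epsilon>\<^sup>2 * (2 * \<eta>)) \<noteq> top" using e d by auto
  show ?thesis using fin unfolding eq ennreal_mult_le_mult_iff[OF k] by (simp only: V_def)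
qed

text \<open>The truncation level \<open>\<delta> / \<epsilon>\<close> tends to infinity, so
  dominated convergence applies with the square of \<open>u\<close> as bound.\<close>

lemma truncated_second_moment_tendsto:
  assumes u: "sq_integrable Q u" and d: "0 < \<delta>"
  shows "((\<lambda>\<epsilon>. \<integral>x. (u x)\<^sup>2 * indicator {- (\<delta> / \<epsilon>)..\<delta> / \<epsilon>} (u x) \<partial>Q) \<longlongrightarrow> (\<integral>x. (u x)\<^sup>2 \<partial>Q)) (at_right 0)"
proof -
  have um[measurable]: "u \<in> borel_measurable Q" using u by (simp add: sq_integrable_def)
  have 1: "((\<lambda>c. \<integral>x. (u x)\<^sup>2 * indicator {- c..c} (u x) \<partial>Q) \<longlongrightarrow> (\<integral>x. (u x)\<^sup>2 \<partial>Q)) at_top"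
  proof (rule integral_dominated_convergence_at_top[where w="\<lambda>x. (u x)\<^sup>2"])
    show "AE x in Q. ((\<lambda>c. (u x)\<^sup>2 * indicator {- c..c} (u x)) \<longlongrightarrow> (u x)\<^sup>2) at_top"
    proof (rule AE_I2)
      fix x
      have "\<forall>\<^sub>F c in at_top. (u x)\<^sup>2 * indicator {- c..c} (u x) = (u x)\<^sup>2"
        using eventually_ge_at_top[of "\<bar>u x\<bar>"] by eventually_elim (auto simp: indicator_def)
      then show "((\<lambda>c. (u x)\<^sup>2 * indicator {- c..c} (u x)) \<longlongrightarrow> (u x)\<^sup>2) at_top" by (rule tendsto_eventually)
    qed
    show "\<forall>\<^sub>F c in at_top. AE x in Q. norm ((u x)\<^sup>2 * indicator {- c..c} (u x)) \<le> (u x)\<^sup>2"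
      by (intro always_eventually allI AE_I2) (auto simp: indicator_def)
  qed (use sq_integrable_square[OF u] in auto)
  have 2: "filterlim (\<lambda>\<epsilon>. \<delta> * inverse \<epsilon>) at_top (at_right 0)"
    by (rule filterlim_tendsto_pos_mult_at_top[OF tendsto_const d filterlim_inverse_at_top_right])
  from filterlim_compose[OF 1 2] show ?thesis by (simp add: divide_inverse)
qed

text \<open>Yields existence of the limit over shrinking neighbourhoods, because the local maximal
  risk is monotone in the radius.\<close>

lemma tendsto_at_right_mono_ennreal:
  fixes F :: "real \<Rightarrow> ennreal"
  assumes mono: "\<And>x y. 0 < x \<Longrightarrow> x \<le> y \<Longrightarrow> F x \<le> F y"
  shows "(F \<longlongrightarrow> (INF x\<in>{0<..}. F x)) (at_right 0)"
proof (rule order_tendstoI)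
  fix a assume a: "a < (INF x\<in>{0<..}. F x)"
  show "\<forall>\<^sub>F x in at_right 0. a < F x"
    using eventually_at_right_less[of 0]
    by eventually_elim (use a in \<open>auto intro: less_le_trans INF_lower\<close>)
next
  fix a assume "(INF x\<in>{0<..}. F x) < a"
  then obtain y where y: "0 < y" "F y < a" by (auto simp: INF_less_iff)
  have "\<forall>\<^sub>F x in at_right 0. x \<in> {0<..<y}" using y(1) by (intro eventually_at_right_real)
  then show "\<forall>\<^sub>F x in at_right 0. F x < a"
  proof eventually_elim
    fix x assume "x \<in> {0<..<y}"
    then have "F x \<le> F y" using mono[of x y] by simp
    then show "F x < a" using y(2) by (rule le_less_trans)
  qed
qed

section \<open>Lower bound for the risk in decomposed coordinates\<close>

context kb_functionals
begin

definition dec_risk :: "(real \<Rightarrow> real) measure \<Rightarrow> real \<Rightarrow> ((real \<Rightarrow> real) \<Rightarrow> real) \<Rightarrow> real \<Rightarrow> ennreal" where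
  "dec_risk Q e h \<theta> = ennreal (1 / e\<^sup>2) *
    (\<integral>\<^sup>+ x. ennreal ((h (obs_path e (\<theta> + e * x (-1)) x) - H_path t (obs_path e (\<theta> + e * x (-1)) x) - \<theta> * Phi0 t)\<^sup>2) \<partial>Q)"

end

context kb_filter
begin

lemma filter_risk_eq_dec_risk:
  "h \<in> borel_measurable (path_space t) \<Longrightarrow> filter_risk M X Y \<epsilon> t (\<lambda>\<omega>. h (path_upto t X \<omega>)) = dec_risk dec_law \<epsilon> h \<theta>"
  by (simp add: filter_risk_eq_dec_law dec_risk_def)

text \<open>The kernels \<open>dec_kernel i\<close> contain neither \<open>\<epsilon>\<close> nor
  \<open>\<theta>\<close>, so the covariances agree in all models.\<close>

lemma dec_law_eq:
  assumes "kb_filter T f \<sigma> a b \<gamma> t pg pe M' W' V' X' Y' \<epsilon>' \<theta>'"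
  shows "kb_filter.dec_law T f \<sigma> a \<gamma> t pe M' X' \<epsilon>' \<theta>' = dec_law"
proof -
  interpret B: kb_filter T f \<sigma> a b \<gamma> t pg pe M' W' V' X' Y' \<epsilon>' \<theta>' by fact
  show ?thesis
    unfolding dec_law_def B.dec_law_def
    by (rule wiener_rep_law_eq[OF B.wiener_pair_axioms wiener_pair_axioms B.dec_rep dec_rep refl])
qed

definition flip :: "(real \<Rightarrow> real) \<Rightarrow> real \<Rightarrow> real" where
  "flip x = (\<lambda>i\<in>dec_index. if i = -1 then - x i else x i)"

text \<open>Invariance under \<open>flip\<close> expresses the independence of the estimation error
  and the residual noise: by orthogonality, a change of sign at index -1 leaves all covariances
  unchanged.\<close>

lemma dec_law_properties:
  shows "prob_space dec_law" "sets dec_law = sets (\<Pi>\<^sub>M i\<in>dec_index. borel)" "sq_integrable dec_law (\<lambda>x. x (-1))"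
    "(\<integral>x. (x (-1))\<^sup>2 \<partial>dec_law) = 1 / info t" "flip \<in> measurable dec_law dec_law" "distr dec_law dec_law flip = dec_law"
proof -
  let ?S = "\<Pi>\<^sub>M i\<in>dec_index. (borel :: real measure)"
  have m1: "-1 \<in> dec_index" by (simp add: dec_index_def)
  show "prob_space dec_law" unfolding dec_law_def by (rule prob_space_distr[OF dec_measurable])
  show S: "sets dec_law = sets ?S" by (simp add: dec_law_def)
  have c: "(\<lambda>x. x (-1)) \<in> borel_measurable ?S" using m1 by (rule measurable_component_singleton)
  have D: "sq_integrable M (dec (-1))" by (rule wiener_rep_sq[OF dec_rep[OF m1]])
  have c2: "(\<lambda>x. (x (-1))\<^sup>2) \<in> borel_measurable ?S" using c by measurable
  have "integrable dec_law (\<lambda>x. (x (-1))\<^sup>2)"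
    unfolding dec_law_def integrable_distr_eq[OF dec_measurable c2] using sq_integrable_square[OF D] m1 by simp
  then show "sq_integrable dec_law (\<lambda>x. x (-1))" using c S by (simp add: sq_integrable_def cong: measurable_cong_sets)
  have "(\<integral>x. (x (-1))\<^sup>2 \<partial>dec_law) = (\<integral>\<omega>. dec (-1) \<omega> * dec (-1) \<omega> \<partial>M)"
    unfolding dec_law_def integral_distr[OF dec_measurable c2] using m1 by (simp add: power2_eq_square)
  also have "\<dots> = 1 / info t" unfolding wiener_rep_inner[OF dec_rep[OF m1] dec_rep[OF m1]] by (rule dec_kernel_norm)
  finally show "(\<integral>x. (x (-1))\<^sup>2 \<partial>dec_law) = 1 / info t" .
  have F: "flip \<in> measurable ?S ?S"
    unfolding flip_def[abs_def]
  proof (rule measurable_restrict)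
    fix i assume i: "i \<in> dec_index"
    have "(\<lambda>x. x i) \<in> borel_measurable ?S" using i by (rule measurable_component_singleton)
    then show "(\<lambda>x. if i = -1 then - x i else x i) \<in> borel_measurable ?S" by (cases "i = -1") auto
  qed
  then show F': "flip \<in> measurable dec_law dec_law" using S by (simp cong: measurable_cong_sets)
  define k where "k i r = (if i = -1 then (-1) *\<^sub>R dec_kernel i r else dec_kernel i r)" for i r
  define A where "A i \<omega> = (if i = -1 then (-1) * dec i \<omega> else dec i \<omega>)" for i \<omega>
  have A: "wiener_rep (A i) (k i)" if "i \<in> dec_index" for i
    using wiener_rep_cmult[OF dec_rep[OF that], of "-1"] dec_rep[OF that] by (cases "i = -1") (auto simp: A_def[abs_def] k_def[abs_def])
  have orth: "(LINT r:{0..T}|lborel. dec_kernel (-1) r \<bullet> dec_kernel i r) = 0"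
    "(LINT r:{0..T}|lborel. dec_kernel i r \<bullet> dec_kernel (-1) r) = 0"
    "(LINT r:{0..T}|lborel. - (dec_kernel (-1) r \<bullet> dec_kernel i r)) = 0"
    "(LINT r:{0..T}|lborel. - (dec_kernel i r \<bullet> dec_kernel (-1) r)) = 0" if "i \<in> {0..t}" for i
    using dec_kernel_orthogonal[OF that] set_integral_mult_right[of lborel "{0..T}" "-1" "\<lambda>r. dec_kernel (-1) r \<bullet> dec_kernel i r"]
    by (simp_all add: inner_commute)
  have "distr M ?S (\<lambda>\<omega>. \<lambda>i\<in>dec_index. A i \<omega>) = dec_law"
    unfolding dec_law_def
  proof (rule wiener_rep_law_eq[OF wiener_pair_axioms wiener_pair_axioms A dec_rep])
    fix i j assume "i \<in> dec_index" "j \<in> dec_index"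
    then show "(LINT r:{0..T}|lborel. k i r \<bullet> k j r) = (LINT r:{0..T}|lborel. dec_kernel i r \<bullet> dec_kernel j r)"
      using orth by (auto simp: k_def dec_index_def)
  qed
  moreover have "distr dec_law dec_law flip = distr M ?S (\<lambda>\<omega>. \<lambda>i\<in>dec_index. A i \<omega>)"
  proof -
    have "distr dec_law dec_law flip = distr dec_law ?S flip" by (rule distr_cong) (simp_all add: S)
    also have "\<dots> = distr M ?S (flip \<circ> (\<lambda>\<omega>. \<lambda>i\<in>dec_index. dec i \<omega>))"
      unfolding dec_law_def by (rule distr_distr[OF F dec_measurable])
    also have "flip \<circ> (\<lambda>\<omega>. \<lambda>i\<in>dec_index. dec i \<omega>) = (\<lambda>\<omega>. \<lambda>i\<in>dec_index. A i \<omega>)"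
      by (auto simp: flip_def A_def fun_eq_iff)
    finally show ?thesis .
  qed
  ultimately show "distr dec_law dec_law flip = dec_law" by simp
qed

text \<open>For given \<open>w\<close> the path \<open>obs_path e w x\<close> does not read the
  coordinate -1, so \<open>h\<close> minus \<open>H_path t\<close> is invariant under
  \<open>flip\<close> and the Bayes bound applies.\<close>

lemma dec_risk_lower_bound:
  assumes h: "h \<in> borel_measurable (path_space t)" and d: "0 < \<delta>" "\<delta> < \<eta>" and e: "0 < e"
  shows "ennreal ((1 - \<delta> / \<eta>) * (Phi0 t)\<^sup>2 * (\<integral>x. (x (-1))\<^sup>2 * indicator {- (\<delta> / e)..\<delta> / e} (x (-1)) \<partial>dec_law))
    \<le> (SUP \<theta>\<in>{\<theta>0 - \<eta>..\<theta>0 + \<eta>}. dec_risk dec_law e h \<theta>)"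
proof -
  let ?S = "\<Pi>\<^sub>M i\<in>dec_index. (borel :: real measure)"
  note L = dec_law_properties
  define K where "K w x = h (obs_path e w x) - H_path t (obs_path e w x)" for w x
  have P: "(\<lambda>z. obs_path e (fst z) (snd z)) \<in> measurable (borel \<Otimes>\<^sub>M ?S) (path_space t)"
    using obs_path_measurable[of e] by (simp add: case_prod_beta')
  have K1: "(\<lambda>(w, x). K w x) \<in> borel_measurable (borel \<Otimes>\<^sub>M ?S)"
    unfolding K_def case_prod_beta'
    using measurable_compose[OF P h] measurable_compose[OF P filter_path_measurable(1)] by (rule borel_measurable_diff)
  have sp: "sets (borel \<Otimes>\<^sub>M dec_law) = sets (borel \<Otimes>\<^sub>M ?S)" using L(2) by (intro sets_pair_measure_cong) auto
  have K: "(\<lambda>(w, x). K w x) \<in> borel_measurable (borel \<Otimes>\<^sub>M dec_law)"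
    using K1 measurable_cong_sets[OF sp refl] by blast
  have u: "flip x (-1) = - x (-1)" for x by (simp add: flip_def dec_index_def)
  have o: "obs_path e w (flip x) = obs_path e w x" for w x by (auto simp: obs_path_def flip_def dec_index_def fun_eq_iff)
  show ?thesis
    unfolding dec_risk_def
    using bayes_risk_lower_bound[where K=K and u="\<lambda>x. x (-1)" and flip=flip and c="Phi0 t", OF L(1,3,5,6) _ _ K d e, of \<theta>0]
    by (simp add: u o K_def)
qed

text \<open>For fixed \<open>\<delta>\<close>, letting \<open>e\<close> tend to 0 removes the
  truncation; only then does \<open>\<delta>\<close> tend to 0, which removes the factor
  \<open>1 - \<delta> / \<eta>\<close>.\<close>

lemma dec_risk_liminf:
  assumes h: "\<And>e. e \<in> {0<..1} \<Longrightarrow> h e \<in> borel_measurable (path_space t)" and \<eta>: "0 < \<eta>"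
  shows "ennreal ((Phi0 t)\<^sup>2 / info t) \<le> Liminf (at_right 0) (\<lambda>e. SUP \<theta>\<in>{\<theta>0 - \<eta>..\<theta>0 + \<eta>}. dec_risk dec_law e (h e) \<theta>)"
    (is "_ \<le> ?L")
proof -
  have b: "ennreal ((1 - \<delta> / \<eta>) * (Phi0 t)\<^sup>2 * (1 / info t)) \<le> ?L" if \<delta>: "0 < \<delta>" "\<delta> < \<eta>" for \<delta>
  proof -
    let ?V = "\<lambda>e. \<integral>x. (x (-1))\<^sup>2 * indicator {- (\<delta> / e)..\<delta> / e} (x (-1)) \<partial>dec_law"
    have "(?V \<longlongrightarrow> 1 / info t) (at_right 0)"
      using truncated_second_moment_tendsto[OF dec_law_properties(3) \<delta>(1)] unfolding dec_law_properties(4) .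
    then have "((\<lambda>e. ennreal ((1 - \<delta> / \<eta>) * (Phi0 t)\<^sup>2 * ?V e)) \<longlongrightarrow> ennreal ((1 - \<delta> / \<eta>) * (Phi0 t)\<^sup>2 * (1 / info t))) (at_right 0)"
      by (intro tendsto_ennrealI tendsto_mult tendsto_const)
    then have "Liminf (at_right 0) (\<lambda>e. ennreal ((1 - \<delta> / \<eta>) * (Phi0 t)\<^sup>2 * ?V e)) = ennreal ((1 - \<delta> / \<eta>) * (Phi0 t)\<^sup>2 * (1 / info t))"
      by (intro lim_imp_Liminf) auto
    moreover have "Liminf (at_right 0) (\<lambda>e. ennreal ((1 - \<delta> / \<eta>) * (Phi0 t)\<^sup>2 * ?V e)) \<le> ?L"
    proof (rule Liminf_mono)
      have "\<forall>\<^sub>F e in at_right (0 :: real). e \<in> {0<..<1}" by (intro eventually_at_right_real) simp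
      then show "\<forall>\<^sub>F e in at_right 0. ennreal ((1 - \<delta> / \<eta>) * (Phi0 t)\<^sup>2 * ?V e) \<le>
        (SUP \<theta>\<in>{\<theta>0 - \<eta>..\<theta>0 + \<eta>}. dec_risk dec_law e (h e) \<theta>)"
      proof eventually_elim
        fix e :: real assume e: "e \<in> {0<..<1}"
        show "ennreal ((1 - \<delta> / \<eta>) * (Phi0 t)\<^sup>2 * ?V e) \<le> (SUP \<theta>\<in>{\<theta>0 - \<eta>..\<theta>0 + \<eta>}. dec_risk dec_law e (h e) \<theta>)"
          by (rule dec_risk_lower_bound[OF h \<delta>]) (use e in auto)
      qed
    qed
    ultimately show ?thesis by simp
  qed
  have "((\<lambda>\<delta>. ennreal ((1 - \<delta> / \<eta>) * (Phi0 t)\<^sup>2 * (1 / info t))) \<longlongrightarrow> ennreal ((1 - 0 / \<eta>) * (Phi0 t)\<^sup>2 * (1 / info t))) (at_right 0)"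
    using \<eta> by (intro tendsto_ennrealI tendsto_mult tendsto_diff tendsto_divide tendsto_const tendsto_ident_at) auto
  moreover have "\<forall>\<^sub>F \<delta> in at_right 0. ennreal ((1 - \<delta> / \<eta>) * (Phi0 t)\<^sup>2 * (1 / info t)) \<le> ?L"
  proof -
    have "\<forall>\<^sub>F \<delta> in at_right (0 :: real). \<delta> \<in> {0<..<\<eta>}" using \<eta> by (intro eventually_at_right_real)
    then show ?thesis by eventually_elim (use b in auto)
  qed
  ultimately have "ennreal ((1 - 0 / \<eta>) * (Phi0 t)\<^sup>2 * (1 / info t)) \<le> ?L" by (rule tendsto_upperbound) simp
  then show ?thesis by simp
qed

end

section \<open>Coefficients given on a bounded interval only\<close>

lemma solves_sde_cong:
  assumes "\<And>s \<omega>. s \<in> {0..T} \<Longrightarrow> D s \<omega> = D' s \<omega>" "\<And>s. s \<in> {0..T} \<Longrightarrow> c s = c' s"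
  shows "solves_sde M T z D \<epsilon> c B Z \<longleftrightarrow> solves_sde M T z D' \<epsilon> c' B Z"
proof -
  have 1: "(LINT r:{0..s}|lborel. D r \<omega>) = (LINT r:{0..s}|lborel. D' r \<omega>)" if "s \<in> {0..T}" for s \<omega>
    using that assms(1) by (intro set_lebesgue_integral_cong) auto
  have 2: "is_stoch_integral M B c s J = is_stoch_integral M B c' s J" if "s \<in> {0..T}" for s J
    using that assms(2) by (intro is_stoch_integral_cong) auto
  have "(\<exists>J. is_stoch_integral M B c s J \<and> (AE \<omega> in M. Z s \<omega> = z + (LINT r:{0..s}|lborel. D r \<omega>) + \<epsilon> * J \<omega>)) \<longleftrightarrow>
      (\<exists>J. is_stoch_integral M B c' s J \<and> (AE \<omega> in M. Z s \<omega> = z + (LINT r:{0..s}|lborel. D' r \<omega>) + \<epsilon> * J \<omega>))"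
    if "s \<in> {0..T}" for s
    unfolding 1[OF that] 2[OF that] ..
  then show ?thesis unfolding solves_sde_def by (intro conj_cong ball_cong refl)
qed

lemma kalman_bucy_cong:
  assumes eq: "\<And>s. s \<in> {0..T} \<Longrightarrow> f' s = f s" "\<And>s. s \<in> {0..T} \<Longrightarrow> \<sigma>' s = \<sigma> s"
      "\<And>s. s \<in> {0..T} \<Longrightarrow> a' s = a s" "\<And>s. s \<in> {0..T} \<Longrightarrow> \<gamma>' s = \<gamma> s" and t: "t \<in> {0..T}"
  shows "KB_Phi f' \<sigma>' a' \<gamma>' 0 t = KB_Phi f \<sigma> a \<gamma> 0 t"
    and "KB_info f' \<sigma>' a' \<gamma>' t = KB_info f \<sigma> a \<gamma> t"
    and "is_adaptive_filter M f' \<sigma>' a' \<gamma>' X t m \<longleftrightarrow> is_adaptive_filter M f \<sigma> a \<gamma> X t m"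
proof -
  have Phi: "KB_Phi f' \<sigma>' a' \<gamma>' r s = KB_Phi f \<sigma> a \<gamma> r s" if "0 \<le> r" "s \<le> T" for r s
  proof -
    have "(LINT u:{r..s}|lborel. KB_A f' \<sigma>' a' \<gamma>' u) = (LINT u:{r..s}|lborel. KB_A f \<sigma> a \<gamma> u)"
      using that eq by (intro set_lebesgue_integral_cong) (auto simp: KB_A_def)
    then show ?thesis by (simp add: KB_Phi_def)
  qed
  show "KB_Phi f' \<sigma>' a' \<gamma>' 0 t = KB_Phi f \<sigma> a \<gamma> 0 t" using Phi t by simp
  show info: "KB_info f' \<sigma>' a' \<gamma>' t = KB_info f \<sigma> a \<gamma> t"
    unfolding KB_info_def using t eq Phi by (intro set_lebesgue_integral_cong) auto
  have H: "is_KB_H M f' \<sigma>' a' \<gamma>' X t H = is_KB_H M f \<sigma> a \<gamma> X t H" for H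
  proof -
    have "is_stoch_integral M X (\<lambda>r. KB_Phi f' \<sigma>' a' \<gamma>' r s * (f' r * \<gamma>' r / (\<sigma>' r)\<^sup>2)) s J =
      is_stoch_integral M X (\<lambda>r. KB_Phi f \<sigma> a \<gamma> r s * (f r * \<gamma> r / (\<sigma> r)\<^sup>2)) s J" if "s \<in> {0..t}" for s J
      using that t eq Phi by (intro is_stoch_integral_cong) auto
    then show ?thesis unfolding is_KB_H_def by (intro conj_cong ball_cong refl)
  qed
  have E: "is_initial_estimator M f' \<sigma>' a' \<gamma>' X t H \<theta>hat = is_initial_estimator M f \<sigma> a \<gamma> X t H \<theta>hat" for H \<theta>hat
  proof -
    have 1: "is_stoch_integral M X (\<lambda>s. f' s * KB_Phi f' \<sigma>' a' \<gamma>' 0 s / (\<sigma>' s)\<^sup>2) t J =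
      is_stoch_integral M X (\<lambda>s. f s * KB_Phi f \<sigma> a \<gamma> 0 s / (\<sigma> s)\<^sup>2) t J" for J
      using t eq Phi by (intro is_stoch_integral_cong) auto
    have 2: "(LINT s:{0..t}|lborel. f' s * KB_Phi f' \<sigma>' a' \<gamma>' 0 s / (\<sigma>' s)\<^sup>2 * (f' s * H s \<omega>)) =
      (LINT s:{0..t}|lborel. f s * KB_Phi f \<sigma> a \<gamma> 0 s / (\<sigma> s)\<^sup>2 * (f s * H s \<omega>))" for \<omega>
      using t eq Phi by (intro set_lebesgue_integral_cong) auto
    show ?thesis unfolding is_initial_estimator_def 1 2 info ..
  qed
  show "is_adaptive_filter M f' \<sigma>' a' \<gamma>' X t m \<longleftrightarrow> is_adaptive_filter M f \<sigma> a \<gamma> X t m"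
    using t by (simp add: is_adaptive_filter_def H E Phi)
qed

text \<open>The hypotheses control the coefficients on \<open>[0,T]\<close> only.\<close>

definition extend_by :: "real \<Rightarrow> real \<Rightarrow> (real \<Rightarrow> real) \<Rightarrow> real \<Rightarrow> real" where
  "extend_by c T g s = (if s \<in> {0..T} then g s else c)"

lemma extend_by_eq: "s \<in> {0..T} \<Longrightarrow> extend_by c T g s = g s"
  by (simp add: extend_by_def)

lemma bounded_borel_extend_by:
  assumes "bounded_coefficient T g" shows "bounded_borel (extend_by c T g)"
proof -
  have "bounded (g ` {0..T})" using assms by (simp add: bounded_coefficient_def)
  then obtain C where C0: "\<forall>x\<in>g ` {0..T}. norm x \<le> C" unfolding bounded_iff ..
  then have C: "norm (g s) \<le> C" if "s \<in> {0..T}" for s using that by blast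
  have "(\<lambda>s. indicator {0..T} s *\<^sub>R g s) \<in> borel_measurable borel"
    using assms by (simp add: bounded_coefficient_def set_borel_measurable_def)
  then have "bounded_borel (\<lambda>s. indicator {0..T} s *\<^sub>R g s)"
    by (rule bounded_borelI[where C="max C 0"]) (use C in \<open>auto simp: indicator_def le_max_iff_disj\<close>)
  then have "bounded_borel (\<lambda>s. if s \<in> {0..T} then indicator {0..T} s *\<^sub>R g s else c)"
    by (intro bounded_borel_if) auto
  moreover have "(\<lambda>s. if s \<in> {0..T} then indicator {0..T} s *\<^sub>R g s else c) = extend_by c T g"
    by (auto simp: extend_by_def)
  ultimately show ?thesis by simp
qed

lemma separated_from_zero_bound:
  assumes "separated_from_zero T g" "0 < T"
  obtains c where "0 < c" "\<And>s. s \<in> {0..T} \<Longrightarrow> c \<le> \<bar>g s\<bar>"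
proof -
  have "(INF s\<in>{0..T}. \<bar>g s\<bar>) \<le> \<bar>g s\<bar>" if "s \<in> {0..T}" for s
    using that by (intro cINF_lower bdd_belowI[where m=0]) auto
  then show ?thesis using that assms by (simp add: separated_from_zero_def)
qed

text \<open>\<open>\<sigma>\<close> is continued by 1, all other functions by 0. Separation from 0
  bounds \<open>1 / \<sigma>\<close> on [0,T], and the value 1 bounds it elsewhere.\<close>

lemma kb_coefficients_extend_by:
  assumes T: "0 < T" and f: "bounded_coefficient T f" "separated_from_zero T f"
    and s: "bounded_coefficient T \<sigma>" "separated_from_zero T \<sigma>"
    and a: "bounded_coefficient T a" and b: "bounded_coefficient T b" and ric: "riccati_solution T f \<sigma> a b \<gamma>"
  shows "kb_coefficients T (extend_by 0 T f) (extend_by 1 T \<sigma>) (extend_by 0 T a) (extend_by 0 T b) (extend_by 0 T \<gamma>)"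
proof -
  let ?f = "extend_by 0 T f" and ?s = "extend_by 1 T \<sigma>" and ?a = "extend_by 0 T a" and ?b = "extend_by 0 T b"
    and ?g = "extend_by 0 T \<gamma>"
  obtain cf where cf: "0 < cf" "\<And>s. s \<in> {0..T} \<Longrightarrow> cf \<le> \<bar>f s\<bar>" using separated_from_zero_bound[OF f(2) T] by blast
  obtain cs where cs: "0 < cs" "\<And>s. s \<in> {0..T} \<Longrightarrow> cs \<le> \<bar>\<sigma> s\<bar>" using separated_from_zero_bound[OF s(2) T] by blast
  note bb = bounded_borel_extend_by[OF f(1), of 0] bounded_borel_extend_by[OF s(1), of 1]
    bounded_borel_extend_by[OF a, of 0] bounded_borel_extend_by[OF b, of 0]
  have c: "continuous_on {0..T} \<gamma>" and r: "\<And>t. t \<in> {0..T} \<Longrightarrow> \<gamma> t =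
        (LINT s:{0..t}|lborel. 2 * a s * \<gamma> s - (f s)\<^sup>2 * (\<gamma> s)\<^sup>2 / (\<sigma> s)\<^sup>2 + (b s)\<^sup>2)"
    using ric unfolding riccati_solution_def by blast+
  have bg: "bounded_borel ?g" using bounded_borel_continuous_on[OF c] by (simp add: extend_by_def[abs_def])
  have s0: "?s x \<noteq> 0" for x using cs(2)[of x] cs(1) by (auto simp: extend_by_def)
  have bis: "bounded_borel (\<lambda>x. 1 / ?s x)"
  proof (rule bounded_borelI[where C="max (1 / cs) 1"])
    show "(\<lambda>x. 1 / ?s x) \<in> borel_measurable borel" using bounded_borel_measurable[OF bb(2)] by measurable
    show "norm (1 / ?s x) \<le> max (1 / cs) 1" for x
    proof (cases "x \<in> {0..T}")
      case True
      then have "norm (1 / ?s x) \<le> 1 / cs"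
        using cs(1) cs(2)[OF True] by (simp add: extend_by_eq frac_le)
      then show ?thesis by simp
    qed (auto simp: extend_by_def)
  qed
  have prim: "has_primitive T ?g (\<lambda>s. 2 * ?a s * ?g s - (?f s)\<^sup>2 * (?g s)\<^sup>2 / (?s s)\<^sup>2 + (?b s)\<^sup>2)"
    unfolding has_primitive_def
  proof (intro conjI ballI bg)
    have "bounded_borel (\<lambda>s. 2 * ?a s * ?g s - (?f s)\<^sup>2 * (?g s)\<^sup>2 * (1 / ?s s)\<^sup>2 + (?b s)\<^sup>2)"
      using bb bg bis by (intro bounded_borel_add bounded_borel_diff bounded_borel_mult bounded_borel_power2 bounded_borel_const) auto
    then show "bounded_borel (\<lambda>s. 2 * ?a s * ?g s - (?f s)\<^sup>2 * (?g s)\<^sup>2 / (?s s)\<^sup>2 + (?b s)\<^sup>2)"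
      by (simp add: power_divide)
    fix x assume x: "x \<in> {0..T}"
    have "?g x = (LINT s:{0..x}|lborel. 2 * a s * \<gamma> s - (f s)\<^sup>2 * (\<gamma> s)\<^sup>2 / (\<sigma> s)\<^sup>2 + (b s)\<^sup>2)"
      using r[OF x] by (simp only: extend_by_eq[OF x])
    also have "\<dots> = (LINT s:{0..x}|lborel. 2 * ?a s * ?g s - (?f s)\<^sup>2 * (?g s)\<^sup>2 / (?s s)\<^sup>2 + (?b s)\<^sup>2)"
      using x by (intro set_lebesgue_integral_cong) (auto simp: extend_by_eq)
    finally show "?g x = ?g 0 + (LINT s:{0..x}|lborel. 2 * ?a s * ?g s - (?f s)\<^sup>2 * (?g s)\<^sup>2 / (?s s)\<^sup>2 + (?b s)\<^sup>2)"
      using r[of 0] T by (simp add: extend_by_eq)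
  qed
  have g0: "?g 0 = 0" using r[of 0] T by (simp add: extend_by_eq)
  have f0: "?f x \<noteq> 0" if "x \<in> {0..T}" for x using cf(2)[OF that] cf(1) by (auto simp: extend_by_eq[OF that])
  show ?thesis
    by (intro kb_coefficients.intro T bb bis s0 f0 prim g0)
qed

text \<open>The first conjunct includes the existence of the limit over the radius. The third
  exhibits the adaptive filter as an estimator family, which also shows that the second does not
  hold vacuously.\<close>

theorem mainTheorem1:
  fixes f \<sigma> a b \<gamma> :: "real \<Rightarrow> real"
    and \<alpha> \<beta> T t :: real
    and M :: "real \<Rightarrow> real \<Rightarrow> 'w measure"
    and W V X Y :: "real \<Rightarrow> real \<Rightarrow> real \<Rightarrow> 'w \<Rightarrow> real"
  assumes "\<alpha> < \<beta>"
    and "bounded_coefficient T f" and "bounded_coefficient T \<sigma>"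
    and "bounded_coefficient T a" and "bounded_coefficient T b"
    and "separated_from_zero T f" and "separated_from_zero T \<sigma>"
    and "riccati_solution T f \<sigma> a b \<gamma>"
    and "\<And>\<epsilon> \<theta>. \<epsilon> \<in> {0<..1} \<Longrightarrow> \<theta> \<in> {\<alpha><..<\<beta>} \<Longrightarrow>
           linear_system (M \<epsilon> \<theta>) T f \<sigma> a b \<epsilon> \<theta> (W \<epsilon> \<theta>) (V \<epsilon> \<theta>) (X \<epsilon> \<theta>) (Y \<epsilon> \<theta>)"
    and "t \<in> {0<..T}"
  shows
    "(\<forall>\<theta>0\<in>{\<alpha><..<\<beta>}. \<forall>h. estimator_family t h \<longrightarrow>
        (\<exists>L. ((local_max_risk M X Y {\<alpha><..<\<beta>} t h \<theta>0) \<longlongrightarrow> L) (at_right 0) \<and>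
             L \<ge> ennreal ((KB_Phi f \<sigma> a \<gamma> 0 t)\<^sup>2 / KB_info f \<sigma> a \<gamma> t)))
     \<and> (\<forall>\<epsilon>\<in>{0<..1}. \<forall>\<theta>\<in>{\<alpha><..<\<beta>}. \<forall>mstar.
        is_adaptive_filter (M \<epsilon> \<theta>) f \<sigma> a \<gamma> (X \<epsilon> \<theta>) t mstar \<longrightarrow>
        filter_risk (M \<epsilon> \<theta>) (X \<epsilon> \<theta>) (Y \<epsilon> \<theta>) \<epsilon> t mstar =
          ennreal ((KB_Phi f \<sigma> a \<gamma> 0 t)\<^sup>2 / KB_info f \<sigma> a \<gamma> t))
     \<and> (\<exists>h. estimator_family t h \<and>
        (\<forall>\<epsilon>\<in>{0<..1}. \<forall>\<theta>\<in>{\<alpha><..<\<beta>}.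
           is_adaptive_filter (M \<epsilon> \<theta>) f \<sigma> a \<gamma> (X \<epsilon> \<theta>) t (\<lambda>\<omega>. h \<epsilon> (path_upto t (X \<epsilon> \<theta>) \<omega>))) \<and>
        (\<forall>\<theta>0\<in>{\<alpha><..<\<beta>}.
           ((local_max_risk M X Y {\<alpha><..<\<beta>} t h \<theta>0) \<longlongrightarrow>
              ennreal ((KB_Phi f \<sigma> a \<gamma> 0 t)\<^sup>2 / KB_info f \<sigma> a \<gamma> t)) (at_right 0)))"
proof -
  let ?\<Theta> = "{\<alpha><..<\<beta>}"
  let ?f = "extend_by 0 T f" and ?\<sigma> = "extend_by 1 T \<sigma>" and ?a = "extend_by 0 T a" and ?b = "extend_by 0 T b"
    and ?\<gamma> = "extend_by 0 T \<gamma>"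
  have T: "0 < T" and tT: "t \<in> {0..T}" "0 < t" using assms(10) by auto
  interpret K: kb_coefficients T ?f ?\<sigma> ?a ?b ?\<gamma>
    by (rule kb_coefficients_extend_by[OF T assms(2,6,3,7,4,5,8)])
  obtain pg where pg: "fast_steps t K.gain pg" using fast_steps_exist[OF K.b_gain tT(2)] by blast
  obtain pe where pe: "fast_steps t (K.est_weight t) pe" using fast_steps_exist[OF K.b_est_weight tT(2)] by blast
  interpret K: kb_functionals T ?f ?\<sigma> ?a ?b ?\<gamma> t pg pe
    by unfold_locales (use assms(10) pg pe in auto)
  have F: "kb_filter T ?f ?\<sigma> ?a ?b ?\<gamma> t pg pe (M \<epsilon> \<theta>) (W \<epsilon> \<theta>) (V \<epsilon> \<theta>) (X \<epsilon> \<theta>) (Y \<epsilon> \<theta>) \<epsilon> \<theta>"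
    if e: "\<epsilon> \<in> {0<..1}" and \<theta>: "\<theta> \<in> ?\<Theta>" for \<epsilon> \<theta>
  proof -
    have lin: "linear_system (M \<epsilon> \<theta>) T f \<sigma> a b \<epsilon> \<theta> (W \<epsilon> \<theta>) (V \<epsilon> \<theta>) (X \<epsilon> \<theta>) (Y \<epsilon> \<theta>)" by (rule assms(9)[OF e \<theta>])
    have WP: "wiener_pair (M \<epsilon> \<theta>) T (W \<epsilon> \<theta>) (V \<epsilon> \<theta>)"
      using lin T unfolding linear_system_def wiener_pair_def wiener_pair_axioms_def by blast
    have sX: "solves_sde (M \<epsilon> \<theta>) T 0 (\<lambda>s \<omega>. ?f s * Y \<epsilon> \<theta> s \<omega>) \<epsilon> ?\<sigma> (W \<epsilon> \<theta>) (X \<epsilon> \<theta>)"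
      using lin solves_sde_cong[of T "\<lambda>s \<omega>. ?f s * Y \<epsilon> \<theta> s \<omega>" "\<lambda>s \<omega>. f s * Y \<epsilon> \<theta> s \<omega>" ?\<sigma> \<sigma>]
      by (simp add: linear_system_def extend_by_eq)
    have sY: "solves_sde (M \<epsilon> \<theta>) T \<theta> (\<lambda>s \<omega>. ?a s * Y \<epsilon> \<theta> s \<omega>) \<epsilon> ?b (V \<epsilon> \<theta>) (Y \<epsilon> \<theta>)"
      using lin solves_sde_cong[of T "\<lambda>s \<omega>. ?a s * Y \<epsilon> \<theta> s \<omega>" "\<lambda>s \<omega>. a s * Y \<epsilon> \<theta> s \<omega>" ?b b]
      by (simp add: linear_system_def extend_by_eq)
    show ?thesis
      by (intro kb_filter.intro kb_system.intro kb_system_axioms.intro K.kb_functionals_axioms K.kb_coefficients_axioms WP sX sY)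
        (use e in simp)
  qed
  note cong = kalman_bucy_cong[of T ?f f ?\<sigma> \<sigma> ?a a ?\<gamma> \<gamma>, OF extend_by_eq extend_by_eq extend_by_eq extend_by_eq tT(1)]
  have Phi: "KB_Phi f \<sigma> a \<gamma> 0 t = K.Phi0 t" and info: "KB_info f \<sigma> a \<gamma> t = K.info t"
    using cong(1,2) K.KB_Phi_eq[of 0 t] K.KB_info_eq[OF tT(1)] tT by simp_all
  let ?C = "ennreal ((K.Phi0 t)\<^sup>2 / K.info t)"
  have mono: "local_max_risk M X Y ?\<Theta> t h \<theta>0 x \<le> local_max_risk M X Y ?\<Theta> t h \<theta>0 y" if "x \<le> y" for h \<theta>0 x y
    unfolding local_max_risk_def by (intro Liminf_mono always_eventually allI SUP_subset_mono) (use that in auto)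
  have lower: "?C \<le> local_max_risk M X Y ?\<Theta> t h \<theta>0 \<nu>"
    if \<theta>0: "\<theta>0 \<in> ?\<Theta>" and h: "estimator_family t h" and \<nu>: "0 < \<nu>" for \<theta>0 h \<nu>
  proof -
    \<comment> \<open>Any single model can serve as reference for the common noise law; the one with
      \<open>\<epsilon> = 1\<close> and \<open>\<theta> = \<theta>0\<close> is taken.\<close>
    interpret R: kb_filter T ?f ?\<sigma> ?a ?b ?\<gamma> t pg pe "M 1 \<theta>0" "W 1 \<theta>0" "V 1 \<theta>0" "X 1 \<theta>0" "Y 1 \<theta>0" 1 \<theta>0
      by (rule F) (use \<theta>0 in auto)
    \<comment> \<open>Halving keeps the closed interval of the prior inside the open parameter
      set.\<close>
    define \<eta> where "\<eta> = min \<nu> (min (\<theta>0 - \<alpha>) (\<beta> - \<theta>0)) / 2"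
    have \<eta>: "0 < \<eta>" using \<theta>0 \<nu> by (auto simp: \<eta>_def)
    have "2 * \<eta> \<le> \<nu>" "2 * \<eta> \<le> \<theta>0 - \<alpha>" "2 * \<eta> \<le> \<beta> - \<theta>0" by (simp_all add: \<eta>_def)
    then have "\<eta> \<le> \<nu>" "\<theta>0 - \<eta> > \<alpha>" "\<theta>0 + \<eta> < \<beta>" using \<eta> by linarith+
    then have sub: "{\<theta>0 - \<eta>..\<theta>0 + \<eta>} \<subseteq> {\<theta>\<in>?\<Theta>. \<bar>\<theta> - \<theta>0\<bar> \<le> \<nu>}" by auto
    have hm: "h e \<in> borel_measurable (path_space t)" if "e \<in> {0<..1}" for e using h that by (simp add: estimator_family_def)
    have "?C \<le> Liminf (at_right 0) (\<lambda>e. SUP \<theta>\<in>{\<theta>0 - \<eta>..\<theta>0 + \<eta>}. K.dec_risk R.dec_law e (h e) \<theta>)"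
      by (rule R.dec_risk_liminf[OF hm \<eta>])
    also have "\<dots> \<le> local_max_risk M X Y ?\<Theta> t h \<theta>0 \<nu>"
      unfolding local_max_risk_def
    proof (rule Liminf_mono)
      have "\<forall>\<^sub>F e in at_right (0 :: real). e \<in> {0<..<1}" by (intro eventually_at_right_real) simp
      then show "\<forall>\<^sub>F e in at_right 0. (SUP \<theta>\<in>{\<theta>0 - \<eta>..\<theta>0 + \<eta>}. K.dec_risk R.dec_law e (h e) \<theta>) \<le>
        (SUP \<theta>\<in>{\<theta> \<in> ?\<Theta>. \<bar>\<theta> - \<theta>0\<bar> \<le> \<nu>}. filter_risk (M e \<theta>) (X e \<theta>) (Y e \<theta>) e t (\<lambda>\<omega>. h e (path_upto t (X e \<theta>) \<omega>)))"
      proof eventually_elim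
        fix e :: real assume "e \<in> {0<..<1}"
        then have e: "e \<in> {0<..1}" by simp
        have "filter_risk (M e \<theta>) (X e \<theta>) (Y e \<theta>) e t (\<lambda>\<omega>. h e (path_upto t (X e \<theta>) \<omega>)) = K.dec_risk R.dec_law e (h e) \<theta>"
          if \<theta>: "\<theta> \<in> ?\<Theta>" for \<theta>
          using kb_filter.filter_risk_eq_dec_risk[OF F[OF e \<theta>] hm[OF e]] R.dec_law_eq[OF F[OF e \<theta>]] by simp
        then show "(SUP \<theta>\<in>{\<theta>0 - \<eta>..\<theta>0 + \<eta>}. K.dec_risk R.dec_law e (h e) \<theta>) \<le>
          (SUP \<theta>\<in>{\<theta> \<in> ?\<Theta>. \<bar>\<theta> - \<theta>0\<bar> \<le> \<nu>}. filter_risk (M e \<theta>) (X e \<theta>) (Y e \<theta>) e t (\<lambda>\<omega>. h e (path_upto t (X e \<theta>) \<omega>)))"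
          using sub by (intro SUP_subset_mono) auto
      qed
    qed
    finally show ?thesis .
  qed
  have part1: "\<exists>L. ((local_max_risk M X Y ?\<Theta> t h \<theta>0) \<longlongrightarrow> L) (at_right 0) \<and> L \<ge> ?C"
    if \<theta>0: "\<theta>0 \<in> ?\<Theta>" and h: "estimator_family t h" for \<theta>0 h
  proof (intro exI conjI)
    show "((local_max_risk M X Y ?\<Theta> t h \<theta>0) \<longlongrightarrow> (INF x\<in>{0<..}. local_max_risk M X Y ?\<Theta> t h \<theta>0 x)) (at_right 0)"
      by (rule tendsto_at_right_mono_ennreal) (rule mono)
    show "?C \<le> (INF x\<in>{0<..}. local_max_risk M X Y ?\<Theta> t h \<theta>0 x)"
      by (rule INF_greatest) (use lower[OF \<theta>0 h] in simp)
  qed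
  have part2: "filter_risk (M \<epsilon> \<theta>) (X \<epsilon> \<theta>) (Y \<epsilon> \<theta>) \<epsilon> t mstar = ?C"
    if "\<epsilon> \<in> {0<..1}" "\<theta> \<in> ?\<Theta>" "is_adaptive_filter (M \<epsilon> \<theta>) f \<sigma> a \<gamma> (X \<epsilon> \<theta>) t mstar" for \<epsilon> \<theta> mstar
    using kb_filter.adaptive_filter_risk[OF F[OF that(1,2)]] that(3) cong(3) by blast
  have ad: "is_adaptive_filter (M \<epsilon> \<theta>) f \<sigma> a \<gamma> (X \<epsilon> \<theta>) t (\<lambda>\<omega>. K.filter_path (path_upto t (X \<epsilon> \<theta>) \<omega>))"
    if "\<epsilon> \<in> {0<..1}" "\<theta> \<in> ?\<Theta>" for \<epsilon> \<theta>
    using kb_filter.filter_path_is_adaptive_filter[OF F[OF that]] cong(3) by blast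
  \<comment> \<open>The risk of the filter is the same at all parameters, so for every radius the
    supremum is constant in \<open>e\<close> below 1 and the limits are limits of constants.\<close>
  have att: "((local_max_risk M X Y ?\<Theta> t (\<lambda>_. K.filter_path) \<theta>0) \<longlongrightarrow> ?C) (at_right 0)" if \<theta>0: "\<theta>0 \<in> ?\<Theta>" for \<theta>0
  proof (rule tendsto_eventually)
    have "local_max_risk M X Y ?\<Theta> t (\<lambda>_. K.filter_path) \<theta>0 \<nu> = ?C" if \<nu>: "0 < \<nu>" for \<nu>
      unfolding local_max_risk_def
    proof (rule lim_imp_Liminf, simp, rule tendsto_eventually)
      have "\<forall>\<^sub>F e in at_right (0 :: real). e \<in> {0<..<1}" by (intro eventually_at_right_real) simp
      then show "\<forall>\<^sub>F e in at_right 0. (SUP \<theta>\<in>{\<theta> \<in> ?\<Theta>. \<bar>\<theta> - \<theta>0\<bar> \<le> \<nu>}.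
        filter_risk (M e \<theta>) (X e \<theta>) (Y e \<theta>) e t (\<lambda>\<omega>. K.filter_path (path_upto t (X e \<theta>) \<omega>))) = ?C"
      proof eventually_elim
        fix e :: real assume "e \<in> {0<..<1}"
        then have e: "e \<in> {0<..1}" by simp
        have "(SUP \<theta>\<in>{\<theta> \<in> ?\<Theta>. \<bar>\<theta> - \<theta>0\<bar> \<le> \<nu>}.
          filter_risk (M e \<theta>) (X e \<theta>) (Y e \<theta>) e t (\<lambda>\<omega>. K.filter_path (path_upto t (X e \<theta>) \<omega>))) =
          (SUP \<theta>\<in>{\<theta> \<in> ?\<Theta>. \<bar>\<theta> - \<theta>0\<bar> \<le> \<nu>}. ?C)"
          using part2[OF e _ ad[OF e]] by (intro SUP_cong) auto
        also have "\<dots> = ?C"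
        proof (rule cSUP_const)
          show "{\<theta> \<in> ?\<Theta>. \<bar>\<theta> - \<theta>0\<bar> \<le> \<nu>} \<noteq> {}" using \<theta>0 \<nu> by force
        qed
        finally show "(SUP \<theta>\<in>{\<theta> \<in> ?\<Theta>. \<bar>\<theta> - \<theta>0\<bar> \<le> \<nu>}.
          filter_risk (M e \<theta>) (X e \<theta>) (Y e \<theta>) e t (\<lambda>\<omega>. K.filter_path (path_upto t (X e \<theta>) \<omega>))) = ?C" .
      qed
    qed
    then show "\<forall>\<^sub>F \<nu> in at_right 0. local_max_risk M X Y ?\<Theta> t (\<lambda>_. K.filter_path) \<theta>0 \<nu> = ?C"
      using eventually_at_right_less[of 0] by (auto elim: eventually_mono)
  qed
  have est: "estimator_family t (\<lambda>_. K.filter_path)"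
    using K.filter_path_measurable(2) by (simp add: estimator_family_def)
  show ?thesis
    unfolding Phi info
    by (intro conjI ballI allI impI exI[of _ "\<lambda>_. K.filter_path"] part1 part2 est ad att)
qed

end
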